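(* Suppose $s>5/2$. Then for any $(u_0,\rho_0)\in H^s(S^1)\times H^{s-1}(S^1)$ there exists an open interval $J$ centered at $0$ and a unique solution $$(u,\rho)\in C\bigl(J,H^s(S^1)\times H^{s-1}(S^1)\bigr)\cap C^1\bigl(J,H^{s-1}(S^1)\times H^{s-2}(S^1)\bigr)$$ of the Cauchy problem $$u_t+uu_x=-A^{-1}\partial_x\Bigl(u^2+\tfrac12u_x^2+\tfrac12\rho^2\Bigr),\qquad \rho_t+u\rho_x=-\rho u_x,\qquad (u(0),\rho(0))=(u_0,\rho_0),$$ which depends continuously on the initial data $(u_0,\rho_0)$.
   Context: $S^1\simeq\mathbb{R}/\mathbb{Z}$; $H^r(S^1)$ is the $L^2$-based Sobolev space of real-valued functions on $S^1$; $A=1-\partial_x^2$, an isomorphism $H^r(S^1)\to H^{r-2}(S^1)$. The Cauchy problem is the weak form of the two-component Camassa--Holm equation $m_t=-um_x-2mu_x-\rho\rho_x$, $\rho_t=-(\rho u)_x$, $m=u-u_{xx}$. *)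

theory Defs
  imports "HOL-Analysis.Analysis"
begin

text \<open>
  Real-valued functions on the circle are 1-periodic functions \<^typ>\<open>real \<Rightarrow> real\<close>.  Elements of
  \<open>L\<^sup>2\<close> and \<open>H\<^sup>r\<close> are represented by (Borel) representatives of their classes, and two
  representatives denote the same element iff they are related by \<open>circ_eq\<close>.
\<close>

definition periodic1 :: "(real \<Rightarrow> real) \<Rightarrow> bool" where
  "periodic1 f \<longleftrightarrow> (\<forall>x. f (x + 1) = f x)"

definition circ_eq :: "(real \<Rightarrow> real) \<Rightarrow> (real \<Rightarrow> real) \<Rightarrow> bool" (infix \<open>\<doteq>\<close> 50) where
  "f \<doteq> g \<longleftrightarrow> (AE x in lborel. f x = g x)"

definition circ_L2 :: "(real \<Rightarrow> real) set" where
  "circ_L2 = {f. periodic1 f \<and> f \<in> borel_measurable borel \<and>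
                 set_integrable lborel {0..1} (\<lambda>x. (f x)\<^sup>2)}"

definition fourier_coeff :: "(real \<Rightarrow> real) \<Rightarrow> int \<Rightarrow> complex" where
  "fourier_coeff f n =
     (LINT x:{0..1}|lborel. complex_of_real (f x) * cis (- 2 * pi * of_int n * x))"

text \<open>
  The factor \<open>1 + 4\<pi>\<^sup>2n\<^sup>2\<close> is the symbol of \<open>1 - \<partial>\<^sub>x\<^sup>2\<close> on \<open>\<real>/\<int>\<close>.  The set \<open>sobolev r\<close> is
  \<open>H\<^sup>r\<close> for \<open>r \<ge> 0\<close> only; for \<open>r < 0\<close> one would have to admit distributions outside \<open>L\<^sup>2\<close>.
\<close>

definition sobolev_term :: "real \<Rightarrow> (real \<Rightarrow> real) \<Rightarrow> int \<Rightarrow> real" where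
  "sobolev_term r f n = (1 + 4 * pi\<^sup>2 * (of_int n)\<^sup>2) powr r * (cmod (fourier_coeff f n))\<^sup>2"

definition sobolev :: "real \<Rightarrow> (real \<Rightarrow> real) set" where
  "sobolev r = {f \<in> circ_L2. sobolev_term r f summable_on UNIV}"

definition sob_norm :: "real \<Rightarrow> (real \<Rightarrow> real) \<Rightarrow> real" where
  "sob_norm r f = sqrt (\<Sum>\<^sub>\<infinity>n. sobolev_term r f n)"

definition sob_dist :: "real \<Rightarrow> (real \<Rightarrow> real) \<Rightarrow> (real \<Rightarrow> real) \<Rightarrow> real" where
  "sob_dist r f g = sob_norm r (\<lambda>x. f x - g x)"

definition circ_test :: "(real \<Rightarrow> real) \<Rightarrow> bool" where
  "circ_test \<phi> \<longleftrightarrow> periodic1 \<phi> \<and> (\<forall>k. (deriv ^^ k) \<phi> differentiable_on UNIV)"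

definition has_weak_deriv :: "(real \<Rightarrow> real) \<Rightarrow> (real \<Rightarrow> real) \<Rightarrow> bool" where
  "has_weak_deriv f g \<longleftrightarrow> f \<in> circ_L2 \<and> g \<in> circ_L2 \<and>
     (\<forall>\<phi>. circ_test \<phi> \<longrightarrow>
        (LINT x:{0..1}|lborel. f x * deriv \<phi> x) = - (LINT x:{0..1}|lborel. g x * \<phi> x))"

text \<open>
  The choice operators below pick a representative; the class it represents is unique
  whenever an admissible one exists.
\<close>

definition weak_deriv :: "(real \<Rightarrow> real) \<Rightarrow> real \<Rightarrow> real" where
  "weak_deriv f = (SOME g. has_weak_deriv f g)"

definition A_op :: "(real \<Rightarrow> real) \<Rightarrow> real \<Rightarrow> real" where
  "A_op f = (\<lambda>x. f x - weak_deriv (weak_deriv f) x)"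

text \<open>
  The inverse of \<open>A : H\<^sup>2 \<rightarrow> L\<^sup>2\<close>.  As \<open>A\<close> is injective on \<open>H\<^sup>2\<close>, this restricts to the inverse of
  \<open>A : H\<^sup>r \<rightarrow> H\<^bsup>r-2\<^esup>\<close> for every \<open>r \<ge> 2\<close>.
\<close>

definition A_inv :: "(real \<Rightarrow> real) \<Rightarrow> real \<Rightarrow> real" where
  "A_inv g = (SOME f. f \<in> sobolev 2 \<and> A_op f \<doteq> g)"

text \<open>Curves \<open>u\<close> in a function space are written \<open>u t x\<close>, with \<open>t\<close> the time variable.\<close>

definition sob_C0 :: "real \<Rightarrow> real set \<Rightarrow> (real \<Rightarrow> real \<Rightarrow> real) \<Rightarrow> bool" where
  "sob_C0 r J u \<longleftrightarrow>
     (\<forall>t\<in>J. u t \<in> sobolev r \<and> ((\<lambda>\<tau>. sob_dist r (u \<tau>) (u t)) \<longlongrightarrow> 0) (at t within J))"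

definition has_time_deriv ::
  "real \<Rightarrow> (real \<Rightarrow> real \<Rightarrow> real) \<Rightarrow> (real \<Rightarrow> real) \<Rightarrow> real \<Rightarrow> bool" where
  "has_time_deriv r u v t \<longleftrightarrow> v \<in> sobolev r \<and>
     ((\<lambda>\<tau>. sob_dist r (\<lambda>x. (u \<tau> x - u t x) / (\<tau> - t)) v) \<longlongrightarrow> 0) (at t)"

definition time_deriv ::
  "real \<Rightarrow> (real \<Rightarrow> real \<Rightarrow> real) \<Rightarrow> real \<Rightarrow> real \<Rightarrow> real" where
  "time_deriv r u t = (SOME v. has_time_deriv r u v t)"

text \<open>For open \<open>J\<close>:\<close>

definition sob_C1 :: "real \<Rightarrow> real set \<Rightarrow> (real \<Rightarrow> real \<Rightarrow> real) \<Rightarrow> bool" where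
  "sob_C1 r J u \<longleftrightarrow>
     (\<forall>t\<in>J. u t \<in> sobolev r \<and> (\<exists>v. has_time_deriv r u v t)) \<and> sob_C0 r J (time_deriv r u)"

definition ch2_solution ::
  "real \<Rightarrow> real set \<Rightarrow> (real \<Rightarrow> real) \<Rightarrow> (real \<Rightarrow> real) \<Rightarrow>
     (real \<Rightarrow> real \<Rightarrow> real) \<Rightarrow> (real \<Rightarrow> real \<Rightarrow> real) \<Rightarrow> bool" where
  "ch2_solution s J u0 \<rho>0 u \<rho> \<longleftrightarrow>
     sob_C0 s J u \<and> sob_C0 (s - 1) J \<rho> \<and> sob_C1 (s - 1) J u \<and> sob_C1 (s - 2) J \<rho> \<and>
     (\<forall>t\<in>J.
        (\<lambda>x. time_deriv (s - 1) u t x + u t x * weak_deriv (u t) x) \<doteq>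
        (\<lambda>x. - A_inv (weak_deriv
                  (\<lambda>y. (u t y)\<^sup>2 + 1/2 * (weak_deriv (u t) y)\<^sup>2 + 1/2 * (\<rho> t y)\<^sup>2)) x)) \<and>
     (\<forall>t\<in>J.
        (\<lambda>x. time_deriv (s - 2) \<rho> t x + u t x * weak_deriv (\<rho> t) x) \<doteq>
        (\<lambda>x. - (\<rho> t x * weak_deriv (u t) x))) \<and>
     u 0 \<doteq> u0 \<and> \<rho> 0 \<doteq> \<rho>0"

definition ch2_unique_solution ::
  "real \<Rightarrow> real set \<Rightarrow> (real \<Rightarrow> real) \<Rightarrow> (real \<Rightarrow> real) \<Rightarrow> bool" where
  "ch2_unique_solution s J u0 \<rho>0 \<longleftrightarrow>
     (\<exists>u \<rho>. ch2_solution s J u0 \<rho>0 u \<rho> \<and>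
        (\<forall>v \<sigma>. ch2_solution s J u0 \<rho>0 v \<sigma> \<longrightarrow> (\<forall>t\<in>J. v t \<doteq> u t \<and> \<sigma> t \<doteq> \<rho> t)))"

definition ch2_data_ball ::
  "real \<Rightarrow> (real \<Rightarrow> real) \<Rightarrow> (real \<Rightarrow> real) \<Rightarrow> real \<Rightarrow> ((real \<Rightarrow> real) \<times> (real \<Rightarrow> real)) set" where
  "ch2_data_ball s u0 \<rho>0 \<delta> =
     {(v0, \<sigma>0). v0 \<in> sobolev s \<and> \<sigma>0 \<in> sobolev (s - 1) \<and>
                 sob_dist s v0 u0 + sob_dist (s - 1) \<sigma>0 \<rho>0 < \<delta>}"

text \<open>
  Continuous dependence near \<open>(u0, \<rho>0)\<close>: all data in some ball around \<open>(u0, \<rho>0)\<close> have a unique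
  solution on the same \<open>J\<close>, and the map from data to solution is continuous on that ball.  The
  space of solutions carries the usual topology of \<open>C(J, H\<^sup>s \<times> H\<^bsup>s-1\<^esup>) \<inter> C\<^sup>1(J, H\<^bsup>s-1\<^esup> \<times> H\<^bsup>s-2\<^esup>)\<close> for
  open \<open>J\<close>, i.e. uniform convergence on compact subsets of \<open>J\<close> of the solution in \<open>H\<^sup>s \<times> H\<^bsup>s-1\<^esup>\<close>
  and of its time derivative in \<open>H\<^bsup>s-1\<^esup> \<times> H\<^bsup>s-2\<^esup>\<close>.
\<close>

definition ch2_continuous_dependence ::
  "real \<Rightarrow> real set \<Rightarrow> (real \<Rightarrow> real) \<Rightarrow> (real \<Rightarrow> real) \<Rightarrow> bool" where
  "ch2_continuous_dependence s J u0 \<rho>0 \<longleftrightarrow>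
     (\<exists>\<delta>>0.
        (\<forall>(v0, \<sigma>0) \<in> ch2_data_ball s u0 \<rho>0 \<delta>. ch2_unique_solution s J v0 \<sigma>0) \<and>
        (\<forall>(v0, \<sigma>0) \<in> ch2_data_ball s u0 \<rho>0 \<delta>. \<forall>v \<sigma>. ch2_solution s J v0 \<sigma>0 v \<sigma> \<longrightarrow>
           (\<forall>K \<epsilon>. compact K \<and> K \<subseteq> J \<and> \<epsilon> > 0 \<longrightarrow>
              (\<exists>\<eta>>0. \<forall>(w0, \<tau>0) \<in> ch2_data_ball s u0 \<rho>0 \<delta> \<inter> ch2_data_ball s v0 \<sigma>0 \<eta>.
                 \<forall>w \<tau>. ch2_solution s J w0 \<tau>0 w \<tau> \<longrightarrow>
                   (\<forall>t\<in>K.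
                      sob_dist s (w t) (v t) < \<epsilon> \<and>
                      sob_dist (s - 1) (\<tau> t) (\<sigma> t) < \<epsilon> \<and>
                      sob_dist (s - 1) (time_deriv (s - 1) w t) (time_deriv (s - 1) v t) < \<epsilon> \<and>
                      sob_dist (s - 2) (time_deriv (s - 2) \<tau> t) (time_deriv (s - 2) \<sigma> t) < \<epsilon>)))))"

end

theory Submission
  imports Defs
begin

text \<open>
  All estimates are made for the Fourier coefficients of \<open>(u, \<rho>)\<close>, where the nonlinearity is the
  quadratic form of a bilinear convolution operator.  A Galerkin truncation gives globally defined
  approximate solutions.  In the energy estimate the transport term loses no derivative, because a
  slowly varying weight almost commutes with it and the rest is skew-adjoint up to \<open>u\<^sub>x\<close>; this bounds
  the norm on a time interval depending only on the size of the data.  In the weak norm of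
  \<open>H\<^sup>1 \<times> L\<^sup>2\<close> the equation is stable, which gives both convergence of the truncations and uniqueness.
  The same energy estimate holds, with constants independent of \<open>R\<close>, for weights that damp the
  frequencies below \<open>R\<close>; so the high-frequency tail of a solution is controlled by the tail of its
  initial data.  Together with weak stability for the low frequencies this yields continuity in time
  and continuous dependence in the strong norm.
\<close>

text \<open>The obstacle is the lost derivative: u u_x and u rho_x lie one order below (u, rho), so
  a contraction argument does not close in the solution space itself. The right-hand side is
  therefore polarised: in \<open>bil m y z\<close> the argument y is the velocity and z is
  transported. A difference of two nonlinearities then splits into the difference transported by a
  given solution, where the energy argument applies, and the difference as velocity, where the
  transported derivative falls on a given solution. Sup norms are replaced by l^1 norms of
  coefficients, so that every product estimate is Young's inequality on a finite window. The
  assumption s > 5/2 enters as summability of \<open>jb n powr (2 - 2 * \<sigma>)\<close> with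
  \<sigma> = s - 1, which gives l^1 control of u_xx and rho_x. Weak stability by itself reaches only
  norms below the top one, which is why tails need an estimate of their own. The existence time is a
  function of a norm bound R alone; R exceeds the norm of the given data by 1, so all data in a ball
  of radius 1 share one interval.\<close>

text \<open>
  A sequence \<open>y\<close> stands for the Fourier coefficients of \<open>(u, \<rho>)\<close>.  The symbols of \<open>A\<^bsup>1/2\<^esup>\<close>, \<open>\<partial>\<^sub>x\<close> and
  \<open>A\<^sup>-\<^sup>1 \<partial>\<^sub>x\<close> are \<open>jb\<close>, \<open>dsym\<close> and \<open>msym\<close>; \<open>sz\<close> gives \<open>u\<close> its additional derivative over \<open>\<rho>\<close>; and
  \<open>bil m y y\<close>, split into the transport part \<open>tra\<close> and the remainder \<open>rst\<close> of order zero, is the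
  right-hand side of the system with the sums restricted to frequencies at most \<open>m\<close>.
\<close>

definition jb :: "int \<Rightarrow> real" where
  "jb n = sqrt (1 + (2 * pi * of_int n)\<^sup>2)"

definition win :: "nat \<Rightarrow> int set" where
  "win m = {- int m..int m}"

definition dsym :: "int \<Rightarrow> complex" where
  "dsym n = \<i> * of_real (2 * pi * of_int n)"

definition msym :: "int \<Rightarrow> complex" where
  "msym n = dsym n / of_real ((jb n)\<^sup>2)"

definition conv :: "nat \<Rightarrow> (int \<Rightarrow> 'a::semiring_0) \<Rightarrow> (int \<Rightarrow> 'a) \<Rightarrow> int \<Rightarrow> 'a" where
  "conv m f g n = (\<Sum>k\<in>win m. f (n - k) * g k)"

definition trn :: "nat \<Rightarrow> (int \<Rightarrow> 'a::zero) \<Rightarrow> int \<Rightarrow> 'a" where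
  "trn m y n = (if n \<in> win m then y n else 0)"

definition supp :: "nat \<Rightarrow> (int \<Rightarrow> 'a::zero) \<Rightarrow> bool" where
  "supp m y \<longleftrightarrow> (\<forall>n. n \<notin> win m \<longrightarrow> y n = 0)"

definition sz :: "int \<Rightarrow> complex \<times> complex \<Rightarrow> real" where
  "sz n z = sqrt ((jb n * cmod (fst z))\<^sup>2 + (cmod (snd z))\<^sup>2)"

text \<open>Weight 1 gives the norm of H^1 x L^2 and \<open>wt \<sigma> 0\<close> that of
  H^(\<sigma>+1) x H^\<sigma>, each restricted to the frequencies in \<open>win m\<close>. With
  finite partial norms, bounded uniformly in m, no summability side conditions arise.\<close>

definition Nv :: "(int \<Rightarrow> real) \<Rightarrow> nat \<Rightarrow> (int \<Rightarrow> complex \<times> complex) \<Rightarrow> real" where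
  "Nv v m y = L2_set (\<lambda>n. v n * sz n (y n)) (win m)"

definition tra :: "nat \<Rightarrow> (int \<Rightarrow> complex \<times> complex) \<Rightarrow> (int \<Rightarrow> complex \<times> complex) \<Rightarrow> int \<Rightarrow> complex \<times> complex" where
  "tra m y z n =
     (- conv m (\<lambda>j. fst (y j)) (\<lambda>k. dsym k * fst (z k)) n,
      - conv m (\<lambda>j. fst (y j)) (\<lambda>k. dsym k * snd (z k)) n)"

definition rst :: "nat \<Rightarrow> (int \<Rightarrow> complex \<times> complex) \<Rightarrow> (int \<Rightarrow> complex \<times> complex) \<Rightarrow> int \<Rightarrow> complex \<times> complex" where
  "rst m y z n =
     (- msym n * (conv m (\<lambda>j. fst (y j)) (\<lambda>k. fst (z k)) n
          + 1/2 * conv m (\<lambda>j. dsym j * fst (y j)) (\<lambda>k. dsym k * fst (z k)) n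
          + 1/2 * conv m (\<lambda>j. snd (y j)) (\<lambda>k. snd (z k)) n),
      - conv m (\<lambda>j. snd (y j)) (\<lambda>k. dsym k * fst (z k)) n)"

definition bil :: "nat \<Rightarrow> (int \<Rightarrow> complex \<times> complex) \<Rightarrow> (int \<Rightarrow> complex \<times> complex) \<Rightarrow> int \<Rightarrow> complex \<times> complex" where
  "bil m y z n = tra m y z n + rst m y z n"

section \<open>Bounds on the symbols and on the size \<open>sz\<close> of a coefficient pair\<close>

lemma finite_win [simp]: "finite (win m)"
  by (simp add: win_def)

lemma mem_win: "n \<in> win m \<longleftrightarrow> \<bar>n\<bar> \<le> int m"
  by (auto simp: win_def)

lemma win_mono: "m \<le> M \<Longrightarrow> win m \<subseteq> win M"
  by (auto simp: win_def)

lemma jb_ge1: "1 \<le> jb n"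
  by (simp add: jb_def)

lemma jb_pos [simp]: "0 < jb n" and jb_ge0 [simp]: "0 \<le> jb n" and jb_nz [simp]: "jb n \<noteq> 0"
  using jb_ge1[of n] by linarith+

lemma jb_minus [simp]: "jb (- n) = jb n"
  by (simp add: jb_def)

lemma jb_sq: "(jb n)\<^sup>2 = 1 + (2 * pi * of_int n)\<^sup>2"
  by (simp add: jb_def)

lemma jb_add: "jb (j + k) \<le> jb j + jb k"
proof -
  let ?x = "2 * pi * real_of_int j" and ?y = "2 * pi * real_of_int k"
  have "\<bar>?x\<bar> \<le> jb j" "\<bar>?y\<bar> \<le> jb k"
    by (auto simp: jb_def intro!: real_le_rsqrt)
  then have "\<bar>?x\<bar> * \<bar>?y\<bar> \<le> jb j * jb k"
    by (intro mult_mono) auto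
  then have "?x * ?y \<le> jb j * jb k"
    by (metis abs_ge_self abs_mult order_trans)
  then have "1 + (?x + ?y)\<^sup>2 \<le> (jb j + jb k)\<^sup>2"
    unfolding power2_sum jb_sq by simp
  then have "sqrt (1 + (?x + ?y)\<^sup>2) \<le> jb j + jb k"
    by (intro real_le_lsqrt) auto
  then show ?thesis
    by (simp add: jb_def algebra_simps)
qed

lemma jb_diff: "\<bar>jb n - jb k\<bar> \<le> jb (n - k)"
  using jb_add[of "n - k" k] jb_add[of "k - n" n] jb_minus[of "n - k"] by simp

lemma jb_add_le_mult: "jb (j + k) \<le> 2 * jb j * jb k"
proof -
  have "jb j * 1 \<le> jb j * jb k" "1 * jb k \<le> jb j * jb k"
    using jb_ge1 by (intro mult_mono; simp)+
  then show ?thesis using jb_add[of j k] by linarith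
qed

lemma cmod_dsym: "cmod (dsym n) = \<bar>2 * pi * of_int n\<bar>"
  by (simp add: dsym_def norm_mult del: of_real_mult)

lemma cmod_dsym_le: "cmod (dsym n) \<le> jb n"
  by (auto simp: cmod_dsym jb_def intro!: real_le_rsqrt)

lemma dsym_diff: "dsym (m - n) = dsym m - dsym n"
  by (simp add: dsym_def algebra_simps)

lemma cnj_dsym [simp]: "cnj (dsym n) = - dsym n"
  by (simp add: dsym_def)

lemma dsym_minus [simp]: "dsym (- n) = - dsym n"
  by (simp add: dsym_def)

lemma cmod_msym_le: "jb n * cmod (msym n) \<le> 1"
proof -
  have "jb n * cmod (msym n) = cmod (dsym n) / jb n"
    by (simp add: msym_def norm_divide norm_power power2_eq_square norm_mult)
  then show ?thesis using cmod_dsym_le[of n] by simp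
qed

lemma sz_ge0 [simp]: "0 \<le> sz n z"
  by (simp add: sz_def)

lemma sz_fst: "jb n * cmod (fst z) \<le> sz n z"
  unfolding sz_def by (rule real_le_rsqrt) simp

lemma sz_fst': "cmod (fst z) \<le> sz n z"
proof -
  have "1 * cmod (fst z) \<le> jb n * cmod (fst z)" by (intro mult_right_mono jb_ge1) simp
  then show ?thesis using sz_fst[of n z] by simp
qed

lemma sz_snd: "cmod (snd z) \<le> sz n z"
  unfolding sz_def by (rule real_le_rsqrt) simp

lemma sz_le: "sz n z \<le> jb n * cmod (fst z) + cmod (snd z)"
  unfolding sz_def using sqrt_add_le_add_sqrt[of "(jb n * cmod (fst z))\<^sup>2" "(cmod (snd z))\<^sup>2"]
  by simp

lemma sz_dsym_fst: "cmod (dsym n * fst z) \<le> sz n z"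
proof -
  have "cmod (dsym n * fst z) \<le> jb n * cmod (fst z)"
    unfolding norm_mult by (intro mult_right_mono cmod_dsym_le) simp
  then show ?thesis using sz_fst[of n z] by simp
qed

lemma sz_sq: "(sz n z)\<^sup>2 = (jb n)\<^sup>2 * (cmod (fst z))\<^sup>2 + (cmod (snd z))\<^sup>2"
  by (simp add: sz_def power_mult_distrib)

lemma sz_0 [simp]: "sz n 0 = 0"
  by (simp add: sz_def)

lemma sz_triangle: "sz n (z + w) \<le> sz n z + sz n w"
proof -
  have *: "jb n * cmod (fst z + fst w) \<le> jb n * cmod (fst z) + jb n * cmod (fst w)"
    by (metis distrib_left jb_ge0 mult_left_mono norm_triangle_ineq)
  have "sz n (z + w) \<le> sqrt ((jb n * cmod (fst z) + jb n * cmod (fst w))\<^sup>2 + (cmod (snd z) + cmod (snd w))\<^sup>2)"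
    unfolding sz_def using * norm_triangle_ineq[of "snd z" "snd w"]
    by (intro real_sqrt_le_mono add_mono power_mono) auto
  also have "\<dots> \<le> sz n z + sz n w"
    unfolding sz_def by (rule real_sqrt_sum_squares_triangle_ineq)
  finally show ?thesis .
qed

lemma sz_minus [simp]: "sz n (- z) = sz n z"
  by (simp add: sz_def)

lemma sz_diff: "sz n (z - w) \<le> sz n z + sz n w"
  using sz_triangle[of n z "- w"] by simp

lemma norm_le_sz: "norm z \<le> sz n z"
proof -
  have "cmod (fst z) \<le> jb n * cmod (fst z)"
    using jb_ge1[of n] mult_right_mono[of 1 "jb n" "cmod (fst z)"] by simp
  then show ?thesis
    unfolding sz_def norm_prod_def by (intro real_sqrt_le_mono add_mono power_mono) auto
qed

lemma sz_le_norm: "sz n z \<le> 2 * jb n * norm z"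
proof -
  have 1: "jb n * cmod (fst z) \<le> jb n * norm z"
    by (intro mult_left_mono) (use norm_fst_le[of "fst z" "snd z"] in auto)
  have "1 * cmod (snd z) \<le> jb n * norm z"
    using jb_ge1[of n] norm_snd_le[of "snd z" "fst z"] by (intro mult_mono) auto
  then show ?thesis using sz_le[of n z] 1 by linarith
qed

lemma sz_tendsto: "(f \<longlongrightarrow> l) F \<Longrightarrow> ((\<lambda>x. sz n (f x)) \<longlongrightarrow> sz n l) F"
  unfolding sz_def by (intro tendsto_intros)

lemma conv_cmod:
  "cmod (conv m f g n) \<le> conv m (\<lambda>j. cmod (f j)) (\<lambda>k. cmod (g k)) n"
  unfolding conv_def by (rule order_trans[OF norm_sum]) (simp add: norm_mult)

lemma conv_mono:
  fixes p q p' q' :: "int \<Rightarrow> real"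
  assumes "\<And>n. p n \<le> p' n" "\<And>n. q n \<le> q' n" "\<And>n. 0 \<le> p n" "\<And>n. 0 \<le> q n"
  shows "conv m p q n \<le> conv m p' q' n"
  unfolding conv_def
proof (intro sum_mono mult_mono assms)
  fix k show "0 \<le> p' (n - k)" using assms(1,3)[of "n - k"] by linarith
qed

lemma conv_nonneg:
  fixes p q :: "int \<Rightarrow> real"
  shows "(\<And>n. 0 \<le> p n) \<Longrightarrow> (\<And>n. 0 \<le> q n) \<Longrightarrow> 0 \<le> conv m p q n"
  unfolding conv_def by (intro sum_nonneg mult_nonneg_nonneg)

lemma conv_cmod_le:
  assumes "\<And>n. cmod (f n) \<le> p n" "\<And>n. cmod (g n) \<le> q n"
  shows "cmod (conv m f g n) \<le> conv m p q n"
  using conv_cmod[of m f g n] conv_mono[of "\<lambda>j. cmod (f j)" p "\<lambda>k. cmod (g k)" q m n] assms by simp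

text \<open>No derivative is lost: the order -1 of \<open>msym\<close> pays exactly for the factor
  \<open>jb n\<close> in the first component of \<open>sz\<close>, and u, u_x and rho are all
  dominated by \<open>sz\<close>.\<close>

lemma sz_rst: "sz n (rst m y z n) \<le> 3 * conv m (\<lambda>j. sz j (y j)) (\<lambda>k. sz k (z k)) n"
proof -
  let ?P = "conv m (\<lambda>j. sz j (y j)) (\<lambda>k. sz k (z k)) n"
  let ?c1 = "conv m (\<lambda>j. fst (y j)) (\<lambda>k. fst (z k)) n"
  let ?c2 = "conv m (\<lambda>j. dsym j * fst (y j)) (\<lambda>k. dsym k * fst (z k)) n"
  let ?c3 = "conv m (\<lambda>j. snd (y j)) (\<lambda>k. snd (z k)) n"
  have 1: "cmod ?c1 \<le> ?P" "cmod ?c2 \<le> ?P" "cmod ?c3 \<le> ?P"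
      "cmod (conv m (\<lambda>j. snd (y j)) (\<lambda>k. dsym k * fst (z k)) n) \<le> ?P"
    by (intro conv_cmod_le sz_fst' sz_dsym_fst sz_snd)+
  have "cmod (?c1 + 1/2 * ?c2 + 1/2 * ?c3) \<le> cmod ?c1 + 1/2 * cmod ?c2 + 1/2 * cmod ?c3"
    by (intro norm_triangle_le add_mono) (auto simp: norm_mult)
  then have 2: "cmod (?c1 + 1/2 * ?c2 + 1/2 * ?c3) \<le> 2 * ?P"
    using 1 by simp
  have "jb n * cmod (fst (rst m y z n)) = (jb n * cmod (msym n)) * cmod (?c1 + 1/2 * ?c2 + 1/2 * ?c3)"
    by (simp add: rst_def norm_mult)
  also have "\<dots> \<le> 1 * (2 * ?P)"
    by (intro mult_mono cmod_msym_le 2) auto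
  finally show ?thesis
    using sz_le[of n "rst m y z n"] 1(4) by (simp add: rst_def)
qed

text \<open>In the first component the output weight \<open>jb n\<close> is at most
  \<open>2 * jb (n - k) * jb k\<close>: one factor is absorbed by the velocity inside
  \<open>sz\<close>, the other is the derivative lost on z.\<close>

lemma sz_tra: "sz n (tra m y z n) \<le> 3 * conv m (\<lambda>j. sz j (y j)) (\<lambda>k. jb k * sz k (z k)) n"
proof -
  have a: "jb n * cmod (fst (tra m y z n)) \<le> 2 * conv m (\<lambda>j. sz j (y j)) (\<lambda>k. jb k * sz k (z k)) n"
  proof -
    have "jb n * cmod (fst (tra m y z n))
        \<le> jb n * (\<Sum>k\<in>win m. cmod (fst (y (n - k))) * cmod (dsym k * fst (z k)))"
      unfolding tra_def using conv_cmod[of m "\<lambda>j. fst (y j)" "\<lambda>k. dsym k * fst (z k)" n]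
      by (intro mult_left_mono) (auto simp: conv_def)
    also have "\<dots> = (\<Sum>k\<in>win m. jb n * (cmod (fst (y (n - k))) * cmod (dsym k * fst (z k))))"
      by (simp add: sum_distrib_left)
    also have "\<dots> \<le> (\<Sum>k\<in>win m. 2 * (sz (n - k) (y (n - k)) * (jb k * sz k (z k))))"
    proof (rule sum_mono)
      fix k
      have "jb n * (cmod (fst (y (n - k))) * cmod (dsym k * fst (z k)))
          \<le> (2 * jb (n - k) * jb k) * (cmod (fst (y (n - k))) * cmod (dsym k * fst (z k)))"
        using jb_add_le_mult[of "n - k" k] by (intro mult_right_mono) auto
      also have "\<dots> = 2 * ((jb (n - k) * cmod (fst (y (n - k)))) * (jb k * cmod (dsym k * fst (z k))))"
        by simp
      also have "\<dots> \<le> 2 * (sz (n - k) (y (n - k)) * (jb k * sz k (z k)))"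
        by (intro mult_left_mono mult_mono sz_fst sz_dsym_fst) auto
      finally show "jb n * (cmod (fst (y (n - k))) * cmod (dsym k * fst (z k)))
          \<le> 2 * (sz (n - k) (y (n - k)) * (jb k * sz k (z k)))" .
    qed
    finally show ?thesis by (simp add: conv_def sum_distrib_left)
  qed
  have "cmod (dsym k * snd (z k)) \<le> jb k * sz k (z k)" for k
    unfolding norm_mult by (intro mult_mono cmod_dsym_le sz_snd) auto
  then have "cmod (snd (tra m y z n)) \<le> conv m (\<lambda>j. sz j (y j)) (\<lambda>k. jb k * sz k (z k)) n"
    unfolding tra_def by (auto intro!: conv_cmod_le sz_fst')
  then show ?thesis using a sz_le[of n "tra m y z n"] by simp
qed

lemma sz_bil: "sz n (bil m y z n) \<le> 6 * conv m (\<lambda>j. sz j (y j)) (\<lambda>k. jb k * sz k (z k)) n"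
proof -
  have "conv m (\<lambda>j. sz j (y j)) (\<lambda>k. sz k (z k)) n \<le> conv m (\<lambda>j. sz j (y j)) (\<lambda>k. jb k * sz k (z k)) n"
    using mult_right_mono[OF jb_ge1 sz_ge0] by (intro conv_mono) auto
  then show ?thesis
    using sz_triangle[of n "tra m y z n" "rst m y z n"] sz_rst[of n m y z] sz_tra[of n m y z]
    by (simp add: bil_def)
qed

subsection \<open>Young's inequality\<close>

lemma L2_set_sum_le:
  assumes "finite S" "finite A"
  shows "L2_set (\<lambda>n. \<Sum>k\<in>A. f k n) S \<le> (\<Sum>k\<in>A. L2_set (f k) S)"
  using assms(2)
proof (induction A rule: finite_induct)
  case empty then show ?case by (simp add: L2_set_0')
next
  case (insert k A)
  then show ?case
    using L2_set_triangle_ineq[of "f k" "\<lambda>n. \<Sum>k\<in>A. f k n" S] by simp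
qed

lemma L2_set_cmult: "0 \<le> c \<Longrightarrow> L2_set (\<lambda>n. c * f n) S = c * L2_set f S"
  by (simp add: L2_set_right_distrib)

lemma L2_set_shift_le:
  fixes p :: "int \<Rightarrow> real"
  assumes "supp M p" "finite S"
  shows "L2_set (\<lambda>n. p (n - k)) S \<le> L2_set p (win M)"
proof -
  have "(\<Sum>n\<in>S. (p (n - k))\<^sup>2) = (\<Sum>j\<in>(\<lambda>n. n - k) ` S. (p j)\<^sup>2)"
    by (subst sum.reindex) (auto simp: inj_on_def)
  also have "\<dots> = (\<Sum>j\<in>(\<lambda>n. n - k) ` S \<inter> win M. (p j)\<^sup>2)"
    using assms by (intro sum.mono_neutral_right) (auto simp: supp_def)
  also have "\<dots> \<le> (\<Sum>j\<in>win M. (p j)\<^sup>2)"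
    by (rule sum_mono2) auto
  finally show ?thesis by (simp add: L2_set_def)
qed

text \<open>The convolution is a combination of translates of p with coefficients q, and a translate
  of p has no larger l^2 norm than p on its support.\<close>

lemma young_right:
  fixes p q :: "int \<Rightarrow> real"
  assumes "supp M p" "finite S" "\<And>n. 0 \<le> q n"
  shows "L2_set (conv m p q) S \<le> L2_set p (win M) * sum q (win m)"
proof -
  have "L2_set (conv m p q) S = L2_set (\<lambda>n. \<Sum>k\<in>win m. q k * p (n - k)) S"
    by (simp add: conv_def[abs_def] mult.commute)
  also have "\<dots> \<le> (\<Sum>k\<in>win m. L2_set (\<lambda>n. q k * p (n - k)) S)"
    by (rule L2_set_sum_le) (use assms in auto)
  also have "\<dots> = (\<Sum>k\<in>win m. q k * L2_set (\<lambda>n. p (n - k)) S)"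
    by (simp add: L2_set_cmult assms)
  also have "\<dots> \<le> (\<Sum>k\<in>win m. q k * L2_set p (win M))"
    by (intro sum_mono mult_left_mono L2_set_shift_le assms)
  finally show ?thesis by (simp add: sum_distrib_right mult.commute)
qed

text \<open>The sum cuts k but not n - k, so symmetry depends on both supports. On either side only
  the k with k and n - k in \<open>win m\<close> survive, and k -> n - k is an involution of that
  set.\<close>

lemma conv_commute:
  fixes f g :: "int \<Rightarrow> 'a::comm_semiring_0"
  assumes "supp m f" "supp m g"
  shows "conv m f g n = conv m g f n"
proof -
  have "conv m f g n = (\<Sum>k\<in>win m \<inter> (\<lambda>j. n - j) ` win m. f (n - k) * g k)"
    unfolding conv_def
  proof (rule sum.mono_neutral_right)
    show "\<forall>i\<in>win m - win m \<inter> (-) n ` win m. f (n - i) * g i = 0"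
    proof
      fix i assume i: "i \<in> win m - win m \<inter> (-) n ` win m"
      then have "n - i \<notin> win m" by (auto simp: image_iff dest!: bspec[of _ _ "n - i"])
      then show "f (n - i) * g i = 0" using assms by (simp add: supp_def)
    qed
  qed auto
  also have "\<dots> = (\<Sum>k\<in>(\<lambda>j. n - j) ` (win m \<inter> (\<lambda>j. n - j) ` win m). f k * g (n - k))"
    by (subst sum.reindex) (auto simp: inj_on_def)
  also have "(\<lambda>j. n - j) ` (win m \<inter> (\<lambda>j. n - j) ` win m) = win m \<inter> (\<lambda>j. n - j) ` win m"
    by (auto simp: image_iff) (metis diff_diff_eq2 add_diff_cancel_left')+
  also have "(\<Sum>k\<in>win m \<inter> (\<lambda>j. n - j) ` win m. f k * g (n - k)) = (\<Sum>k\<in>win m. f k * g (n - k))"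
  proof (rule sum.mono_neutral_left)
    show "\<forall>i\<in>win m - win m \<inter> (-) n ` win m. f i * g (n - i) = 0"
    proof
      fix i assume i: "i \<in> win m - win m \<inter> (-) n ` win m"
      then have "n - i \<notin> win m" by (auto simp: image_iff dest!: bspec[of _ _ "n - i"])
      then show "f i * g (n - i) = 0" using assms by (simp add: supp_def)
    qed
  qed auto
  finally show ?thesis by (simp add: conv_def mult.commute)
qed

lemma young_left:
  fixes p q :: "int \<Rightarrow> real"
  assumes "supp m p" "supp m q" "finite S" "\<And>n. 0 \<le> p n"
  shows "L2_set (conv m p q) S \<le> sum p (win m) * L2_set q (win m)"
proof -
  have "conv m p q = conv m q p" using conv_commute[OF assms(1,2)] by auto
  then show ?thesis
    using young_right[OF assms(2,3), of p m] assms(4) by (simp add: mult.commute)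
qed

lemma conv_weight_le:
  fixes p q v :: "int \<Rightarrow> real"
  assumes V: "\<And>j k. v (j + k) \<le> K * v k + L * v' j" and "\<And>n. 0 \<le> p n" "\<And>n. 0 \<le> q n"
  shows "v n * conv m p q n \<le> K * conv m p (\<lambda>k. v k * q k) n + L * conv m (\<lambda>j. v' j * p j) q n"
proof -
  have "v n * conv m p q n = (\<Sum>k\<in>win m. v n * (p (n - k) * q k))"
    by (simp add: conv_def sum_distrib_left)
  also have "\<dots> \<le> (\<Sum>k\<in>win m. (K * v k + L * v' (n - k)) * (p (n - k) * q k))"
    using V[of "n - k" k for k] assms by (intro sum_mono mult_right_mono) auto
  also have "\<dots> = K * conv m p (\<lambda>k. v k * q k) n + L * conv m (\<lambda>j. v' j * p j) q n"
    by (simp add: conv_def sum_distrib_left sum.distrib algebra_simps)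
  finally show ?thesis .
qed

lemma L2_set_mono': "(\<And>n. n \<in> S \<Longrightarrow> \<bar>f n\<bar> \<le> g n) \<Longrightarrow> L2_set f S \<le> L2_set g S"
  unfolding L2_set_def
  by (intro real_sqrt_le_mono sum_mono) (metis abs_ge_zero power2_abs power_mono)

lemma supp_sz: "supp m y \<Longrightarrow> supp m (\<lambda>n. sz n (y n))"
  and supp_mult: "supp m f \<Longrightarrow> supp m (\<lambda>n. (v n::'a::mult_zero) * f n)"
  by (auto simp: supp_def)

lemma supp_trn: "supp m (trn m y)" by (simp add: supp_def trn_def)

lemma trn_id: "supp m y \<Longrightarrow> trn m y = y" by (auto simp: supp_def trn_def fun_eq_iff)

text \<open>The sequence form of the product estimate: the weight is passed to one factor, and the
  other is measured in l^1, which plays the role of the sup norm.\<close>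

lemma young_weight:
  fixes p q v :: "int \<Rightarrow> real"
  assumes V: "\<And>j k. v (j + k) \<le> K * v k + L * v' j" and "0 \<le> K" "0 \<le> L"
    and p: "supp m p" "\<And>n. 0 \<le> p n" and q: "supp m q" "\<And>n. 0 \<le> q n"
    and v: "\<And>n. 0 \<le> v n" "\<And>n. 0 \<le> v' n" and S: "finite S"
  shows "L2_set (\<lambda>n. v n * conv m p q n) S
     \<le> K * (sum p (win m) * L2_set (\<lambda>n. v n * q n) (win m))
      + L * (L2_set (\<lambda>n. v' n * p n) (win m) * sum q (win m))"
proof -
  have "L2_set (\<lambda>n. v n * conv m p q n) S
      \<le> L2_set (\<lambda>n. K * conv m p (\<lambda>k. v k * q k) n + L * conv m (\<lambda>j. v' j * p j) q n) S"
    using v p q by (intro L2_set_mono') (auto intro!: conv_weight_le[OF V] simp: abs_of_nonneg conv_nonneg)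
  also have "\<dots> \<le> L2_set (\<lambda>n. K * conv m p (\<lambda>k. v k * q k) n) S + L2_set (\<lambda>n. L * conv m (\<lambda>j. v' j * p j) q n) S"
    by (rule L2_set_triangle_ineq)
  also have "\<dots> = K * L2_set (conv m p (\<lambda>k. v k * q k)) S + L * L2_set (conv m (\<lambda>j. v' j * p j) q) S"
    using assms by (simp add: L2_set_cmult)
  also have "\<dots> \<le> K * (sum p (win m) * L2_set (\<lambda>n. v n * q n) (win m))
      + L * (L2_set (\<lambda>n. v' n * p n) (win m) * sum q (win m))"
    using assms by (intro add_mono mult_left_mono young_left young_right supp_mult) auto
  finally show ?thesis .
qed

subsection \<open>Weights\<close>

text \<open>The two inequalities are what a product estimate and a commutator estimate need of a weight.\<close>

definition admw :: "real \<Rightarrow> real \<Rightarrow> (int \<Rightarrow> real) \<Rightarrow> bool" where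
  "admw K L v \<longleftrightarrow> 0 \<le> K \<and> 0 \<le> L \<and> (\<forall>n. 0 \<le> v n) \<and>
     (\<forall>j k. v (j + k) \<le> K * v k + L * v j) \<and>
     (\<forall>j k. \<bar>v (j + k) - v k\<bar> * jb k \<le> jb j * (K * v k + L * v j))"

text \<open>The factor \<open>jb n / (jb n + R)\<close> is close to \<open>1\<close> for frequencies far above \<open>R\<close> and small below, but
  varies slowly uniformly in \<open>R\<close>.\<close>

definition wt :: "real \<Rightarrow> real \<Rightarrow> int \<Rightarrow> real" where
  "wt \<sigma> R n = jb n powr (\<sigma> + 1) / (jb n + R)"

text \<open>A constant weight has no commutator. That L may be 0 is what \<open>comparison\<close>
  relies on: the l^1 norm of the difference, which the weak norm cannot control, then drops out of
  \<open>ipr_bil_le\<close>.\<close>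

lemma admw_1: "admw 1 0 (\<lambda>_. 1)"
  by (simp add: admw_def)

lemma wt_ge0 [simp]: "0 \<le> R \<Longrightarrow> 0 \<le> wt \<sigma> R n"
  by (simp add: wt_def add_nonneg_nonneg)

lemma wt_0: "wt \<sigma> 0 n = jb n powr \<sigma>"
  by (simp add: wt_def powr_add)

lemma wt_0_add: "wt (\<sigma> + 1) 0 n = jb n * wt \<sigma> 0 n"
  by (simp add: wt_0 powr_add)

lemma wt_le: "0 \<le> R \<Longrightarrow> wt \<sigma> R n \<le> wt \<sigma> 0 n"
  unfolding wt_def by (intro divide_left_mono mult_pos_pos add_pos_nonneg) auto

lemma wt_le_jb: "0 < R \<Longrightarrow> wt \<sigma> R n \<le> jb n / R * wt \<sigma> 0 n"
proof -
  assume R: "0 < R"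
  have "wt \<sigma> R n \<le> jb n powr (\<sigma> + 1) / R"
    unfolding wt_def using R by (intro divide_left_mono mult_pos_pos add_pos_pos) auto
  then show ?thesis by (simp add: wt_0 powr_add mult.commute)
qed

text \<open>Above R the damping factor is at least 1/2, below R the full weight is at most
  \<open>R powr \<sigma>\<close>. Hence the strong norm is bounded by a tail norm and a multiple of
  the weak norm.\<close>

lemma wt_split: "0 \<le> R \<Longrightarrow> 0 \<le> \<sigma> \<Longrightarrow> wt \<sigma> 0 n \<le> 2 * wt \<sigma> R n + R powr \<sigma>"
proof (cases "R \<le> jb n")
  assume R: "0 \<le> R" "0 \<le> \<sigma>"
  case True
  have "wt \<sigma> 0 n = 2 * (jb n powr (\<sigma> + 1) / (jb n + jb n))"
    by (simp add: wt_0 powr_add)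
  also have "\<dots> \<le> 2 * wt \<sigma> R n"
    unfolding wt_def using True R by (intro mult_left_mono divide_left_mono mult_pos_pos add_pos_nonneg) auto
  finally show ?thesis by (simp add: add_increasing2)
next
  assume R: "0 \<le> R" "0 \<le> \<sigma>"
  case False
  then have "wt \<sigma> 0 n \<le> R powr \<sigma>"
    unfolding wt_0 using R by (intro powr_mono2) auto
  then show ?thesis using R by (simp add: add_increasing)
qed

text \<open>Mean value theorem; restricting to arguments up to 2 bounds the derivative. Frequencies
  with \<open>jb j \<le> jb k\<close> have such a ratio \<open>jb (j + k) / jb k\<close>.\<close>

lemma powr_lip:
  assumes p: "1 \<le> p" and \<tau>: "0 < \<tau>" "\<tau> \<le> (2::real)"
  shows "\<bar>\<tau> powr p - 1\<bar> \<le> p * 2 powr p * \<bar>\<tau> - 1\<bar>"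
proof -
  have "norm (\<tau> powr p - 1 powr p) \<le> (p * 2 powr p) * norm (\<tau> - 1)"
  proof (rule field_differentiable_bound[where S = "{0<..2}" and f' = "\<lambda>x. p * x powr (p - 1)"])
    fix z :: real assume z: "z \<in> {0<..2}"
    then show "((\<lambda>x. x powr p) has_field_derivative p * z powr (p - 1)) (at z within {0<..2})"
      by (auto intro!: derivative_eq_intros simp: has_field_derivative_at_within)
    have "z powr (p - 1) \<le> 2 powr (p - 1)" using z p by (intro powr_mono2) auto
    also have "\<dots> \<le> 2 powr p" by (intro powr_mono) auto
    finally show "norm (p * z powr (p - 1)) \<le> p * 2 powr p" using p by (simp add: abs_mult)
  qed (use \<tau> in auto)
  then show ?thesis by simp
qed

text \<open>The profile of \<open>wt\<close> in the variable \<open>jb n\<close>, taken as a real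
  variable so that monotonicity and doubling can be used between frequencies.\<close>

definition phi :: "real \<Rightarrow> real \<Rightarrow> real \<Rightarrow> real" where
  "phi \<sigma> R x = x powr (\<sigma> + 1) / (x + R)"

lemma phi_mono:
  assumes "0 \<le> \<sigma>" "0 \<le> R" "0 < x" "x \<le> y"
  shows "phi \<sigma> R x \<le> phi \<sigma> R y"
proof -
  have "x / (x + R) \<le> y / (y + R)"
    using assms mult_right_mono[of x y R] by (simp add: divide_simps add_pos_nonneg algebra_simps)
  moreover have "x powr \<sigma> \<le> y powr \<sigma>" using assms by (intro powr_mono2) auto
  ultimately have "x powr \<sigma> * (x / (x + R)) \<le> y powr \<sigma> * (y / (y + R))"
    using assms by (intro mult_mono) auto
  then show ?thesis using assms by (simp add: phi_def powr_add)
qed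

lemma phi_double:
  assumes "0 \<le> \<sigma>" "0 \<le> R" "0 < x"
  shows "phi \<sigma> R (2 * x) \<le> 2 powr (\<sigma> + 1) * phi \<sigma> R x"
proof -
  have "phi \<sigma> R (2 * x) \<le> (2 * x) powr (\<sigma> + 1) / (x + R)"
    unfolding phi_def using assms by (intro divide_left_mono mult_pos_pos add_pos_nonneg) auto
  then show ?thesis using assms by (simp add: phi_def powr_mult)
qed

text \<open>The factor (y + R) / (x + R) pulls the quotient of the two values from (x /
  y)^(\<sigma>+1) towards 1 without passing 1. So the oscillation of the damped profile is at most
  that of the pure power, and R disappears from the bound.\<close>

lemma phi_ratio:
  assumes \<sigma>: "0 \<le> \<sigma>" and R: "0 \<le> R" and x: "0 < x" and y: "0 < y"
  shows "\<bar>phi \<sigma> R x - phi \<sigma> R y\<bar> \<le> phi \<sigma> R y * \<bar>(x / y) powr (\<sigma> + 1) - 1\<bar>"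
proof -
  have e: "phi \<sigma> R x = phi \<sigma> R y * ((x / y) powr (\<sigma> + 1) * ((y + R) / (x + R)))"
    using assms by (simp add: phi_def powr_divide add_pos_nonneg)
  let ?p = "(x / y) powr (\<sigma> + 1)" and ?r = "(y + R) / (x + R)"
  have p0: "0 \<le> ?p" by simp
  have ph: "0 \<le> phi \<sigma> R y" using assms by (simp add: phi_def)
  have "\<bar>?p * ?r - 1\<bar> \<le> \<bar>?p - 1\<bar>"
  proof (cases "y \<le> x")
    case True
    then have r: "?r \<le> 1" using assms by (simp add: divide_simps)
    have "1 powr (\<sigma> + 1) \<le> ?p" using True assms by (intro powr_mono2) auto
    then have p1: "1 \<le> ?p" by simp
    have "1 \<le> x / y * ?r"
    proof -
      have "y * (x + R) \<le> x * (y + R)" using mult_right_mono[OF True R] by (simp add: algebra_simps)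
      then show ?thesis using assms by (simp add: divide_simps add_pos_nonneg)
    qed
    also have "\<dots> \<le> ?p * ?r"
    proof -
      have "(x / y) powr 1 \<le> ?p" using True assms by (intro powr_mono) auto
      then show ?thesis using assms by (intro mult_right_mono) auto
    qed
    finally have "1 \<le> ?p * ?r" .
    moreover have "?p * ?r \<le> ?p * 1" using r p0 by (rule mult_left_mono)
    ultimately show ?thesis using p1 by simp
  next
    case False
    then have r: "1 \<le> ?r" using assms by (simp add: divide_simps add_pos_nonneg)
    have "?p \<le> 1 powr (\<sigma> + 1)" using False assms by (intro powr_mono2) auto
    then have p1: "?p \<le> 1" by simp
    have "x / y * ?r \<le> 1"
    proof -
      have "x * (y + R) \<le> y * (x + R)" using mult_right_mono[of x y R] False R by (simp add: algebra_simps)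
      then show ?thesis using assms by (simp add: divide_simps add_pos_nonneg)
    qed
    moreover have "?p * ?r \<le> x / y * ?r"
    proof -
      have "?p \<le> (x / y) powr 1" using False assms by (intro powr_mono') auto
      then show ?thesis using assms by (intro mult_right_mono) auto
    qed
    ultimately have "?p * ?r \<le> 1" by linarith
    moreover have "?p * 1 \<le> ?p * ?r" using r p0 by (rule mult_left_mono)
    ultimately show ?thesis using p1 by simp
  qed
  then have "phi \<sigma> R y * \<bar>?p * ?r - 1\<bar> \<le> phi \<sigma> R y * \<bar>?p - 1\<bar>"
    using ph by (rule mult_left_mono)
  moreover have "\<bar>phi \<sigma> R x - phi \<sigma> R y\<bar> = phi \<sigma> R y * \<bar>?p * ?r - 1\<bar>"
  proof -
    have "phi \<sigma> R x - phi \<sigma> R y = phi \<sigma> R y * (?p * ?r - 1)"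
      by (simp add: e right_diff_distrib)
    then show ?thesis using ph by (simp add: abs_mult)
  qed
  ultimately show ?thesis by simp
qed

lemma wt_phi: "wt \<sigma> R n = phi \<sigma> R (jb n)"
  by (simp add: wt_def phi_def)

lemma wt_add:
  assumes "0 \<le> \<sigma>" "0 \<le> R"
  shows "wt \<sigma> R (j + k) \<le> 2 powr (\<sigma> + 1) * max (wt \<sigma> R k) (wt \<sigma> R j)"
proof -
  have "jb (j + k) \<le> 2 * max (jb k) (jb j)" using jb_add[of j k] by linarith
  then have "wt \<sigma> R (j + k) \<le> phi \<sigma> R (2 * max (jb k) (jb j))"
    unfolding wt_phi using assms by (intro phi_mono) auto
  also have "\<dots> \<le> 2 powr (\<sigma> + 1) * phi \<sigma> R (max (jb k) (jb j))"
    using assms by (intro phi_double) (auto simp: less_max_iff_disj)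
  also have "phi \<sigma> R (max (jb k) (jb j)) \<le> max (wt \<sigma> R k) (wt \<sigma> R j)"
    unfolding wt_phi by (simp add: max_def)
  finally show ?thesis by simp
qed

text \<open>For the commutator inequality there are two cases. If \<open>jb j \<le> jb k\<close>,
  the relative change of the frequency is at most \<open>jb j / jb k\<close>, and Lipschitz
  continuity of the power trades \<open>jb k\<close> for \<open>jb j\<close>. Otherwise
  \<open>jb k\<close> is below \<open>jb j\<close> and the product inequality already suffices. K
  depends on \<sigma> only, which makes the tail estimates uniform in R.\<close>

lemma admw_wt:
  assumes "0 \<le> \<sigma>"
  obtains K where "1 \<le> K" "\<And>R. 0 \<le> R \<Longrightarrow> admw K K (wt \<sigma> R)"
proof -
  \<comment> \<open>The Lipschitz constant of \<open>powr_lip\<close> at the exponent \<sigma> + 1;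
    it also dominates the doubling constant of \<open>wt_add\<close>.\<close>
  define K where "K = (\<sigma> + 1) * 2 powr (\<sigma> + 1)"
  have K2: "2 powr (\<sigma> + 1) \<le> K" unfolding K_def using assms by (simp add: mult_le_cancel_right1)
  have "2 powr 0 \<le> 2 powr (\<sigma> + 1)" using assms by (intro powr_mono) auto
  then have K1: "1 \<le> K" using K2 by simp
  moreover have "admw K K (wt \<sigma> R)" if R: "0 \<le> R" for R
  proof -
    have V1: "wt \<sigma> R (j + k) \<le> K * wt \<sigma> R k + K * wt \<sigma> R j" for j k
    proof -
      have "2 powr (\<sigma> + 1) * max (wt \<sigma> R k) (wt \<sigma> R j) \<le> K * (wt \<sigma> R k + wt \<sigma> R j)"
        using K2 R K1 by (intro mult_mono) (auto simp: le_max_iff_disj)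
      then show ?thesis using wt_add[OF assms R, of j k] by (simp add: algebra_simps)
    qed
    have "\<bar>wt \<sigma> R (j + k) - wt \<sigma> R k\<bar> * jb k \<le> jb j * (K * wt \<sigma> R k + K * wt \<sigma> R j)" for j k
    proof (cases "jb j \<le> jb k")
      case True
      let ?\<tau> = "jb (j + k) / jb k"
      have t: "0 < ?\<tau>" "?\<tau> \<le> 2" using jb_add[of j k] True by (auto simp: divide_simps)
      have d: "\<bar>?\<tau> - 1\<bar> * jb k \<le> jb j"
      proof -
        have "\<bar>?\<tau> - 1\<bar> * jb k = \<bar>(?\<tau> - 1) * jb k\<bar>" by (simp add: abs_mult)
        also have "(?\<tau> - 1) * jb k = jb (j + k) - jb k" by (simp add: left_diff_distrib)
        finally show ?thesis using jb_diff[of "j + k" k] by simp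
      qed
      have "\<bar>wt \<sigma> R (j + k) - wt \<sigma> R k\<bar> * jb k \<le> (wt \<sigma> R k * (K * \<bar>?\<tau> - 1\<bar>)) * jb k"
      proof (rule mult_right_mono)
        have "\<bar>wt \<sigma> R (j + k) - wt \<sigma> R k\<bar> \<le> wt \<sigma> R k * \<bar>?\<tau> powr (\<sigma> + 1) - 1\<bar>"
          unfolding wt_phi using assms R by (intro phi_ratio) auto
        also have "\<dots> \<le> wt \<sigma> R k * (K * \<bar>?\<tau> - 1\<bar>)"
          unfolding K_def using assms R t by (intro mult_left_mono powr_lip) auto
        finally show "\<bar>wt \<sigma> R (j + k) - wt \<sigma> R k\<bar> \<le> wt \<sigma> R k * (K * \<bar>?\<tau> - 1\<bar>)" .
      qed simp
      also have "\<dots> = K * wt \<sigma> R k * (\<bar>?\<tau> - 1\<bar> * jb k)" by simp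
      also have "\<dots> \<le> K * wt \<sigma> R k * jb j" using d K1 R by (intro mult_left_mono) auto
      also have "\<dots> \<le> (K * wt \<sigma> R k + K * wt \<sigma> R j) * jb j"
        using K1 R by (intro mult_right_mono) auto
      finally show ?thesis by (simp add: mult.commute)
    next
      case False
      have "K * wt \<sigma> R k \<ge> 1 * wt \<sigma> R k" "0 \<le> K * wt \<sigma> R j"
        using mult_right_mono[OF K1 wt_ge0[OF R]] K1 R by auto
      then have "\<bar>wt \<sigma> R (j + k) - wt \<sigma> R k\<bar> \<le> K * wt \<sigma> R k + K * wt \<sigma> R j"
        using V1[of j k] R wt_ge0[of R \<sigma> "j + k"] wt_ge0[of R \<sigma> "k"] by linarith
      then have "\<bar>wt \<sigma> R (j + k) - wt \<sigma> R k\<bar> * jb k \<le> (K * wt \<sigma> R k + K * wt \<sigma> R j) * jb j"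
        using False by (intro mult_mono) auto
      then show ?thesis by (simp add: mult.commute)
    qed
    then show ?thesis using V1 K1 R by (simp add: admw_def)
  qed
  ultimately show ?thesis using that by blast
qed

text \<open>Comparison with a p-series through 1 + |n| <= \<open>jb n\<close>. The exponents
  \<open>2 * \<sigma> - 2\<close> in \<open>ch2_exists\<close> and \<open>2 * r\<close> in
  \<open>sobolev_l1\<close> turn 1 < q into \<sigma> > 3/2 and r > 1/2.\<close>

lemma jb_powr_sum_bound:
  assumes "1 < q"
  obtains C where "0 \<le> C" "\<And>m. (\<Sum>n\<in>win m. jb n powr (- q)) \<le> C"
proof -
  let ?f = "\<lambda>i::nat. real i powr (- q)"
  have s: "summable ?f" using assms by (simp add: summable_real_powr_iff)
  then have s': "summable (\<lambda>i. ?f (Suc i))" using summable_Suc_iff[of ?f] by blast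
  have jb: "real (Suc (nat \<bar>n\<bar>)) \<le> jb n" for n
  proof -
    have "\<bar>n\<bar> \<le> n\<^sup>2" by (metis abs_le_square_iff abs_power2 abs_zero int_one_le_iff_zero_less abs_ge_self
          linorder_not_less mult_le_cancel_left1 nle_le power2_eq_square abs_mult zero_less_abs_iff power2_abs)
    then have n2: "\<bar>real_of_int n\<bar> \<le> (real_of_int n)\<^sup>2" by (metis of_int_abs of_int_le_iff of_int_power)
    have pi: "3 * 3 \<le> pi * pi" using pi_gt3 by (intro mult_mono) auto
    have "(1 + \<bar>real_of_int n\<bar>)\<^sup>2 = 1 + 2 * \<bar>real_of_int n\<bar> + (real_of_int n)\<^sup>2"
      by (simp add: power2_sum)
    also have "\<dots> \<le> 1 + 3 * (real_of_int n)\<^sup>2" using n2 by simp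
    also have "\<dots> \<le> 1 + (2 * pi * real_of_int n)\<^sup>2"
    proof -
      have "3 * (real_of_int n)\<^sup>2 \<le> (4 * (pi * pi)) * (real_of_int n)\<^sup>2" using pi by (intro mult_right_mono) auto
      then show ?thesis by (simp add: power_mult_distrib power2_eq_square mult_ac)
    qed
    finally have "1 + \<bar>real_of_int n\<bar> \<le> jb n" unfolding jb_def by (intro real_le_rsqrt)
    then show ?thesis by simp
  qed
  have "(\<Sum>n\<in>win m. jb n powr (- q)) \<le> 2 * suminf (\<lambda>i. ?f (Suc i))" for m
  proof -
    have le: "(\<Sum>i\<le>m. ?f (Suc i)) \<le> suminf (\<lambda>i. ?f (Suc i))" by (rule sum_le_suminf[OF s']) auto
    have "(\<Sum>n\<in>win m. jb n powr (- q)) \<le> (\<Sum>n\<in>win m. ?f (Suc (nat \<bar>n\<bar>)))"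
      using jb assms by (intro sum_mono powr_mono2') auto
    also have "\<dots> \<le> (\<Sum>n\<in>int ` {..m} \<union> (\<lambda>i. - int i) ` {..m}. ?f (Suc (nat \<bar>n\<bar>)))"
    proof (rule sum_mono2)
      show "win m \<subseteq> int ` {..m} \<union> (\<lambda>i. - int i) ` {..m}"
      proof
        fix n assume "n \<in> win m"
        then have "nat \<bar>n\<bar> \<in> {..m}" "n = int (nat \<bar>n\<bar>) \<or> n = - int (nat \<bar>n\<bar>)" by (auto simp: mem_win)
        then show "n \<in> int ` {..m} \<union> (\<lambda>i. - int i) ` {..m}" by blast
      qed
    qed auto
    \<comment> \<open>The two images overlap at 0, so splitting the union costs an
      inequality.\<close>
    also have "\<dots> \<le> (\<Sum>n\<in>int ` {..m}. ?f (Suc (nat \<bar>n\<bar>))) + (\<Sum>n\<in>(\<lambda>i. - int i) ` {..m}. ?f (Suc (nat \<bar>n\<bar>)))"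
      by (subst sum_Un) (auto intro!: sum_nonneg)
    also have "\<dots> = (\<Sum>i\<le>m. ?f (Suc i)) + (\<Sum>i\<le>m. ?f (Suc i))"
      by (subst (1 2) sum.reindex) (auto simp: inj_on_def o_def)
    finally show ?thesis using le by simp
  qed
  moreover have "0 \<le> 2 * suminf (\<lambda>i. ?f (Suc i))" using suminf_nonneg[OF s'] by simp
  ultimately show ?thesis using that by blast
qed

subsection \<open>Energy estimates\<close>

text \<open>The real inner product whose norm is \<open>Nv v m\<close>; the weights therefore enter
  squared.\<close>

definition ipr :: "(int \<Rightarrow> real) \<Rightarrow> nat \<Rightarrow> (int \<Rightarrow> complex \<times> complex) \<Rightarrow> (int \<Rightarrow> complex \<times> complex) \<Rightarrow> real" where
  "ipr v m x y = (\<Sum>n\<in>win m. (v n)\<^sup>2 *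
     ((jb n)\<^sup>2 * Re (cnj (fst (x n)) * fst (y n)) + Re (cnj (snd (x n)) * snd (y n))))"

text \<open>Wiener-algebra norms in place of Sobolev embeddings: \<open>S1\<close> dominates the sup
  norms of the truncated u, u_x and rho, and \<open>X1\<close> also those of u_xx and rho_x.\<close>

definition S1 :: "nat \<Rightarrow> (int \<Rightarrow> complex \<times> complex) \<Rightarrow> real" where
  "S1 m y = (\<Sum>n\<in>win m. sz n (y n))"

definition X1 :: "nat \<Rightarrow> (int \<Rightarrow> complex \<times> complex) \<Rightarrow> real" where
  "X1 m y = (\<Sum>n\<in>win m. jb n * sz n (y n))"

text \<open>Reality of the two functions behind the sequence. Skew-adjointness of the transport term
  requires it of the velocity.\<close>

definition hrm :: "(int \<Rightarrow> complex \<times> complex) \<Rightarrow> bool" where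
  "hrm y \<longleftrightarrow> (\<forall>n. fst (y (- n)) = cnj (fst (y n)) \<and> snd (y (- n)) = cnj (snd (y n)))"

lemma Nv_ge0 [simp]: "0 \<le> Nv v m y" by (simp add: Nv_def)

lemma X1_ge0 [simp]: "0 \<le> X1 m y" by (simp add: X1_def sum_nonneg)

lemma S1_le_X1: "S1 m y \<le> X1 m y"
  unfolding S1_def X1_def using mult_right_mono[OF jb_ge1 sz_ge0] by (intro sum_mono) auto

lemma ipr_self: "ipr v m y y = (Nv v m y)\<^sup>2"
proof -
  have "Re (cnj z * z) = (cmod z)\<^sup>2" for z unfolding cmod_power2 by (simp add: power2_eq_square)
  then show ?thesis
    by (simp add: ipr_def Nv_def L2_set_def sum_nonneg power_mult_distrib sz_sq)
qed

lemma ipr_add: "ipr v m x (\<lambda>n. y n + z n) = ipr v m x y + ipr v m x z"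
  unfolding ipr_def sum.distrib[symmetric] by (intro sum.cong refl) (simp add: algebra_simps)

lemma ipr_diff: "ipr v m x (\<lambda>n. y n - z n) = ipr v m x y - ipr v m x z"
  unfolding ipr_def sum_subtractf[symmetric] by (intro sum.cong refl) (simp add: algebra_simps)

lemma ipr_scaleR: "ipr v m x (\<lambda>n. c *\<^sub>R y n) = c * ipr v m x y"
  unfolding ipr_def sum_distrib_left by (intro sum.cong refl) (simp add: algebra_simps)

lemma ipr_cong: "(\<And>n. n \<in> win m \<Longrightarrow> y n = z n) \<Longrightarrow> ipr v m x y = ipr v m x z"
  by (simp add: ipr_def)

lemma ipr_le:
  assumes "\<And>n. 0 \<le> v n"
  shows "\<bar>ipr v m x y\<bar> \<le> Nv v m x * Nv v m y"
proof -
  have pt: "\<bar>(v n)\<^sup>2 * ((jb n)\<^sup>2 * Re (cnj (fst (x n)) * fst (y n)) + Re (cnj (snd (x n)) * snd (y n)))\<bar>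
     \<le> \<bar>v n * sz n (x n)\<bar> * \<bar>v n * sz n (y n)\<bar>" for n
  proof -
    let ?a = "jb n * cmod (fst (x n))" and ?b = "cmod (snd (x n))"
    let ?c = "jb n * cmod (fst (y n))" and ?d = "cmod (snd (y n))"
    have r: "\<bar>Re (cnj z * w)\<bar> \<le> cmod z * cmod w" for z w
      using abs_Re_le_cmod[of "cnj z * w"] by (simp add: norm_mult)
    have "\<bar>(jb n)\<^sup>2 * Re (cnj (fst (x n)) * fst (y n)) + Re (cnj (snd (x n)) * snd (y n))\<bar>
        \<le> (jb n)\<^sup>2 * (cmod (fst (x n)) * cmod (fst (y n))) + ?b * ?d"
      using r[of "snd (x n)" "snd (y n)"] mult_left_mono[OF r[of "fst (x n)" "fst (y n)"], of "(jb n)\<^sup>2"]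
      by (intro order_trans[OF abs_triangle_ineq] add_mono) (auto simp: abs_mult)
    also have "\<dots> = ?a * ?c + ?b * ?d" by (simp add: power2_eq_square)
    also have "\<dots> \<le> sz n (x n) * sz n (y n)"
    proof -
      \<comment> \<open>Lagrange's identity yields Cauchy-Schwarz within a single frequency; the sum
        over n is handled by Cauchy-Schwarz for \<open>L2_set\<close>.\<close>
      have "(?a * ?c + ?b * ?d)\<^sup>2 + (?a * ?d - ?b * ?c)\<^sup>2 = (?a\<^sup>2 + ?b\<^sup>2) * (?c\<^sup>2 + ?d\<^sup>2)"
        by (simp add: power2_eq_square algebra_simps)
      then have "(?a * ?c + ?b * ?d)\<^sup>2 \<le> (?a\<^sup>2 + ?b\<^sup>2) * (?c\<^sup>2 + ?d\<^sup>2)"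
        by (smt (verit) zero_le_power2)
      then show ?thesis
        unfolding sz_def real_sqrt_mult[symmetric] by (rule real_le_rsqrt)
    qed
    finally have "(v n)\<^sup>2 * \<bar>(jb n)\<^sup>2 * Re (cnj (fst (x n)) * fst (y n)) + Re (cnj (snd (x n)) * snd (y n))\<bar>
       \<le> (v n)\<^sup>2 * (sz n (x n) * sz n (y n))" by (intro mult_left_mono) auto
    then show ?thesis using assms by (simp add: abs_mult power2_eq_square mult_ac)
  qed
  have "\<bar>ipr v m x y\<bar> \<le> (\<Sum>n\<in>win m. \<bar>v n * sz n (x n)\<bar> * \<bar>v n * sz n (y n)\<bar>)"
    unfolding ipr_def by (rule order_trans[OF sum_abs sum_mono[OF pt]])
  also have "\<dots> \<le> Nv v m x * Nv v m y"
    unfolding Nv_def by (rule L2_set_mult_ineq)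
  finally show ?thesis .
qed

text \<open>The commutator argument: the part of the transport term that carries the weight symmetrically
  is skew-adjoint up to the multiplication by the derivative of the velocity.\<close>

lemma transport_scalar:
  fixes a c :: "int \<Rightarrow> complex" and w :: "int \<Rightarrow> real"
  assumes herm: "\<And>j. a (- j) = cnj (a j)"
  shows "\<bar>\<Sum>n\<in>win m. (w n)\<^sup>2 * Re (cnj (c n) * conv m a (\<lambda>k. dsym k * c k) n)\<bar>
    \<le> (\<Sum>n\<in>win m. \<Sum>k\<in>win m. cmod (w n * c n) *
          (cmod (dsym (n - k) * a (n - k)) * cmod (w k * c k) / 2
           + \<bar>w n - w k\<bar> * cmod (a (n - k)) * cmod (dsym k * c k)))"
proof -
  \<comment> \<open>One of the two factors \<open>w n\<close> is exchanged for \<open>w k\<close>: T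
    carries the weight symmetrically on both sides, U contains the commutator w n - w k.\<close>
  define \<beta> where "\<beta> n = of_real (w n) * c n" for n
  define T where "T = (\<Sum>n\<in>win m. \<Sum>k\<in>win m. cnj (\<beta> n) * a (n - k) * dsym k * \<beta> k)"
  define U where "U = (\<Sum>n\<in>win m. \<Sum>k\<in>win m. cnj (\<beta> n) * of_real (w n - w k) * a (n - k) * (dsym k * c k))"
  have "(\<Sum>n\<in>win m. (w n)\<^sup>2 * Re (cnj (c n) * conv m a (\<lambda>k. dsym k * c k) n))
      = Re (\<Sum>n\<in>win m. of_real ((w n)\<^sup>2) * (cnj (c n) * conv m a (\<lambda>k. dsym k * c k) n))"
    unfolding Re_sum by (intro sum.cong refl) (simp del: of_real_power complex_cnj_mult)
  also have "(\<Sum>n\<in>win m. of_real ((w n)\<^sup>2) * (cnj (c n) * conv m a (\<lambda>k. dsym k * c k) n)) = T + U"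
    unfolding T_def U_def conv_def \<beta>_def
    unfolding sum.distrib[symmetric] sum_distrib_left
    by (intro sum.cong refl) (simp add: algebra_simps power2_eq_square)
  finally have e: "(\<Sum>n\<in>win m. (w n)\<^sup>2 * Re (cnj (c n) * conv m a (\<lambda>k. dsym k * c k) n)) = Re T + Re U"
    by simp
  \<comment> \<open>Conjugating and renaming n and k turns T + cnj T into the sum with the symbol
    dsym k - dsym n = - dsym (n - k): the derivative has moved onto the velocity.\<close>
  have "cnj T = (\<Sum>n\<in>win m. \<Sum>k\<in>win m. - (\<beta> n * a (k - n) * dsym k * cnj (\<beta> k)))"
  proof -
    have h: "cnj (a (n - k)) = a (k - n)" for n k by (metis herm minus_diff_eq)
    show ?thesis unfolding T_def by (simp add: h)
  qed
  also have "\<dots> = (\<Sum>k\<in>win m. \<Sum>n\<in>win m. - (\<beta> n * a (k - n) * dsym k * cnj (\<beta> k)))"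
    by (rule sum.swap)
  finally have "T + cnj T = (\<Sum>n\<in>win m. \<Sum>k\<in>win m. cnj (\<beta> n) * a (n - k) * dsym k * \<beta> k)
      + (\<Sum>k\<in>win m. \<Sum>n\<in>win m. - (\<beta> n * a (k - n) * dsym k * cnj (\<beta> k)))"
    unfolding T_def by simp
  also have "\<dots> = (\<Sum>n\<in>win m. \<Sum>k\<in>win m. cnj (\<beta> n) * a (n - k) * (dsym k - dsym n) * \<beta> k)"
    unfolding sum.distrib[symmetric] by (intro sum.cong refl) (simp add: algebra_simps)
  also have "\<dots> = - (\<Sum>n\<in>win m. \<Sum>k\<in>win m. cnj (\<beta> n) * (dsym (n - k) * a (n - k)) * \<beta> k)"
    unfolding sum_negf[symmetric] dsym_diff by (intro sum.cong refl) (simp add: algebra_simps)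
  finally have T2: "of_real (2 * Re T) = - (\<Sum>n\<in>win m. \<Sum>k\<in>win m. cnj (\<beta> n) * (dsym (n - k) * a (n - k)) * \<beta> k)"
    by (simp add: complex_add_cnj)
  have "2 * \<bar>Re T\<bar> = cmod (of_real (2 * Re T))" by (simp del: of_real_mult)
  also have "\<dots> \<le> (\<Sum>n\<in>win m. \<Sum>k\<in>win m. cmod (\<beta> n) * (cmod (dsym (n - k) * a (n - k)) * cmod (\<beta> k)))"
    unfolding T2 norm_minus_cancel
    by (intro order_trans[OF norm_sum] sum_mono) (auto simp: norm_mult mult_ac)
  finally have T0: "2 * \<bar>Re T\<bar> \<le> (\<Sum>n\<in>win m. \<Sum>k\<in>win m. cmod (\<beta> n) * (cmod (dsym (n - k) * a (n - k)) * cmod (\<beta> k)))" .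
  have T3: "\<bar>Re T\<bar> \<le> (\<Sum>n\<in>win m. \<Sum>k\<in>win m. cmod (\<beta> n) * (cmod (dsym (n - k) * a (n - k)) * cmod (\<beta> k) / 2))"
  proof -
    have "(\<Sum>n\<in>win m. \<Sum>k\<in>win m. cmod (\<beta> n) * (cmod (dsym (n - k) * a (n - k)) * cmod (\<beta> k) / 2))
       = (\<Sum>n\<in>win m. \<Sum>k\<in>win m. cmod (\<beta> n) * (cmod (dsym (n - k) * a (n - k)) * cmod (\<beta> k))) / 2"
      unfolding sum_divide_distrib times_divide_eq_right ..
    then show ?thesis using T0 by linarith
  qed
  have "\<bar>Re U\<bar> \<le> cmod U" by (rule abs_Re_le_cmod)
  also have "\<dots> \<le> (\<Sum>n\<in>win m. \<Sum>k\<in>win m. cmod (\<beta> n) * (\<bar>w n - w k\<bar> * cmod (a (n - k)) * cmod (dsym k * c k)))"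
    unfolding U_def
  proof (intro order_trans[OF norm_sum] sum_mono)
    fix n k
    have "cmod (complex_of_real (w n - w k)) = \<bar>w n - w k\<bar>" by (rule norm_of_real)
    then show "cmod (cnj (\<beta> n) * complex_of_real (w n - w k) * a (n - k) * (dsym k * c k))
      \<le> cmod (\<beta> n) * (\<bar>w n - w k\<bar> * cmod (a (n - k)) * cmod (dsym k * c k))"
      unfolding norm_mult by (simp add: mult.assoc)
  qed
  finally have U3: "\<bar>Re U\<bar> \<le> (\<Sum>n\<in>win m. \<Sum>k\<in>win m. cmod (\<beta> n) * (\<bar>w n - w k\<bar> * cmod (a (n - k)) * cmod (dsym k * c k)))" .
  have "\<bar>Re T + Re U\<bar> \<le> \<bar>Re T\<bar> + \<bar>Re U\<bar>" by (rule abs_triangle_ineq)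
  also have "\<dots> \<le> (\<Sum>n\<in>win m. \<Sum>k\<in>win m. cmod (\<beta> n) * (cmod (dsym (n - k) * a (n - k)) * cmod (\<beta> k) / 2))
     + (\<Sum>n\<in>win m. \<Sum>k\<in>win m. cmod (\<beta> n) * (\<bar>w n - w k\<bar> * cmod (a (n - k)) * cmod (dsym k * c k)))"
    by (rule add_mono[OF T3 U3])
  also have "\<dots> = (\<Sum>n\<in>win m. \<Sum>k\<in>win m. cmod (w n * c n) *
          (cmod (dsym (n - k) * a (n - k)) * cmod (w k * c k) / 2
           + \<bar>w n - w k\<bar> * cmod (a (n - k)) * cmod (dsym k * c k)))"
    unfolding sum.distrib[symmetric] \<beta>_def distrib_left ..
  finally show ?thesis unfolding e .
qed

text \<open>\<open>transport_scalar\<close> is used twice, for u with the weight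
  \<open>jb n * v n\<close> and for rho with the weight \<open>v n\<close>. The commutator costs
  \<open>jb (n - k)\<close>, which the velocity absorbs inside \<open>sz\<close>.\<close>

lemma ipr_tra_le:
  assumes v: "admw K L v" and h: "hrm y" and y: "supp m y" and z: "supp m z"
  shows "\<bar>ipr v m z (tra m y z)\<bar>
     \<le> Nv v m z * ((1 + 4 * K) * S1 m y * Nv v m z + 4 * L * Nv v m y * S1 m z)"
proof -
  define p where "p n = sz n (y n)" for n
  define q where "q n = sz n (z n)" for n
  define g where "g n = v n * q n" for n
  have v0: "0 \<le> v n" for n using v by (simp add: admw_def)
  have K: "0 \<le> K" "0 \<le> L" using v by (auto simp: admw_def)
  have V1: "v (j + k) \<le> K * v k + L * v j" for j k using v by (simp add: admw_def)
  have V2: "\<bar>v n - v k\<bar> * jb k \<le> jb (n - k) * (K * v k + L * v (n - k))" for n k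
    using v unfolding admw_def by (metis diff_add_cancel)
  have pq: "0 \<le> p n" "0 \<le> q n" "0 \<le> g n" for n by (auto simp: p_def q_def g_def v0)
  \<comment> \<open>A common majorant for both components: the first term is the half derivative of
    the velocity left by the skew-adjoint part, the doubled bracket bounds the commutator.\<close>
  define G where "G n k = g n * (p (n - k) * g k / 2 + 2 * (K * (p (n - k) * g k) + L * ((v (n - k) * p (n - k)) * q k)))" for n k
  have one: "\<bar>\<Sum>n\<in>win m. (w n)\<^sup>2 * Re (cnj (c n) * conv m (\<lambda>j. fst (y j)) (\<lambda>k. dsym k * c k) n)\<bar>
       \<le> (\<Sum>n\<in>win m. \<Sum>k\<in>win m. G n k)"
    if c: "\<And>n. cmod (w n * c n) \<le> g n"
      and w: "\<And>n k. \<bar>w n - w k\<bar> * cmod (dsym k * c k) \<le> 2 * jb (n - k) * (K * v k + L * v (n - k)) * q k"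
    for w :: "int \<Rightarrow> real" and c :: "int \<Rightarrow> complex"
  proof (rule order_trans[OF transport_scalar], goal_cases)
    case 1 then show ?case using h by (simp add: hrm_def)
  next
    case 2 show ?case
    proof (intro sum_mono)
      fix n k
      let ?a = "cmod (fst (y (n - k)))"
      have a: "jb (n - k) * ?a \<le> p (n - k)" "cmod (dsym (n - k) * fst (y (n - k))) \<le> p (n - k)"
        using sz_fst sz_dsym_fst by (auto simp: p_def)
      have "\<bar>w n - w k\<bar> * ?a * cmod (dsym k * c k) = ?a * (\<bar>w n - w k\<bar> * cmod (dsym k * c k))" by simp
      also have "\<dots> \<le> ?a * (2 * jb (n - k) * (K * v k + L * v (n - k)) * q k)"
        by (intro mult_left_mono w) auto
      also have "\<dots> = (jb (n - k) * ?a) * (2 * (K * v k + L * v (n - k)) * q k)" by simp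
      also have "\<dots> \<le> p (n - k) * (2 * (K * v k + L * v (n - k)) * q k)"
        using a K v0 pq by (intro mult_right_mono) auto
      also have "\<dots> = 2 * (K * (p (n - k) * g k) + L * ((v (n - k) * p (n - k)) * q k))"
        by (simp add: g_def algebra_simps)
      finally have *: "\<bar>w n - w k\<bar> * ?a * cmod (dsym k * c k) \<le> \<dots>" .
      have **: "cmod (dsym (n - k) * fst (y (n - k))) * cmod (w k * c k) / 2 \<le> p (n - k) * g k / 2"
        using mult_mono[OF a(2) c[of k]] pq by simp
      have "0 \<le> p (n - k) * g k / 2 + 2 * (K * (p (n - k) * g k) + L * ((v (n - k) * p (n - k)) * q k))"
        using pq v0 K by (intro add_nonneg_nonneg mult_nonneg_nonneg) auto
      then show "cmod (w n * c n) *
          (cmod (dsym (n - k) * fst (y (n - k))) * cmod (w k * c k) / 2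
           + \<bar>w n - w k\<bar> * ?a * cmod (dsym k * c k)) \<le> G n k"
        unfolding G_def using mult_mono[OF c[of n] add_mono[OF ** *]] pq by simp
    qed
  qed
  have A: "\<bar>\<Sum>n\<in>win m. (jb n * v n)\<^sup>2 * Re (cnj (fst (z n)) * conv m (\<lambda>j. fst (y j)) (\<lambda>k. dsym k * fst (z k)) n)\<bar>
       \<le> (\<Sum>n\<in>win m. \<Sum>k\<in>win m. G n k)"
  proof (rule one)
    show "cmod (complex_of_real (jb n * v n) * fst (z n)) \<le> g n" for n
      using mult_left_mono[OF sz_fst[of n "z n"] v0[of n]] v0[of n]
      by (simp add: g_def q_def norm_mult mult_ac)
    show "\<bar>jb n * v n - jb k * v k\<bar> * cmod (dsym k * fst (z k)) \<le> 2 * jb (n - k) * (K * v k + L * v (n - k)) * q k" for n k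
    proof -
      \<comment> \<open>A discrete Leibniz rule for the product weight. Each of its two terms obeys
        the same bound, whence the factor 2 in G.\<close>
      have "jb n * v n - jb k * v k = (jb n - jb k) * v n + jb k * (v n - v k)" by (simp add: algebra_simps)
      then have "\<bar>jb n * v n - jb k * v k\<bar> \<le> \<bar>jb n - jb k\<bar> * v n + \<bar>v n - v k\<bar> * jb k"
        using abs_triangle_ineq[of "(jb n - jb k) * v n" "jb k * (v n - v k)"] v0[of n] by (simp add: abs_mult mult.commute)
      also have "\<dots> \<le> jb (n - k) * (K * v k + L * v (n - k)) + jb (n - k) * (K * v k + L * v (n - k))"
        using V1[of "n - k" k] v0[of n] by (intro add_mono mult_mono V2 jb_diff) auto
      finally have "\<bar>jb n * v n - jb k * v k\<bar> \<le> 2 * jb (n - k) * (K * v k + L * v (n - k))" by simp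
      moreover have "cmod (dsym k * fst (z k)) \<le> q k" by (simp add: q_def sz_dsym_fst)
      ultimately show ?thesis using K v0 by (intro mult_mono) auto
    qed
  qed
  have B: "\<bar>\<Sum>n\<in>win m. (v n)\<^sup>2 * Re (cnj (snd (z n)) * conv m (\<lambda>j. fst (y j)) (\<lambda>k. dsym k * snd (z k)) n)\<bar>
       \<le> (\<Sum>n\<in>win m. \<Sum>k\<in>win m. G n k)"
  proof (rule one)
    show "cmod (complex_of_real (v n) * snd (z n)) \<le> g n" for n
      using mult_left_mono[OF sz_snd[of "z n" n] v0[of n]] v0[of n]
      by (simp add: g_def q_def norm_mult mult_ac)
    show "\<bar>v n - v k\<bar> * cmod (dsym k * snd (z k)) \<le> 2 * jb (n - k) * (K * v k + L * v (n - k)) * q k" for n k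
    proof -
      have "cmod (dsym k * snd (z k)) \<le> jb k * q k"
        unfolding norm_mult q_def by (intro mult_mono cmod_dsym_le sz_snd) auto
      then have "\<bar>v n - v k\<bar> * cmod (dsym k * snd (z k)) \<le> (\<bar>v n - v k\<bar> * jb k) * q k"
        using mult_left_mono[of _ _ "\<bar>v n - v k\<bar>"] by fastforce
      also have "\<dots> \<le> jb (n - k) * (K * v k + L * v (n - k)) * q k"
        using pq by (intro mult_right_mono V2) auto
      also have "\<dots> \<le> 2 * \<dots>" using K v0 pq by (simp add: mult_nonneg_nonneg)
      finally show ?thesis by simp
    qed
  qed
  have Nz: "Nv v m z = L2_set g (win m)" by (simp add: Nv_def g_def[abs_def] q_def)
  have Ny: "Nv v m y = L2_set (\<lambda>n. v n * p n) (win m)" by (simp add: Nv_def p_def)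
  have sp: "supp m p" "supp m q" "supp m g"
    using y z by (auto simp: p_def[abs_def] q_def[abs_def] g_def[abs_def] supp_def)
  have S: "(\<Sum>n\<in>win m. \<Sum>k\<in>win m. G n k) = (\<Sum>n\<in>win m. g n * ((1/2 + 2 * K) * conv m p g n + 2 * L * conv m (\<lambda>j. v j * p j) q n))"
    unfolding G_def conv_def sum_distrib_left sum.distrib[symmetric]
    by (intro sum.cong refl) (simp add: algebra_simps)
  also have "\<dots> \<le> (\<Sum>n\<in>win m. \<bar>g n\<bar> * \<bar>(1/2 + 2 * K) * conv m p g n + 2 * L * conv m (\<lambda>j. v j * p j) q n\<bar>)"
    unfolding abs_mult[symmetric] by (intro sum_mono abs_ge_self)
  also have "\<dots> \<le> L2_set g (win m) * L2_set (\<lambda>n. (1/2 + 2 * K) * conv m p g n + 2 * L * conv m (\<lambda>j. v j * p j) q n) (win m)"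
    by (rule L2_set_mult_ineq)
  also have "\<dots> \<le> L2_set g (win m) * ((1/2 + 2 * K) * (S1 m y * Nv v m z) + 2 * L * (Nv v m y * S1 m z))"
  proof (intro mult_left_mono L2_set_nonneg)
    have "L2_set (\<lambda>n. (1/2 + 2 * K) * conv m p g n + 2 * L * conv m (\<lambda>j. v j * p j) q n) (win m)
       \<le> L2_set (\<lambda>n. (1/2 + 2 * K) * conv m p g n) (win m) + L2_set (\<lambda>n. 2 * L * conv m (\<lambda>j. v j * p j) q n) (win m)"
      by (rule L2_set_triangle_ineq)
    also have "\<dots> = (1/2 + 2 * K) * L2_set (conv m p g) (win m) + 2 * L * L2_set (conv m (\<lambda>j. v j * p j) q) (win m)"
      using K by (simp add: L2_set_cmult)
    also have "\<dots> \<le> (1/2 + 2 * K) * (sum p (win m) * L2_set g (win m)) + 2 * L * (L2_set (\<lambda>j. v j * p j) (win m) * sum q (win m))"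
      using K pq sp by (intro add_mono mult_left_mono young_left young_right supp_mult) auto
    finally show "L2_set (\<lambda>n. (1/2 + 2 * K) * conv m p g n + 2 * L * conv m (\<lambda>j. v j * p j) q n) (win m)
      \<le> (1/2 + 2 * K) * (S1 m y * Nv v m z) + 2 * L * (Nv v m y * S1 m z)"
      by (simp add: Nz Ny S1_def p_def q_def)
  qed
  finally have S': "(\<Sum>n\<in>win m. \<Sum>k\<in>win m. G n k)
     \<le> Nv v m z * ((1/2 + 2 * K) * (S1 m y * Nv v m z) + 2 * L * (Nv v m y * S1 m z))" by (simp add: Nz)
  have "ipr v m z (tra m y z)
    = - (\<Sum>n\<in>win m. (jb n * v n)\<^sup>2 * Re (cnj (fst (z n)) * conv m (\<lambda>j. fst (y j)) (\<lambda>k. dsym k * fst (z k)) n))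
      - (\<Sum>n\<in>win m. (v n)\<^sup>2 * Re (cnj (snd (z n)) * conv m (\<lambda>j. fst (y j)) (\<lambda>k. dsym k * snd (z k)) n))"
    unfolding ipr_def tra_def sum_negf[symmetric] sum_subtractf[symmetric]
    by (intro sum.cong) (auto simp: algebra_simps power_mult_distrib)
  then have "\<bar>ipr v m z (tra m y z)\<bar> \<le> 2 * (\<Sum>n\<in>win m. \<Sum>k\<in>win m. G n k)"
    using A B by linarith
  then show ?thesis using S' by (simp add: algebra_simps)
qed

lemma Nv_mono: "(\<And>n. n \<in> win m \<Longrightarrow> \<bar>v n * sz n (y n)\<bar> \<le> w n * sz n (z n)) \<Longrightarrow> Nv v m y \<le> Nv w m z"
  unfolding Nv_def by (rule L2_set_mono')

text \<open>The energy estimate proper: transport through its cancellation, the remainder through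
  the product estimate. Only norms of z of the same order as the energy occur; the l^1 norm
  \<open>S1 m z\<close> comes with the factor L.\<close>

lemma ipr_bil_le:
  assumes v: "admw K L v" and h: "hrm y" and y: "supp m y" and z: "supp m z"
  shows "\<bar>ipr v m z (bil m y z)\<bar>
     \<le> Nv v m z * ((1 + 7 * K) * S1 m y * Nv v m z + 7 * L * Nv v m y * S1 m z)"
proof -
  have v0: "0 \<le> v n" for n using v by (simp add: admw_def)
  have K: "0 \<le> K" "0 \<le> L" using v by (auto simp: admw_def)
  have "Nv v m (rst m y z) \<le> L2_set (\<lambda>n. 3 * (v n * conv m (\<lambda>j. sz j (y j)) (\<lambda>k. sz k (z k)) n)) (win m)"
    unfolding Nv_def
  proof (rule L2_set_mono')
    fix n
    show "\<bar>v n * sz n (rst m y z n)\<bar> \<le> 3 * (v n * conv m (\<lambda>j. sz j (y j)) (\<lambda>k. sz k (z k)) n)"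
      using mult_left_mono[OF sz_rst[of n m y z] v0[of n]] v0[of n] by (simp add: abs_mult mult_ac)
  qed
  also have "\<dots> = 3 * L2_set (\<lambda>n. v n * conv m (\<lambda>j. sz j (y j)) (\<lambda>k. sz k (z k)) n) (win m)"
    by (simp add: L2_set_cmult)
  also have "\<dots> \<le> 3 * (K * (S1 m y * Nv v m z) + L * (Nv v m y * S1 m z))"
    unfolding S1_def Nv_def
    by (intro mult_left_mono young_weight) (use v v0 K supp_sz[OF y] supp_sz[OF z] in \<open>auto simp: admw_def\<close>)
  finally have r: "Nv v m (rst m y z) \<le> 3 * (K * (S1 m y * Nv v m z) + L * (Nv v m y * S1 m z))" .
  have "\<bar>ipr v m z (bil m y z)\<bar> \<le> \<bar>ipr v m z (tra m y z)\<bar> + \<bar>ipr v m z (rst m y z)\<bar>"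
    unfolding bil_def[abs_def] ipr_add by (rule abs_triangle_ineq)
  also have "\<dots> \<le> Nv v m z * ((1 + 4 * K) * S1 m y * Nv v m z + 4 * L * Nv v m y * S1 m z)
     + Nv v m z * (3 * (K * (S1 m y * Nv v m z) + L * (Nv v m y * S1 m z)))"
    by (intro add_mono ipr_tra_le[OF v h y z] order_trans[OF ipr_le] mult_left_mono r v0) auto
  finally show ?thesis by (simp add: algebra_simps)
qed

text \<open>The counterpart where no cancellation is available and one derivative on z may be lost.
  It serves for differences with the derivative on a known solution, for truncation errors and for
  time derivatives.\<close>

lemma Nv_bil_le:
  assumes V: "\<And>j k. v (j + k) \<le> K * v k + L * v j" and K: "0 \<le> K" "0 \<le> L" and v0: "\<And>n. 0 \<le> v n"
    and y: "supp m y" and z: "supp m z"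
  shows "Nv v M (bil m y z) \<le> 6 * (K * S1 m y * Nv (\<lambda>n. v n * jb n) m z + L * Nv v m y * X1 m z)"
proof -
  let ?c = "conv m (\<lambda>j. sz j (y j)) (\<lambda>k. jb k * sz k (z k))"
  have "Nv v M (bil m y z) \<le> L2_set (\<lambda>n. 6 * (v n * ?c n)) (win M)"
    unfolding Nv_def
  proof (rule L2_set_mono')
    fix n
    show "\<bar>v n * sz n (bil m y z n)\<bar> \<le> 6 * (v n * ?c n)"
      using mult_left_mono[OF sz_bil[of n m y z] v0[of n]] v0[of n] by (simp add: abs_mult mult_ac)
  qed
  also have "\<dots> = 6 * L2_set (\<lambda>n. v n * ?c n) (win M)"
    by (simp add: L2_set_cmult)
  also have "\<dots> \<le> 6 * (K * (S1 m y * L2_set (\<lambda>n. v n * (jb n * sz n (z n))) (win m)) + L * (Nv v m y * X1 m z))"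
    unfolding S1_def Nv_def X1_def
    by (intro mult_left_mono young_weight V) (use K v0 supp_sz[OF y] supp_sz[OF z] in \<open>auto intro: supp_mult\<close>)
  finally show ?thesis by (simp add: Nv_def mult.assoc)
qed

subsection \<open>Global solutions of Lipschitz differential equations\<close>

lemma antiderivative_exists:
  fixes g :: "real \<Rightarrow> 'a::banach"
  assumes "continuous_on UNIV g"
  shows "\<exists>G. G 0 = 0 \<and> (\<forall>t. (G has_vector_derivative g t) (at t))"
proof -
  \<comment> \<open>One of the two integrals is over an empty or one-point interval, so this is the
    oriented integral from 0 to t.\<close>
  define G where "G t = integral {0..t} g - integral {t..0} g" for t
  have int: "g integrable_on {a..b}" for a b
    by (rule integrable_continuous_real) (rule continuous_on_subset[OF assms], simp)
  have "(G has_vector_derivative g t) (at t)" for t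
  proof -
    define c where "c = \<bar>t\<bar> + 1"
    have eq: "integral {-c..\<tau>} g - integral {-c..0} g = G \<tau>" if "\<tau> \<in> {-c<..<c}" for \<tau>
    proof (cases "0 \<le> \<tau>")
      case True
      then show ?thesis
        using Henstock_Kurzweil_Integration.integral_combine[of "-c" 0 \<tau> g] int c_def
        by (cases "\<tau> = 0") (auto simp: G_def algebra_simps)
    next
      case False
      then show ?thesis
        using Henstock_Kurzweil_Integration.integral_combine[of "-c" \<tau> 0 g] int that
        by (auto simp: G_def algebra_simps)
    qed
    have t: "t \<in> {-c<..<c}" by (auto simp: c_def)
    have "((\<lambda>\<tau>. integral {-c..\<tau>} g) has_vector_derivative g t) (at t within {-c..c})"
      using t by (intro integral_has_vector_derivative continuous_on_subset[OF assms]) auto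
    then have "((\<lambda>\<tau>. integral {-c..\<tau>} g) has_vector_derivative g t) (at t within {-c<..<c})"
      by (rule has_vector_derivative_within_subset) auto
    from has_vector_derivative_diff[OF this has_vector_derivative_const[of "integral {-c..0} g"]]
    have "((\<lambda>\<tau>. integral {-c..\<tau>} g - integral {-c..0} g) has_vector_derivative g t) (at t within {-c<..<c})"
      by simp
    then have "((\<lambda>\<tau>. integral {-c..\<tau>} g - integral {-c..0} g) has_vector_derivative g t) (at t)"
      unfolding at_within_open[OF t open_greaterThanLessThan] .
    then show ?thesis
      by (rule has_vector_derivative_transform_within_open[OF _ _ t]) (auto simp: eq)
  qed
  moreover have "G 0 = 0" by (simp add: G_def)
  ultimately show ?thesis by blast
qed

text \<open>Negative times are reflected to positive ones, so that one bound in |t| serves both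
  directions of time.\<close>

lemma vector_derivative_bound_zero:
  fixes f :: "real \<Rightarrow> 'a::real_normed_vector"
  assumes f: "\<And>\<tau>. \<bar>\<tau>\<bar> \<le> \<bar>t\<bar> \<Longrightarrow> (f has_vector_derivative f' \<tau>) (at \<tau>)"
    and p: "\<And>\<tau>. (p has_real_derivative p' \<tau>) (at \<tau>)"
    and b: "\<And>\<tau>. \<bar>\<tau>\<bar> \<le> \<bar>t\<bar> \<Longrightarrow> norm (f' \<tau>) \<le> p' \<bar>\<tau>\<bar>"
  shows "norm (f t - f 0) \<le> p \<bar>t\<bar> - p 0"
proof -
  have main: "norm (g \<bar>t\<bar> - g 0) \<le> p \<bar>t\<bar> - p 0"
    if g: "\<And>\<tau>. \<bar>\<tau>\<bar> \<le> \<bar>t\<bar> \<Longrightarrow> (g has_vector_derivative g' \<tau>) (at \<tau>)"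
      and gb: "\<And>\<tau>. \<bar>\<tau>\<bar> \<le> \<bar>t\<bar> \<Longrightarrow> norm (g' \<tau>) \<le> p' \<bar>\<tau>\<bar>" for g g' :: "real \<Rightarrow> 'a"
  proof (cases "t = 0")
    case False
    show ?thesis
    proof (rule differentiable_bound_general[where f' = g' and \<phi>' = p'])
      show "continuous_on {0..\<bar>t\<bar>} g"
        by (rule continuous_at_imp_continuous_on)
          (auto intro!: has_vector_derivative_continuous[OF g])
      show "continuous_on {0..\<bar>t\<bar>} p"
        using p by (intro continuous_at_imp_continuous_on) (auto intro: DERIV_isCont)
      show "\<And>x. 0 < x \<Longrightarrow> x < \<bar>t\<bar> \<Longrightarrow> norm (g' x) \<le> p' x"
        using gb by (metis abs_of_pos less_imp_le)
    qed (use False g p in \<open>auto simp: has_real_derivative_iff_has_vector_derivative\<close>)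
  qed simp
  show ?thesis
  proof (cases "0 \<le> t")
    case True then show ?thesis using main[of f f'] f b by simp
  next
    case False
    have "norm (f (- \<bar>t\<bar>) - f (- 0)) \<le> p \<bar>t\<bar> - p 0"
    proof (rule main[of "\<lambda>x. f (- x)" "\<lambda>x. - f' (- x)"])
      fix \<tau> :: real assume \<tau>: "\<bar>\<tau>\<bar> \<le> \<bar>t\<bar>"
      then have "(f has_vector_derivative f' (- \<tau>)) (at (- \<tau>))" using f by simp
      moreover have "((\<lambda>x. - x) has_vector_derivative - 1) (at \<tau>)"
        by (auto intro!: derivative_eq_intros)
      ultimately show "((\<lambda>x. f (- x)) has_vector_derivative - f' (- \<tau>)) (at \<tau>)"
        using vector_diff_chain_at[of "\<lambda>x. - x" "-1" \<tau> f "f' (- \<tau>)"] by (simp add: o_def)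
      show "norm (- f' (- \<tau>)) \<le> p' \<bar>\<tau>\<bar>" using b[of "- \<tau>"] \<tau> by simp
    qed
    then show ?thesis using False by simp
  qed
qed

lemma vector_derivative_const_bound_zero:
  fixes f :: "real \<Rightarrow> 'a::real_normed_vector"
  assumes f: "\<And>\<tau>. \<bar>\<tau>\<bar> \<le> \<bar>t\<bar> \<Longrightarrow> (f has_vector_derivative f' \<tau>) (at \<tau>)"
    and b: "\<And>\<tau>. \<bar>\<tau>\<bar> \<le> \<bar>t\<bar> \<Longrightarrow> norm (f' \<tau>) \<le> B"
  shows "norm (f t - f 0) \<le> B * \<bar>t\<bar>"
  using vector_derivative_bound_zero[OF f, of t "\<lambda>\<tau>. B * \<tau>" "\<lambda>_. B"] b
  by (auto intro!: derivative_eq_intros)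

text \<open>Picard iteration on the whole line at once. Measured against exp (2 L |t|) the iteration
  contracts globally, so no local solutions have to be continued.\<close>

lemma lipschitz_ode_exists:
  fixes F :: "'a::banach \<Rightarrow> 'a"
  assumes lip: "\<And>x y. norm (F x - F y) \<le> L * norm (x - y)" and L: "0 < L"
  shows "\<exists>y. y 0 = y0 \<and> (\<forall>t. (y has_vector_derivative F (y t)) (at t))"
proof -
  define AD where "AD g = (SOME G. G 0 = (0::'a) \<and> (\<forall>t. (G has_vector_derivative g t) (at t)))" for g :: "real \<Rightarrow> 'a"
  have AD: "AD g 0 = 0" "(AD g has_vector_derivative g t) (at t)" if "continuous_on UNIV g" for g t
    using someI_ex[OF antiderivative_exists[OF that]] by (auto simp: AD_def)
  define Y where "Y = rec_nat (\<lambda>t. y0) (\<lambda>_ y t. y0 + AD (\<lambda>t. F (y t)) t)"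
  have Y0: "Y 0 t = y0" for t by (simp add: Y_def)
  have YS: "Y (Suc k) t = y0 + AD (\<lambda>t. F (Y k t)) t" for k t by (simp add: Y_def)
  have Fc: "continuous_on UNIV F"
  proof (rule lipschitz_on_continuous_on)
    show "L-lipschitz_on UNIV F" using lip L by (auto simp: lipschitz_on_def dist_norm)
  qed
  have Fy: "continuous_on UNIV (\<lambda>t. F (y t))" if "continuous_on UNIV y" for y :: "real \<Rightarrow> 'a"
    using continuous_on_compose2[OF Fc that] by simp
  have Yc: "continuous_on UNIV (Y k)" for k
  proof (induction k)
    case 0 then show ?case by (simp add: Y_def)
  next
    case (Suc k)
    have "continuous_on UNIV (AD (\<lambda>t. F (Y k t)))"
      using AD(2)[OF Fy[OF Suc]] by (intro continuous_at_imp_continuous_on) (auto intro: has_vector_derivative_continuous)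
    then show ?case by (simp add: YS[abs_def] continuous_intros)
  qed
  define M where "M = norm (F y0) / L"
  have M0: "0 \<le> M" using L by (simp add: M_def)
  \<comment> \<open>Integrating L exp (2 L t) gains the factor 1/2: this is the contraction in the
    exponentially weighted norm.\<close>
  have step: "norm (Y (Suc k) t - Y k t) \<le> M / 2 ^ k * exp (2 * L * \<bar>t\<bar>)" for k t
  proof (induction k arbitrary: t)
    case 0
    let ?f = "AD (\<lambda>t. F (Y 0 t))"
    have "norm (?f t - ?f 0) \<le> M * exp (2 * L * \<bar>t\<bar>) - M * exp (2 * L * 0)"
    proof (rule vector_derivative_bound_zero)
      show "(?f has_vector_derivative F (Y 0 \<tau>)) (at \<tau>)" for \<tau> by (rule AD(2)[OF Fy[OF Yc]])
      show "((\<lambda>x. M * exp (2 * L * x)) has_real_derivative M * exp (2 * L * \<tau>) * (2 * L)) (at \<tau>)" for \<tau>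
        by (auto intro!: derivative_eq_intros)
      have "1 * norm (F y0) \<le> (exp (2 * L * \<bar>\<tau>\<bar>) * 2) * norm (F y0)" for \<tau>
      proof (intro mult_right_mono)
        have "1 \<le> exp (2 * L * \<bar>\<tau>\<bar>)" using L by simp
        then show "1 \<le> exp (2 * L * \<bar>\<tau>\<bar>) * 2" by linarith
      qed simp
      then show "norm (F (Y 0 \<tau>)) \<le> M * exp (2 * L * \<bar>\<tau>\<bar>) * (2 * L)" for \<tau>
        using L by (simp add: Y0 M_def mult_ac)
    qed
    then show ?case using M0 AD(1)[OF Fy[OF Yc[of 0]]] unfolding YS Y0 by simp
  next
    case (Suc k)
    let ?f = "\<lambda>t. AD (\<lambda>t. F (Y (Suc k) t)) t - AD (\<lambda>t. F (Y k t)) t"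
    let ?M = "M / 2 ^ Suc k"
    have "norm (?f t - ?f 0) \<le> ?M * exp (2 * L * \<bar>t\<bar>) - ?M * exp (2 * L * 0)"
    proof (rule vector_derivative_bound_zero)
      show "(?f has_vector_derivative F (Y (Suc k) \<tau>) - F (Y k \<tau>)) (at \<tau>)" for \<tau>
        by (intro has_vector_derivative_diff AD(2)[OF Fy[OF Yc]])
      show "((\<lambda>x. ?M * exp (2 * L * x)) has_real_derivative ?M * exp (2 * L * \<tau>) * (2 * L)) (at \<tau>)" for \<tau>
        by (auto intro!: derivative_eq_intros)
      show "norm (F (Y (Suc k) \<tau>) - F (Y k \<tau>)) \<le> ?M * exp (2 * L * \<bar>\<tau>\<bar>) * (2 * L)" for \<tau>
      proof -
        have "L * norm (Y (Suc k) \<tau> - Y k \<tau>) \<le> L * (M / 2 ^ k * exp (2 * L * \<bar>\<tau>\<bar>))"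
          using L by (intro mult_left_mono Suc.IH) auto
        then show ?thesis using lip[of "Y (Suc k) \<tau>" "Y k \<tau>"] by (simp add: mult_ac)
      qed
    qed
    moreover have "?f 0 = 0" using AD(1)[OF Fy[OF Yc]] by simp
    moreover have "0 \<le> ?M * exp (2 * L * 0)" using M0 by simp
    ultimately show ?case unfolding YS[of "Suc k"] YS[of k] by simp
  qed
  have summ: "summable (\<lambda>k. M / 2 ^ k * exp (2 * L * c))" for c
    using summable_mult2[OF summable_mult[OF summable_geometric[of "1/2::real"], of M], of "exp (2 * L * c)"]
    by (simp add: power_divide)
  define E where "E n = 2 * M / 2 ^ n" for n
  define y where "y t = lim (\<lambda>k. Y k t)" for t
  have conv0: "summable (\<lambda>k. Y (Suc k) t - Y k t)" for t
    by (rule summable_comparison_test[OF _ summ[of "\<bar>t\<bar>"]]) (use step in auto)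
  have conv: "(\<lambda>k. Y k t) \<longlonglongrightarrow> y t" for t
  proof -
    have "convergent (\<lambda>n. \<Sum>k<n. Y (Suc k) t - Y k t)"
      using conv0 by (simp add: summable_iff_convergent)
    then have "convergent (\<lambda>n. Y n t - Y 0 t)" unfolding sum_lessThan_telescope[of "\<lambda>k. Y k t"] .
    then have "convergent (\<lambda>n. Y n t - Y 0 t + Y 0 t)" by (intro convergent_add convergent_const)
    then show ?thesis by (simp add: y_def convergent_LIMSEQ_iff)
  qed
  \<comment> \<open>The factor 1 - 1 / 2^d is the partial geometric sum; it is kept so that the
    induction closes.\<close>
  have cauchy: "norm (Y (n + d) t - Y n t) \<le> (2 * M / 2 ^ n) * exp (2 * L * \<bar>t\<bar>) * (1 - 1 / 2 ^ d)" for n d t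
  proof (induction d)
    case (Suc d)
    have "norm (Y (n + Suc d) t - Y n t) \<le> norm (Y (Suc (n + d)) t - Y (n + d) t) + norm (Y (n + d) t - Y n t)"
      using norm_triangle_ineq[of "Y (Suc (n + d)) t - Y (n + d) t" "Y (n + d) t - Y n t"] by simp
    also have "\<dots> \<le> M / 2 ^ (n + d) * exp (2 * L * \<bar>t\<bar>) + (2 * M / 2 ^ n) * exp (2 * L * \<bar>t\<bar>) * (1 - 1 / 2 ^ d)"
      by (intro add_mono step Suc)
    also have "\<dots> = (2 * M / 2 ^ n) * exp (2 * L * \<bar>t\<bar>) * (1 - 1 / 2 ^ Suc d)"
      by (simp add: power_add field_simps)
    finally show ?case .
  qed simp
  have close: "norm (y t - Y n t) \<le> (2 * M / 2 ^ n) * exp (2 * L * \<bar>t\<bar>)" for n t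
  proof (rule tendsto_upperbound)
    show "((\<lambda>d. norm (Y (n + d) t - Y n t)) \<longlongrightarrow> norm (y t - Y n t)) sequentially"
      using LIMSEQ_ignore_initial_segment[OF conv, of n t] by (intro tendsto_intros) (simp add: add.commute)
    have "(2 * M / 2 ^ n) * exp (2 * L * \<bar>t\<bar>) * (1 - 1 / 2 ^ d) \<le> (2 * M / 2 ^ n) * exp (2 * L * \<bar>t\<bar>) * 1" for d
      using M0 by (intro mult_left_mono mult_nonneg_nonneg) auto
    then have "norm (Y (n + d) t - Y n t) \<le> (2 * M / 2 ^ n) * exp (2 * L * \<bar>t\<bar>)" for d
      using order_trans[OF cauchy[of n d t]] by (metis mult.right_neutral)
    then show "\<forall>\<^sub>F d in sequentially. norm (Y (n + d) t - Y n t) \<le> (2 * M / 2 ^ n) * exp (2 * L * \<bar>t\<bar>)"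
      by (intro always_eventually allI)
  qed simp
  have lim0: "(\<lambda>n. (2 * M / 2 ^ n) * c) \<longlonglongrightarrow> 0" for c :: real
  proof -
    have "(\<lambda>n. (2 * M * c) * (1 / 2) ^ n) \<longlonglongrightarrow> (2 * M * c) * 0"
      by (intro tendsto_intros LIMSEQ_power_zero) auto
    then show ?thesis by (simp add: power_divide mult_ac)
  qed
  have yc: "continuous_on UNIV y"
  proof -
    have "continuous_on {-c<..<c} y" if "0 < c" for c
    proof (rule uniform_limit_theorem)
      show "\<forall>\<^sub>F n in sequentially. continuous_on {-c<..<c} (Y n)"
        using continuous_on_subset[OF Yc] by auto
      show "uniform_limit {-c<..<c} Y y sequentially"
      proof (rule uniform_limitI)
        fix e :: real assume "e > 0"
        then have "\<forall>\<^sub>F n in sequentially. (2 * M / 2 ^ n) * exp (2 * L * c) < e"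
          using lim0 by (rule order_tendstoD[rotated])
        then show "\<forall>\<^sub>F n in sequentially. \<forall>x\<in>{-c<..<c}. dist (Y n x) (y x) < e"
        proof eventually_elim
          case (elim n)
          show ?case
          proof
            fix x assume "x \<in> {-c<..<c}"
            then have "(2 * M / 2 ^ n) * exp (2 * L * \<bar>x\<bar>) \<le> (2 * M / 2 ^ n) * exp (2 * L * c)"
              using M0 L by (intro mult_left_mono) auto
            then show "dist (Y n x) (y x) < e" using close[of x n] elim by (simp add: dist_norm norm_minus_commute)
          qed
        qed
      qed
    qed auto
    note yci = this
    have "isCont y t" for t
    proof -
      have "continuous_on {-(\<bar>t\<bar> + 1)<..<\<bar>t\<bar> + 1} y" by (rule yci) simp
      moreover have "t \<in> {-(\<bar>t\<bar> + 1)<..<\<bar>t\<bar> + 1}" by auto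
      ultimately show ?thesis using continuous_on_eq_continuous_at[OF open_greaterThanLessThan] by blast
    qed
    then show ?thesis by (simp add: continuous_at_imp_continuous_on)
  qed
  have "y t = y0 + AD (\<lambda>t. F (y t)) t" for t
  proof -
    have "norm (AD (\<lambda>t. F (y t)) t - AD (\<lambda>t. F (Y n t)) t) \<le> (2 * M / 2 ^ n) * (L * exp (2 * L * \<bar>t\<bar>) * \<bar>t\<bar>)" for n
    proof -
      let ?f = "\<lambda>t. AD (\<lambda>t. F (y t)) t - AD (\<lambda>t. F (Y n t)) t"
      have "norm (?f t - ?f 0) \<le> (L * ((2 * M / 2 ^ n) * exp (2 * L * \<bar>t\<bar>))) * \<bar>t\<bar>"
      proof (rule vector_derivative_const_bound_zero)
        show "(?f has_vector_derivative F (y \<tau>) - F (Y n \<tau>)) (at \<tau>)" for \<tau>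
          by (intro has_vector_derivative_diff AD(2) Fy Yc yc)
        fix \<tau> assume "\<bar>\<tau>\<bar> \<le> \<bar>t\<bar>"
        then have "(2 * M / 2 ^ n) * exp (2 * L * \<bar>\<tau>\<bar>) \<le> (2 * M / 2 ^ n) * exp (2 * L * \<bar>t\<bar>)"
          using M0 L by (intro mult_left_mono) auto
        then have "L * norm (y \<tau> - Y n \<tau>) \<le> L * ((2 * M / 2 ^ n) * exp (2 * L * \<bar>t\<bar>))"
          using L close[of \<tau> n] by (intro mult_left_mono) linarith+
        then show "norm (F (y \<tau>) - F (Y n \<tau>)) \<le> L * ((2 * M / 2 ^ n) * exp (2 * L * \<bar>t\<bar>))"
          using lip order_trans by blast
      qed
      moreover have "?f 0 = 0" using AD(1) Fy Yc yc by simp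
      ultimately show ?thesis by (simp add: mult_ac)
    qed
    then have "(\<lambda>n. AD (\<lambda>t. F (y t)) t - AD (\<lambda>t. F (Y n t)) t) \<longlonglongrightarrow> 0"
      by (intro Lim_null_comparison[OF _ lim0[of "L * exp (2 * L * \<bar>t\<bar>) * \<bar>t\<bar>"]] always_eventually allI)
    then have "(\<lambda>n. AD (\<lambda>t. F (y t)) t - (AD (\<lambda>t. F (y t)) t - AD (\<lambda>t. F (Y n t)) t)) \<longlonglongrightarrow> AD (\<lambda>t. F (y t)) t - 0"
      by (intro tendsto_intros)
    then have "(\<lambda>n. AD (\<lambda>t. F (Y n t)) t) \<longlonglongrightarrow> AD (\<lambda>t. F (y t)) t" by simp
    then have "(\<lambda>n. Y (Suc n) t) \<longlonglongrightarrow> y0 + AD (\<lambda>t. F (y t)) t"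
      unfolding YS by (intro tendsto_intros)
    moreover have "(\<lambda>n. Y (Suc n) t) \<longlonglongrightarrow> y t" using conv by (rule LIMSEQ_Suc)
    ultimately show ?thesis by (rule LIMSEQ_unique[OF _ _, symmetric])
  qed
  note ye = this
  define Z where "Z t = y0 + AD (\<lambda>t. F (y t)) t" for t
  have Zy: "Z = y" by (rule ext) (simp only: Z_def ye[symmetric])
  have "(Z has_vector_derivative 0 + F (y t)) (at t)" for t
    unfolding Z_def[abs_def]
    by (intro has_vector_derivative_add has_vector_derivative_const AD(2)[OF Fy[OF yc]])
  then have "(y has_vector_derivative F (y t)) (at t)" for t by (simp add: Zy)
  moreover have "Z 0 = y0" unfolding Z_def AD(1)[OF Fy[OF yc]] by simp
  then have "y 0 = y0" by (simp add: Zy)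
  ultimately show ?thesis by blast
qed

subsection \<open>Galerkin approximation\<close>

instance bcontfun :: (metric_space, banach) banach ..

text \<open>\<open>lipschitz_ode_exists\<close> needs a type in class \<open>banach\<close>, whereas
  families on the set I, which depends on the truncation, do not form one. A family is stored as a
  bounded continuous function interpolating it at the integers and is read off by evaluation
  there.\<close>

lemma finite_ode_exists:
  fixes F :: "(int \<Rightarrow> 'a::banach) \<Rightarrow> int \<Rightarrow> 'a"
  assumes I: "finite I"
    and lip: "\<And>x y n. n \<in> I \<Longrightarrow> norm (F x n - F y n) \<le> L * (\<Sum>k\<in>I. norm (x k - y k))" and L: "0 \<le> L"
  obtains y where "\<And>n. n \<in> I \<Longrightarrow> y (0::real) n = y0 n" "\<And>t n. n \<notin> I \<Longrightarrow> y t n = 0"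
    "\<And>t n. n \<in> I \<Longrightarrow> ((\<lambda>t. y t n) has_vector_derivative F (y t) n) (at t)"
proof -
  \<comment> \<open>Hat functions of width 1 around each integer: at integer points they form a
    Kronecker delta, and they are bounded by 1.\<close>
  define hat where "hat x = max 0 (1 - \<bar>x\<bar>)" for x :: real
  have hat: "0 \<le> hat x" "hat x \<le> 1" for x by (auto simp: hat_def)
  have hat_int: "hat (of_int n - of_int k) = (if n = k then 1 else 0)" for n k
  proof (cases "n = k")
    case False
    then have "1 \<le> \<bar>n - k\<bar>" by linarith
    then have "1 \<le> \<bar>real_of_int n - of_int k\<bar>" by (metis of_int_1_le_iff of_int_abs of_int_diff)
    then show ?thesis using False by (simp add: hat_def)
  qed (simp add: hat_def)
  define e where "e f x = (\<Sum>k\<in>I. hat (x - of_int k) *\<^sub>R f k)" for f :: "int \<Rightarrow> 'a" and x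
  have e_le: "norm (e f x) \<le> (\<Sum>k\<in>I. norm (f k))" for f x
    unfolding e_def using hat by (intro order_trans[OF norm_sum] sum_mono) (simp add: mult_left_le_one_le)
  have e_int: "e f (of_int n) = (if n \<in> I then f n else 0)" for f n
  proof -
    have "e f (of_int n) = (\<Sum>k\<in>I. if n = k then f k else 0)"
      unfolding e_def by (intro sum.cong) (auto simp: hat_int)
    then show ?thesis using I by simp
  qed
  have mem: "e f \<in> bcontfun" for f
    by (rule bcontfun_normI[OF _ e_le]) (auto simp: e_def[abs_def] hat_def intro!: continuous_intros)
  define E where "E f = Bcontfun (e f)" for f
  have E: "apply_bcontfun (E f) = e f" for f
    using mem[of f] by (simp add: E_def Bcontfun_inverse)
  have bl: "bounded_linear (\<lambda>b::real \<Rightarrow>\<^sub>C 'a. apply_bcontfun b x)" for x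
    by (rule bounded_linear_intro[of _ 1]) (auto simp: norm_bounded)
  define ev where "ev b = (\<lambda>k. apply_bcontfun b (of_int k))" for b :: "real \<Rightarrow>\<^sub>C 'a"
  define G where "G b = E (F (ev b))" for b
  \<comment> \<open>One factor \<open>card I\<close> comes from the sum defining e, the other from
    the sum in the Lipschitz bound of F; adding 1 secures 0 < M.\<close>
  define M where "M = real (card I) * (L * real (card I)) + 1"
  have "norm (G b - G c) \<le> M * norm (b - c)" for b c
  proof (rule norm_bound)
    fix x
    have s: "(\<Sum>k\<in>I. norm (ev b k - ev c k)) \<le> real (card I) * norm (b - c)"
    proof (rule sum_bounded_above)
      fix k show "norm (ev b k - ev c k) \<le> norm (b - c)"
        using norm_bounded[of "b - c" "of_int k"] by (simp add: ev_def)
    qed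
    have "apply_bcontfun (G b - G c) x = e (\<lambda>k. F (ev b) k - F (ev c) k) x"
      by (simp add: G_def E e_def scaleR_right_diff_distrib sum_subtractf)
    then have "norm (apply_bcontfun (G b - G c) x) \<le> (\<Sum>k\<in>I. norm (F (ev b) k - F (ev c) k))"
      using e_le by simp
    also have "\<dots> \<le> real (card I) * (L * (real (card I) * norm (b - c)))"
      by (intro sum_bounded_above order_trans[OF lip] mult_left_mono s L)
    also have "\<dots> \<le> M * norm (b - c)" by (simp add: M_def distrib_right)
    finally show "norm (apply_bcontfun (G b - G c) x) \<le> M * norm (b - c)" .
  qed
  moreover have "0 < M" using L by (simp add: M_def add_nonneg_pos)
  ultimately obtain b where b: "b 0 = E y0" "\<And>t. (b has_vector_derivative G (b t)) (at t)"
    using lipschitz_ode_exists[of G M "E y0"] by blast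
  have bd: "((\<lambda>t. ev (b t) n) has_vector_derivative (if n \<in> I then F (ev (b t)) n else 0)) (at t)" for n t
    using bounded_linear.has_vector_derivative[OF bl b(2), of "of_int n" t] by (auto simp: G_def E ev_def e_int split: if_splits)
  have b0: "ev (b 0) n = (if n \<in> I then y0 n else 0)" for n by (simp add: b E ev_def e_int)
  show ?thesis
  proof (rule that)
    show "\<And>n. n \<in> I \<Longrightarrow> ev (b 0) n = y0 n" by (simp add: b0)
    show "\<And>t n. n \<in> I \<Longrightarrow> ((\<lambda>t. ev (b t) n) has_vector_derivative F (ev (b t)) n) (at t)"
      using bd by (metis (full_types))
    fix t n assume n: "n \<notin> I"
    have "((\<lambda>t. ev (b t) n) has_vector_derivative 0) (at \<tau>)" for \<tau> using bd[of n \<tau>] n by simp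
    then have "norm (ev (b t) n - ev (b 0) n) \<le> 0 * \<bar>t\<bar>"
      by (rule vector_derivative_const_bound_zero) simp
    then show "ev (b t) n = 0" using n by (simp add: b0)
  qed
qed

text \<open>The bound is on the absolute value of the derivative, so it is stable under reflection
  of time and Gronwall's argument also runs backwards.\<close>

lemma gronwall_zero:
  fixes f :: "real \<Rightarrow> real"
  assumes f: "\<And>\<tau>. \<bar>\<tau>\<bar> \<le> \<bar>t\<bar> \<Longrightarrow> (f has_real_derivative f' \<tau>) (at \<tau>)"
    and b: "\<And>\<tau>. \<bar>\<tau>\<bar> \<le> \<bar>t\<bar> \<Longrightarrow> \<bar>f' \<tau>\<bar> \<le> C * f \<tau>"
  shows "f t \<le> f 0 * exp (C * \<bar>t\<bar>)"
proof -
  have main: "g \<bar>t\<bar> \<le> g 0 * exp (C * \<bar>t\<bar>)"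
    if g: "\<And>\<tau>. \<bar>\<tau>\<bar> \<le> \<bar>t\<bar> \<Longrightarrow> (g has_real_derivative g' \<tau>) (at \<tau>)"
      and gb: "\<And>\<tau>. \<bar>\<tau>\<bar> \<le> \<bar>t\<bar> \<Longrightarrow> \<bar>g' \<tau>\<bar> \<le> C * g \<tau>" for g g'
  proof -
    have "g \<bar>t\<bar> * exp (- C * \<bar>t\<bar>) \<le> g 0 * exp (- C * 0)"
    proof (rule DERIV_nonpos_imp_nonincreasing[of 0 "\<bar>t\<bar>" "\<lambda>x. g x * exp (- C * x)"])
      fix x assume x: "0 \<le> x" "x \<le> \<bar>t\<bar>"
      have "((\<lambda>x. g x * exp (- C * x)) has_real_derivative g' x * exp (- C * x) + (exp (- C * x) * - C) * g x) (at x)"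
        using x by (auto intro!: derivative_eq_intros g)
      moreover have "g' x * exp (- C * x) + (exp (- C * x) * - C) * g x = (g' x - C * g x) * exp (- C * x)"
        by (simp add: algebra_simps)
      moreover have "(g' x - C * g x) * exp (- C * x) \<le> 0"
        using gb[of x] x by (intro mult_nonpos_nonneg) auto
      ultimately show "\<exists>y. ((\<lambda>x. g x * exp (- C * x)) has_real_derivative y) (at x) \<and> y \<le> 0" by metis
    qed simp
    then have "g \<bar>t\<bar> * exp (- C * \<bar>t\<bar>) * exp (C * \<bar>t\<bar>) \<le> g 0 * exp (C * \<bar>t\<bar>)"
      by (intro mult_right_mono) auto
    moreover have "exp (- C * \<bar>t\<bar>) * exp (C * \<bar>t\<bar>) = 1" by (simp add: exp_add[symmetric])
    ultimately show ?thesis by (simp only: mult.assoc mult_1_right)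
  qed
  show ?thesis
  proof (cases "0 \<le> t")
    case True then show ?thesis using main[of f f'] f b by simp
  next
    case False
    have "f (- \<bar>t\<bar>) \<le> f (- 0) * exp (C * \<bar>t\<bar>)"
    proof (rule main[of "\<lambda>x. f (- x)" "\<lambda>x. - f' (- x)"])
      fix \<tau> :: real assume \<tau>: "\<bar>\<tau>\<bar> \<le> \<bar>t\<bar>"
      show "((\<lambda>x. f (- x)) has_real_derivative - f' (- \<tau>)) (at \<tau>)"
        using DERIV_mirror[of f "f' (- \<tau>)" \<tau>] f[of "- \<tau>"] \<tau> by simp
      show "\<bar>- f' (- \<tau>)\<bar> \<le> C * f (- \<tau>)" using b[of "- \<tau>"] \<tau> by simp
    qed
    then show ?thesis using False by simp
  qed
qed

lemma conv_diff_right: "conv m f (\<lambda>k. g k - h k) n = conv m f g n - conv m f (h::int \<Rightarrow> 'a::comm_ring) n"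
  by (simp add: conv_def algebra_simps sum_subtractf)

lemma conv_diff_left: "conv m (\<lambda>k. g k - h k) f n = conv m g f n - conv m (h::int \<Rightarrow> 'a::comm_ring) f n"
  by (simp add: conv_def algebra_simps sum_subtractf)

lemma bil_diff_right: "bil m y (\<lambda>k. z k - w k) n = bil m y z n - bil m y w n"
  by (rule prod_eqI) (simp_all add: bil_def tra_def rst_def right_diff_distrib conv_diff_right field_simps)

lemma bil_diff_left: "bil m (\<lambda>k. z k - w k) y n = bil m z y n - bil m w y n"
  by (rule prod_eqI) (simp_all add: bil_def tra_def rst_def right_diff_distrib conv_diff_left field_simps)

text \<open>The order of the slots is deliberate: first the difference is transported by y, which
  suits the energy estimate, then it is the velocity and the transported derivative falls on
  z.\<close>

lemma bil_diff_self:
  "bil m y y n - bil m z z n = bil m y (\<lambda>k. y k - z k) n + bil m (\<lambda>k. y k - z k) z n"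
  by (simp add: bil_diff_left bil_diff_right)

lemma conv_scaleR2: "conv m (\<lambda>j. c *\<^sub>R f j) (\<lambda>k. c *\<^sub>R g k) n = (c\<^sup>2) *\<^sub>R conv m f (g :: int \<Rightarrow> complex) n"
  by (simp add: conv_def scaleR_sum_right power2_eq_square)

lemma bil_scaleR: "bil m (\<lambda>k. c *\<^sub>R y k) (\<lambda>k. c *\<^sub>R y k) n = (c\<^sup>2) *\<^sub>R bil m y y n"
  by (rule prod_eqI) (simp_all add: bil_def tra_def rst_def conv_scaleR2 scaleR_right_diff_distrib algebra_simps)

definition cjp :: "complex \<times> complex \<Rightarrow> complex \<times> complex" where
  "cjp z = (cnj (fst z), cnj (snd z))"

lemma hrm_cjp: "hrm y \<longleftrightarrow> (\<forall>n. y (- n) = cjp (y n))"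
  by (auto simp: hrm_def cjp_def prod_eq_iff)

lemma norm_cjp [simp]: "norm (cjp z) = norm z"
  by (simp add: norm_prod_def cjp_def)

lemma cjp_diff: "cjp (x - y) = cjp x - cjp y" and cjp_cjp [simp]: "cjp (cjp x) = x"
  and cjp_add: "cjp (x + y) = cjp x + cjp y"
  and cjp_scaleR: "cjp (c *\<^sub>R x) = c *\<^sub>R cjp x" and cjp_0 [simp]: "cjp 0 = 0"
  by (auto simp: cjp_def prod_eq_iff)

lemma bounded_linear_cjp: "bounded_linear cjp"
  by (rule bounded_linear_intro[of _ 1]) (auto simp: cjp_add cjp_scaleR)

lemma win_minus [simp]: "- n \<in> win m \<longleftrightarrow> n \<in> win m"
  by (simp add: mem_win)

lemma conv_herm:
  fixes f g :: "int \<Rightarrow> complex"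
  assumes "\<And>n. f (- n) = cnj (f n)" "\<And>n. g (- n) = cnj (g n)"
  shows "conv m f g (- n) = cnj (conv m f g n)"
proof -
  have "conv m f g (- n) = (\<Sum>k\<in>uminus ` win m. f (- n - k) * g k)"
  proof -
    have "uminus ` win m = win m"
    proof (rule set_eqI)
      fix x show "x \<in> uminus ` win m \<longleftrightarrow> x \<in> win m"
        using win_minus[of x m] by (auto simp: image_iff intro: bexI[of _ "- x"])
    qed
    then show ?thesis by (simp add: conv_def)
  qed
  also have "\<dots> = (\<Sum>k\<in>win m. f (- n - (- k)) * g (- k))"
    by (subst sum.reindex) auto
  also have "\<dots> = (\<Sum>k\<in>win m. cnj (f (n - k) * g k))"
  proof (rule sum.cong)
    fix k
    have "f (- n - - k) = cnj (f (n - k))" using assms(1)[of "n - k"] by simp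
    then show "f (- n - (- k)) * g (- k) = cnj (f (n - k) * g k)" using assms(2)[of k] by simp
  qed simp
  finally show ?thesis by (simp add: conv_def)
qed

lemma hrm_bil: "hrm y \<Longrightarrow> hrm (bil m y y)"
proof -
  assume h: "hrm y"
  have d: "dsym (- n) * fst (y (- n)) = cnj (dsym n * fst (y n))" "dsym (- n) * snd (y (- n)) = cnj (dsym n * snd (y n))" for n
    using h by (simp_all add: hrm_def)
  have a: "fst (y (- n)) = cnj (fst (y n))" "snd (y (- n)) = cnj (snd (y n))" for n
    using h by (simp_all add: hrm_def)
  have "msym (- n) = cnj (msym n)" for n by (simp add: msym_def)
  then show ?thesis
    unfolding hrm_def bil_def tra_def rst_def
    using conv_herm[of "\<lambda>n. fst (y n)" "\<lambda>n. dsym n * fst (y n)" m, OF a(1) d(1)]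
      conv_herm[of "\<lambda>n. fst (y n)" "\<lambda>n. dsym n * snd (y n)" m, OF a(1) d(2)]
      conv_herm[of "\<lambda>n. fst (y n)" "\<lambda>n. fst (y n)" m, OF a(1) a(1)]
      conv_herm[of "\<lambda>n. dsym n * fst (y n)" "\<lambda>n. dsym n * fst (y n)" m, OF d(1) d(1)]
      conv_herm[of "\<lambda>n. snd (y n)" "\<lambda>n. snd (y n)" m, OF a(2) a(2)]
      conv_herm[of "\<lambda>n. snd (y n)" "\<lambda>n. dsym n * fst (y n)" m, OF a(2) d(1)]
    by simp
qed

lemma sz_le_S1: "supp m y \<Longrightarrow> sz n (y n) \<le> S1 m y"
  by (cases "n \<in> win m") (auto simp: S1_def supp_def intro: member_le_sum sum_nonneg)

lemma sz_bil_le: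
  assumes "supp m y"
  shows "sz n (bil m y z n) \<le> 6 * (S1 m y * X1 m z)"
proof -
  have "conv m (\<lambda>j. sz j (y j)) (\<lambda>k. jb k * sz k (z k)) n \<le> S1 m y * X1 m z"
    unfolding conv_def X1_def sum_distrib_left
    by (intro sum_mono mult_right_mono sz_le_S1 assms) auto
  then show ?thesis using sz_bil[of n m y z] by simp
qed

lemma Nv_triangle: "(\<And>n. 0 \<le> v n) \<Longrightarrow> Nv v m (\<lambda>n. y n + z n) \<le> Nv v m y + Nv v m z"
proof -
  assume v: "\<And>n. 0 \<le> v n"
  have "Nv v m (\<lambda>n. y n + z n) \<le> L2_set (\<lambda>n. v n * sz n (y n) + v n * sz n (z n)) (win m)"
    unfolding Nv_def
    using v mult_left_mono[OF sz_triangle v] by (intro L2_set_mono') (auto simp: abs_mult distrib_left)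
  also have "\<dots> \<le> Nv v m y + Nv v m z" unfolding Nv_def by (rule L2_set_triangle_ineq)
  finally show ?thesis .
qed

lemma Nv_minus: "Nv v m (\<lambda>n. - y n) = Nv v m y"
  by (simp add: Nv_def)

lemma Nv_diff: "(\<And>n. 0 \<le> v n) \<Longrightarrow> Nv v m (\<lambda>n. y n - z n) \<le> Nv v m y + Nv v m z"
  using Nv_triangle[of v m y "\<lambda>n. - z n"] by (simp add: Nv_minus)

lemma Nv_diff_commute: "Nv v m (\<lambda>n. y n - z n) = Nv v m (\<lambda>n. z n - y n)"
  using Nv_minus[of v m "\<lambda>n. y n - z n"] by simp

lemma Nv_le_diff:
  "(\<And>n. 0 \<le> v n) \<Longrightarrow> \<bar>Nv v m y - Nv v m z\<bar> \<le> Nv v m (\<lambda>n. y n - z n)"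
  using Nv_triangle[of v m z "\<lambda>n. y n - z n"] Nv_triangle[of v m y "\<lambda>n. z n - y n"] Nv_diff_commute[of v m y z]
  by (simp add: abs_le_iff)

lemma le_Nv: "n \<in> win m \<Longrightarrow> v n * sz n (y n) \<le> Nv v m y"
  unfolding Nv_def by (rule member_le_L2_set[where f = "\<lambda>n. v n * sz n (y n)"]) auto

lemma Nv_le_sum: "(\<And>n. 0 \<le> v n) \<Longrightarrow> Nv v m y \<le> (\<Sum>n\<in>win m. v n * sz n (y n))"
  unfolding Nv_def by (rule L2_set_le_sum) auto

text \<open>The quadratic field is made globally Lipschitz by scaling its argument back into the
  ball of radius Bd. A scalar cut-off, unlike one frequency by frequency, leaves the structure of
  \<open>bil\<close> intact: by homogeneity it is just a factor between 0 and 1, and the energy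
  estimate survives.\<close>

lemma galerkin_exists:
  assumes v: "\<And>n. 1 \<le> v n" and h0: "hrm x0" and Bd: "0 < Bd"
  obtains y where "\<And>t. supp m (y (t::real))" "\<And>t. hrm (y t)" "y 0 = trn m x0"
    "\<And>t n. n \<in> win m \<Longrightarrow>
       ((\<lambda>t. y t n) has_vector_derivative ((Bd / max Bd (Nv v m (y t)))\<^sup>2) *\<^sub>R bil m (y t) (y t) n) (at t)"
proof -
  \<comment> \<open>Projection onto truncated Hermitian sequences. With it the field maps into
    Hermitian sequences whatever the state, and along the solution it turns out to be the
    identity.\<close>
  define hs where "hs y n = (if n \<in> win m then (1/2) *\<^sub>R (y n + cjp (y (- n))) else 0)" for y n
  define c where "c y = Bd / max Bd (Nv v m (hs y))" for y
  define \<pi> where "\<pi> y n = c y *\<^sub>R hs y n" for y n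
  define D where "D x y = (\<Sum>k\<in>win m. norm (x k - y k :: complex \<times> complex))" for x y
  define V where "V = (\<Sum>k\<in>win m. v k * (2 * jb k))"
  have v0: "0 \<le> v n" for n using v[of n] by linarith
  have V0: "0 \<le> V" unfolding V_def by (intro sum_nonneg mult_nonneg_nonneg v0) auto
  have c01: "0 \<le> c y" "c y \<le> 1" for y using Bd by (auto simp: c_def divide_simps)
  have D1: "norm (x k - y k) \<le> D x y" if "k \<in> win m" for x y k
    unfolding D_def by (rule member_le_sum[OF that]) auto
  have D0: "0 \<le> D x y" for x y unfolding D_def by (intro sum_nonneg) auto
  have hsD: "norm (hs x k - hs y k) \<le> D x y" for x y k
  proof (cases "k \<in> win m")
    case True
    have "hs x k - hs y k = (1/2) *\<^sub>R ((x k - y k) + cjp (x (- k) - y (- k)))"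
      using True by (simp add: hs_def cjp_diff scaleR_right_diff_distrib scaleR_right_distrib)
    then have "norm (hs x k - hs y k) \<le> (1/2) * (norm (x k - y k) + norm (x (- k) - y (- k)))"
      using norm_triangle_ineq[of "x k - y k" "cjp (x (- k) - y (- k))"] by simp
    also have "\<dots> \<le> (1/2) * (D x y + D x y)" using True by (intro mult_left_mono add_mono D1) auto
    finally show ?thesis by simp
  qed (simp add: hs_def D0)
  have NhsD: "\<bar>Nv v m (hs x) - Nv v m (hs y)\<bar> \<le> V * D x y" for x y
  proof -
    have "\<bar>Nv v m (hs x) - Nv v m (hs y)\<bar> \<le> Nv v m (\<lambda>n. hs x n - hs y n)" by (rule Nv_le_diff[OF v0])
    also have "\<dots> \<le> (\<Sum>n\<in>win m. v n * sz n (hs x n - hs y n))" by (rule Nv_le_sum[OF v0])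
    also have "\<dots> \<le> (\<Sum>n\<in>win m. v n * (2 * jb n * D x y))"
      by (intro sum_mono mult_left_mono v0 order_trans[OF sz_le_norm] hsD) auto
    also have "\<dots> = V * D x y" by (simp add: V_def sum_distrib_right mult.assoc)
    finally show ?thesis .
  qed
  have hsN: "norm (hs y k) \<le> Nv v m (hs y)" for y k
  proof (cases "k \<in> win m")
    case True
    have "norm (hs y k) \<le> 1 * sz k (hs y k)" using norm_le_sz by simp
    also have "\<dots> \<le> v k * sz k (hs y k)" by (intro mult_right_mono v) auto
    also have "\<dots> \<le> Nv v m (hs y)" by (rule le_Nv[OF True])
    finally show ?thesis .
  qed (simp add: hs_def)
  have pB: "norm (\<pi> y k) \<le> Bd" for y k
  proof -
    have "norm (\<pi> y k) = c y * norm (hs y k)" using c01 by (simp add: \<pi>_def)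
    also have "\<dots> \<le> c y * max Bd (Nv v m (hs y))" using c01 hsN[of y k] by (intro mult_left_mono) auto
    also have "\<dots> = Bd" using Bd by (simp add: c_def less_max_iff_disj)
    finally show ?thesis .
  qed
  have pL: "norm (\<pi> x k - \<pi> y k) \<le> (1 + V) * D x y" for x y k
  proof -
    let ?p = "max Bd (Nv v m (hs x))" and ?q = "max Bd (Nv v m (hs y))"
    have pq: "0 < ?p" "0 < ?q" "Bd \<le> ?p" using Bd by auto
    have "\<pi> x k - \<pi> y k = c x *\<^sub>R (hs x k - hs y k) + (c x - c y) *\<^sub>R hs y k"
      by (simp add: \<pi>_def algebra_simps)
    then have "norm (\<pi> x k - \<pi> y k) \<le> c x * norm (hs x k - hs y k) + \<bar>c x - c y\<bar> * norm (hs y k)"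
      using norm_triangle_ineq[of "c x *\<^sub>R (hs x k - hs y k)" "(c x - c y) *\<^sub>R hs y k"] c01 by simp
    also have "c x * norm (hs x k - hs y k) \<le> 1 * D x y"
      using c01 hsD by (intro mult_mono) auto
    also have "\<bar>c x - c y\<bar> * norm (hs y k) \<le> V * D x y"
    proof -
      \<comment> \<open>The retraction onto the ball is Lipschitz: Bd / p is at most 1, and the
        remaining 1 / q cancels against the size of \<open>hs y k\<close>.\<close>
      have "c x - c y = Bd * (?q - ?p) / (?p * ?q)" using pq by (simp add: c_def field_simps)
      then have "\<bar>c x - c y\<bar> = (Bd / ?p) * (\<bar>?q - ?p\<bar> / ?q)" using pq Bd by (simp add: abs_mult)
      also have "\<dots> \<le> 1 * (\<bar>?q - ?p\<bar> / ?q)" using pq by (intro mult_right_mono) auto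
      finally have "\<bar>c x - c y\<bar> * norm (hs y k) \<le> (\<bar>?q - ?p\<bar> / ?q) * ?q"
        using hsN[of y k] pq by (intro mult_mono) auto
      also have "\<dots> = \<bar>?q - ?p\<bar>" using pq by simp
      also have "\<dots> \<le> \<bar>Nv v m (hs x) - Nv v m (hs y)\<bar>" by linarith
      finally show ?thesis using NhsD[of x y] by linarith
    qed
    finally show ?thesis by (simp add: distrib_right)
  qed
  define W where "W = (\<Sum>k\<in>win m. jb k * (2 * jb k))"
  have W0: "0 \<le> W" unfolding W_def by (intro sum_nonneg mult_nonneg_nonneg) auto
  have XW: "X1 m z \<le> W * C" if "\<And>k. norm (z k) \<le> C" for z C
  proof -
    have "X1 m z \<le> (\<Sum>k\<in>win m. jb k * (2 * jb k * C))"
      unfolding X1_def by (intro sum_mono mult_left_mono order_trans[OF sz_le_norm] that) auto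
    then show ?thesis by (simp add: W_def sum_distrib_right mult.assoc)
  qed
  have bilW: "norm (bil m y z n) \<le> 6 * ((W * C) * (W * C'))"
    if "supp m y" "\<And>k. norm (y k) \<le> C" "\<And>k. norm (z k) \<le> C'" for y z n C C'
  proof -
    have C: "0 \<le> C" using that(2)[of 0] norm_ge_zero order_trans by blast
    have "norm (bil m y z n) \<le> 6 * (S1 m y * X1 m z)"
      using norm_le_sz sz_bil_le[OF that(1)] order_trans by blast
    also have "\<dots> \<le> 6 * ((W * C) * (W * C'))"
      using order_trans[OF S1_le_X1 XW[OF that(2)]] XW[OF that(3)] W0 C
      by (intro mult_left_mono mult_mono) auto
    finally show ?thesis .
  qed
  have sp: "supp m (\<pi> y)" for y by (simp add: supp_def \<pi>_def hs_def)
  define L where "L = 12 * (W * Bd * W * (1 + V))"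
  obtain y where y: "\<And>n. n \<in> win m \<Longrightarrow> y (0::real) n = x0 n" "\<And>t n. n \<notin> win m \<Longrightarrow> y t n = 0"
    "\<And>t n. n \<in> win m \<Longrightarrow> ((\<lambda>t. y t n) has_vector_derivative bil m (\<pi> (y t)) (\<pi> (y t)) n) (at t)"
  proof (rule finite_ode_exists[where I = "win m" and F = "\<lambda>y n. bil m (\<pi> y) (\<pi> y) n" and L = L and ?y0.0 = x0])
    show "norm (bil m (\<pi> x) (\<pi> x) n - bil m (\<pi> y) (\<pi> y) n) \<le> L * (\<Sum>k\<in>win m. norm (x k - y k))" for x y n
    proof -
      have "norm (bil m (\<pi> x) (\<pi> x) n - bil m (\<pi> y) (\<pi> y) n)
         \<le> norm (bil m (\<pi> x) (\<lambda>k. \<pi> x k - \<pi> y k) n) + norm (bil m (\<lambda>k. \<pi> x k - \<pi> y k) (\<pi> y) n)"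
        unfolding bil_diff_self by (rule norm_triangle_ineq)
      also have "\<dots> \<le> 6 * ((W * Bd) * (W * ((1 + V) * D x y))) + 6 * ((W * ((1 + V) * D x y)) * (W * Bd))"
        by (intro add_mono bilW pB pL sp) (use sp in \<open>auto simp: supp_def\<close>)
      finally show ?thesis by (simp add: L_def D_def algebra_simps)
    qed
    show "0 \<le> L" using W0 V0 Bd by (simp add: L_def)
  qed (auto intro: that)
  have hp: "hrm (\<pi> y)" for y
    unfolding hrm_cjp by (auto simp: \<pi>_def hs_def cjp_scaleR cjp_add add.commute)
  have hy: "hrm (y t)" for t
    unfolding hrm_cjp
  proof
    fix n
    show "y t (- n) = cjp (y t n)"
    proof (cases "n \<in> win m")
      case True
      \<comment> \<open>The defect from Hermitian symmetry starts at 0 and has zero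
        derivative.\<close>
      have "((\<lambda>t. y t (- n) - cjp (y t n)) has_vector_derivative
         bil m (\<pi> (y \<tau>)) (\<pi> (y \<tau>)) (- n) - cjp (bil m (\<pi> (y \<tau>)) (\<pi> (y \<tau>)) n)) (at \<tau>)" for \<tau>
        using True by (intro has_vector_derivative_diff y bounded_linear.has_vector_derivative[OF bounded_linear_cjp]) auto
      moreover have "bil m (\<pi> (y \<tau>)) (\<pi> (y \<tau>)) (- n) - cjp (bil m (\<pi> (y \<tau>)) (\<pi> (y \<tau>)) n) = 0" for \<tau>
        using hrm_bil[OF hp, of m "y \<tau>"] unfolding hrm_cjp by simp
      ultimately have "((\<lambda>t. y t (- n) - cjp (y t n)) has_vector_derivative 0) (at \<tau>)" for \<tau> by metis
      then have "norm ((y t (- n) - cjp (y t n)) - (y 0 (- n) - cjp (y 0 n))) \<le> 0 * \<bar>t\<bar>"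
        by (rule vector_derivative_const_bound_zero) simp
      moreover have "y 0 (- n) - cjp (y 0 n) = 0"
        using True h0 by (simp add: y hrm_cjp)
      ultimately show ?thesis by simp
    qed (simp add: y)
  qed
  have hsy: "hs (y t) = y t" for t
  proof
    fix n
    have "cjp (y t (- n)) = y t n" using hy[of t] by (simp add: hrm_cjp)
    then show "hs (y t) n = y t n"
      by (simp add: hs_def y scaleR_2[symmetric] del: scaleR_2)
  qed
  show ?thesis
  proof (rule that)
    show "supp m (y t)" for t by (simp add: supp_def y)
    show "y 0 = trn m x0" by (auto simp: trn_def y)
    show "((\<lambda>t. y t n) has_vector_derivative ((Bd / max Bd (Nv v m (y t)))\<^sup>2) *\<^sub>R bil m (y t) (y t) n) (at t)"
      if "n \<in> win m" for t n
    proof -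
      have "\<pi> (y t) = (\<lambda>n. (Bd / max Bd (Nv v m (y t))) *\<^sub>R y t n)"
        by (simp add: \<pi>_def[abs_def] c_def hsy)
      then show ?thesis using y(3)[OF that, of t] by (simp add: bil_scaleR)
    qed
  qed (rule hy)
qed

subsection \<open>Energy and stability estimates\<close>

lemma ipr_inner:
  "ipr v m x y = (\<Sum>n\<in>win m. (v n)\<^sup>2 * ((jb n)\<^sup>2 * (fst (x n) \<bullet> fst (y n)) + snd (x n) \<bullet> snd (y n)))"
  by (simp add: ipr_def inner_complex_def)

lemma Nv_sq_deriv:
  assumes "\<And>n. n \<in> win m \<Longrightarrow> ((\<lambda>t. y t n) has_vector_derivative y' n) (at t)"
  shows "((\<lambda>t. (Nv v m (y t))\<^sup>2) has_real_derivative 2 * ipr v m (y t) y') (at t)"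
proof -
  have i: "((\<lambda>t. f t \<bullet> f t) has_real_derivative 2 * (f t \<bullet> f')) (at t)"
    if "(f has_vector_derivative f') (at t)" for f :: "real \<Rightarrow> complex" and f'
    using bounded_bilinear.has_vector_derivative[OF bounded_bilinear_inner that that]
    by (simp add: has_real_derivative_iff_has_vector_derivative inner_commute)
  have "((\<lambda>t. ipr v m (y t) (y t)) has_real_derivative
     (\<Sum>n\<in>win m. (v n)\<^sup>2 * ((jb n)\<^sup>2 * (2 * (fst (y t n) \<bullet> fst (y' n))) + 2 * (snd (y t n) \<bullet> snd (y' n))))) (at t)"
    unfolding ipr_inner
  proof (intro DERIV_sum DERIV_cmult DERIV_add i)
    fix n assume n: "n \<in> win m"
    show "((\<lambda>t. fst (y t n)) has_vector_derivative fst (y' n)) (at t)"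
      by (rule bounded_linear.has_vector_derivative[OF bounded_linear_fst assms[OF n]])
    show "((\<lambda>t. snd (y t n)) has_vector_derivative snd (y' n)) (at t)"
      by (rule bounded_linear.has_vector_derivative[OF bounded_linear_snd assms[OF n]])
  qed
  moreover have "(\<Sum>n\<in>win m. (v n)\<^sup>2 * ((jb n)\<^sup>2 * (2 * (fst (y t n) \<bullet> fst (y' n))) + 2 * (snd (y t n) \<bullet> snd (y' n))))
     = 2 * ipr v m (y t) y'"
    unfolding ipr_inner sum_distrib_left by (intro sum.cong refl) (simp add: algebra_simps)
  ultimately show ?thesis by (simp add: ipr_self)
qed

lemma Nv_cong: "(\<And>n. n \<in> win m \<Longrightarrow> y n = z n) \<Longrightarrow> Nv v m y = Nv v m z"
  unfolding Nv_def by (rule L2_set_cong) auto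

lemma Nv_trn [simp]: "Nv v m (trn m y) = Nv v m y"
  by (rule Nv_cong) (simp add: trn_def)

lemma Nv_win_mono: "m \<le> M \<Longrightarrow> Nv v m y \<le> Nv v M y"
  unfolding Nv_def L2_set_def using win_mono[of m M]
  by (intro real_sqrt_le_mono sum_mono2) auto

lemma Nv_mono_weight: "(\<And>n. 0 \<le> v n) \<Longrightarrow> (\<And>n. v n \<le> w n) \<Longrightarrow> Nv v m y \<le> Nv w m y"
  by (rule Nv_mono) (simp add: abs_mult mult_right_mono)

lemma Nv_trn_le: "(\<And>n. 0 \<le> v n) \<Longrightarrow> Nv v M (trn m y) \<le> Nv v M y"
  by (rule Nv_mono) (simp add: trn_def)

lemma Nv_tendsto:
  assumes "\<And>n. n \<in> win m \<Longrightarrow> ((\<lambda>i. f i n) \<longlongrightarrow> y n) F"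
  shows "((\<lambda>i. Nv v m (f i)) \<longlongrightarrow> Nv v m y) F"
  unfolding Nv_def L2_set_def by (intro tendsto_intros sz_tendsto assms)

lemma hrm_trn: "hrm y \<Longrightarrow> hrm (trn m y)"
  by (simp add: hrm_cjp trn_def)

lemma trn_trn: "m \<le> M \<Longrightarrow> trn m (trn M y) = trn m y"
  using win_mono[of m M] by (auto simp: trn_def fun_eq_iff)

lemma supp_mono: "supp m y \<Longrightarrow> m \<le> M \<Longrightarrow> supp M y"
  using win_mono[of m M] by (auto simp: supp_def)

lemma conv_win_mono:
  assumes "supp m g" "m \<le> M"
  shows "conv M f g n = conv m f (g :: int \<Rightarrow> 'a::semiring_0) n"
  unfolding conv_def
  by (rule sum.mono_neutral_right) (use assms win_mono in \<open>auto simp: supp_def\<close>)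

text \<open>Only the second argument of \<open>conv\<close> is cut by the window, so its support
  alone decides.\<close>

lemma bil_win_mono:
  assumes z: "supp m z" and "m \<le> M"
  shows "bil M y z n = bil m y z n"
proof -
  have s: "supp m (\<lambda>k. fst (z k))" "supp m (\<lambda>k. snd (z k))"
      "supp m (\<lambda>k. dsym k * fst (z k))" "supp m (\<lambda>k. dsym k * snd (z k))"
    using z by (auto simp: supp_def)
  show ?thesis
    by (simp add: bil_def tra_def rst_def s[THEN conv_win_mono, OF assms(2)])
qed

text \<open>Here \<open>\<sigma>\<close> is \<open>s - 1\<close>.\<close>

locale ch2 =
  fixes \<sigma> K c :: real
  assumes \<sigma>: "3/2 < \<sigma>" and K: "1 \<le> K" and c: "0 \<le> c"
    and adm: "\<And>R. 0 \<le> R \<Longrightarrow> admw K K (wt \<sigma> R)"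
    and V': "\<And>j k. wt (\<sigma> - 1) 0 (j + k) \<le> K * wt (\<sigma> - 1) 0 k + K * wt (\<sigma> - 1) 0 j"
    and X1_le: "\<And>m y. X1 m y \<le> c * Nv (wt \<sigma> 0) m y"
begin

text \<open>Membership in H^(\<sigma>+1) x H^\<sigma> with norm at most B, expressed through the
  partial norms.\<close>

definition bdd :: "real \<Rightarrow> (int \<Rightarrow> complex \<times> complex) \<Rightarrow> bool" where
  "bdd B y \<longleftrightarrow> (\<forall>m. Nv (wt \<sigma> 0) m y \<le> B)"

lemma wt1: "1 \<le> wt \<sigma> 0 n"
  using ge_one_powr_ge_zero[OF jb_ge1, of \<sigma> n] \<sigma> by (simp add: wt_0)

lemma bdd_ge0: "bdd B y \<Longrightarrow> 0 \<le> B"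
  unfolding bdd_def using Nv_ge0 order_trans by blast

lemma X1_bdd: "bdd B y \<Longrightarrow> X1 m y \<le> c * B"
  using X1_le[of m y] mult_left_mono[OF _ c, of "Nv (wt \<sigma> 0) m y" B] by (auto simp: bdd_def intro: order_trans)

lemma S1_bdd: "bdd B y \<Longrightarrow> S1 m y \<le> c * B"
  using X1_bdd S1_le_X1 order_trans by blast

lemma bdd_trn: "bdd B y \<Longrightarrow> bdd B (trn m y)"
  unfolding bdd_def using Nv_trn_le[of "wt \<sigma> 0"] order_trans by (metis order_refl wt_ge0)

lemma bdd_supp: "supp m y \<Longrightarrow> Nv (wt \<sigma> 0) m y \<le> B \<Longrightarrow> bdd B y"
  unfolding bdd_def
proof
  fix M assume y: "supp m y" "Nv (wt \<sigma> 0) m y \<le> B"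
  have "Nv (wt \<sigma> 0) M y \<le> Nv (wt \<sigma> 0) (max m M) y" by (rule Nv_win_mono) simp
  also have "\<dots> = Nv (wt \<sigma> 0) m y"
    unfolding Nv_def L2_set_def using y(1) win_mono[of m "max m M"]
    by (intro arg_cong[where f = sqrt] sum.mono_neutral_right) (auto simp: supp_def)
  finally show "Nv (wt \<sigma> 0) M y \<le> B" using y(2) by simp
qed

text \<open>Twice, from differentiating a square, the constant 1 + 14 K of \<open>ipr_bil_le\<close>
  with K = L and both arguments equal, times the embedding constant c.\<close>

definition C0 :: real where "C0 = 2 * (1 + 14 * K) * c"

lemma C0_ge0: "0 \<le> C0" using K c by (simp add: C0_def)

text \<open>The l^1 norm is estimated by the undamped norm and compensated by the cut-off, so the
  growth is linear in the damped energy with a rate free of R. A small tail at time 0 therefore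
  stays small.\<close>

lemma galerkin_energy:
  assumes y: "\<And>t. supp m (y (t::real))" "\<And>t. hrm (y t)" and Bd: "0 < Bd" and R: "0 \<le> R"
    and d: "\<And>t n. n \<in> win m \<Longrightarrow> ((\<lambda>t. y t n) has_vector_derivative
         ((Bd / max Bd (Nv (wt \<sigma> 0) m (y t)))\<^sup>2) *\<^sub>R bil m (y t) (y t) n) (at t)"
  shows "(Nv (wt \<sigma> R) m (y t))\<^sup>2 \<le> (Nv (wt \<sigma> R) m (y 0))\<^sup>2 * exp (C0 * Bd * \<bar>t\<bar>)"
proof (rule gronwall_zero)
  fix \<tau>
  let ?v = "wt \<sigma> R"
  let ?N = "Nv (wt \<sigma> 0) m (y \<tau>)" and ?E = "Nv ?v m (y \<tau>)"
  let ?c = "Bd / max Bd ?N"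
  show "((\<lambda>t. (Nv ?v m (y t))\<^sup>2) has_real_derivative
      2 * ipr ?v m (y \<tau>) (\<lambda>n. (?c\<^sup>2) *\<^sub>R bil m (y \<tau>) (y \<tau>) n)) (at \<tau>)"
    by (rule Nv_sq_deriv[OF d])
  have c01: "0 \<le> ?c" "?c \<le> 1" using Bd by (auto simp: divide_simps)
  \<comment> \<open>The cut-off bounds one factor c times the norm by Bd; the other is at most
    1.\<close>
  have cN: "?c\<^sup>2 * ?N \<le> Bd"
  proof -
    have "?c * ?N \<le> Bd" using Bd by (auto simp: divide_simps mult.commute intro: mult_left_mono)
    then have "?c * (?c * ?N) \<le> 1 * Bd" using c01 Bd by (intro mult_mono) auto
    then show ?thesis by (simp add: power2_eq_square)
  qed
  have "\<bar>ipr ?v m (y \<tau>) (bil m (y \<tau>) (y \<tau>))\<bar>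
      \<le> ?E * ((1 + 7 * K) * S1 m (y \<tau>) * ?E + 7 * K * ?E * S1 m (y \<tau>))"
    by (intro ipr_bil_le adm R y)
  also have "\<dots> = (1 + 14 * K) * ?E\<^sup>2 * S1 m (y \<tau>)" by (simp add: power2_eq_square algebra_simps)
  also have "\<dots> \<le> (1 + 14 * K) * ?E\<^sup>2 * (c * ?N)"
    using K S1_le_X1[of m "y \<tau>"] X1_le[of m "y \<tau>"] by (intro mult_left_mono) auto
  finally have i: "\<bar>ipr ?v m (y \<tau>) (bil m (y \<tau>) (y \<tau>))\<bar> \<le> (1 + 14 * K) * ?E\<^sup>2 * (c * ?N)" .
  have "\<bar>2 * ipr ?v m (y \<tau>) (\<lambda>n. (?c\<^sup>2) *\<^sub>R bil m (y \<tau>) (y \<tau>) n)\<bar>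
     = 2 * ?c\<^sup>2 * \<bar>ipr ?v m (y \<tau>) (bil m (y \<tau>) (y \<tau>))\<bar>"
    unfolding ipr_scaleR by (simp add: abs_mult)
  also have "\<dots> \<le> 2 * ?c\<^sup>2 * ((1 + 14 * K) * ?E\<^sup>2 * (c * ?N))" by (intro mult_left_mono i) auto
  also have "\<dots> = C0 * ?E\<^sup>2 * (?c\<^sup>2 * ?N)" by (simp add: C0_def)
  also have "\<dots> \<le> C0 * ?E\<^sup>2 * Bd" by (intro mult_left_mono cN mult_nonneg_nonneg C0_ge0) auto
  finally show "\<bar>2 * ipr ?v m (y \<tau>) (\<lambda>n. (?c\<^sup>2) *\<^sub>R bil m (y \<tau>) (y \<tau>) n)\<bar> \<le> C0 * Bd * ?E\<^sup>2"
    by (simp add: mult_ac)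
qed

text \<open>Chosen so that \<open>C0 * (2 * R) * Tm R \<le> 1\<close>: squared energies grow at most
  by e < 4, norms at most by 2. Adding 1 keeps the denominator positive even for C0 = 0.\<close>

definition Tm :: "real \<Rightarrow> real" where "Tm R = 1 / (C0 * (2 * R) + 1)"

lemma Tm_pos: "0 < R \<Longrightarrow> 0 < Tm R"
  using C0_ge0 by (simp add: Tm_def add_nonneg_pos)

text \<open>The cut-off is placed at 2 R. On this time interval the norm at most doubles, so the
  cut-off factor equals 1 and the truncated system itself is solved.\<close>

lemma galerkin_bounded:
  assumes R: "0 < R" and x0: "hrm x0" "bdd R x0"
  obtains y where "\<And>t. supp m (y (t::real))" "\<And>t. hrm (y t)" "y 0 = trn m x0"
    "\<And>t n. \<bar>t\<bar> \<le> Tm R \<Longrightarrow> n \<in> win m \<Longrightarrow> ((\<lambda>t. y t n) has_vector_derivative bil m (y t) (y t) n) (at t)"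
    "\<And>t R'. \<bar>t\<bar> \<le> Tm R \<Longrightarrow> 0 \<le> R' \<Longrightarrow> Nv (wt \<sigma> R') m (y t) \<le> 2 * Nv (wt \<sigma> R') m x0"
proof -
  have "0 < 2 * R" using R by simp
  with galerkin_exists[of "wt \<sigma> 0" x0 "2 * R" m, OF wt1 x0(1)]
  obtain y where y: "\<And>t. supp m (y (t::real))" "\<And>t. hrm (y t)" "y 0 = trn m x0"
    and d: "\<And>t n. n \<in> win m \<Longrightarrow> ((\<lambda>t. y t n) has_vector_derivative
       ((2 * R / max (2 * R) (Nv (wt \<sigma> 0) m (y t)))\<^sup>2) *\<^sub>R bil m (y t) (y t) n) (at t)"
    by blast
  have b: "Nv (wt \<sigma> R') m (y t) \<le> 2 * Nv (wt \<sigma> R') m x0" if t: "\<bar>t\<bar> \<le> Tm R" and R': "0 \<le> R'" for t R'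
  proof -
    have "C0 * (2 * R) * \<bar>t\<bar> \<le> C0 * (2 * R) * Tm R"
      using t R C0_ge0 by (intro mult_left_mono) auto
    also have "\<dots> \<le> 1" using R C0_ge0 by (simp add: Tm_def divide_simps add_nonneg_pos)
    finally have "exp (C0 * (2 * R) * \<bar>t\<bar>) \<le> exp 1" by simp
    also have "exp 1 \<le> (4::real)" using exp_le by linarith
    finally have e: "exp (C0 * (2 * R) * \<bar>t\<bar>) \<le> 4" .
    have "(Nv (wt \<sigma> R') m (y t))\<^sup>2 \<le> (Nv (wt \<sigma> R') m (y 0))\<^sup>2 * exp (C0 * (2 * R) * \<bar>t\<bar>)"
      using R by (intro galerkin_energy y R' d) auto
    also have "\<dots> \<le> (Nv (wt \<sigma> R') m x0)\<^sup>2 * 4" using e by (simp add: y mult_left_mono)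
    also have "\<dots> = (2 * Nv (wt \<sigma> R') m x0)\<^sup>2" by (simp add: power2_eq_square)
    finally show ?thesis by (rule power2_le_imp_le) simp
  qed
  show ?thesis
  proof (rule that)
    show "Nv (wt \<sigma> R') m (y t) \<le> 2 * Nv (wt \<sigma> R') m x0" if "\<bar>t\<bar> \<le> Tm R" "0 \<le> R'" for t R'
      using b that by blast
    fix t n assume t: "\<bar>t\<bar> \<le> Tm R" and n: "n \<in> win m"
    have "Nv (wt \<sigma> 0) m (y t) \<le> 2 * R"
      using b[OF t, of 0] x0(2) by (auto simp: bdd_def intro: order_trans)
    then have "2 * R / max (2 * R) (Nv (wt \<sigma> 0) m (y t)) = 1" using R by (simp add: max_def)
    then show "((\<lambda>t. y t n) has_vector_derivative bil m (y t) (y t) n) (at t)"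
      using d[OF n, of t] by (simp only: power_one scaleR_one)
  qed (fact y)+
qed

text \<open>28 = 2 (8 + 6): 8 from \<open>ipr_bil_le\<close> with \<open>admw_1\<close>, 6 from
  \<open>Nv_bil_le\<close>, and 2 from differentiating the square. The extra 1 absorbs the
  consistency errors.\<close>

definition C1 :: "real \<Rightarrow> real" where "C1 B = 28 * (c * B) + 1"

lemma C1_ge0: "0 \<le> B \<Longrightarrow> 0 \<le> C1 B" using c by (simp add: C1_def)

text \<open>Weak stability is stated for two approximate solutions with errors up to \<epsilon>, so
  that it applies alike to Galerkin solutions of different levels and to truncated exact solutions.
  Reality is asked of z because z acts as the velocity on the difference.\<close>

lemma comparison:
  fixes y z gy gz :: "real \<Rightarrow> int \<Rightarrow> complex \<times> complex"
  assumes y: "\<And>\<tau>. \<bar>\<tau>\<bar> \<le> \<bar>t\<bar> \<Longrightarrow> supp m (y \<tau>)" "\<And>\<tau>. \<bar>\<tau>\<bar> \<le> \<bar>t\<bar> \<Longrightarrow> bdd B (y \<tau>)"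
    and z: "\<And>\<tau>. \<bar>\<tau>\<bar> \<le> \<bar>t\<bar> \<Longrightarrow> supp m (z \<tau>)" "\<And>\<tau>. \<bar>\<tau>\<bar> \<le> \<bar>t\<bar> \<Longrightarrow> bdd B (z \<tau>)"
    and h: "\<And>\<tau>. \<bar>\<tau>\<bar> \<le> \<bar>t\<bar> \<Longrightarrow> hrm (z \<tau>)"
    and dy: "\<And>\<tau> n. \<bar>\<tau>\<bar> \<le> \<bar>t\<bar> \<Longrightarrow> n \<in> win m \<Longrightarrow> ((\<lambda>t. y t n) has_vector_derivative gy \<tau> n) (at \<tau>)"
    and dz: "\<And>\<tau> n. \<bar>\<tau>\<bar> \<le> \<bar>t\<bar> \<Longrightarrow> n \<in> win m \<Longrightarrow> ((\<lambda>t. z t n) has_vector_derivative gz \<tau> n) (at \<tau>)"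
    and ey: "\<And>\<tau>. \<bar>\<tau>\<bar> \<le> \<bar>t\<bar> \<Longrightarrow> Nv (\<lambda>_. 1) m (\<lambda>n. gy \<tau> n - bil m (y \<tau>) (y \<tau>) n) \<le> \<epsilon>"
    and ez: "\<And>\<tau>. \<bar>\<tau>\<bar> \<le> \<bar>t\<bar> \<Longrightarrow> Nv (\<lambda>_. 1) m (\<lambda>n. gz \<tau> n - bil m (z \<tau>) (z \<tau>) n) \<le> \<epsilon>"
    and D: "Nv (\<lambda>_. 1) m (\<lambda>n. z 0 n - y 0 n) \<le> D"
  shows "Nv (\<lambda>_. 1) m (\<lambda>n. z t n - y t n) \<le> (D + 2 * \<epsilon>) * exp (C1 B * \<bar>t\<bar>)"
proof -
  let ?N = "Nv (\<lambda>_. 1) m"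
  define \<delta> where "\<delta> \<tau> n = z \<tau> n - y \<tau> n" for \<tau> n
  have \<epsilon>0: "0 \<le> \<epsilon>" by (rule order_trans[OF Nv_ge0 ey[of 0]]) simp
  have D0: "0 \<le> D" using D Nv_ge0 order_trans by blast
  have B0: "0 \<le> B" using y(2)[of 0] bdd_ge0 by auto
  \<comment> \<open>Adding the constant (2 \<epsilon>)^2 to the energy makes the differential
    inequality homogeneous.\<close>
  have "(?N (\<delta> t))\<^sup>2 + (2 * \<epsilon>)\<^sup>2 \<le> ((?N (\<delta> 0))\<^sup>2 + (2 * \<epsilon>)\<^sup>2) * exp (C1 B * \<bar>t\<bar>)"
  proof (rule gronwall_zero[where f' = "\<lambda>\<tau>. 2 * ipr (\<lambda>_. 1) m (\<delta> \<tau>) (\<lambda>n. gz \<tau> n - gy \<tau> n)"])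
    fix \<tau> assume \<tau>: "\<bar>\<tau>\<bar> \<le> \<bar>t\<bar>"
    have "((\<lambda>t. (?N (\<delta> t))\<^sup>2) has_real_derivative 2 * ipr (\<lambda>_. 1) m (\<delta> \<tau>) (\<lambda>n. gz \<tau> n - gy \<tau> n)) (at \<tau>)"
      by (rule Nv_sq_deriv) (auto simp: \<delta>_def intro!: has_vector_derivative_diff dy dz \<tau>)
    from DERIV_add[OF this DERIV_const[of "(2 * \<epsilon>)\<^sup>2"]]
    show "((\<lambda>t. (?N (\<delta> t))\<^sup>2 + (2 * \<epsilon>)\<^sup>2) has_real_derivative 2 * ipr (\<lambda>_. 1) m (\<delta> \<tau>) (\<lambda>n. gz \<tau> n - gy \<tau> n)) (at \<tau>)"
      by simp
    define ez' where "ez' n = gz \<tau> n - bil m (z \<tau>) (z \<tau>) n" for n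
    define ey' where "ey' n = gy \<tau> n - bil m (y \<tau>) (y \<tau>) n" for n
    have s\<delta>: "supp m (\<delta> \<tau>)" using y(1)[OF \<tau>] z(1)[OF \<tau>] by (simp add: supp_def \<delta>_def)
    have i: "ipr (\<lambda>_. 1) m (\<delta> \<tau>) (\<lambda>n. gz \<tau> n - gy \<tau> n) = ipr (\<lambda>_. 1) m (\<delta> \<tau>) ez' - ipr (\<lambda>_. 1) m (\<delta> \<tau>) ey'
       + ipr (\<lambda>_. 1) m (\<delta> \<tau>) (bil m (z \<tau>) (\<delta> \<tau>)) + ipr (\<lambda>_. 1) m (\<delta> \<tau>) (bil m (\<delta> \<tau>) (y \<tau>))"
      unfolding ipr_add[symmetric] ipr_diff[symmetric]
    proof (rule ipr_cong)
      fix n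
      have "bil m (z \<tau>) (z \<tau>) n - bil m (y \<tau>) (y \<tau>) n = bil m (z \<tau>) (\<delta> \<tau>) n + bil m (\<delta> \<tau>) (y \<tau>) n"
        unfolding bil_diff_self \<delta>_def ..
      then show "gz \<tau> n - gy \<tau> n = ez' n - ey' n + bil m (z \<tau>) (\<delta> \<tau>) n + bil m (\<delta> \<tau>) (y \<tau>) n"
        by (simp add: ez'_def ey'_def algebra_simps)
    qed
    have 1: "\<bar>ipr (\<lambda>_. 1) m (\<delta> \<tau>) ez'\<bar> \<le> ?N (\<delta> \<tau>) * \<epsilon>"
      using ez[OF \<tau>] by (intro order_trans[OF ipr_le] mult_left_mono) (auto simp: ez'_def[abs_def])
    have 2: "\<bar>ipr (\<lambda>_. 1) m (\<delta> \<tau>) ey'\<bar> \<le> ?N (\<delta> \<tau>) * \<epsilon>"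
      using ey[OF \<tau>] by (intro order_trans[OF ipr_le] mult_left_mono) (auto simp: ey'_def[abs_def])
    have "\<bar>ipr (\<lambda>_. 1) m (\<delta> \<tau>) (bil m (z \<tau>) (\<delta> \<tau>))\<bar> \<le> ?N (\<delta> \<tau>) * (8 * S1 m (z \<tau>) * ?N (\<delta> \<tau>))"
      using ipr_bil_le[OF admw_1 h[OF \<tau>] z(1)[OF \<tau>] s\<delta>] by simp
    also have "\<dots> \<le> ?N (\<delta> \<tau>) * (8 * (c * B) * ?N (\<delta> \<tau>))"
      by (intro mult_left_mono mult_right_mono S1_bdd z \<tau>) auto
    finally have 3: "\<bar>ipr (\<lambda>_. 1) m (\<delta> \<tau>) (bil m (z \<tau>) (\<delta> \<tau>))\<bar> \<le> 8 * (c * B) * (?N (\<delta> \<tau>))\<^sup>2"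
      by (simp add: power2_eq_square mult_ac)
    have "?N (bil m (\<delta> \<tau>) (y \<tau>)) \<le> 6 * (0 * S1 m (\<delta> \<tau>) * Nv (\<lambda>n. 1 * jb n) m (y \<tau>) + 1 * ?N (\<delta> \<tau>) * X1 m (y \<tau>))"
      by (rule Nv_bil_le) (auto simp: s\<delta> y(1)[OF \<tau>])
    also have "\<dots> \<le> 6 * (?N (\<delta> \<tau>) * (c * B))"
      using X1_bdd[OF y(2)[OF \<tau>], of m] by (simp add: mult_left_mono)
    finally have "?N (bil m (\<delta> \<tau>) (y \<tau>)) \<le> 6 * (?N (\<delta> \<tau>) * (c * B))" .
    then have "\<bar>ipr (\<lambda>_. 1) m (\<delta> \<tau>) (bil m (\<delta> \<tau>) (y \<tau>))\<bar> \<le> ?N (\<delta> \<tau>) * (6 * (?N (\<delta> \<tau>) * (c * B)))"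
      by (intro order_trans[OF ipr_le] mult_left_mono) auto
    then have 4: "\<bar>ipr (\<lambda>_. 1) m (\<delta> \<tau>) (bil m (\<delta> \<tau>) (y \<tau>))\<bar> \<le> 6 * (c * B) * (?N (\<delta> \<tau>))\<^sup>2"
      by (simp add: power2_eq_square mult_ac)
    have "2 * ?N (\<delta> \<tau>) * (2 * \<epsilon>) \<le> (?N (\<delta> \<tau>))\<^sup>2 + (2 * \<epsilon>)\<^sup>2" by (rule sum_squares_bound)
    then have "\<bar>2 * ipr (\<lambda>_. 1) m (\<delta> \<tau>) (\<lambda>n. gz \<tau> n - gy \<tau> n)\<bar> \<le> 28 * (c * B) * (?N (\<delta> \<tau>))\<^sup>2 + ((?N (\<delta> \<tau>))\<^sup>2 + (2 * \<epsilon>)\<^sup>2)"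
      using 1 2 3 4 unfolding i by argo
    also have "\<dots> \<le> 28 * (c * B) * ((?N (\<delta> \<tau>))\<^sup>2 + (2 * \<epsilon>)\<^sup>2) + ((?N (\<delta> \<tau>))\<^sup>2 + (2 * \<epsilon>)\<^sup>2)"
      using c B0 by (intro add_right_mono mult_left_mono) auto
    finally show "\<bar>2 * ipr (\<lambda>_. 1) m (\<delta> \<tau>) (\<lambda>n. gz \<tau> n - gy \<tau> n)\<bar> \<le> C1 B * ((?N (\<delta> \<tau>))\<^sup>2 + (2 * \<epsilon>)\<^sup>2)"
      by (simp add: C1_def algebra_simps)
  qed
  then have "(?N (\<delta> t))\<^sup>2 \<le> ((?N (\<delta> 0))\<^sup>2 + (2 * \<epsilon>)\<^sup>2) * exp (C1 B * \<bar>t\<bar>)"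
    by (smt (verit) zero_le_power2)
  \<comment> \<open>Both factors are enlarged to squares, using that the exponential is at least 1,
    so that the root can be taken.\<close>
  also have "\<dots> \<le> (D + 2 * \<epsilon>)\<^sup>2 * (exp (C1 B * \<bar>t\<bar>))\<^sup>2"
  proof (rule mult_mono)
    have "(?N (\<delta> 0))\<^sup>2 \<le> D\<^sup>2" using D by (intro power_mono) (auto simp: \<delta>_def[abs_def])
    then show "(?N (\<delta> 0))\<^sup>2 + (2 * \<epsilon>)\<^sup>2 \<le> (D + 2 * \<epsilon>)\<^sup>2"
      using mult_nonneg_nonneg[OF D0 \<epsilon>0] unfolding power2_sum by linarith
    have "1 \<le> exp (C1 B * \<bar>t\<bar>)" using C1_ge0[OF B0] by simp
    then show "exp (C1 B * \<bar>t\<bar>) \<le> (exp (C1 B * \<bar>t\<bar>))\<^sup>2" by (simp add: power2_eq_square)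
  qed auto
  also have "\<dots> = ((D + 2 * \<epsilon>) * exp (C1 B * \<bar>t\<bar>))\<^sup>2" by (simp add: power_mult_distrib)
  finally show ?thesis using D0 \<epsilon>0 unfolding \<delta>_def by (intro power2_le_imp_le[OF _ mult_nonneg_nonneg]) auto
qed

end

subsection \<open>Passing to the limit\<close>

text \<open>The limit exists for sequences satisfying \<open>bdd\<close>; otherwise \<open>lim\<close> is arbitrary.\<close>

definition Bq :: "(int \<Rightarrow> complex \<times> complex) \<Rightarrow> int \<Rightarrow> complex \<times> complex" where
  "Bq y n = lim (\<lambda>m. bil m (trn m y) (trn m y) n)"

lemma jb_mono: "\<bar>n\<bar> \<le> \<bar>k\<bar> \<Longrightarrow> jb n \<le> jb k"
proof -
  assume "\<bar>n\<bar> \<le> \<bar>k\<bar>"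
  then have "\<bar>real_of_int n\<bar> \<le> \<bar>real_of_int k\<bar>" by (metis of_int_abs of_int_le_iff)
  then have "\<bar>2 * pi * real_of_int n\<bar> \<le> \<bar>2 * pi * real_of_int k\<bar>" by (simp add: abs_mult)
  then show ?thesis unfolding jb_def by (simp add: abs_le_square_iff)
qed

lemma jb_powr_tendsto_0: "r < 0 \<Longrightarrow> (\<lambda>m. jb (int m) powr r) \<longlonglongrightarrow> 0"
proof -
  assume r: "r < 0"
  have "filterlim (\<lambda>m. jb (int m)) at_top sequentially"
  proof (rule filterlim_at_top_mono[OF filterlim_real_sequentially])
    have "real m \<le> jb (int m)" for m
    proof -
      have "1 * real m \<le> 2 * pi * real m" using pi_gt3 by (intro mult_right_mono) auto
      also have "\<dots> \<le> jb (int m)" unfolding jb_def by (intro real_le_rsqrt) simp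
      finally show ?thesis by simp
    qed
    then show "\<forall>\<^sub>F m in sequentially. real m \<le> jb (int m)" by simp
  qed
  then show ?thesis using tendsto_neg_powr[OF r] by blast
qed

text \<open>At a fixed output frequency n the derivative can be taken off z, since
  \<open>jb k \<le> 2 * jb n * jb (n - k)\<close>. This is needed to pass to the limit in the
  equation, where z is small in the weak norm only.\<close>

lemma sz_bil_le_left:
  assumes y: "supp m y" and z: "supp m z"
  shows "sz n (bil m y z n) \<le> 12 * jb n * (X1 m y * Nv (\<lambda>_. 1) m z)"
proof -
  let ?N = "Nv (\<lambda>_. 1) m z"
  have "conv m (\<lambda>j. sz j (y j)) (\<lambda>k. jb k * sz k (z k)) n
     \<le> (\<Sum>k\<in>win m. (2 * jb n * (jb (n - k) * sz (n - k) (y (n - k)))) * ?N)"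
    unfolding conv_def
  proof (rule sum_mono)
    fix k assume k: "k \<in> win m"
    have "jb k \<le> 2 * jb n * jb (n - k)" using jb_add_le_mult[of n "k - n"] jb_minus[of "n - k"] by simp
    moreover have "sz k (z k) \<le> ?N" using le_Nv[OF k, of "\<lambda>_. 1" z] by simp
    ultimately have "jb k * sz k (z k) \<le> 2 * jb n * jb (n - k) * ?N" by (intro mult_mono) auto
    then have "sz (n - k) (y (n - k)) * (jb k * sz k (z k)) \<le> sz (n - k) (y (n - k)) * (2 * jb n * jb (n - k) * ?N)"
      by (rule mult_left_mono) simp
    then show "sz (n - k) (y (n - k)) * (jb k * sz k (z k)) \<le> (2 * jb n * (jb (n - k) * sz (n - k) (y (n - k)))) * ?N"
      by (simp add: mult_ac)
  qed
  also have "\<dots> = 2 * jb n * (\<Sum>k\<in>win m. jb (n - k) * sz (n - k) (y (n - k))) * ?N"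
    by (simp add: sum_distrib_left sum_distrib_right)
  also have "(\<Sum>k\<in>win m. jb (n - k) * sz (n - k) (y (n - k))) \<le> X1 m y"
  proof -
    have "(\<Sum>k\<in>win m. jb (n - k) * sz (n - k) (y (n - k))) = (\<Sum>j\<in>(\<lambda>k. n - k) ` win m. jb j * sz j (y j))"
      by (subst sum.reindex) (auto simp: inj_on_def)
    also have "\<dots> = (\<Sum>j\<in>(\<lambda>k. n - k) ` win m \<inter> win m. jb j * sz j (y j))"
      using y by (intro sum.mono_neutral_right) (auto simp: supp_def)
    also have "\<dots> \<le> X1 m y" unfolding X1_def by (rule sum_mono2) auto
    finally show ?thesis .
  qed
  finally have "conv m (\<lambda>j. sz j (y j)) (\<lambda>k. jb k * sz k (z k)) n \<le> 2 * jb n * X1 m y * ?N"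
    by (simp add: mult_left_mono mult_right_mono)
  then show ?thesis using sz_bil[of n m y z] by simp
qed

lemma sz_bil_le_right:
  assumes y: "supp m y"
  shows "sz n (bil m y z n) \<le> 6 * (Nv (\<lambda>_. 1) m y * X1 m z)"
proof -
  have "sz j (y j) \<le> Nv (\<lambda>_. 1) m y" for j
    using le_Nv[of j m "\<lambda>_. 1" y] y by (cases "j \<in> win m") (auto simp: supp_def)
  then have "conv m (\<lambda>j. sz j (y j)) (\<lambda>k. jb k * sz k (z k)) n \<le> Nv (\<lambda>_. 1) m y * X1 m z"
    unfolding conv_def X1_def sum_distrib_left by (intro sum_mono mult_right_mono) auto
  then show ?thesis using sz_bil[of n m y z] by simp
qed

lemma sz_le_Nv1: "n \<in> win m \<Longrightarrow> sz n (y n) \<le> Nv (\<lambda>_. 1) m y"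
  using le_Nv[of n m "\<lambda>_. 1" y] by simp

context ch2
begin

text \<open>The consistency error of truncation at m. The power is the loss when a tail bounded with
  weight \<open>wt \<sigma> 0\<close> is measured with weight \<open>jb\<close>; 12 collects the 6
  of \<open>Nv_bil_le\<close> from two terms.\<close>

definition er :: "real \<Rightarrow> nat \<Rightarrow> real" where
  "er B m = 12 * (c * B) * (jb (int m) powr (1 - \<sigma>) * B)"

lemma er_tendsto: "er B \<longlonglongrightarrow> 0"
proof -
  have "(\<lambda>m. 12 * (c * B) * (jb (int m) powr (1 - \<sigma>) * B)) \<longlonglongrightarrow> 12 * (c * B) * (0 * B)"
    using \<sigma> by (intro tendsto_intros jb_powr_tendsto_0) auto
  then show ?thesis by (simp add: er_def[abs_def])
qed

text \<open>The two truncations differ by frequencies above m. One derivative on them is affordable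
  in the weak norm because \<sigma> > 1, and this yields a negative power of
  \<open>jb (int m)\<close>.\<close>

lemma bil_error:
  assumes y: "bdd B y" and mM: "m \<le> M"
  shows "Nv (\<lambda>_. 1) m (\<lambda>n. bil M (trn M y) (trn M y) n - bil m (trn m y) (trn m y) n) \<le> er B m"
proof -
  define w where "w = trn M y"
  define u where "u = trn m y"
  define \<delta> where "\<delta> n = w n - u n" for n
  let ?j = "jb (int m) powr (1 - \<sigma>)"
  have B: "0 \<le> B" using y by (rule bdd_ge0)
  have w: "bdd B w" "supp M w" and u: "bdd B u" "supp M u" "supp m u"
    unfolding w_def u_def using y by (auto intro: bdd_trn supp_trn supp_mono[OF supp_trn mM])
  have \<delta>: "supp M \<delta>" using w u by (auto simp: \<delta>_def supp_def)
  have N\<delta>: "Nv jb M \<delta> \<le> ?j * B"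
  proof -
    have "Nv jb M \<delta> \<le> L2_set (\<lambda>n. ?j * (wt \<sigma> 0 n * sz n (w n))) (win M)"
      unfolding Nv_def
    proof (rule L2_set_mono')
      fix n assume n: "n \<in> win M"
      show "\<bar>jb n * sz n (\<delta> n)\<bar> \<le> ?j * (wt \<sigma> 0 n * sz n (w n))"
      proof (cases "n \<in> win m")
        case True
        then have "\<delta> n = 0" using n by (simp add: \<delta>_def w_def u_def trn_def)
        then show ?thesis by simp
      next
        case False
        then have "\<delta> n = w n" by (simp add: \<delta>_def u_def trn_def)
        moreover have "jb n \<le> ?j * wt \<sigma> 0 n"
        proof -
          have "jb (int m) \<le> jb n" using False by (intro jb_mono) (auto simp: mem_win)
          then have "jb n powr (1 - \<sigma>) \<le> ?j" using \<sigma> by (intro powr_mono2') auto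
          then have "jb n powr (1 - \<sigma>) * wt \<sigma> 0 n \<le> ?j * wt \<sigma> 0 n" by (intro mult_right_mono) auto
          then show ?thesis by (simp add: wt_0 powr_add[symmetric])
        qed
        then have "jb n * sz n (w n) \<le> ?j * wt \<sigma> 0 n * sz n (w n)" by (intro mult_right_mono) auto
        ultimately show ?thesis by (simp add: mult.assoc)
      qed
    qed
    also have "\<dots> = ?j * Nv (wt \<sigma> 0) M w" by (simp add: L2_set_cmult Nv_def)
    also have "\<dots> \<le> ?j * B" using w(1) by (intro mult_left_mono) (auto simp: bdd_def)
    finally show ?thesis .
  qed
  have "(\<lambda>n. bil M w w n - bil m u u n) = (\<lambda>n. bil M w \<delta> n + bil M \<delta> u n)"
    unfolding bil_win_mono[OF u(3) mM, symmetric] bil_diff_self \<delta>_def ..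
  moreover have "Nv (\<lambda>_. 1) m (\<lambda>n. bil M w \<delta> n + bil M \<delta> u n) \<le> Nv (\<lambda>_. 1) m (bil M w \<delta>) + Nv (\<lambda>_. 1) m (bil M \<delta> u)"
    by (rule Nv_triangle) simp
  moreover have "Nv (\<lambda>_. 1) m (bil M w \<delta>) \<le> 6 * ((c * B) * (?j * B))"
  proof -
    \<comment> \<open>For the weight 1 either of the constants in the product inequality may be
      taken as 0, so the l^1 norm can be placed at will: on w here, on u in the other term.\<close>
    have "Nv (\<lambda>_. 1) m (bil M w \<delta>) \<le> 6 * (1 * S1 M w * Nv (\<lambda>n. 1 * jb n) M \<delta> + 0 * Nv (\<lambda>_. 1) M w * X1 M \<delta>)"
      by (rule Nv_bil_le) (auto simp: w \<delta>)
    also have "\<dots> = 6 * (S1 M w * Nv jb M \<delta>)" by simp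
    also have "\<dots> \<le> 6 * ((c * B) * (?j * B))"
      using c B by (intro mult_left_mono mult_mono S1_bdd w N\<delta>) auto
    finally show ?thesis .
  qed
  moreover have "Nv (\<lambda>_. 1) m (bil M \<delta> u) \<le> 6 * ((?j * B) * (c * B))"
  proof -
    have "Nv (\<lambda>_. 1) m (bil M \<delta> u) \<le> 6 * (0 * S1 M \<delta> * Nv (\<lambda>n. 1 * jb n) M u + 1 * Nv (\<lambda>_. 1) M \<delta> * X1 M u)"
      by (rule Nv_bil_le) (auto simp: u \<delta>)
    also have "\<dots> = 6 * (Nv (\<lambda>_. 1) M \<delta> * X1 M u)" by simp
    also have "\<dots> \<le> 6 * ((?j * B) * (c * B))"
      using c B by (intro mult_left_mono mult_mono X1_bdd u order_trans[OF Nv_mono_weight N\<delta>] jb_ge1) auto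
    finally show ?thesis .
  qed
  ultimately show ?thesis unfolding w_def[symmetric] u_def[symmetric] by (simp add: er_def mult_ac)
qed

lemma Bq_lim:
  assumes y: "bdd B y"
  shows "(\<lambda>m. bil m (trn m y) (trn m y) n) \<longlonglongrightarrow> Bq y n"
proof -
  let ?b = "\<lambda>m. bil m (trn m y) (trn m y) n"
  have "Cauchy ?b"
  proof (rule CauchyI', unfold dist_norm)
    fix e :: real assume "0 < e"
    then have "\<forall>\<^sub>F m in sequentially. er B m < e" by (rule order_tendstoD[OF er_tendsto])
    then obtain m0 where m0: "\<And>m. m \<ge> m0 \<Longrightarrow> er B m < e" unfolding eventually_sequentially by blast
    show "\<exists>m0. \<forall>m\<ge>m0. \<forall>M>m. norm (?b m - ?b M) < e"
    \<comment> \<open>The second entry of the maximum guarantees that n lies in the window.\<close>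
    proof (intro exI[of _ "max m0 (nat \<bar>n\<bar>)"] allI impI)
      fix m M assume m: "max m0 (nat \<bar>n\<bar>) \<le> m" and M: "m < M"
      have "norm (?b m - ?b M) = norm (?b M - ?b m)" by (rule norm_minus_commute)
      also have "\<dots> \<le> sz n (?b M - ?b m)" by (rule norm_le_sz)
      also have "\<dots> \<le> Nv (\<lambda>_. 1) m (\<lambda>n. bil M (trn M y) (trn M y) n - bil m (trn m y) (trn m y) n)"
        using m by (intro sz_le_Nv1) (auto simp: mem_win)
      also have "\<dots> \<le> er B m" using M by (intro bil_error y) auto
      finally show "norm (?b m - ?b M) < e" using m0[of m] m by simp
    qed
  qed
  then show ?thesis unfolding Bq_def by (simp add: Cauchy_convergent_iff convergent_LIMSEQ_iff)
qed

lemma Bq_error: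
  assumes y: "bdd B y"
  shows "Nv (\<lambda>_. 1) m (\<lambda>n. Bq y n - bil m (trn m y) (trn m y) n) \<le> er B m"
proof (rule tendsto_upperbound)
  show "((\<lambda>M. Nv (\<lambda>_. 1) m (\<lambda>n. bil M (trn M y) (trn M y) n - bil m (trn m y) (trn m y) n))
     \<longlongrightarrow> Nv (\<lambda>_. 1) m (\<lambda>n. Bq y n - bil m (trn m y) (trn m y) n)) sequentially"
    by (intro Nv_tendsto tendsto_intros Bq_lim[OF y])
  show "\<forall>\<^sub>F M in sequentially. Nv (\<lambda>_. 1) m (\<lambda>n. bil M (trn M y) (trn M y) n - bil m (trn m y) (trn m y) n) \<le> er B m"
    using eventually_ge_at_top[of m] by eventually_elim (rule bil_error[OF y])
qed simp

text \<open>A deliberately weak notion: coefficientwise derivatives and bounds on compact time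
  intervals, without continuity in the strong norm. Limits of Galerkin solutions and coefficients of
  function-space solutions both satisfy it, so uniqueness in this class serves both.\<close>

definition seqsol :: "real \<Rightarrow> (real \<Rightarrow> int \<Rightarrow> complex \<times> complex) \<Rightarrow> bool" where
  "seqsol T y \<longleftrightarrow> (\<forall>t. \<bar>t\<bar> < T \<longrightarrow> hrm (y t)) \<and> (\<forall>t0<T. \<exists>B. \<forall>t. \<bar>t\<bar> \<le> t0 \<longrightarrow> bdd B (y t)) \<and>
     (\<forall>t n. \<bar>t\<bar> < T \<longrightarrow> ((\<lambda>t. y t n) has_vector_derivative Bq (y t) n) (at t))"

lemma bdd_mono: "bdd B y \<Longrightarrow> B \<le> B' \<Longrightarrow> bdd B' y"
  unfolding bdd_def using order_trans by blast

text \<open>The truncation of an exact solution at k solves the system of level k up to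
  \<open>er B k\<close>; \<open>comparison\<close> applies, and the error vanishes as k
  grows.\<close>

lemma seqsol_stable:
  assumes y: "seqsol T y" "\<And>\<tau>. \<bar>\<tau>\<bar> \<le> \<bar>t\<bar> \<Longrightarrow> bdd B (y \<tau>)"
    and z: "seqsol T z" "\<And>\<tau>. \<bar>\<tau>\<bar> \<le> \<bar>t\<bar> \<Longrightarrow> bdd B (z \<tau>)"
    and t: "\<bar>t\<bar> < T" and D: "\<And>m. Nv (\<lambda>_. 1) m (\<lambda>n. z 0 n - y 0 n) \<le> D"
  shows "Nv (\<lambda>_. 1) m (\<lambda>n. z t n - y t n) \<le> D * exp (C1 B * \<bar>t\<bar>)"
proof -
  have main: "Nv (\<lambda>_. 1) k (\<lambda>n. z t n - y t n) \<le> (D + 2 * er B k) * exp (C1 B * \<bar>t\<bar>)" for k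
  proof -
    have "Nv (\<lambda>_. 1) k (\<lambda>n. trn k (z t) n - trn k (y t) n) \<le> (D + 2 * er B k) * exp (C1 B * \<bar>t\<bar>)"
    proof (rule comparison[where gy = "\<lambda>t. Bq (y t)" and gz = "\<lambda>t. Bq (z t)"])
      fix \<tau> assume \<tau>: "\<bar>\<tau>\<bar> \<le> \<bar>t\<bar>"
      then have \<tau>T: "\<bar>\<tau>\<bar> < T" using t by simp
      show "supp k (trn k (y \<tau>))" "supp k (trn k (z \<tau>))" by (rule supp_trn)+
      show "bdd B (trn k (y \<tau>))" "bdd B (trn k (z \<tau>))" by (intro bdd_trn y z \<tau>)+
      show "hrm (trn k (z \<tau>))" using z(1) \<tau>T by (intro hrm_trn) (simp add: seqsol_def)
      show "Nv (\<lambda>_. 1) k (\<lambda>n. Bq (y \<tau>) n - bil k (trn k (y \<tau>)) (trn k (y \<tau>)) n) \<le> er B k"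
        by (rule Bq_error[OF y(2)[OF \<tau>]])
      show "Nv (\<lambda>_. 1) k (\<lambda>n. Bq (z \<tau>) n - bil k (trn k (z \<tau>)) (trn k (z \<tau>)) n) \<le> er B k"
        by (rule Bq_error[OF z(2)[OF \<tau>]])
      fix n assume n: "n \<in> win k"
      show "((\<lambda>t. trn k (y t) n) has_vector_derivative Bq (y \<tau>) n) (at \<tau>)"
        using y(1) \<tau>T n by (simp add: seqsol_def trn_def)
      show "((\<lambda>t. trn k (z t) n) has_vector_derivative Bq (z \<tau>) n) (at \<tau>)"
        using z(1) \<tau>T n by (simp add: seqsol_def trn_def)
    next
      have "Nv (\<lambda>_. 1) k (\<lambda>n. trn k (z 0) n - trn k (y 0) n) = Nv (\<lambda>_. 1) k (\<lambda>n. z 0 n - y 0 n)"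
        by (rule Nv_cong) (simp add: trn_def)
      then show "Nv (\<lambda>_. 1) k (\<lambda>n. trn k (z 0) n - trn k (y 0) n) \<le> D" using D by simp
    qed
    moreover have "Nv (\<lambda>_. 1) k (\<lambda>n. trn k (z t) n - trn k (y t) n) = Nv (\<lambda>_. 1) k (\<lambda>n. z t n - y t n)"
      by (rule Nv_cong) (simp add: trn_def)
    ultimately show ?thesis by simp
  qed
  show ?thesis
  proof (rule tendsto_lowerbound)
    show "(\<lambda>k. (D + 2 * er B k) * exp (C1 B * \<bar>t\<bar>)) \<longlonglongrightarrow> D * exp (C1 B * \<bar>t\<bar>)"
    proof -
      have "(\<lambda>k. (D + 2 * er B k) * exp (C1 B * \<bar>t\<bar>)) \<longlonglongrightarrow> (D + 2 * 0) * exp (C1 B * \<bar>t\<bar>)"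
        by (intro tendsto_intros er_tendsto)
      then show ?thesis by simp
    qed
    show "\<forall>\<^sub>F k in sequentially. Nv (\<lambda>_. 1) m (\<lambda>n. z t n - y t n) \<le> (D + 2 * er B k) * exp (C1 B * \<bar>t\<bar>)"
      using eventually_ge_at_top[of m]
    proof eventually_elim
      case (elim k)
      show ?case using Nv_win_mono[OF elim] main order_trans by blast
    qed
  qed simp
qed

text \<open>Galerkin solutions are Cauchy in the weak norm, and the bounds in all damped norms pass
  to the limit because each involves finitely many coefficients. These bounds carry the tail of the
  data to all later and earlier times in the interval.\<close>

lemma flow_exists:
  assumes R: "0 < R" and x0: "hrm x0" "bdd R x0"
  obtains y where "seqsol (Tm R) y" "y 0 = x0"
    "\<And>t R' C m. \<bar>t\<bar> < Tm R \<Longrightarrow> 0 \<le> R' \<Longrightarrow> (\<And>m. Nv (wt \<sigma> R') m x0 \<le> C) \<Longrightarrow> Nv (wt \<sigma> R') m (y t) \<le> 2 * C"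
proof -
  define T where "T = Tm R"
  have T: "0 < T" using Tm_pos[OF R] by (simp add: T_def)
  have "\<exists>y. (\<forall>t. supp m (y (t::real))) \<and> (\<forall>t. hrm (y t)) \<and> y 0 = trn m x0 \<and>
    (\<forall>t n. \<bar>t\<bar> \<le> T \<longrightarrow> n \<in> win m \<longrightarrow> ((\<lambda>t. y t n) has_vector_derivative bil m (y t) (y t) n) (at t)) \<and>
    (\<forall>t R'. \<bar>t\<bar> \<le> T \<longrightarrow> 0 \<le> R' \<longrightarrow> Nv (wt \<sigma> R') m (y t) \<le> 2 * Nv (wt \<sigma> R') m x0)" for m
  proof -
    obtain y where y: "\<And>t. supp m (y (t::real))" "\<And>t. hrm (y t)" "y 0 = trn m x0"
      "\<And>t n. \<bar>t\<bar> \<le> Tm R \<Longrightarrow> n \<in> win m \<Longrightarrow> ((\<lambda>t. y t n) has_vector_derivative bil m (y t) (y t) n) (at t)"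
      "\<And>t R'. \<bar>t\<bar> \<le> Tm R \<Longrightarrow> 0 \<le> R' \<Longrightarrow> Nv (wt \<sigma> R') m (y t) \<le> 2 * Nv (wt \<sigma> R') m x0"
      using galerkin_bounded[OF R x0, of m] by blast
    show ?thesis unfolding T_def by (intro exI[of _ y] conjI allI impI y)
  qed
  then obtain g where g: "\<And>m t. supp m (g m (t::real))" "\<And>m t. hrm (g m t)" "\<And>m. g m 0 = trn m x0"
    and gd: "\<And>m t n. \<bar>t\<bar> \<le> T \<Longrightarrow> n \<in> win m \<Longrightarrow> ((\<lambda>t. g m t n) has_vector_derivative bil m (g m t) (g m t) n) (at t)"
    and gb: "\<And>m t R'. \<bar>t\<bar> \<le> T \<Longrightarrow> 0 \<le> R' \<Longrightarrow> Nv (wt \<sigma> R') m (g m t) \<le> 2 * Nv (wt \<sigma> R') m x0"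
    by metis
  define B where "B = 2 * R"
  have gB: "bdd B (g m t)" if "\<bar>t\<bar> \<le> T" for m t
    using gb[OF that, of 0 m] x0(2) unfolding B_def by (intro bdd_supp[OF g(1)]) (auto simp: bdd_def intro: order_trans)
  define E where "E = exp (C1 B * T)"
  have B0: "0 \<le> B" using R by (simp add: B_def)
  have er0: "0 \<le> er B m" for m using c B0 by (simp add: er_def)
  have close: "Nv (\<lambda>_. 1) m (\<lambda>n. g M t n - g m t n) \<le> 2 * er B m * E" if mM: "m \<le> M" and t: "\<bar>t\<bar> \<le> T" for m M t
  proof -
    \<comment> \<open>Seen from level m, the truncated solution of level M is an approximate
      solution with error \<open>er B m\<close>.\<close>
    have "Nv (\<lambda>_. 1) m (\<lambda>n. trn m (g M t) n - g m t n) \<le> (0 + 2 * er B m) * exp (C1 B * \<bar>t\<bar>)"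
    proof (rule comparison[where gy = "\<lambda>t. bil m (g m t) (g m t)" and gz = "\<lambda>t. bil M (g M t) (g M t)"])
      fix \<tau> assume "\<bar>\<tau>\<bar> \<le> \<bar>t\<bar>"
      then have \<tau>: "\<bar>\<tau>\<bar> \<le> T" using t by simp
      show "supp m (g m \<tau>)" "supp m (trn m (g M \<tau>))" by (auto intro: supp_trn g)
      show "bdd B (g m \<tau>)" "bdd B (trn m (g M \<tau>))" by (auto intro: bdd_trn gB \<tau>)
      show "hrm (trn m (g M \<tau>))" by (intro hrm_trn g)
      have "Nv (\<lambda>_. 1) m (\<lambda>n. 0) = 0" by (simp add: Nv_def L2_set_0')
      then show "Nv (\<lambda>_. 1) m (\<lambda>n. bil m (g m \<tau>) (g m \<tau>) n - bil m (g m \<tau>) (g m \<tau>) n) \<le> er B m"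
        using er0 by simp
      show "Nv (\<lambda>_. 1) m (\<lambda>n. bil M (g M \<tau>) (g M \<tau>) n - bil m (trn m (g M \<tau>)) (trn m (g M \<tau>)) n) \<le> er B m"
        using bil_error[OF gB[OF \<tau>] mM, of M] by (simp add: trn_id g)
      fix n assume n: "n \<in> win m"
      then have nM: "n \<in> win M" using win_mono[OF mM] by auto
      show "((\<lambda>t. g m t n) has_vector_derivative bil m (g m \<tau>) (g m \<tau>) n) (at \<tau>)" by (rule gd[OF \<tau> n])
      show "((\<lambda>t. trn m (g M t) n) has_vector_derivative bil M (g M \<tau>) (g M \<tau>) n) (at \<tau>)"
        using gd[OF \<tau> nM] n by (simp add: trn_def)
    next
      show "Nv (\<lambda>_. 1) m (\<lambda>n. trn m (g M 0) n - g m 0 n) \<le> 0"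
        by (simp add: g trn_trn mM Nv_def L2_set_0')
    qed
    also have "\<dots> \<le> 2 * er B m * E"
      unfolding E_def using er0 t C1_ge0[OF B0] by (simp add: mult_left_mono)
    also have "Nv (\<lambda>_. 1) m (\<lambda>n. trn m (g M t) n - g m t n) = Nv (\<lambda>_. 1) m (\<lambda>n. g M t n - g m t n)"
      by (rule Nv_cong) (simp add: trn_def)
    finally show ?thesis .
  qed
  have erE: "(\<lambda>m. 2 * er B m * E) \<longlonglongrightarrow> 0"
  proof -
    have "(\<lambda>m. 2 * er B m * E) \<longlonglongrightarrow> 2 * 0 * E" by (intro tendsto_intros er_tendsto)
    then show ?thesis by simp
  qed
  define y where "y t n = lim (\<lambda>m. g m t n)" for t n
  have glim: "(\<lambda>m. g m t n) \<longlonglongrightarrow> y t n" if t: "\<bar>t\<bar> \<le> T" for t n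
  proof -
    have "Cauchy (\<lambda>m. g m t n)"
    proof (rule CauchyI', unfold dist_norm)
      fix e :: real assume "0 < e"
      then have "\<forall>\<^sub>F m in sequentially. 2 * er B m * E < e" by (rule order_tendstoD[OF erE])
      then obtain m0 where m0: "\<And>m. m \<ge> m0 \<Longrightarrow> 2 * er B m * E < e" unfolding eventually_sequentially by blast
      show "\<exists>m0. \<forall>m\<ge>m0. \<forall>M>m. norm (g m t n - g M t n) < e"
      proof (intro exI[of _ "max m0 (nat \<bar>n\<bar>)"] allI impI)
        fix m M assume m: "max m0 (nat \<bar>n\<bar>) \<le> m" and M: "m < M"
        have "norm (g m t n - g M t n) = norm (g M t n - g m t n)" by (rule norm_minus_commute)
        also have "\<dots> \<le> sz n (g M t n - g m t n)" by (rule norm_le_sz)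
        also have "\<dots> \<le> Nv (\<lambda>_. 1) m (\<lambda>n. g M t n - g m t n)"
          using m by (intro sz_le_Nv1) (auto simp: mem_win)
        also have "\<dots> \<le> 2 * er B m * E" using M t by (intro close) auto
        finally show "norm (g m t n - g M t n) < e" using m0[of m] m by simp
      qed
    qed
    then show ?thesis unfolding y_def by (simp add: Cauchy_convergent_iff convergent_LIMSEQ_iff)
  qed
  have yclose: "Nv (\<lambda>_. 1) m (\<lambda>n. y t n - g m t n) \<le> 2 * er B m * E" if t: "\<bar>t\<bar> \<le> T" for m t
  proof (rule tendsto_upperbound)
    show "((\<lambda>M. Nv (\<lambda>_. 1) m (\<lambda>n. g M t n - g m t n)) \<longlongrightarrow> Nv (\<lambda>_. 1) m (\<lambda>n. y t n - g m t n)) sequentially"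
      by (intro Nv_tendsto tendsto_intros glim t)
    show "\<forall>\<^sub>F M in sequentially. Nv (\<lambda>_. 1) m (\<lambda>n. g M t n - g m t n) \<le> 2 * er B m * E"
      using eventually_ge_at_top[of m] by eventually_elim (rule close[OF _ t])
  qed simp
  have yb: "Nv (wt \<sigma> R') m (y t) \<le> 2 * C" if t: "\<bar>t\<bar> \<le> T" and R': "0 \<le> R'" and C: "\<And>m. Nv (wt \<sigma> R') m x0 \<le> C" for t R' C m
  proof (rule tendsto_upperbound)
    show "((\<lambda>M. Nv (wt \<sigma> R') m (g M t)) \<longlongrightarrow> Nv (wt \<sigma> R') m (y t)) sequentially"
      by (intro Nv_tendsto glim t)
    show "\<forall>\<^sub>F M in sequentially. Nv (wt \<sigma> R') m (g M t) \<le> 2 * C"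
      using eventually_ge_at_top[of m]
    proof eventually_elim
      case (elim M)
      show ?case using Nv_win_mono[OF elim, of "wt \<sigma> R'" "g M t"] gb[OF t R', of M] C[of M] by linarith
    qed
  qed simp
  have yB: "bdd B (y t)" if t: "\<bar>t\<bar> \<le> T" for t
    unfolding bdd_def B_def using x0(2) by (intro allI yb[OF t]) (auto simp: bdd_def)
  have yh: "hrm (y t)" if t: "\<bar>t\<bar> \<le> T" for t
    unfolding hrm_cjp
  proof
    fix n
    have "(\<lambda>m. g m t (- n)) \<longlonglongrightarrow> cjp (y t n)"
      using bounded_linear.tendsto[OF bounded_linear_cjp glim[OF t, of n]] g(2) by (simp add: hrm_cjp)
    then show "y t (- n) = cjp (y t n)" using glim[OF t, of "- n"] by (rule LIMSEQ_unique[rotated])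
  qed
  have y0: "y 0 = x0"
  proof
    fix n
    have "\<forall>\<^sub>F m in sequentially. g m 0 n = x0 n"
      using eventually_ge_at_top[of "nat \<bar>n\<bar>"] by eventually_elim (auto simp: g trn_def mem_win)
    then have "(\<lambda>m. g m 0 n) \<longlonglongrightarrow> x0 n" by (rule tendsto_eventually)
    moreover have "(\<lambda>m. g m 0 n) \<longlonglongrightarrow> y 0 n" using T by (intro glim) simp
    ultimately show "y 0 n = x0 n" by (rule LIMSEQ_unique[rotated])
  qed
  have yd: "((\<lambda>t. y t n) has_vector_derivative Bq (y t) n) (at t)" if t: "\<bar>t\<bar> < T" for t n
  proof -
    let ?S = "{-T<..<T}"
    \<comment> \<open>The two summands in the bracket belong to the two slots of the quadratic form,
      where \<open>g m\<close> and the limit differ by a quantity small in the weak norm; the last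
      one is the truncation error of \<open>Bq\<close>.\<close>
    define Q where "Q m = (12 * jb n * (c * B) + 6 * (c * B)) * (2 * er B m * E) + er B m" for m
    have Q0: "Q \<longlonglongrightarrow> 0"
    proof -
      have "Q \<longlonglongrightarrow> (12 * jb n * (c * B) + 6 * (c * B)) * 0 + 0"
        unfolding Q_def[abs_def] by (intro tendsto_intros erE er_tendsto)
      then show ?thesis by simp
    qed
    have dist: "norm (bil m (g m \<tau>) (g m \<tau>) n - Bq (y \<tau>) n) \<le> Q m" if n: "n \<in> win m" and \<tau>: "\<bar>\<tau>\<bar> \<le> T" for m \<tau>
    proof -
      define \<delta> where "\<delta> n = g m \<tau> n - trn m (y \<tau>) n" for n
      have s: "supp m \<delta>" using g(1)[of m \<tau>] by (auto simp: \<delta>_def supp_def trn_def)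
      have "Nv (\<lambda>_. 1) m \<delta> = Nv (\<lambda>_. 1) m (\<lambda>n. g m \<tau> n - y \<tau> n)"
        by (rule Nv_cong) (simp add: \<delta>_def trn_def)
      then have N: "Nv (\<lambda>_. 1) m \<delta> \<le> 2 * er B m * E" using yclose[OF \<tau>, of m] by (simp add: Nv_diff_commute)
      have EE: "0 \<le> 2 * er B m * E" using N Nv_ge0 order_trans by blast
      have "bil m (g m \<tau>) (g m \<tau>) n - Bq (y \<tau>) n = bil m (g m \<tau>) \<delta> n + bil m \<delta> (trn m (y \<tau>)) n
         - (Bq (y \<tau>) n - bil m (trn m (y \<tau>)) (trn m (y \<tau>)) n)"
        unfolding \<delta>_def bil_diff_self[symmetric] by simp
      then have "norm (bil m (g m \<tau>) (g m \<tau>) n - Bq (y \<tau>) n) \<le> sz n (bil m (g m \<tau>) \<delta> n) + sz n (bil m \<delta> (trn m (y \<tau>)) n)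
         + sz n (Bq (y \<tau>) n - bil m (trn m (y \<tau>)) (trn m (y \<tau>)) n)"
        by (simp only:) (intro order_trans[OF norm_le_sz[of _ n]] order_trans[OF sz_diff] add_right_mono sz_triangle)
      also have "\<dots> \<le> 12 * jb n * ((c * B) * (2 * er B m * E)) + 6 * ((2 * er B m * E) * (c * B)) + er B m"
      proof (intro add_mono)
        show "sz n (bil m (g m \<tau>) \<delta> n) \<le> 12 * jb n * ((c * B) * (2 * er B m * E))"
          using c B0 by (intro order_trans[OF sz_bil_le_left[OF g(1) s]] mult_left_mono mult_mono X1_bdd gB \<tau> N) auto
        show "sz n (bil m \<delta> (trn m (y \<tau>)) n) \<le> 6 * ((2 * er B m * E) * (c * B))"
          using EE by (intro order_trans[OF sz_bil_le_right[OF s]] mult_left_mono mult_mono N X1_bdd bdd_trn yB \<tau>) auto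
        show "sz n (Bq (y \<tau>) n - bil m (trn m (y \<tau>)) (trn m (y \<tau>)) n) \<le> er B m"
          using order_trans[OF sz_le_Nv1[OF n] Bq_error[OF yB[OF \<tau>]]] .
      qed
      finally show ?thesis by (simp add: Q_def algebra_simps)
    qed
    \<comment> \<open>The derivatives converge uniformly in time, so the limit may be
      differentiated. Shifting the index by |n| puts n into every window.\<close>
    have "\<exists>h. \<forall>x\<in>?S. (\<lambda>m. g (m + nat \<bar>n\<bar>) x n) \<longlonglongrightarrow> h x \<and> (h has_derivative (\<lambda>d. d *\<^sub>R Bq (y x) n)) (at x within ?S)"
    proof (rule has_derivative_sequence)
      show "((\<lambda>x. g (m + nat \<bar>n\<bar>) x n) has_derivative (\<lambda>d. d *\<^sub>R bil (m + nat \<bar>n\<bar>) (g (m + nat \<bar>n\<bar>) x) (g (m + nat \<bar>n\<bar>) x) n)) (at x within ?S)"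
        if "x \<in> ?S" for m x
        using gd[of x n "m + nat \<bar>n\<bar>"] that
        by (auto simp: mem_win has_vector_derivative_def intro: has_derivative_at_withinI)
      show "(\<lambda>m. g (m + nat \<bar>n\<bar>) 0 n) \<longlonglongrightarrow> y 0 n"
        using T by (intro LIMSEQ_ignore_initial_segment glim) simp
      fix e :: real assume e: "0 < e"
      have "(\<lambda>m. Q (m + nat \<bar>n\<bar>)) \<longlonglongrightarrow> 0" by (rule LIMSEQ_ignore_initial_segment[OF Q0])
      then have "\<forall>\<^sub>F m in sequentially. Q (m + nat \<bar>n\<bar>) < e" using e by (rule order_tendstoD)
      then show "\<forall>\<^sub>F m in sequentially. \<forall>x\<in>?S. \<forall>d. norm (d *\<^sub>R bil (m + nat \<bar>n\<bar>) (g (m + nat \<bar>n\<bar>) x) (g (m + nat \<bar>n\<bar>) x) n - d *\<^sub>R Bq (y x) n) \<le> e * norm d"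
      proof eventually_elim
        case (elim m)
        show ?case
        proof (intro ballI allI)
          fix x d assume "x \<in> ?S"
          then have "norm (bil (m + nat \<bar>n\<bar>) (g (m + nat \<bar>n\<bar>) x) (g (m + nat \<bar>n\<bar>) x) n - Bq (y x) n) \<le> e"
            using elim by (intro order_trans[OF dist]) (auto simp: mem_win)
          then show "norm (d *\<^sub>R bil (m + nat \<bar>n\<bar>) (g (m + nat \<bar>n\<bar>) x) (g (m + nat \<bar>n\<bar>) x) n - d *\<^sub>R Bq (y x) n) \<le> e * norm d"
            unfolding scaleR_right_diff_distrib[symmetric] norm_scaleR
            by (metis abs_ge_zero mult.commute mult_right_mono real_norm_def)
        qed
      qed
    qed (use T in auto)
    then obtain h where h: "\<And>x. x \<in> ?S \<Longrightarrow> (\<lambda>m. g (m + nat \<bar>n\<bar>) x n) \<longlonglongrightarrow> h x"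
      "\<And>x. x \<in> ?S \<Longrightarrow> (h has_derivative (\<lambda>d. d *\<^sub>R Bq (y x) n)) (at x within ?S)" by blast
    have tS: "t \<in> ?S" using t by auto
    have hy: "h x = y x n" if "x \<in> ?S" for x
      using LIMSEQ_unique[OF h(1)[OF that] LIMSEQ_ignore_initial_segment[OF glim]] that by auto
    have hd: "(h has_derivative (\<lambda>d. d *\<^sub>R Bq (y t) n)) (at t)"
      using h(2)[OF tS] unfolding at_within_open[OF tS open_greaterThanLessThan] .
    have "((\<lambda>x. y x n) has_derivative (\<lambda>d. d *\<^sub>R Bq (y t) n)) (at t)"
      by (rule has_derivative_transform_within_open[OF hd open_greaterThanLessThan tS]) (rule hy)
    then show ?thesis by (simp add: has_vector_derivative_def)
  qed
  show ?thesis
  proof (rule that)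
    show "seqsol (Tm R) y"
      unfolding seqsol_def T_def[symmetric]
    proof (intro conjI allI impI)
      fix t0 assume "t0 < T"
      then show "\<exists>B. \<forall>t. \<bar>t\<bar> \<le> t0 \<longrightarrow> bdd B (y t)" by (intro exI[of _ B] allI impI yB) simp
    qed (auto intro: yh yd)
    show "y 0 = x0" by (rule y0)
    show "Nv (wt \<sigma> R') m (y t) \<le> 2 * C" if "\<bar>t\<bar> < Tm R" "0 \<le> R'" "\<And>m. Nv (wt \<sigma> R') m x0 \<le> C" for t R' C m
      using that by (intro yb) (auto simp: T_def)
  qed
qed

end

section \<open>Strong continuity, uniqueness and continuous dependence for sequences\<close>

lemma Nv_weight_add:
  assumes "\<And>n. 0 \<le> v n" "\<And>n. v n \<le> a * v1 n + b * v2 n" "0 \<le> a" "0 \<le> b"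
  shows "Nv v m y \<le> a * Nv v1 m y + b * Nv v2 m y"
proof -
  have "Nv v m y \<le> L2_set (\<lambda>n. a * (v1 n * sz n (y n)) + b * (v2 n * sz n (y n))) (win m)"
    unfolding Nv_def
  proof (rule L2_set_mono')
    fix n
    have "v n * sz n (y n) \<le> (a * v1 n + b * v2 n) * sz n (y n)" by (intro mult_right_mono assms) auto
    then show "\<bar>v n * sz n (y n)\<bar> \<le> a * (v1 n * sz n (y n)) + b * (v2 n * sz n (y n))"
      using assms(1) by (simp add: abs_mult algebra_simps)
  qed
  also have "\<dots> \<le> a * Nv v1 m y + b * Nv v2 m y"
    unfolding Nv_def using L2_set_triangle_ineq assms(3,4) by (simp add: L2_set_cmult[symmetric])
  finally show ?thesis .
qed

text \<open>The remainder w is paired with the curve: the scalar function F has increment equal to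
  the square of the norm of w, and one factor of that norm cancels.\<close>

lemma Nv_mean_value:
  assumes d: "\<And>s n. \<bar>s - t\<bar> \<le> \<bar>\<tau> - t\<bar> \<Longrightarrow> ((\<lambda>t. y t n) has_vector_derivative g s n) (at s)"
    and b: "\<And>s. \<bar>s - t\<bar> \<le> \<bar>\<tau> - t\<bar> \<Longrightarrow> Nv v m (\<lambda>n. g s n - a n) \<le> D"
    and v: "\<And>n. 0 \<le> v n"
  shows "Nv v m (\<lambda>n. y \<tau> n - y t n - (\<tau> - t) *\<^sub>R a n) \<le> \<bar>\<tau> - t\<bar> * D"
proof -
  define w where "w n = y \<tau> n - y t n - (\<tau> - t) *\<^sub>R a n" for n
  define F where "F s = ipr v m w (\<lambda>n. y (t + s) n - s *\<^sub>R a n)" for s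
  have "norm (F (\<tau> - t) - F 0) \<le> (Nv v m w * D) * \<bar>\<tau> - t\<bar>"
  proof (rule vector_derivative_const_bound_zero)
    fix s assume s: "\<bar>s\<bar> \<le> \<bar>\<tau> - t\<bar>"
    have yd: "((\<lambda>s. y (t + s) n - s *\<^sub>R a n) has_vector_derivative g (t + s) n - a n) (at s)" for n
    proof (rule has_vector_derivative_diff)
      have "((\<lambda>t. y t n) has_vector_derivative g (t + s) n) (at (t + s))" using s by (intro d) simp
      moreover have "((\<lambda>s. t + s) has_vector_derivative 1) (at s)" by (auto intro!: derivative_eq_intros)
      ultimately show "((\<lambda>s. y (t + s) n) has_vector_derivative g (t + s) n) (at s)"
        using vector_diff_chain_at[of "\<lambda>s. t + s" 1 s "\<lambda>t. y t n" "g (t + s) n"] by (simp add: o_def)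
      show "((\<lambda>s. s *\<^sub>R a n) has_vector_derivative a n) (at s)"
        by (auto intro!: derivative_eq_intros)
    qed
    have in_d: "((\<lambda>s. z \<bullet> f s) has_real_derivative z \<bullet> f') (at s)"
      if "(f has_vector_derivative f') (at s)" for f :: "real \<Rightarrow> complex" and f' z
      using bounded_linear.has_vector_derivative[OF bounded_linear_inner_right that]
      by (simp add: has_real_derivative_iff_has_vector_derivative)
    have "(F has_real_derivative ipr v m w (\<lambda>n. g (t + s) n - a n)) (at s)"
      unfolding F_def[abs_def] ipr_inner
      by (intro DERIV_sum DERIV_cmult DERIV_add in_d
          bounded_linear.has_vector_derivative[OF bounded_linear_fst yd]
          bounded_linear.has_vector_derivative[OF bounded_linear_snd yd])
    then show "(F has_vector_derivative ipr v m w (\<lambda>n. g (t + s) n - a n)) (at s)"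
      by (simp add: has_real_derivative_iff_has_vector_derivative)
    show "norm (ipr v m w (\<lambda>n. g (t + s) n - a n)) \<le> Nv v m w * D"
    proof -
      have "Nv v m (\<lambda>n. g (t + s) n - a n) \<le> D" using s by (intro b) simp
      then have "Nv v m w * Nv v m (\<lambda>n. g (t + s) n - a n) \<le> Nv v m w * D" by (intro mult_left_mono) auto
      then show ?thesis using ipr_le[of v m w "\<lambda>n. g (t + s) n - a n", OF v] by simp
    qed
  qed
  moreover have "F (\<tau> - t) - F 0 = (Nv v m w)\<^sup>2"
    unfolding F_def ipr_diff[symmetric] ipr_self[symmetric]
    by (rule ipr_cong) (simp add: w_def)
  ultimately have i: "Nv v m w * Nv v m w \<le> Nv v m w * (\<bar>\<tau> - t\<bar> * D)"
    by (simp add: power2_eq_square mult_ac)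
  show ?thesis
  proof (cases "Nv v m w = 0")
    case True
    have "0 \<le> D" by (rule order_trans[OF Nv_ge0 b[of t]]) simp
    then show ?thesis using True by (simp add: w_def[abs_def])
  next
    case False
    then have "0 < Nv v m w" using Nv_ge0[of v m w] by linarith
    then have "Nv v m w \<le> \<bar>\<tau> - t\<bar> * D" using i by simp
    then show ?thesis by (simp add: w_def[abs_def])
  qed
qed

lemma Bq_0: "Bq (\<lambda>_. 0) n = 0"
proof -
  have "bil m (trn m (\<lambda>_. 0)) (trn m (\<lambda>_. 0)) n = 0" for m
    by (rule prod_eqI) (simp_all add: trn_def bil_def tra_def rst_def conv_def)
  then show ?thesis by (simp add: Bq_def)
qed

context ch2
begin

definition Cb :: "real \<Rightarrow> real" where "Cb B = 24 * K * c * B"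

text \<open>The right-hand side is locally Lipschitz with the loss of one derivative, which is why
  time derivatives live one order lower. The estimate passes from the truncations to
  \<open>Bq\<close> by coefficientwise limits.\<close>

lemma Bq_diff:
  assumes y: "bdd B y" and z: "bdd B z" and D: "bdd D (\<lambda>n. y n - z n)"
  shows "Nv (wt (\<sigma> - 1) 0) m (\<lambda>n. Bq y n - Bq z n) \<le> Cb B * D"
proof (rule tendsto_upperbound)
  let ?v = "wt (\<sigma> - 1) 0"
  let ?f = "\<lambda>M n. bil M (trn M y) (trn M y) n - bil M (trn M z) (trn M z) n"
  show "((\<lambda>M. Nv ?v m (?f M)) \<longlongrightarrow> Nv ?v m (\<lambda>n. Bq y n - Bq z n)) sequentially"
    by (intro Nv_tendsto tendsto_intros Bq_lim[OF y] Bq_lim[OF z])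
  have B0: "0 \<le> B" using y by (rule bdd_ge0)
  have D0: "0 \<le> D" using D by (rule bdd_ge0)
  have vj: "(\<lambda>n. ?v n * jb n) = wt \<sigma> 0" using wt_0_add[of "\<sigma> - 1"] by (auto simp: mult.commute)
  have vle: "?v n \<le> wt \<sigma> 0 n" for n using mult_right_mono[OF jb_ge1, of "?v n" n] wt_0_add[of "\<sigma> - 1" n] by simp
  have "Nv ?v m (?f M) \<le> Cb B * D" for M
  proof -
    define Y where "Y = trn M y"
    define Z where "Z = trn M z"
    define \<delta> where "\<delta> n = Y n - Z n" for n
    have Y: "bdd B Y" "supp M Y" and Z: "bdd B Z" "supp M Z"
      using y z by (auto simp: Y_def Z_def intro: bdd_trn supp_trn)
    have s: "supp M \<delta>" using Y Z by (auto simp: \<delta>_def supp_def)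
    have "\<delta> = trn M (\<lambda>n. y n - z n)" by (auto simp: \<delta>_def Y_def Z_def trn_def)
    then have \<delta>: "bdd D \<delta>" using bdd_trn[OF D] by simp
    have one: "Nv ?v m (bil M Y' Z') \<le> 12 * K * c * (B1 * B2)"
      if "bdd B1 Y'" "supp M Y'" "bdd B2 Z'" "supp M Z'" for Y' Z' B1 B2
    proof -
      have B12: "0 \<le> B1" "0 \<le> B2" using that bdd_ge0 by auto
      have "Nv ?v m (bil M Y' Z') \<le> 6 * (K * S1 M Y' * Nv (\<lambda>n. ?v n * jb n) M Z' + K * Nv ?v M Y' * X1 M Z')"
        using K that by (intro Nv_bil_le V') auto
      also have "\<dots> \<le> 6 * (K * (c * B1) * B2 + K * B1 * (c * B2))"
      proof (intro mult_left_mono add_mono mult_mono S1_bdd X1_bdd that)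
        show "Nv (\<lambda>n. ?v n * jb n) M Z' \<le> B2" unfolding vj using that by (simp add: bdd_def)
        show "Nv ?v M Y' \<le> B1"
          using that(1) by (intro order_trans[OF Nv_mono_weight[OF _ vle]]) (auto simp: bdd_def)
      qed (use K c B12 in auto)
      finally show ?thesis by (simp add: algebra_simps)
    qed
    have "?f M = (\<lambda>n. bil M Y \<delta> n + bil M \<delta> Z n)"
      unfolding Y_def[symmetric] Z_def[symmetric] bil_diff_self \<delta>_def ..
    then have "Nv ?v m (?f M) \<le> Nv ?v m (bil M Y \<delta>) + Nv ?v m (bil M \<delta> Z)"
      using Nv_triangle[of ?v m "bil M Y \<delta>" "bil M \<delta> Z"] by simp
    also have "\<dots> \<le> 12 * K * c * (B * D) + 12 * K * c * (D * B)"
      by (intro add_mono one Y Z s \<delta>)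
    finally show ?thesis by (simp add: Cb_def algebra_simps)
  qed
  then show "\<forall>\<^sub>F M in sequentially. Nv ?v m (?f M) \<le> Cb B * D" by simp
qed simp

lemma Bq_bound:
  assumes y: "bdd B y"
  shows "Nv (wt (\<sigma> - 1) 0) m (Bq y) \<le> Cb B * B"
proof -
  have "bdd B (\<lambda>_. 0)" using bdd_ge0[OF y] by (simp add: bdd_def Nv_def L2_set_0')
  then show ?thesis using Bq_diff[OF y, of "\<lambda>_. 0" B m] y by (simp add: Bq_0)
qed

lemma Nv1_le: "Nv (\<lambda>_. 1) m y \<le> Nv (wt (\<sigma> - 1) 0) m y"
  using ge_one_powr_ge_zero[OF jb_ge1, of "\<sigma> - 1"] \<sigma> by (intro Nv_mono_weight) (auto simp: wt_0)

lemma Nv1_le_wt: "Nv (\<lambda>_. 1) m y \<le> Nv (wt \<sigma> 0) m y"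
  using wt1 by (intro Nv_mono_weight) auto

text \<open>Frequencies beyond some m0 contribute little because the increasing partial sums of the
  squared norm converge; the finitely many below m0 are damped by
  \<open>jb (int m0) / R\<close>.\<close>

lemma tail_small:
  assumes x: "bdd B x" and e: "0 < e"
  obtains R where "0 \<le> R" "\<And>m. Nv (wt \<sigma> R) m x \<le> e"
proof -
  define s where "s m = (Nv (wt \<sigma> 0) m x)\<^sup>2" for m
  have s_sum: "s m = (\<Sum>n\<in>win m. (wt \<sigma> 0 n * sz n (x n))\<^sup>2)" for m
    by (simp add: s_def Nv_def L2_set_def sum_nonneg)
  have B: "0 \<le> B" using x by (rule bdd_ge0)
  have "incseq s" unfolding incseq_def s_def by (intro allI impI power_mono Nv_win_mono) auto
  moreover have sB: "s m \<le> B\<^sup>2" for m unfolding s_def using x by (intro power_mono) (auto simp: bdd_def)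
  ultimately obtain L where "s \<longlonglongrightarrow> L" using incseq_convergent[of s "B\<^sup>2"] by metis
  then have "Cauchy s" by (rule LIMSEQ_imp_Cauchy)
  then obtain m0 where m0: "\<And>m. m \<ge> m0 \<Longrightarrow> \<bar>s m - s m0\<bar> < e\<^sup>2 / 2"
    using e unfolding Cauchy_def dist_real_def by (metis half_gt_zero_iff order_refl zero_less_power)
  \<comment> \<open>Makes the damping factor on \<open>win m0\<close> times B at most e / 2; then (e
    / 2)^2 + e^2 / 2 is below e^2.\<close>
  define R where "R = 2 * jb (int m0) * (B + 1) / e"
  have R: "0 < R" using e B by (simp add: R_def)
  have "Nv (wt \<sigma> R) m x \<le> e" for m
  proof -
    define M where "M = max m m0"
    have wM: "win m0 \<subseteq> win M" unfolding M_def by (rule win_mono) simp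
    let ?q = "jb (int m0) / R"
    have q: "?q * B \<le> e / 2"
    proof -
      have "?q = e / (2 * (B + 1))" by (simp add: R_def)
      then have "?q * B = e * (B / (B + 1)) / 2" by (simp only: times_divide_eq_left times_divide_eq_right divide_divide_eq_left mult_ac)
      also have "\<dots> \<le> e * 1 / 2" using B e by (intro divide_right_mono mult_left_mono) auto
      finally show ?thesis by simp
    qed
    have "(Nv (wt \<sigma> R) M x)\<^sup>2 = (\<Sum>n\<in>win M. (wt \<sigma> R n * sz n (x n))\<^sup>2)"
      by (simp add: Nv_def L2_set_def sum_nonneg)
    also have "\<dots> = (\<Sum>n\<in>win m0. (wt \<sigma> R n * sz n (x n))\<^sup>2) + (\<Sum>n\<in>win M - win m0. (wt \<sigma> R n * sz n (x n))\<^sup>2)"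
      using sum.subset_diff[OF wM, of "\<lambda>n. (wt \<sigma> R n * sz n (x n))\<^sup>2"] by simp
    finally have split: "(Nv (wt \<sigma> R) M x)\<^sup>2 = (\<Sum>n\<in>win m0. (wt \<sigma> R n * sz n (x n))\<^sup>2) + (\<Sum>n\<in>win M - win m0. (wt \<sigma> R n * sz n (x n))\<^sup>2)" .
    have "(\<Sum>n\<in>win M - win m0. (wt \<sigma> R n * sz n (x n))\<^sup>2) \<le> (\<Sum>n\<in>win M - win m0. (wt \<sigma> 0 n * sz n (x n))\<^sup>2)"
      using R by (intro sum_mono power_mono mult_right_mono wt_le) auto
    also have "\<dots> = s M - s m0" unfolding s_sum using wM by (simp add: sum_diff)
    also have "\<dots> \<le> e\<^sup>2 / 2" using m0[of M] unfolding M_def by linarith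
    finally have high: "(\<Sum>n\<in>win M - win m0. (wt \<sigma> R n * sz n (x n))\<^sup>2) \<le> e\<^sup>2 / 2" .
    have "(\<Sum>n\<in>win m0. (wt \<sigma> R n * sz n (x n))\<^sup>2) \<le> (\<Sum>n\<in>win m0. ?q\<^sup>2 * (wt \<sigma> 0 n * sz n (x n))\<^sup>2)"
    proof (rule sum_mono)
      fix n assume n: "n \<in> win m0"
      have "wt \<sigma> R n \<le> jb n / R * wt \<sigma> 0 n" by (rule wt_le_jb[OF R])
      also have "\<dots> \<le> ?q * wt \<sigma> 0 n"
        using n R by (intro mult_right_mono divide_right_mono jb_mono) (auto simp: mem_win)
      finally have "wt \<sigma> R n * sz n (x n) \<le> ?q * (wt \<sigma> 0 n * sz n (x n))"
        unfolding mult.assoc[symmetric] by (rule mult_right_mono) simp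
      then have "(wt \<sigma> R n * sz n (x n))\<^sup>2 \<le> (?q * (wt \<sigma> 0 n * sz n (x n)))\<^sup>2" using R by (intro power_mono) auto
      then show "(wt \<sigma> R n * sz n (x n))\<^sup>2 \<le> ?q\<^sup>2 * (wt \<sigma> 0 n * sz n (x n))\<^sup>2" by (simp only: power_mult_distrib)
    qed
    also have "\<dots> = ?q\<^sup>2 * s m0" by (simp add: s_sum sum_distrib_left)
    also have "\<dots> \<le> ?q\<^sup>2 * B\<^sup>2" by (intro mult_left_mono sB) auto
    also have "\<dots> = (?q * B)\<^sup>2" by (simp only: power_mult_distrib)
    also have "\<dots> \<le> (e / 2)\<^sup>2" using q B R by (intro power_mono) auto
    finally have "(Nv (wt \<sigma> R) M x)\<^sup>2 \<le> (e / 2)\<^sup>2 + e\<^sup>2 / 2"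
      unfolding split using high by (rule add_mono)
    also have "\<dots> \<le> e\<^sup>2" by (simp add: power_divide)
    finally have "Nv (wt \<sigma> R) M x \<le> e" using e by (rule power2_le_imp_le[OF _ less_imp_le])
    moreover have "Nv (wt \<sigma> R) m x \<le> Nv (wt \<sigma> R) M x" by (rule Nv_win_mono) (simp add: M_def)
    ultimately show ?thesis by (rule order_trans[rotated])
  qed
  with R show ?thesis by (intro that[of R]) auto
qed

lemma seqsolD:
  assumes "seqsol T y"
  shows "\<bar>t\<bar> < T \<Longrightarrow> hrm (y t)" "t0 < T \<Longrightarrow> \<exists>B. \<forall>t. \<bar>t\<bar> \<le> t0 \<longrightarrow> bdd B (y t)"
    "\<bar>t\<bar> < T \<Longrightarrow> ((\<lambda>t. y t n) has_vector_derivative Bq (y t) n) (at t)"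
  using assms by (simp_all add: seqsol_def)

lemma seqsol_unique:
  assumes y: "seqsol T y" and z: "seqsol T z" and eq: "y 0 = z 0" and t: "\<bar>t\<bar> < T"
  shows "y t = z t"
proof -
  obtain B1 where B1: "\<And>\<tau>. \<bar>\<tau>\<bar> \<le> \<bar>t\<bar> \<Longrightarrow> bdd B1 (y \<tau>)" using seqsolD(2)[OF y t] by blast
  obtain B2 where B2: "\<And>\<tau>. \<bar>\<tau>\<bar> \<le> \<bar>t\<bar> \<Longrightarrow> bdd B2 (z \<tau>)" using seqsolD(2)[OF z t] by blast
  have N0: "Nv (\<lambda>_. 1) m (\<lambda>n. z t n - y t n) \<le> 0 * exp (C1 (max B1 B2) * \<bar>t\<bar>)" for m
  proof (rule seqsol_stable[OF y _ z _ t])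
    show "bdd (max B1 B2) (y \<tau>)" if "\<bar>\<tau>\<bar> \<le> \<bar>t\<bar>" for \<tau> by (rule bdd_mono[OF B1[OF that]]) simp
    show "bdd (max B1 B2) (z \<tau>)" if "\<bar>\<tau>\<bar> \<le> \<bar>t\<bar>" for \<tau> by (rule bdd_mono[OF B2[OF that]]) simp
  qed (simp add: eq Nv_def L2_set_0')
  then have *: "sz n (z t n - y t n) \<le> 0" if "n \<in> win m" for n m
    using order_trans[OF sz_le_Nv1[OF that] N0] by simp
  show ?thesis
  proof
    fix n
    have "n \<in> win (nat \<bar>n\<bar>)" by (simp add: mem_win)
    then have "norm (z t n - y t n) \<le> 0" by (intro order_trans[OF norm_le_sz *])
    then show "y t n = z t n" by simp
  qed
qed

text \<open>Continuity in the strong norm is obtained through \<open>wt_split\<close>: the damped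
  norms at both times are small by the tail of the data, and the weak norm changes at bounded
  speed.\<close>

lemma flow:
  assumes R: "0 < R" and x0: "hrm x0" "bdd R x0"
  obtains y where "seqsol (Tm R) y" "y 0 = x0" "\<And>t. \<bar>t\<bar> < Tm R \<Longrightarrow> bdd (2 * R) (y t)"
    "\<And>t e. \<bar>t\<bar> < Tm R \<Longrightarrow> 0 < e \<Longrightarrow> \<exists>d>0. \<forall>\<tau>. \<bar>\<tau>\<bar> < Tm R \<longrightarrow> \<bar>\<tau> - t\<bar> < d \<longrightarrow> bdd e (\<lambda>n. y \<tau> n - y t n)"
proof -
  obtain y where y: "seqsol (Tm R) y" "y 0 = x0"
    and yt: "\<And>t R' C m. \<bar>t\<bar> < Tm R \<Longrightarrow> 0 \<le> R' \<Longrightarrow> (\<And>m. Nv (wt \<sigma> R') m x0 \<le> C) \<Longrightarrow> Nv (wt \<sigma> R') m (y t) \<le> 2 * C"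
    using flow_exists[OF R x0] by blast
  have b: "bdd (2 * R) (y t)" if "\<bar>t\<bar> < Tm R" for t
    using x0(2) unfolding bdd_def by (intro allI yt that) auto
  have "\<exists>d>0. \<forall>\<tau>. \<bar>\<tau>\<bar> < Tm R \<longrightarrow> \<bar>\<tau> - t\<bar> < d \<longrightarrow> bdd e (\<lambda>n. y \<tau> n - y t n)"
    if t: "\<bar>t\<bar> < Tm R" and e: "0 < e" for t e
  proof -
    obtain Q where Q: "0 \<le> Q" "\<And>m. Nv (wt \<sigma> Q) m x0 \<le> e / 16"
      using tail_small[OF x0(2), of "e / 16"] e by auto
    \<comment> \<open>The speed of the low-frequency part. A tail e / 16 of the data doubles at each
      of two times and again in \<open>wt_split\<close>, which uses e / 2; the time step e / (2 A)
      uses the rest.\<close>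
    define A where "A = Q powr \<sigma> * (Cb (2 * R) * (2 * R)) + 1"
    have A: "0 < A" using K c R by (simp add: A_def Cb_def add_nonneg_pos)
    show ?thesis
    proof (intro exI[of _ "min (e / (2 * A)) (Tm R - \<bar>t\<bar>)"] conjI allI impI)
      show "0 < min (e / (2 * A)) (Tm R - \<bar>t\<bar>)" using A e t by simp
      fix \<tau> assume \<tau>: "\<bar>\<tau>\<bar> < Tm R" and "\<bar>\<tau> - t\<bar> < min (e / (2 * A)) (Tm R - \<bar>t\<bar>)"
      then have d: "\<bar>\<tau> - t\<bar> < e / (2 * A)" "\<bar>\<tau> - t\<bar> < Tm R - \<bar>t\<bar>" by auto
      show "bdd e (\<lambda>n. y \<tau> n - y t n)" unfolding bdd_def
      proof
        fix m
        have "Nv (\<lambda>_. 1) m (\<lambda>n. y \<tau> n - y t n - (\<tau> - t) *\<^sub>R 0) \<le> \<bar>\<tau> - t\<bar> * (Cb (2 * R) * (2 * R))"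
        proof (rule Nv_mean_value[where g = "\<lambda>t. Bq (y t)"])
          fix s assume s: "\<bar>s - t\<bar> \<le> \<bar>\<tau> - t\<bar>"
          have sT: "\<bar>s\<bar> < Tm R"
            using s d(2) by linarith
          show "((\<lambda>t. y t n) has_vector_derivative Bq (y s) n) (at s)" for n
            by (rule seqsolD(3)[OF y(1) sT])
          show "Nv (\<lambda>_. 1) m (\<lambda>n. Bq (y s) n - 0) \<le> Cb (2 * R) * (2 * R)"
            using order_trans[OF Nv1_le Bq_bound[OF b[OF sT]]] by simp
        qed simp
        then have w: "Nv (\<lambda>_. 1) m (\<lambda>n. y \<tau> n - y t n) \<le> \<bar>\<tau> - t\<bar> * (Cb (2 * R) * (2 * R))" by simp
        have "Nv (wt \<sigma> 0) m (\<lambda>n. y \<tau> n - y t n)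
           \<le> 2 * Nv (wt \<sigma> Q) m (\<lambda>n. y \<tau> n - y t n) + Q powr \<sigma> * Nv (\<lambda>_. 1) m (\<lambda>n. y \<tau> n - y t n)"
          using wt_split[OF Q(1), of \<sigma>] \<sigma> by (intro Nv_weight_add) auto
        also have "\<dots> \<le> 2 * (e / 8 + e / 8) + Q powr \<sigma> * (\<bar>\<tau> - t\<bar> * (Cb (2 * R) * (2 * R)))"
        proof (intro add_mono mult_left_mono w)
          have "Nv (wt \<sigma> Q) m (\<lambda>n. y \<tau> n - y t n) \<le> Nv (wt \<sigma> Q) m (y \<tau>) + Nv (wt \<sigma> Q) m (y t)"
            using Q by (intro Nv_diff) auto
          then show "Nv (wt \<sigma> Q) m (\<lambda>n. y \<tau> n - y t n) \<le> e / 8 + e / 8"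
            using yt[OF t Q, of m] yt[OF \<tau> Q, of m] by simp
        qed auto
        also have "\<dots> \<le> e / 2 + \<bar>\<tau> - t\<bar> * A"
          by (simp add: A_def algebra_simps)
        also have "\<dots> \<le> e / 2 + e / (2 * A) * A" using d(1) A by (intro add_left_mono mult_right_mono) auto
        also have "\<dots> = e" using A by simp
        finally show "Nv (wt \<sigma> 0) m (\<lambda>n. y \<tau> n - y t n) \<le> e" .
      qed
    qed
  qed
  from that[OF y b this] show ?thesis by simp
qed

text \<open>Nearby data have nearly the same tail as x0, so the damped norms of both solutions are
  small at all times; weak stability controls the low frequencies. One radius \<eta> serves all
  t.\<close>

lemma flow_continuous:
  assumes R: "0 < R" and x0: "hrm x0" "bdd R x0" and y: "seqsol (Tm R) y" "y 0 = x0" and e: "0 < e"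
  obtains \<eta> where "0 < \<eta>"
    "\<And>z t. seqsol (Tm R) z \<Longrightarrow> bdd R (z 0) \<Longrightarrow> bdd \<eta> (\<lambda>n. z 0 n - x0 n) \<Longrightarrow> \<bar>t\<bar> < Tm R \<Longrightarrow> bdd e (\<lambda>n. z t n - y t n)"
proof -
  obtain Q where Q: "0 \<le> Q" "\<And>m. Nv (wt \<sigma> Q) m x0 \<le> e / 32"
    using tail_small[OF x0(2), of "e / 32"] e by auto
  \<comment> \<open>With \<eta> = e / (4 A) the total is e / 4 + A \<eta>: the 4 collects what
    \<eta> adds to the tail of z, the second summand the weak distance.\<close>
  define A where "A = 4 + Q powr \<sigma> * exp (C1 (2 * R) * Tm R)"
  have A: "0 < A" by (simp add: A_def add_pos_nonneg)
  have T0: "0 < Tm R" by (rule Tm_pos[OF R])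
  \<comment> \<open>The given y is an arbitrary solution; by uniqueness it coincides with the
    constructed one, for which the damped bounds are known.\<close>
  obtain y' where y': "seqsol (Tm R) y'" "y' 0 = x0"
    and yt': "\<And>t R' C m. \<bar>t\<bar> < Tm R \<Longrightarrow> 0 \<le> R' \<Longrightarrow> (\<And>m. Nv (wt \<sigma> R') m x0 \<le> C) \<Longrightarrow> Nv (wt \<sigma> R') m (y' t) \<le> 2 * C"
    using flow_exists[OF R x0] by blast
  have yy: "y t = y' t" if "\<bar>t\<bar> < Tm R" for t
    by (rule seqsol_unique[OF y(1) y'(1) _ that]) (simp only: y(2) y'(2))
  show ?thesis
  proof (rule that[of "e / (4 * A)"])
    show "0 < e / (4 * A)" using A e by simp
    fix z t assume z: "seqsol (Tm R) z" "bdd R (z 0)" and \<eta>: "bdd (e / (4 * A)) (\<lambda>n. z 0 n - x0 n)" and t: "\<bar>t\<bar> < Tm R"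
    define \<eta>' where "\<eta>' = e / (4 * A)"
    have z0: "hrm (z 0)" using seqsolD(1)[OF z(1), of 0] T0 by simp
    obtain z' where z': "seqsol (Tm R) z'" "z' 0 = z 0"
      and zt': "\<And>t R' C m. \<bar>t\<bar> < Tm R \<Longrightarrow> 0 \<le> R' \<Longrightarrow> (\<And>m. Nv (wt \<sigma> R') m (z 0) \<le> C) \<Longrightarrow> Nv (wt \<sigma> R') m (z' t) \<le> 2 * C"
      using flow_exists[OF R z0 z(2)] by blast
    have zz: "z t = z' t" if "\<bar>t\<bar> < Tm R" for t
      by (rule seqsol_unique[OF z(1) z'(1) _ that]) (simp only: z'(2))
    have b: "bdd (2 * R) (y \<tau>)" "bdd (2 * R) (z \<tau>)" if "\<bar>\<tau>\<bar> \<le> \<bar>t\<bar>" for \<tau>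
    proof -
      have \<tau>: "\<bar>\<tau>\<bar> < Tm R" using that t by simp
      show "bdd (2 * R) (y \<tau>)" using x0(2) unfolding bdd_def yy[OF \<tau>] by (intro allI yt' \<tau>) auto
      show "bdd (2 * R) (z \<tau>)" using z(2) unfolding bdd_def zz[OF \<tau>] by (intro allI zt' \<tau>) auto
    qed
    have Dw: "Nv (\<lambda>_. 1) m (\<lambda>n. z 0 n - y 0 n) \<le> \<eta>'" for m
      using \<eta> by (intro order_trans[OF Nv1_le_wt]) (simp add: bdd_def y \<eta>'_def)
    have \<eta>0: "0 \<le> \<eta>'" using \<eta> bdd_ge0 by (auto simp: \<eta>'_def)
    have zQ: "Nv (wt \<sigma> Q) m (z 0) \<le> e / 32 + \<eta>'" for m
    proof -
      have "Nv (wt \<sigma> Q) m (z 0) = Nv (wt \<sigma> Q) m (\<lambda>n. x0 n + (z 0 n - x0 n))" by simp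
      also have "\<dots> \<le> Nv (wt \<sigma> Q) m x0 + Nv (wt \<sigma> Q) m (\<lambda>n. z 0 n - x0 n)"
        using Q by (intro Nv_triangle) auto
      also have "Nv (wt \<sigma> Q) m (\<lambda>n. z 0 n - x0 n) \<le> Nv (wt \<sigma> 0) m (\<lambda>n. z 0 n - x0 n)"
        using Q by (intro Nv_mono_weight wt_le) auto
      also have "\<dots> \<le> \<eta>'" using \<eta> by (simp add: bdd_def \<eta>'_def)
      finally show ?thesis using Q(2)[of m] by simp
    qed
    show "bdd e (\<lambda>n. z t n - y t n)" unfolding bdd_def
    proof
      fix m
      have w: "Nv (\<lambda>_. 1) m (\<lambda>n. z t n - y t n) \<le> \<eta>' * exp (C1 (2 * R) * \<bar>t\<bar>)"
        by (rule seqsol_stable[OF y(1) b(1) z(1) b(2) t Dw])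
      also have "\<dots> \<le> \<eta>' * exp (C1 (2 * R) * Tm R)"
      proof (rule mult_left_mono[OF _ \<eta>0])
        have "C1 (2 * R) * \<bar>t\<bar> \<le> C1 (2 * R) * Tm R"
          using t R C1_ge0[of "2 * R"] by (intro mult_left_mono) auto
        then show "exp (C1 (2 * R) * \<bar>t\<bar>) \<le> exp (C1 (2 * R) * Tm R)" by simp
      qed
      finally have w: "Nv (\<lambda>_. 1) m (\<lambda>n. z t n - y t n) \<le> \<eta>' * exp (C1 (2 * R) * Tm R)" .
      have "Nv (wt \<sigma> 0) m (\<lambda>n. z t n - y t n)
         \<le> 2 * Nv (wt \<sigma> Q) m (\<lambda>n. z t n - y t n) + Q powr \<sigma> * Nv (\<lambda>_. 1) m (\<lambda>n. z t n - y t n)"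
        using wt_split[OF Q(1), of \<sigma>] \<sigma> by (intro Nv_weight_add) auto
      also have "\<dots> \<le> 2 * (2 * (e / 32 + \<eta>') + 2 * (e / 32)) + Q powr \<sigma> * (\<eta>' * exp (C1 (2 * R) * Tm R))"
      proof (intro add_mono mult_left_mono w)
        have "Nv (wt \<sigma> Q) m (\<lambda>n. z t n - y t n) \<le> Nv (wt \<sigma> Q) m (z t) + Nv (wt \<sigma> Q) m (y t)"
          using Q by (intro Nv_diff) auto
        then show "Nv (wt \<sigma> Q) m (\<lambda>n. z t n - y t n) \<le> 2 * (e / 32 + \<eta>') + 2 * (e / 32)"
          using yt'[OF t Q, of m] zt'[OF t Q(1) zQ, of m] yy[OF t] zz[OF t] by simp
      qed auto
      also have "\<dots> = e / 4 + \<eta>' * A" by (simp add: A_def algebra_simps)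
      also have "\<dots> = e / 4 + e / 4" using A by (simp add: \<eta>'_def)
      also have "\<dots> \<le> e" using e by simp
      finally show "Nv (wt \<sigma> 0) m (\<lambda>n. z t n - y t n) \<le> e" .
    qed
  qed
qed

end

text \<open>The embedding \<open>X1_le\<close> is Cauchy-Schwarz with the sequence
  \<open>jb n powr (1 - \<sigma>)\<close>, which is square summable because \<sigma> > 3/2.\<close>

lemma ch2_exists:
  assumes \<sigma>: "3/2 < (\<sigma>::real)"
  obtains K c where "ch2 \<sigma> K c"
proof -
  obtain K1 where K1: "1 \<le> K1" "\<And>R. 0 \<le> R \<Longrightarrow> admw K1 K1 (wt \<sigma> R)" using admw_wt[of \<sigma>] \<sigma> by auto
  obtain K2 where K2: "1 \<le> K2" "\<And>R. 0 \<le> R \<Longrightarrow> admw K2 K2 (wt (\<sigma> - 1) R)" using admw_wt[of "\<sigma> - 1"] \<sigma> by auto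
  \<comment> \<open>One constant is wanted for two orders: \<sigma> for the energy and \<sigma> - 1
    for the time derivative.\<close>
  define K where "K = max K1 K2"
  have adm: "admw K K (wt \<sigma> R)" if R: "0 \<le> R" for R
  proof -
    have m: "K1 * wt \<sigma> R k + K1 * wt \<sigma> R j \<le> K * wt \<sigma> R k + K * wt \<sigma> R j" for j k
      using R by (intro add_mono mult_right_mono) (auto simp: K_def)
    have "jb j * (K1 * wt \<sigma> R k + K1 * wt \<sigma> R j) \<le> jb j * (K * wt \<sigma> R k + K * wt \<sigma> R j)" for j k
      by (intro mult_left_mono m) auto
    note m2 = this
    have a: "\<And>n. 0 \<le> wt \<sigma> R n" "\<And>j k. wt \<sigma> R (j + k) \<le> K1 * wt \<sigma> R k + K1 * wt \<sigma> R j"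
      "\<And>j k. \<bar>wt \<sigma> R (j + k) - wt \<sigma> R k\<bar> * jb k \<le> jb j * (K1 * wt \<sigma> R k + K1 * wt \<sigma> R j)"
      using K1(2)[OF R] by (simp_all add: admw_def)
    show ?thesis
      unfolding admw_def
      by (intro conjI allI a order_trans[OF a(2) m] order_trans[OF a(3) m2]) (use K1 in \<open>auto simp: K_def\<close>)
  qed
  have V: "wt (\<sigma> - 1) 0 (j + k) \<le> K * wt (\<sigma> - 1) 0 k + K * wt (\<sigma> - 1) 0 j" for j k
  proof -
    have "wt (\<sigma> - 1) 0 (j + k) \<le> K2 * wt (\<sigma> - 1) 0 k + K2 * wt (\<sigma> - 1) 0 j" using K2(2)[of 0] by (simp add: admw_def)
    also have "\<dots> \<le> K * wt (\<sigma> - 1) 0 k + K * wt (\<sigma> - 1) 0 j"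
      by (intro add_mono mult_right_mono) (auto simp: K_def)
    finally show ?thesis .
  qed
  have "1 < 2 * \<sigma> - 2" using \<sigma> by simp
  then obtain C where C: "0 \<le> C" "\<And>m. (\<Sum>n\<in>win m. jb n powr (- (2 * \<sigma> - 2))) \<le> C"
    using jb_powr_sum_bound by blast
  have X: "X1 m y \<le> sqrt C * Nv (wt \<sigma> 0) m y" for m y
  proof -
    have "X1 m y = (\<Sum>n\<in>win m. \<bar>jb n powr (1 - \<sigma>)\<bar> * \<bar>wt \<sigma> 0 n * sz n (y n)\<bar>)"
      unfolding X1_def
    proof (intro sum.cong refl)
      fix n
      have "jb n = jb n powr (1 - \<sigma>) * wt \<sigma> 0 n" by (simp add: wt_0 powr_add[symmetric])
      then have "jb n * sz n (y n) = (jb n powr (1 - \<sigma>) * wt \<sigma> 0 n) * sz n (y n)" by simp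
      then show "jb n * sz n (y n) = \<bar>jb n powr (1 - \<sigma>)\<bar> * \<bar>wt \<sigma> 0 n * sz n (y n)\<bar>"
        by (simp add: mult.assoc)
    qed
    also have "\<dots> \<le> L2_set (\<lambda>n. jb n powr (1 - \<sigma>)) (win m) * Nv (wt \<sigma> 0) m y"
      unfolding Nv_def by (rule L2_set_mult_ineq)
    also have "L2_set (\<lambda>n. jb n powr (1 - \<sigma>)) (win m) \<le> sqrt C"
    proof -
      have "(jb n powr (1 - \<sigma>))\<^sup>2 = jb n powr (- (2 * \<sigma> - 2))" for n
        by (simp add: power2_eq_square powr_add[symmetric])
      then show ?thesis unfolding L2_set_def using C(2)[of m] by simp
    qed
    finally show ?thesis by (simp add: mult_right_mono)
  qed
  have "ch2 \<sigma> K (sqrt C)"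
    by unfold_locales (use \<sigma> K1(1) C adm V X in \<open>auto simp: K_def\<close>)
  then show ?thesis using that by blast
qed

subsection \<open>Fourier coefficients on the circle\<close>

text \<open>One period as a measure space of its own: being finite, it makes bounded measurable
  functions integrable, and set integrals become plain ones.\<close>

definition m01 :: "real measure" where
  "m01 = restrict_space lborel {0..1}"

definition ee :: "int \<Rightarrow> real \<Rightarrow> complex" where
  "ee n x = cis (2 * pi * of_int n * x)"

definition fco :: "(real \<Rightarrow> complex) \<Rightarrow> int \<Rightarrow> complex" where
  "fco g n = integral\<^sup>L m01 (\<lambda>x. g x * ee (- n) x)"

lemma space_m01 [simp]: "space m01 = {0..1}"
  by (simp add: m01_def space_restrict_space)

lemma finite_measure_m01: "finite_measure m01"
  by (rule finite_measureI) (simp add: m01_def emeasure_restrict_space space_restrict_space)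

lemma measure_m01 [simp]: "measure m01 {0..1} = 1"
  by (simp add: m01_def measure_restrict_space)

lemma set_integral_m01:
  fixes f :: "real \<Rightarrow> 'b::{banach, second_countable_topology}"
  shows "(LINT x:{0..1}|lborel. f x) = integral\<^sup>L m01 f"
  by (simp add: m01_def integral_restrict_space set_lebesgue_integral_def)

lemma set_integrable_m01:
  fixes f :: "real \<Rightarrow> 'b::{banach, second_countable_topology}"
  shows "set_integrable lborel {0..1} f \<longleftrightarrow> integrable m01 f"
  by (simp add: m01_def integrable_restrict_space set_integrable_def)

lemma measurable_m01: "f \<in> borel_measurable borel \<Longrightarrow> f \<in> borel_measurable m01"
  by (simp add: m01_def measurable_restrict_space1)

lemma AE_m01: "(AE x in m01. P x) \<longleftrightarrow> (AE x in lborel. x \<in> {0..1} \<longrightarrow> P x)"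
  unfolding m01_def by (rule AE_restrict_space_iff) simp

lemma integrable_m01_bounded:
  fixes f :: "real \<Rightarrow> 'b::{banach, second_countable_topology}"
  assumes "f \<in> borel_measurable borel" "\<And>x. x \<in> {0..1} \<Longrightarrow> norm (f x) \<le> B"
  shows "integrable m01 f"
proof (rule finite_measure.integrable_const_bound[OF finite_measure_m01])
  show "AE x in m01. norm (f x) \<le> B" by (rule AE_I2) (use assms(2) in simp)
qed (rule measurable_m01[OF assms(1)])

lemma bounded_on_01:
  fixes F :: "real \<Rightarrow> 'b::real_normed_vector"
  assumes "continuous_on UNIV F"
  obtains B where "0 \<le> B" "\<And>x. x \<in> {0..1} \<Longrightarrow> norm (F x) \<le> B"
proof -
  have "compact (F ` {0..1})" by (intro compact_continuous_image continuous_on_subset[OF assms]) auto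
  then obtain B where "\<And>x. x \<in> {0..1} \<Longrightarrow> norm (F x) \<le> B"
    using compact_imp_bounded bounded_iff by (metis imageI)
  note B = this
  have "0 \<le> B" by (rule order_trans[OF norm_ge_zero B[of 0]]) simp
  then show ?thesis using that B by blast
qed

lemma integrable_m01_continuous:
  fixes f :: "real \<Rightarrow> 'b::{banach, second_countable_topology}"
  assumes "continuous_on UNIV f"
  shows "integrable m01 f"
proof -
  obtain B where "\<And>x. x \<in> {0..1} \<Longrightarrow> norm (f x) \<le> B" using bounded_on_01[OF assms] by blast
  then show ?thesis by (intro integrable_m01_bounded borel_measurable_continuous_onI assms)
qed

lemma integrable_m01_mult:
  fixes h F :: "real \<Rightarrow> complex"
  assumes h: "integrable m01 h" and F: "continuous_on UNIV F"
  shows "integrable m01 (\<lambda>x. h x * F x)"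
proof -
  obtain B where B: "0 \<le> B" "\<And>x. x \<in> {0..1} \<Longrightarrow> norm (F x) \<le> B" using bounded_on_01[OF F] by blast
  show ?thesis
  proof (rule Bochner_Integration.integrable_bound)
    show "integrable m01 (\<lambda>x. B * norm (h x))" using h by simp
    have [measurable]: "h \<in> borel_measurable m01" using h by simp
    have [measurable]: "F \<in> borel_measurable m01" using F by (intro measurable_m01 borel_measurable_continuous_onI)
    show "(\<lambda>x. h x * F x) \<in> borel_measurable m01" by (rule borel_measurable_times) fact+
    show "AE x in m01. norm (h x * F x) \<le> norm (B * norm (h x))"
    proof (rule AE_I2)
      fix x assume "x \<in> space m01"
      then have "norm (h x) * norm (F x) \<le> norm (h x) * B" using B(2) by (intro mult_left_mono) auto
      then show "norm (h x * F x) \<le> norm (B * norm (h x))"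
        using B(1) by (simp only: norm_mult real_norm_def abs_mult abs_of_nonneg abs_norm_cancel mult.commute)
    qed
  qed
qed

lemma ee_0 [simp]: "ee 0 x = 1" by (simp add: ee_def)

lemma ee_add: "ee (n + k) x = ee n x * ee k x"
  by (simp add: ee_def cis_mult algebra_simps)

lemma norm_ee [simp]: "cmod (ee n x) = 1" by (simp add: ee_def)

lemma cnj_ee: "cnj (ee n x) = ee (- n) x" by (simp add: ee_def cis_cnj)

lemma ee_exp: "ee n x = exp (dsym n * of_real x)"
  by (simp add: ee_def dsym_def cis_conv_exp mult_ac)

lemma ee_period: "ee n (x + 1) = ee n x"
proof -
  have "ee n (x + 1) = ee n x * cis (2 * pi * of_int n)"
    by (simp add: ee_def cis_mult algebra_simps)
  also have "cis (2 * pi * of_int n) = 1" using cis_multiple_2pi[of "of_int n"] by simp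
  finally show ?thesis by simp
qed

lemma ee_vd: "((\<lambda>x. ee n x) has_vector_derivative dsym n * ee n x) (at x within S)"
proof -
  have "((\<lambda>z. exp (dsym n * z)) has_field_derivative dsym n * exp (dsym n * of_real x)) (at (of_real x))"
    by (auto intro!: derivative_eq_intros)
  from has_vector_derivative_real_field[OF this] show ?thesis
    unfolding ee_exp by (rule has_vector_derivative_at_within)
qed

lemma continuous_ee: "continuous_on S (ee n)"
  unfolding ee_def[abs_def] by (intro continuous_intros)

lemma measurable_ee [measurable]: "ee n \<in> borel_measurable borel"
  by (intro borel_measurable_continuous_onI continuous_ee)

lemma fourier_coeff_fco: "fourier_coeff f n = fco (\<lambda>x. of_real (f x)) n"
proof -
  have "cis (- 2 * pi * of_int n * x) = ee (- n) x" for x by (simp add: ee_def)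
  then show ?thesis unfolding fourier_coeff_def fco_def set_integral_m01 by simp
qed

lemma integral_vd_m01:
  fixes F :: "real \<Rightarrow> complex"
  assumes "\<And>x. (F has_vector_derivative f x) (at x)" "continuous_on UNIV f"
  shows "integral\<^sup>L m01 f = F 1 - F 0"
proof -
  have "integral\<^sup>L lborel (\<lambda>x. indicator {0..1} x *\<^sub>R f x) = F 1 - F 0"
    using assms by (intro integral_FTC_atLeastAtMost)
      (auto intro: has_vector_derivative_at_within continuous_on_subset)
  then show ?thesis by (simp add: m01_def integral_restrict_space)
qed

lemma integral_ee: "integral\<^sup>L m01 (ee n) = (if n = 0 then 1 else 0)"
proof (cases "n = 0")
  case False
  then have d: "dsym n \<noteq> 0" by (simp add: dsym_def)
  have "integral\<^sup>L m01 (ee n) = ee n 1 / dsym n - ee n 0 / dsym n"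
  proof (rule integral_vd_m01)
    show "((\<lambda>x. ee n x / dsym n) has_vector_derivative ee n x) (at x)" for x
      using has_vector_derivative_divide[OF ee_vd[of n x UNIV], of "dsym n"] d by simp
  qed (rule continuous_ee)
  also have "ee n 1 = ee n 0" using ee_period[of n 0] by simp
  finally show ?thesis using False by simp
next
  case True
  have "ee 0 = (\<lambda>x. 1)" by (rule ext) simp
  then show ?thesis using True by simp
qed

lemma circ_L2D:
  assumes "f \<in> circ_L2"
  shows "periodic1 f" "f \<in> borel_measurable borel" "integrable m01 (\<lambda>x. (f x)\<^sup>2)" "integrable m01 f"
proof -
  show 1: "periodic1 f" "f \<in> borel_measurable borel" "integrable m01 (\<lambda>x. (f x)\<^sup>2)"
    using assms by (auto simp: circ_L2_def set_integrable_m01)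
  show "integrable m01 f"
  proof (rule Bochner_Integration.integrable_bound)
    show "integrable m01 (\<lambda>x. 1 + (f x)\<^sup>2)"
      by (intro Bochner_Integration.integrable_add 1(3) integrable_m01_continuous continuous_on_const)
    have "\<bar>a\<bar> \<le> 1 + a\<^sup>2" for a :: real
      using sum_squares_bound[of 1 "\<bar>a\<bar>"] by (simp add: power2_abs)
    then show "AE x in m01. norm (f x) \<le> norm (1 + (f x)\<^sup>2)"
      by (intro AE_I2) (simp add: add_nonneg_nonneg)
  qed (rule measurable_m01[OF 1(2)])
qed

lemma circ_L2I:
  "periodic1 f \<Longrightarrow> f \<in> borel_measurable borel \<Longrightarrow> integrable m01 (\<lambda>x. (f x)\<^sup>2) \<Longrightarrow> f \<in> circ_L2"
  by (auto simp: circ_L2_def set_integrable_m01)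

lemma circ_L2_add:
  assumes "f \<in> circ_L2" "g \<in> circ_L2"
  shows "(\<lambda>x. f x + g x) \<in> circ_L2"
proof (rule circ_L2I)
  note f = circ_L2D[OF assms(1)] and g = circ_L2D[OF assms(2)]
  have [measurable]: "f \<in> borel_measurable borel" "g \<in> borel_measurable borel" using f g by auto
  show "periodic1 (\<lambda>x. f x + g x)" using f g by (simp add: periodic1_def)
  show "(\<lambda>x. f x + g x) \<in> borel_measurable borel" by measurable
  show "integrable m01 (\<lambda>x. (f x + g x)\<^sup>2)"
  proof (rule Bochner_Integration.integrable_bound)
    show "integrable m01 (\<lambda>x. 2 * (f x)\<^sup>2 + 2 * (g x)\<^sup>2)" using f g by simp
    show "(\<lambda>x. (f x + g x)\<^sup>2) \<in> borel_measurable m01" by (rule measurable_m01) measurable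
    have "(a + b)\<^sup>2 \<le> 2 * a\<^sup>2 + 2 * b\<^sup>2" for a b :: real
      using sum_squares_bound[of a b] by (simp add: power2_sum)
    then show "AE x in m01. norm ((f x + g x)\<^sup>2) \<le> norm (2 * (f x)\<^sup>2 + 2 * (g x)\<^sup>2)"
      by (intro AE_I2) (simp add: add_nonneg_nonneg)
  qed
qed

lemma circ_L2_cmult: "f \<in> circ_L2 \<Longrightarrow> (\<lambda>x. a * f x) \<in> circ_L2"
  using circ_L2D[of f] by (intro circ_L2I) (auto simp: periodic1_def power_mult_distrib)

lemma circ_L2_diff: "f \<in> circ_L2 \<Longrightarrow> g \<in> circ_L2 \<Longrightarrow> (\<lambda>x. f x - g x) \<in> circ_L2"
  using circ_L2_add[of f "\<lambda>x. - 1 * g x"] circ_L2_cmult[of g "- 1"] by simp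

lemma fourier_coeff_add:
  assumes "f \<in> circ_L2" "g \<in> circ_L2"
  shows "fourier_coeff (\<lambda>x. f x + g x) n = fourier_coeff f n + fourier_coeff g n"
  using assms[THEN circ_L2D(4)] unfolding fourier_coeff_fco fco_def
  by (simp add: distrib_right integrable_m01_mult continuous_ee)

lemma fourier_coeff_diff:
  assumes "f \<in> circ_L2" "g \<in> circ_L2"
  shows "fourier_coeff (\<lambda>x. f x - g x) n = fourier_coeff f n - fourier_coeff g n"
  using assms[THEN circ_L2D(4)] unfolding fourier_coeff_fco fco_def
  by (simp add: left_diff_distrib integrable_m01_mult continuous_ee)

lemma fourier_coeff_cmult: "fourier_coeff (\<lambda>x. a * f x) n = of_real a * fourier_coeff f n"
  unfolding fourier_coeff_fco fco_def by (simp add: mult.assoc)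

lemma fourier_coeff_minus: "fourier_coeff f (- n) = cnj (fourier_coeff f n)"
  unfolding fourier_coeff_fco fco_def Bochner_Integration.integral_cnj[symmetric]
  by (simp only: complex_cnj_mult complex_cnj_complex_of_real cnj_ee minus_minus)

lemma fourier_coeff_cong:
  assumes "f \<in> borel_measurable borel" "g \<in> borel_measurable borel" "f \<doteq> g"
  shows "fourier_coeff f n = fourier_coeff g n"
  unfolding fourier_coeff_fco fco_def
proof (rule integral_cong_AE)
  show "AE x in m01. complex_of_real (f x) * ee (- n) x = complex_of_real (g x) * ee (- n) x"
    using assms(3) unfolding AE_m01 circ_eq_def by eventually_elim simp
  have [measurable]: "f \<in> borel_measurable borel" "g \<in> borel_measurable borel" by (fact assms)+
  show "(\<lambda>x. complex_of_real (f x) * ee (- n) x) \<in> borel_measurable m01"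
    "(\<lambda>x. complex_of_real (g x) * ee (- n) x) \<in> borel_measurable m01"
    by (rule measurable_m01, measurable)+
qed

lemma cmod_fourier_coeff_le:
  assumes "f \<in> circ_L2"
  shows "cmod (fourier_coeff f n) \<le> integral\<^sup>L m01 (\<lambda>x. \<bar>f x\<bar>)"
proof -
  have "cmod (fourier_coeff f n) \<le> integral\<^sup>L m01 (\<lambda>x. norm (complex_of_real (f x) * ee (- n) x))"
    unfolding fourier_coeff_fco fco_def by (rule integral_norm_bound)
  then show ?thesis by (simp add: norm_mult)
qed

text \<open>\<open>\<doteq>\<close> refers to the whole line, which is covered by countably many
  integer translates of one period.\<close>

lemma circ_eqI_m01:
  assumes p: "periodic1 f" "periodic1 g" and m: "f \<in> borel_measurable borel" "g \<in> borel_measurable borel"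
    and ae: "AE x in m01. f x = g x"
  shows "f \<doteq> g"
proof -
  have per: "F (x + of_int k) = F x" if "periodic1 F" for F :: "real \<Rightarrow> real" and x k
  proof (induction k rule: int_induct[where k = 0])
    case (step1 i)
    have "F (x + of_int (i + 1)) = F ((x + of_int i) + 1)" by (simp add: add.assoc)
    then show ?case using that step1 by (simp add: periodic1_def)
  next
    case (step2 i)
    have "F (x + of_int (i - 1)) = F ((x + of_int (i - 1)) + 1)" using that unfolding periodic1_def by metis
    also have "(x + of_int (i - 1)) + 1 = x + real_of_int i" by simp
    finally show ?case using step2 by simp
  qed simp
  have [measurable]: "f \<in> borel_measurable borel" "g \<in> borel_measurable borel" by (fact m)+
  have "AE x in lborel. x - of_int k \<in> {0..1} \<longrightarrow> f x = g x" for k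
  proof -
    have "AE x in distr lborel borel ((+) (of_int k)). x - of_int k \<in> {0..1} \<longrightarrow> f x = g x"
    proof (subst AE_distr_iff)
      show "{x \<in> space borel. x - real_of_int k \<in> {0..1} \<longrightarrow> f x = g x} \<in> sets borel" by measurable
      show "AE x in lborel. real_of_int k + x - real_of_int k \<in> {0..1} \<longrightarrow> f (real_of_int k + x) = g (real_of_int k + x)"
        using ae per[OF p(1)] per[OF p(2)] unfolding AE_m01 by (simp add: add.commute)
    qed simp
    then show ?thesis by (simp only: lborel_distr_plus)
  qed
  then have "AE x in lborel. \<forall>k::int. x - of_int k \<in> {0..1} \<longrightarrow> f x = g x"
    unfolding AE_all_countable by blast
  then show ?thesis unfolding circ_eq_def
  proof eventually_elim
    case (elim x)
    have "x - of_int \<lfloor>x\<rfloor> \<in> {0..1}" by (simp add: of_int_floor_le) linarith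
    then show ?case using elim by blast
  qed
qed

text \<open>Uniqueness: the annihilator of all characters is stable under multiplication by polynomials in
  the point of the unit circle, hence, by Stone--Weierstrass, by continuous functions on the circle.\<close>

lemma integral_polynomial_zero:
  assumes h: "integrable m01 (h :: real \<Rightarrow> complex)" and g: "real_polynomial_function (g :: complex \<Rightarrow> real)"
    and F: "continuous_on UNIV F" and z: "\<And>k. integral\<^sup>L m01 (\<lambda>x. h x * F x * ee k x) = 0"
  shows "integral\<^sup>L m01 (\<lambda>x. h x * (F x * of_real (g (ee 1 x))) * ee k x) = 0"
  using g F z
proof (induction g arbitrary: F k)
  case (linear f)
  note F = linear.prems(1) and z = linear.prems(2)
  \<comment> \<open>A real-linear functional on the complex plane is a combination of w and cnj w,
    that is, of \<open>ee 1\<close> and \<open>ee (- 1)\<close> on the circle. The linear case thus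
    only shifts the character index.\<close>
  have e: "complex_of_real (f w) = of_real (f 1) * ((w + cnj w) / 2) + of_real (f \<i>) * ((w - cnj w) / (2 * \<i>))" for w
  proof -
    interpret bounded_linear f by (fact linear.hyps)
    have "w = Re w *\<^sub>R 1 + Im w *\<^sub>R \<i>" by (simp add: complex_eq_iff)
    then have "f w = f (Re w *\<^sub>R 1 + Im w *\<^sub>R \<i>)" by (rule arg_cong)
    also have "\<dots> = Re w * f 1 + Im w * f \<i>" by (simp only: add scaleR real_scaleR_def)
    finally have "f w = Re w * f 1 + Im w * f \<i>" .
    moreover have "(w + cnj w) / 2 = of_real (Re w)" "(w - cnj w) / (2 * \<i>) = of_real (Im w)"
      by (simp_all add: complex_eq_iff)
    ultimately show ?thesis by (simp only: of_real_add of_real_mult mult.commute)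
  qed
  define a where "a = of_real (f 1) / 2 + of_real (f \<i>) / (2 * \<i>)"
  define b where "b = of_real (f 1) / 2 - of_real (f \<i>) / (2 * \<i>)"
  have e2: "h x * (F x * of_real (f (ee 1 x))) * ee k x = a * (h x * F x * ee (k + 1) x) + b * (h x * F x * ee (k - 1) x)" for x
  proof -
    have 1: "ee (k + 1) x = ee k x * ee 1 x" "ee (k - 1) x = ee k x * ee (- 1) x"
      using ee_add[of k 1 x] ee_add[of k "-1" x] by simp_all
    show ?thesis unfolding e[of "ee 1 x"] cnj_ee 1 a_def b_def by (simp add: field_simps)
  qed
  have i: "integrable m01 (\<lambda>x. h x * F x * ee j x)" for j
    unfolding mult.assoc by (intro integrable_m01_mult h continuous_intros F continuous_ee)
  show ?case unfolding e2 using i z by simp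
next
  case (const a)
  have "(\<lambda>x. h x * (F x * of_real a) * ee k x) = (\<lambda>x. of_real a * (h x * F x * ee k x))" by (auto simp: mult_ac)
  then show ?case using const.prems(2)[of k] by simp
next
  case (add f g)
  have c: "continuous_on UNIV (\<lambda>x. complex_of_real (p (ee 1 x)))" if "real_polynomial_function p" for p
  proof -
    have "continuous_on UNIV p"
      using continuous_real_polymonial_function[OF that] by (intro continuous_at_imp_continuous_on) blast
    then show ?thesis
      by (intro continuous_on_of_real continuous_on_compose2[of UNIV p UNIV "ee 1"] continuous_ee) auto
  qed
  have i: "integrable m01 (\<lambda>x. h x * (F x * complex_of_real (p (ee 1 x))) * ee k x)" if "real_polynomial_function p" for p
    unfolding mult.assoc by (intro integrable_m01_mult h continuous_intros add.prems(1) continuous_ee c that)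
  show ?case
    using add.IH(1)[OF add.prems, of k] add.IH(2)[OF add.prems, of k] i[OF add.hyps(1)] i[OF add.hyps(2)]
    by (simp add: algebra_simps)
next
  case (mult f g)
  have c: "continuous_on UNIV (\<lambda>x. F x * complex_of_real (f (ee 1 x)))"
  proof -
    have "continuous_on UNIV f"
      using continuous_real_polymonial_function[OF mult.hyps(1)] by (intro continuous_at_imp_continuous_on) blast
    then show ?thesis
      by (intro continuous_on_mult mult.prems(1) continuous_on_of_real
          continuous_on_compose2[of UNIV f UNIV "ee 1"] continuous_ee) auto
  qed
  \<comment> \<open>The hypothesis for g is used with the continuous factor F f, which annihilates
    all characters by the hypothesis for f. This is why F is kept arbitrary in the
    induction.\<close>
  have "integral\<^sup>L m01 (\<lambda>x. h x * (F x * complex_of_real (f (ee 1 x)) * complex_of_real (g (ee 1 x))) * ee k x) = 0"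
    by (rule mult.IH(2)[OF c mult.IH(1)[OF mult.prems]])
  then show ?case by (simp add: mult.assoc)
qed

lemma integral_continuous_zero:
  assumes h: "integrable m01 (h :: real \<Rightarrow> complex)" and z: "\<And>k. integral\<^sup>L m01 (\<lambda>x. h x * ee k x) = 0"
    and \<phi>: "continuous_on UNIV (\<phi> :: complex \<Rightarrow> real)"
  shows "integral\<^sup>L m01 (\<lambda>x. h x * of_real (\<phi> (ee 1 x))) = 0"
proof -
  define I where "I = integral\<^sup>L m01 (\<lambda>x. norm (h x))"
  have I0: "0 \<le> I" by (simp add: I_def)
  have c: "continuous_on UNIV (\<lambda>x. complex_of_real (p (ee 1 x)))" if "continuous_on UNIV p" for p :: "complex \<Rightarrow> real"
    by (intro continuous_on_of_real continuous_on_compose2[OF that continuous_ee]) auto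
  have "norm (integral\<^sup>L m01 (\<lambda>x. h x * of_real (\<phi> (ee 1 x)))) \<le> 0 + e" if "0 < e" for e
  proof -
    have "0 < e / (I + 1)" using that I0 by simp
    then obtain g where g: "real_polynomial_function g" "\<And>z. z \<in> sphere 0 1 \<Longrightarrow> \<bar>\<phi> z - g z\<bar> < e / (I + 1)"
      using Stone_Weierstrass_real_polynomial_function[of "sphere 0 (1::real)" \<phi>]
        continuous_on_subset[OF \<phi>] by (metis compact_sphere subset_UNIV)
    have gc: "continuous_on UNIV g"
      using continuous_real_polymonial_function[OF g(1)] by (simp add: continuous_at_imp_continuous_on)
    have "integral\<^sup>L m01 (\<lambda>x. h x * (1 * of_real (g (ee 1 x))) * ee 0 x) = 0"
      by (rule integral_polynomial_zero[OF h g(1)]) (use z in auto)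
    then have g0: "integral\<^sup>L m01 (\<lambda>x. h x * of_real (g (ee 1 x))) = 0" by simp
    have i: "integrable m01 (\<lambda>x. h x * complex_of_real (\<phi> (ee 1 x)))" "integrable m01 (\<lambda>x. h x * complex_of_real (g (ee 1 x)))"
      by (intro integrable_m01_mult h c \<phi> gc)+
    have "integral\<^sup>L m01 (\<lambda>x. h x * of_real (\<phi> (ee 1 x))) = integral\<^sup>L m01 (\<lambda>x. h x * of_real (\<phi> (ee 1 x)) - h x * of_real (g (ee 1 x)))"
      using i g0 by simp
    also have "norm \<dots> \<le> integral\<^sup>L m01 (\<lambda>x. norm (h x * of_real (\<phi> (ee 1 x)) - h x * of_real (g (ee 1 x))))"
      by (rule integral_norm_bound)
    also have "\<dots> \<le> integral\<^sup>L m01 (\<lambda>x. norm (h x) * (e / (I + 1)))"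
    proof (rule integral_mono)
      show "integrable m01 (\<lambda>x. norm (h x * of_real (\<phi> (ee 1 x)) - h x * of_real (g (ee 1 x))))"
        by (intro integrable_norm Bochner_Integration.integrable_diff i)
      show "integrable m01 (\<lambda>x. norm (h x) * (e / (I + 1)))"
        by (intro integrable_mult_left integrable_norm h)
      fix x
      have "norm (h x * of_real (\<phi> (ee 1 x)) - h x * of_real (g (ee 1 x))) = norm (h x) * \<bar>\<phi> (ee 1 x) - g (ee 1 x)\<bar>"
        unfolding right_diff_distrib[symmetric] of_real_diff[symmetric] norm_mult norm_of_real ..
      also have "\<dots> \<le> norm (h x) * (e / (I + 1))"
        using g(2)[of "ee 1 x"] by (intro mult_left_mono) auto
      finally show "norm (h x * of_real (\<phi> (ee 1 x)) - h x * of_real (g (ee 1 x))) \<le> norm (h x) * (e / (I + 1))" .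
    qed
    also have "\<dots> = I * (e / (I + 1))" by (simp add: I_def)
    also have "\<dots> \<le> e"
      using I0 that by (simp add: divide_simps)
    finally show ?thesis by simp
  qed
  then have "norm (integral\<^sup>L m01 (\<lambda>x. h x * of_real (\<phi> (ee 1 x)))) \<le> 0" by (rule field_le_epsilon)
  then show ?thesis by simp
qed

lemma ee_eq_iff: "ee 1 x = ee 1 y \<longleftrightarrow> (\<exists>k::int. x = y + of_int k)"
proof
  assume "ee 1 x = ee 1 y"
  then have "cos (2 * pi * x - 2 * pi * y) = 1"
    by (simp add: ee_def complex_eq_iff cos_diff)
  then obtain k :: int where "2 * pi * x - 2 * pi * y = of_int k * 2 * pi"
    unfolding cos_one_2pi_int by blast
  then have "2 * pi * (x - y) = 2 * pi * of_int k" by (simp add: algebra_simps)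
  then have "x - y = of_int k" by simp
  then show "\<exists>k::int. x = y + of_int k" by (intro exI[of _ k]) linarith
next
  assume "\<exists>k::int. x = y + of_int k"
  then obtain k :: int where k: "x = y + of_int k" by blast
  have "ee 1 x = ee 1 y * cis (2 * pi * of_int k)"
    unfolding k by (simp add: ee_def cis_mult algebra_simps)
  then show "ee 1 x = ee 1 y" using cis_multiple_2pi[of "of_int k"] by simp
qed

text \<open>The indicator of an open set is the pointwise limit of truncated multiples of the
  distance to its complement on the circle, and dominated convergence applies.\<close>

lemma integral_open_zero:
  assumes h: "integrable m01 (h :: real \<Rightarrow> complex)" and z: "\<And>k. integral\<^sup>L m01 (\<lambda>x. h x * ee k x) = 0"
    and V: "open (V :: real set)"
  shows "integral\<^sup>L m01 (\<lambda>x. indicator V x *\<^sub>R h x) = 0"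
proof -
  \<comment> \<open>Removing the endpoints, a null set, makes the map to the circle injective on the
    set, so that its complement in one period has a disjoint compact image.\<close>
  define V' where "V' = V \<inter> {0<..<1}"
  define C where "C = ee 1 ` ({0..1} - V')"
  have "compact ({0..1} - V')"
    unfolding V'_def using V by (intro compact_diff open_Int) auto
  then have cC: "compact C" unfolding C_def by (intro compact_continuous_image continuous_ee)
  have "0 \<in> {0..1} - V'" by (simp add: V'_def)
  then have C0: "C \<noteq> {}" unfolding C_def by blast
  define \<phi> where "\<phi> k z = min 1 (real k * infdist z C)" for k :: nat and z
  have \<phi>c: "continuous_on UNIV (\<phi> k)" for k
    unfolding \<phi>_def by (intro continuous_intros)
  have inC: "ee 1 x \<in> C \<longleftrightarrow> x \<notin> V'" if x: "x \<in> {0..1}" for x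
  proof
    assume "ee 1 x \<in> C"
    then obtain y where y: "y \<in> {0..1}" "y \<notin> V'" "ee 1 x = ee 1 y" by (auto simp: C_def)
    show "x \<notin> V'"
    proof
      assume "x \<in> V'"
      then have x01: "0 < x" "x < 1" by (auto simp: V'_def)
      obtain k :: int where k: "x = y + of_int k" using y(3) ee_eq_iff by blast
      then have "-1 < real_of_int k" "real_of_int k < 1" using x01 y(1) by auto
      then have "k = 0" by linarith
      then show False using k y(2) \<open>x \<in> V'\<close> by simp
    qed
  qed (use x in \<open>auto simp: C_def\<close>)
  have lim: "(\<lambda>k. h x * of_real (\<phi> k (ee 1 x))) \<longlonglongrightarrow> indicator V' x *\<^sub>R h x" if x: "x \<in> {0..1}" for x
  proof (cases "x \<in> V'")
    case True
    then have "ee 1 x \<notin> C" using inC[OF x] by simp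
    then have d: "0 < infdist (ee 1 x) C"
      using in_closed_iff_infdist_zero[OF compact_imp_closed[OF cC] C0] infdist_nonneg[of "ee 1 x" C] by fastforce
    have "\<forall>\<^sub>F k in sequentially. \<phi> k (ee 1 x) = 1"
      using eventually_ge_at_top[of "nat \<lceil>1 / infdist (ee 1 x) C\<rceil>"]
    proof eventually_elim
      case (elim k)
      then have "1 / infdist (ee 1 x) C \<le> real k" by linarith
      then have "1 \<le> real k * infdist (ee 1 x) C" using d by (simp add: field_simps)
      then show ?case by (simp add: \<phi>_def)
    qed
    then have "\<forall>\<^sub>F k in sequentially. h x * of_real (\<phi> k (ee 1 x)) = indicator V' x *\<^sub>R h x"
      by eventually_elim (use True in simp)
    then show ?thesis by (rule tendsto_eventually)
  next
    case False
    then have "ee 1 x \<in> C" using inC[OF x] by simp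
    then show ?thesis using False by (simp add: \<phi>_def)
  qed
  have "(\<lambda>k. integral\<^sup>L m01 (\<lambda>x. h x * of_real (\<phi> k (ee 1 x)))) \<longlonglongrightarrow> integral\<^sup>L m01 (\<lambda>x. indicator V' x *\<^sub>R h x)"
  proof (rule integral_dominated_convergence[where w = "\<lambda>x. norm (h x)"])
    have hm: "h \<in> borel_measurable m01" using h by simp
    show "(\<lambda>x. indicator V' x *\<^sub>R h x) \<in> borel_measurable m01"
      using V by (intro borel_measurable_scaleR hm measurable_m01 borel_measurable_indicator) (auto simp: V'_def)
    have "continuous_on UNIV (\<lambda>x. complex_of_real (\<phi> k (ee 1 x)))" for k
      by (intro continuous_on_of_real continuous_on_compose2[OF \<phi>c continuous_ee]) auto
    then show "(\<lambda>x. h x * of_real (\<phi> k (ee 1 x))) \<in> borel_measurable m01" for k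
      by (intro borel_measurable_times hm measurable_m01 borel_measurable_continuous_onI)
    show "integrable m01 (\<lambda>x. norm (h x))" using h by simp
    show "AE x in m01. (\<lambda>k. h x * of_real (\<phi> k (ee 1 x))) \<longlonglongrightarrow> indicator V' x *\<^sub>R h x"
      by (rule AE_I2) (use lim in simp)
    show "AE x in m01. norm (h x * of_real (\<phi> k (ee 1 x))) \<le> norm (h x)" for k
    proof (rule AE_I2)
      fix x
      have "\<bar>\<phi> k (ee 1 x)\<bar> \<le> 1" by (simp add: \<phi>_def infdist_nonneg)
      then have "norm (h x) * \<bar>\<phi> k (ee 1 x)\<bar> \<le> norm (h x) * 1" by (intro mult_left_mono) auto
      then show "norm (h x * of_real (\<phi> k (ee 1 x))) \<le> norm (h x)" by (simp add: norm_mult)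
    qed
  qed
  moreover have "integral\<^sup>L m01 (\<lambda>x. h x * of_real (\<phi> k (ee 1 x))) = 0" for k
    by (rule integral_continuous_zero[OF h z \<phi>c])
  ultimately have "(\<lambda>k. 0) \<longlonglongrightarrow> integral\<^sup>L m01 (\<lambda>x. indicator V' x *\<^sub>R h x)" by simp
  then have "integral\<^sup>L m01 (\<lambda>x. indicator V' x *\<^sub>R h x) = 0" by (simp add: LIMSEQ_const_iff)
  also have "integral\<^sup>L m01 (\<lambda>x. indicator V' x *\<^sub>R h x) = integral\<^sup>L m01 (\<lambda>x. indicator V x *\<^sub>R h x)"
  proof (rule integral_cong_AE)
    have hm: "h \<in> borel_measurable m01" using h by simp
    show "(\<lambda>x. indicator V' x *\<^sub>R h x) \<in> borel_measurable m01" "(\<lambda>x. indicator V x *\<^sub>R h x) \<in> borel_measurable m01"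
      using V by (intro borel_measurable_scaleR[OF measurable_m01[OF borel_measurable_indicator] hm]; auto simp: V'_def)+
    have "AE x in lborel. x \<noteq> (0::real)" "AE x in lborel. x \<noteq> (1::real)" by (rule AE_lborel_singleton)+
    then show "AE x in m01. indicator V' x *\<^sub>R h x = indicator V x *\<^sub>R h x"
      unfolding AE_m01 by eventually_elim (auto simp: V'_def indicator_def)
  qed
  finally show ?thesis .
qed

text \<open>A Dynkin-system argument: open sets are stable under intersection and generate the Borel
  sets, so the integral of h vanishes over every Borel set.\<close>

lemma fourier_zero_AE:
  assumes h: "integrable m01 (h :: real \<Rightarrow> complex)" and z: "\<And>k. integral\<^sup>L m01 (\<lambda>x. h x * ee k x) = 0"
  shows "AE x in m01. h x = 0"
proof (rule sigma_finite_measure.density_zero[OF _ h])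
  show "sigma_finite_measure m01"
    using finite_measure_m01 by (rule finite_measure.axioms)
  fix A assume "A \<in> sets m01"
  then have "A \<in> sets borel" by (auto simp: m01_def sets_restrict_space)
  then have A: "A \<in> sigma_sets UNIV {S. open S}" by (simp add: borel_def)
  have hm: "h \<in> borel_measurable m01" using h by simp
  have im: "integrable m01 (\<lambda>x. indicator B x *\<^sub>R h x)" if "B \<in> sigma_sets UNIV {S. open S}" for B
  proof -
    have "B \<in> sets borel" using that by (simp add: borel_def)
    then have m: "(\<lambda>x. indicator B x *\<^sub>R h x) \<in> borel_measurable m01"
      by (intro borel_measurable_scaleR hm measurable_m01 borel_measurable_indicator) auto
    show ?thesis
      by (rule Bochner_Integration.integrable_bound[OF h m]) (auto intro!: AE_I2 simp: indicator_def)
  qed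
  have "integral\<^sup>L m01 (\<lambda>x. indicator A x *\<^sub>R h x) = 0"
  proof (rule sigma_sets_induct_disjoint[OF _ _ A])
    show "Int_stable {S :: real set. open S}" by (auto simp: Int_stable_def)
    show "integral\<^sup>L m01 (\<lambda>x. indicator S x *\<^sub>R h x) = 0" if "S \<in> {S. open S}" for S
      using integral_open_zero[OF h z] that by blast
    have all: "integral\<^sup>L m01 h = 0" using z[of 0] by simp
    show "integral\<^sup>L m01 (\<lambda>x. indicator (UNIV - B) x *\<^sub>R h x) = 0"
      if B: "B \<in> sigma_sets UNIV {S. open S}" "integral\<^sup>L m01 (\<lambda>x. indicator B x *\<^sub>R h x) = 0" for B
    proof -
      have "(\<lambda>x. indicator (UNIV - B) x *\<^sub>R h x) = (\<lambda>x. h x - indicator B x *\<^sub>R h x)"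
        by (auto simp: indicator_def)
      then show ?thesis using h im[OF B(1)] B(2) all by simp
    qed
    show "integral\<^sup>L m01 (\<lambda>x. indicator (\<Union>i. B i) x *\<^sub>R h x) = 0"
      if B: "disjoint_family B" "range B \<subseteq> sigma_sets UNIV {S. open S}" "\<And>i. integral\<^sup>L m01 (\<lambda>x. indicator (B i) x *\<^sub>R h x) = 0"
      for B :: "nat \<Rightarrow> real set"
    proof -

      have "(\<lambda>k. integral\<^sup>L m01 (\<lambda>x. \<Sum>i<k. indicator (B i) x *\<^sub>R h x)) \<longlonglongrightarrow> integral\<^sup>L m01 (\<lambda>x. indicator (\<Union>i. B i) x *\<^sub>R h x)"
      proof (rule integral_dominated_convergence[where w = "\<lambda>x. norm (h x)"])
        have "(\<Union>i. B i) \<in> sigma_sets UNIV {S. open S}" using B(2) by (intro sigma_sets.Union) auto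
        from im[OF this] show "(\<lambda>x. indicator (\<Union>i. B i) x *\<^sub>R h x) \<in> borel_measurable m01" by simp
        have "integrable m01 (\<lambda>x. \<Sum>i<k. indicator (B i) x *\<^sub>R h x)" for k
          using B(2) by (intro Bochner_Integration.integrable_sum im) auto
        then show "(\<lambda>x. \<Sum>i<k. indicator (B i) x *\<^sub>R h x) \<in> borel_measurable m01" for k by simp
        show "integrable m01 (\<lambda>x. norm (h x))" using h by simp
        have s: "(\<Sum>i<k. indicator (B i) x *\<^sub>R h x) = indicator (\<Union>i<k. B i) x *\<^sub>R h x" for x k
        proof -
          have "disjoint_family_on B {..<k}" using B(1) by (auto simp: disjoint_family_on_def)
          then have "(\<Sum>i<k. indicator (B i) x :: real) = indicator (\<Union>i<k. B i) x"
            by (intro indicator_UN_disjoint[symmetric]) auto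
          then show ?thesis unfolding scaleR_sum_left[symmetric] by simp
        qed
        show "AE x in m01. (\<lambda>k. \<Sum>i<k. indicator (B i) x *\<^sub>R h x) \<longlonglongrightarrow> indicator (\<Union>i. B i) x *\<^sub>R h x"
          unfolding s by (intro AE_I2 tendsto_scaleR tendsto_const LIMSEQ_indicator_UN)
        show "AE x in m01. norm (\<Sum>i<k. indicator (B i) x *\<^sub>R h x) \<le> norm (h x)" for k
          unfolding s by (intro AE_I2) (simp add: indicator_def)
      qed
      moreover have "integral\<^sup>L m01 (\<lambda>x. \<Sum>i<k. indicator (B i) x *\<^sub>R h x) = 0" for k
        using B by (subst Bochner_Integration.integral_sum) (auto intro!: im)
      ultimately show ?thesis by (simp add: LIMSEQ_const_iff)
    qed
  qed auto
  then show "set_lebesgue_integral m01 A h = 0" by (simp add: set_lebesgue_integral_def)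
qed

lemma fourier_coeff_inj:
  assumes f: "f \<in> circ_L2" and g: "g \<in> circ_L2" and eq: "\<And>n. fourier_coeff f n = fourier_coeff g n"
  shows "f \<doteq> g"
proof (rule circ_eqI_m01)
  have d: "(\<lambda>x. f x - g x) \<in> circ_L2" by (rule circ_L2_diff[OF f g])
  have "AE x in m01. complex_of_real (f x - g x) = 0"
  proof (rule fourier_zero_AE)
    show "integrable m01 (\<lambda>x. complex_of_real (f x - g x))" by (rule integrable_of_real[OF circ_L2D(4)[OF d]])
    fix k
    have "fourier_coeff (\<lambda>x. f x - g x) (- k) = 0" using fourier_coeff_diff[OF f g] eq by simp
    then show "integral\<^sup>L m01 (\<lambda>x. complex_of_real (f x - g x) * ee k x) = 0"
      by (simp add: fourier_coeff_fco fco_def)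
  qed
  then show "AE x in m01. f x = g x" by eventually_elim simp
qed (use circ_L2D f g in blast)+

section \<open>Riesz-Fischer theorem, absolutely convergent Fourier series and products\<close>

definition herm :: "(int \<Rightarrow> complex) \<Rightarrow> bool" where
  "herm a \<longleftrightarrow> (\<forall>n. a (- n) = cnj (a n))"

text \<open>The real part makes the symmetric partial sum a real function; for Hermitian
  coefficients it removes nothing.\<close>

definition SP :: "(int \<Rightarrow> complex) \<Rightarrow> nat \<Rightarrow> real \<Rightarrow> real" where
  "SP a m x = Re (\<Sum>k\<in>win m. a k * ee k x)"

lemma sum_win_minus: "(\<Sum>k\<in>win m. f (- k)) = (\<Sum>k\<in>win m. f k)"
  by (rule sum.reindex_bij_witness[of _ uminus uminus]) auto

lemma of_real_SP:
  assumes "herm a"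
  shows "complex_of_real (SP a m x) = (\<Sum>k\<in>win m. a k * ee k x)"
proof -
  have "cnj (\<Sum>k\<in>win m. a k * ee k x) = (\<Sum>k\<in>win m. a (- k) * ee (- k) x)"
    using assms by (simp add: cnj_ee herm_def)
  also have "\<dots> = (\<Sum>k\<in>win m. a k * ee k x)" by (rule sum_win_minus)
  finally have "Im (\<Sum>k\<in>win m. a k * ee k x) = 0" by (metis Reals_cnj_iff complex_is_Real_iff)
  then show ?thesis unfolding SP_def by (simp add: complex_eq_iff)
qed

lemma continuous_SP: "continuous_on UNIV (SP a m)"
  unfolding SP_def[abs_def] by (intro continuous_intros continuous_ee)

lemma circ_L2_continuous:
  assumes "continuous_on UNIV f" "periodic1 f"
  shows "f \<in> circ_L2"
  using assms by (intro circ_L2I integrable_m01_continuous borel_measurable_continuous_onI continuous_intros)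

lemma SP_circ_L2: "SP a m \<in> circ_L2"
  by (rule circ_L2_continuous[OF continuous_SP]) (simp add: periodic1_def SP_def ee_period)

lemma integral_ee_mult: "integral\<^sup>L m01 (\<lambda>x. ee j x * ee k x) = (if j + k = 0 then 1 else 0)"
  using integral_ee[of "j + k"] by (simp add: ee_add[symmetric])

lemma integrable_ee_mult: "integrable m01 (\<lambda>x. ee j x * ee k x)"
  by (intro integrable_m01_continuous continuous_intros continuous_ee)

lemma fourier_coeff_SP:
  assumes "herm a"
  shows "fourier_coeff (SP a m) n = trn m a n"
proof -
  have "fourier_coeff (SP a m) n = integral\<^sup>L m01 (\<lambda>x. \<Sum>k\<in>win m. a k * (ee k x * ee (- n) x))"
    unfolding fourier_coeff_fco fco_def of_real_SP[OF assms] by (simp add: sum_distrib_right mult.assoc)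
  also have "\<dots> = (\<Sum>k\<in>win m. a k * (if k + (- n) = 0 then 1 else 0))"
    unfolding integral_ee_mult[symmetric]
    by (subst Bochner_Integration.integral_sum) (auto intro: integrable_mult_right integrable_ee_mult)
  also have "\<dots> = (\<Sum>k\<in>win m. if k = n then a k else 0)" by (intro sum.cong) auto
  finally show ?thesis by (simp add: trn_def)
qed

lemma parseval_finite:
  assumes A: "finite A"
  shows "integral\<^sup>L m01 (\<lambda>x. (cmod (\<Sum>k\<in>A. a k * ee k x))\<^sup>2) = (\<Sum>k\<in>A. (cmod (a k))\<^sup>2)"
proof -
  have e: "complex_of_real ((cmod (\<Sum>k\<in>A. a k * ee k x))\<^sup>2) = (\<Sum>j\<in>A. \<Sum>k\<in>A. (a j * cnj (a k)) * (ee j x * ee (- k) x))" for x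
    unfolding complex_norm_square cnj_sum sum_product
    by (intro sum.cong refl) (simp add: cnj_ee mult_ac)
  have "complex_of_real (integral\<^sup>L m01 (\<lambda>x. (cmod (\<Sum>k\<in>A. a k * ee k x))\<^sup>2))
     = integral\<^sup>L m01 (\<lambda>x. \<Sum>j\<in>A. \<Sum>k\<in>A. (a j * cnj (a k)) * (ee j x * ee (- k) x))"
    unfolding e[symmetric]
    by (rule integral_of_real[symmetric]) (intro integrable_m01_continuous continuous_intros continuous_ee)
  also have "\<dots> = (\<Sum>j\<in>A. \<Sum>k\<in>A. (a j * cnj (a k)) * (if j + (- k) = 0 then 1 else 0))"
    unfolding integral_ee_mult[symmetric]
    by (simp add: Bochner_Integration.integral_sum Bochner_Integration.integrable_sum integrable_ee_mult)
  also have "\<dots> = (\<Sum>j\<in>A. \<Sum>k\<in>A. if k = j then a j * cnj (a k) else 0)"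
    by (intro sum.cong refl) auto
  also have "\<dots> = (\<Sum>j\<in>A. a j * cnj (a j))" using A by simp
  also have "\<dots> = complex_of_real (\<Sum>k\<in>A. (cmod (a k))\<^sup>2)"
    by (simp add: complex_norm_square[symmetric])
  finally show ?thesis by (simp only: of_real_eq_iff)
qed

text \<open>The inequality between geometric and arithmetic mean with a parameter, in the role of
  Cauchy-Schwarz: matching \<delta> to the L^2 distance makes the L^1 distance small.\<close>

lemma integral_abs_le:
  assumes d: "d \<in> circ_L2" and \<delta>: "0 < \<delta>"
  shows "integral\<^sup>L m01 (\<lambda>x. \<bar>d x\<bar>) \<le> \<delta> / 2 + integral\<^sup>L m01 (\<lambda>x. (d x)\<^sup>2) / (2 * \<delta>)"
proof -
  note D = circ_L2D[OF d]
  have one: "integrable m01 (\<lambda>x. \<delta> / 2)" by (intro integrable_m01_continuous continuous_on_const)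
  have "integral\<^sup>L m01 (\<lambda>x. \<bar>d x\<bar>) \<le> integral\<^sup>L m01 (\<lambda>x. \<delta> / 2 + (d x)\<^sup>2 / (2 * \<delta>))"
  proof (rule integral_mono)
    show "integrable m01 (\<lambda>x. \<bar>d x\<bar>)" by (rule integrable_abs[OF D(4)])
    show "integrable m01 (\<lambda>x. \<delta> / 2 + (d x)\<^sup>2 / (2 * \<delta>))"
      by (intro Bochner_Integration.integrable_add one integrable_divide D(3))
    fix x
    have "2 * \<delta> * \<bar>d x\<bar> \<le> \<delta>\<^sup>2 + (d x)\<^sup>2" using sum_squares_bound[of \<delta> "\<bar>d x\<bar>"] by simp
    then show "\<bar>d x\<bar> \<le> \<delta> / 2 + (d x)\<^sup>2 / (2 * \<delta>)" using \<delta> by (simp add: field_simps power2_eq_square)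
  qed
  also have "\<dots> = \<delta> / 2 + integral\<^sup>L m01 (\<lambda>x. (d x)\<^sup>2) / (2 * \<delta>)"
    using one D(3) by (subst Bochner_Integration.integral_add) auto
  finally show ?thesis .
qed

lemma bounded_incseq_limit:
  fixes s :: "nat \<Rightarrow> real"
  assumes "incseq s" "\<And>m. s m \<le> B"
  obtains L where "s \<longlonglongrightarrow> L" "\<And>m. s m \<le> L"
  using incseq_convergent[OF assms(1), of B] assms(2) by metis

lemma SP_diff:
  assumes a: "herm a" and mM: "m \<le> M"
  shows "\<bar>SP a M x - SP a m x\<bar> = cmod (\<Sum>k\<in>win M - win m. a k * ee k x)"
proof -
  have "complex_of_real (SP a M x - SP a m x) = (\<Sum>k\<in>win M - win m. a k * ee k x)"
    unfolding of_real_diff of_real_SP[OF a] using win_mono[OF mM] by (simp add: sum_diff)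
  then show ?thesis by (metis norm_of_real)
qed

text \<open>By Parseval the partial sums are Cauchy in L^2, hence in L^1, so a subsequence converges
  almost everywhere. Its limit is the function sought, and Fatou's lemma keeps the L^2 distance to
  the partial sums under control.\<close>

lemma riesz_fischer:
  fixes a :: "int \<Rightarrow> complex"
  assumes a: "herm a" and B: "\<And>m. (\<Sum>n\<in>win m. (cmod (a n))\<^sup>2) \<le> B"
  obtains f where "f \<in> circ_L2" "\<And>n. fourier_coeff f n = a n"
proof -
  define s where "s m = (\<Sum>n\<in>win m. (cmod (a n))\<^sup>2)" for m
  have inc: "incseq s" unfolding incseq_def s_def using win_mono by (auto intro!: sum_mono2)
  obtain L where L: "s \<longlonglongrightarrow> L" "\<And>m. s m \<le> L"
    using bounded_incseq_limit[OF inc, of B] B unfolding s_def by blast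
  have dd: "integral\<^sup>L m01 (\<lambda>x. (SP a M x - SP a m x)\<^sup>2) = s M - s m" if mM: "m \<le> M" for m M
  proof -
    have "(SP a M x - SP a m x)\<^sup>2 = (cmod (\<Sum>k\<in>win M - win m. a k * ee k x))\<^sup>2" for x
      unfolding SP_diff[OF a mM, symmetric] by simp
    then have "integral\<^sup>L m01 (\<lambda>x. (SP a M x - SP a m x)\<^sup>2) = (\<Sum>k\<in>win M - win m. (cmod (a k))\<^sup>2)"
      by (simp add: parseval_finite)
    then show ?thesis using win_mono[OF mM] by (simp add: s_def sum_diff)
  qed
  have dL2: "(\<lambda>x. SP a i x - SP a j x) \<in> circ_L2" for i j by (intro circ_L2_diff SP_circ_L2)
  have cau: "\<exists>N. \<forall>i\<ge>N. \<forall>j\<ge>N. integral\<^sup>L m01 (\<lambda>x. norm (SP a i x - SP a j x)) < e" if e: "0 < e" for e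
  proof -
    have "\<forall>\<^sub>F m in sequentially. L - e\<^sup>2 / 2 < s m" using e by (intro order_tendstoD[OF L(1)]) simp
    then obtain N where N: "\<And>m. N \<le> m \<Longrightarrow> L - e\<^sup>2 / 2 < s m" unfolding eventually_sequentially by blast
    have "integral\<^sup>L m01 (\<lambda>x. \<bar>SP a i x - SP a j x\<bar>) < e" if "N \<le> i" "N \<le> j" for i j
    proof -
      have sq: "integral\<^sup>L m01 (\<lambda>x. (SP a i x - SP a j x)\<^sup>2) < e\<^sup>2"
      proof (cases "j \<le> i")
        case True
        have "s i - s j < e\<^sup>2" using N[OF that(2)] L(2)[of i] zero_le_power2[of e] by linarith
        then show ?thesis by (simp only: dd[OF True])
      next
        case False
        then have ji: "i \<le> j" by simp
        have "s j - s i < e\<^sup>2" using N[OF that(1)] L(2)[of j] zero_le_power2[of e] by linarith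
        then show ?thesis using dd[OF ji] by (simp only: power2_commute[of "SP a i _"])
      qed
      have "integral\<^sup>L m01 (\<lambda>x. \<bar>SP a i x - SP a j x\<bar>) \<le> e / 2 + integral\<^sup>L m01 (\<lambda>x. (SP a i x - SP a j x)\<^sup>2) / (2 * e)"
        by (rule integral_abs_le[OF dL2 e])
      also have "\<dots> < e / 2 + e\<^sup>2 / (2 * e)" using sq e by (intro add_strict_left_mono divide_strict_right_mono) auto
      also have "\<dots> = e" using e by (simp add: power2_eq_square)
      finally show ?thesis .
    qed
    then show ?thesis by (intro exI[of _ N]) (simp only: real_norm_def, blast)
  qed
  obtain r where r: "strict_mono r" "AE x in m01. Cauchy (\<lambda>i. SP a (r i) x)"
    using cauchy_L1_AE_cauchy_subseq[of m01 "SP a", OF circ_L2D(4)[OF SP_circ_L2] cau] by blast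
  define f where "f x = lim (\<lambda>i. SP a (r i) x)" for x
  have SPm: "SP a m \<in> borel_measurable borel" for m using SP_circ_L2 by (rule circ_L2D)
  have fm: "f \<in> borel_measurable borel"
    unfolding f_def[abs_def] by (intro borel_measurable_lim_metric SPm)
  \<comment> \<open>At x and x + 1 the \<open>lim\<close> is taken of the same sequence, so
    periodicity holds even where it diverges.\<close>
  have fp: "periodic1 f" by (simp add: periodic1_def f_def SP_def ee_period)
  have flim: "AE x in m01. (\<lambda>i. SP a (r i) x) \<longlonglongrightarrow> f x"
    using r(2) unfolding f_def by eventually_elim (simp add: Cauchy_convergent_iff convergent_LIMSEQ_iff)
  \<comment> \<open>Fatou's lemma along the subsequence transfers the Parseval bound on increments
    to the limit.\<close>
  have nn: "(\<integral>\<^sup>+x. ennreal ((f x - SP a m x)\<^sup>2) \<partial>m01) \<le> ennreal (L - s m)" for m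
  proof -
    let ?u = "\<lambda>i x. ennreal ((SP a (r i) x - SP a m x)\<^sup>2)"
    have um: "(\<lambda>x. (SP a i x - SP a m x)\<^sup>2) \<in> borel_measurable m01" for i
      by (intro measurable_m01 borel_measurable_power borel_measurable_diff SPm)
    have "(\<integral>\<^sup>+x. ennreal ((f x - SP a m x)\<^sup>2) \<partial>m01) = (\<integral>\<^sup>+x. liminf (\<lambda>i. ?u i x) \<partial>m01)"
    proof (rule nn_integral_cong_AE)
      show "AE x in m01. ennreal ((f x - SP a m x)\<^sup>2) = liminf (\<lambda>i. ?u i x)"
        using flim
      proof eventually_elim
        case (elim x)
        have "(\<lambda>i. ?u i x) \<longlonglongrightarrow> ennreal ((f x - SP a m x)\<^sup>2)"
          by (intro tendsto_ennrealI tendsto_intros elim)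
        then show ?case by (rule lim_imp_Liminf[OF sequentially_bot, symmetric])
      qed
    qed
    also have "\<dots> \<le> liminf (\<lambda>i. \<integral>\<^sup>+x. ?u i x \<partial>m01)"
      by (rule nn_integral_liminf) (intro measurable_compose[OF um] measurable_ennreal)
    also have "\<dots> \<le> ennreal (L - s m)"
    proof (rule Liminf_le)
      show "\<forall>\<^sub>F i in sequentially. (\<integral>\<^sup>+x. ?u i x \<partial>m01) \<le> ennreal (L - s m)"
        using eventually_ge_at_top[of m]
      proof eventually_elim
        case (elim i)
        have mi: "m \<le> r i" using elim seq_suble[OF r(1), of i] by linarith
        have "(\<integral>\<^sup>+x. ?u i x \<partial>m01) = ennreal (s (r i) - s m)"
          unfolding dd[OF mi, symmetric] by (intro nn_integral_eq_integral circ_L2D(3)[OF dL2] AE_I2) simp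
        then show ?case using L(2)[of "r i"] by (simp add: ennreal_leI)
      qed
    qed simp
    finally show ?thesis .
  qed
  have dfm: "(\<lambda>x. f x - SP a m x) \<in> borel_measurable borel" for m by (intro borel_measurable_diff fm SPm)
  have dint: "integrable m01 (\<lambda>x. (f x - SP a m x)\<^sup>2)" for m
  proof (rule integrableI_bounded)
    show "(\<lambda>x. (f x - SP a m x)\<^sup>2) \<in> borel_measurable m01"
      by (intro measurable_m01 borel_measurable_power dfm)
    show "(\<integral>\<^sup>+x. ennreal (norm ((f x - SP a m x)\<^sup>2)) \<partial>m01) < \<infinity>"
      using le_less_trans[OF nn ennreal_less_top] by simp
  qed
  have dcirc: "(\<lambda>x. f x - SP a m x) \<in> circ_L2" for m
    using fp circ_L2D(1)[OF SP_circ_L2[of a m]] by (intro circ_L2I dfm dint) (simp add: periodic1_def)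
  have dle: "integral\<^sup>L m01 (\<lambda>x. (f x - SP a m x)\<^sup>2) \<le> L - s m" for m
  proof -
    have "ennreal (integral\<^sup>L m01 (\<lambda>x. (f x - SP a m x)\<^sup>2)) = (\<integral>\<^sup>+x. ennreal ((f x - SP a m x)\<^sup>2) \<partial>m01)"
      by (rule nn_integral_eq_integral[symmetric, OF dint]) simp
    then have "ennreal (integral\<^sup>L m01 (\<lambda>x. (f x - SP a m x)\<^sup>2)) \<le> ennreal (L - s m)"
      using nn[of m] by (simp only:)
    then show ?thesis using L(2)[of m] by (subst (asm) ennreal_le_iff) auto
  qed
  have fc: "f \<in> circ_L2" using circ_L2_add[OF dcirc[of 0] SP_circ_L2[of a 0]] by simp
  have "fourier_coeff f n = a n" for n
  proof -
    have "cmod (fourier_coeff f n - a n) \<le> 0 + e" if e: "0 < e" for e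
    proof -
      have "\<forall>\<^sub>F m in sequentially. L - e\<^sup>2 < s m" using e by (intro order_tendstoD[OF L(1)]) simp
      then obtain N where N: "\<And>m. N \<le> m \<Longrightarrow> L - e\<^sup>2 < s m" unfolding eventually_sequentially by blast
      define m where "m = max N (nat \<bar>n\<bar>)"
      have n: "n \<in> win m" by (auto simp: m_def mem_win)
      have "fourier_coeff f n - a n = fourier_coeff (\<lambda>x. f x - SP a m x) n"
        using n by (simp add: fourier_coeff_diff[OF fc SP_circ_L2] fourier_coeff_SP[OF a] trn_def)
      then have "cmod (fourier_coeff f n - a n) \<le> integral\<^sup>L m01 (\<lambda>x. \<bar>f x - SP a m x\<bar>)"
        using cmod_fourier_coeff_le[OF dcirc] by simp
      also have "\<dots> \<le> e / 2 + integral\<^sup>L m01 (\<lambda>x. (f x - SP a m x)\<^sup>2) / (2 * e)"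
        by (rule integral_abs_le[OF dcirc e])
      also have "\<dots> \<le> e / 2 + e\<^sup>2 / (2 * e)"
      proof -
        have "L - s m \<le> e\<^sup>2" using N[of m] by (simp add: m_def)
        then have "integral\<^sup>L m01 (\<lambda>x. (f x - SP a m x)\<^sup>2) \<le> e\<^sup>2" using dle order_trans by blast
        then show ?thesis using e by (intro add_left_mono divide_right_mono) auto
      qed
      also have "\<dots> = e" using e by (simp add: power2_eq_square)
      finally show ?thesis by simp
    qed
    then have "cmod (fourier_coeff f n - a n) \<le> 0" by (rule field_le_epsilon)
    then show ?thesis by simp
  qed
  then show ?thesis using that fc by blast
qed

text \<open>With absolutely summable coefficients the partial sums converge uniformly, with the l^1
  tail as rate. The limit F is a bounded representative, equal to f almost everywhere by uniqueness
  of coefficients.\<close>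

lemma uniform_fourier_series:
  assumes f: "f \<in> circ_L2" and C: "\<And>m. (\<Sum>n\<in>win m. cmod (fourier_coeff f n)) \<le> C"
  obtains F \<tau> where "F \<in> circ_L2" "f \<doteq> F" "\<And>x. \<bar>F x\<bar> \<le> C" "\<tau> \<longlonglongrightarrow> 0" "\<And>m. 0 \<le> \<tau> m"
    "\<And>m x. \<bar>F x - SP (fourier_coeff f) m x\<bar> \<le> \<tau> m" "\<And>m x. \<bar>SP (fourier_coeff f) m x\<bar> \<le> C"
proof -
  define a where "a = fourier_coeff f"
  have a: "herm a" by (simp add: herm_def a_def fourier_coeff_minus)
  define s where "s m = (\<Sum>n\<in>win m. cmod (a n))" for m
  have inc: "incseq s" unfolding incseq_def s_def using win_mono by (auto intro!: sum_mono2)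
  obtain L where L: "s \<longlonglongrightarrow> L" "\<And>m. s m \<le> L"
    using bounded_incseq_limit[OF inc, of C] C unfolding s_def a_def by blast
  have le: "\<bar>SP a M x - SP a m x\<bar> \<le> L - s m" if mM: "m \<le> M" for m M x
  proof -
    have "\<bar>SP a M x - SP a m x\<bar> \<le> (\<Sum>k\<in>win M - win m. cmod (a k * ee k x))"
      unfolding SP_diff[OF a mM] by (rule norm_sum)
    also have "\<dots> = s M - s m" using win_mono[OF mM] by (simp add: norm_mult s_def sum_diff)
    finally show ?thesis using L(2)[of M] by simp
  qed
  have SPC: "\<bar>SP a m x\<bar> \<le> C" for m x
  proof -
    have "\<bar>SP a m x\<bar> \<le> cmod (\<Sum>k\<in>win m. a k * ee k x)" unfolding SP_def by (rule abs_Re_le_cmod)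
    also have "\<dots> \<le> (\<Sum>k\<in>win m. cmod (a k * ee k x))" by (rule norm_sum)
    also have "\<dots> \<le> C" using C[of m] by (simp add: norm_mult a_def)
    finally show ?thesis .
  qed
  have t0: "(\<lambda>m. L - s m) \<longlonglongrightarrow> 0" using tendsto_diff[OF tendsto_const L(1), of L] by simp
  define F where "F x = lim (\<lambda>m. SP a m x)" for x
  have Flim: "(\<lambda>m. SP a m x) \<longlonglongrightarrow> F x" for x
  proof -
    have "Cauchy (\<lambda>m. SP a m x)"
    proof (rule CauchyI', unfold dist_norm)
      fix e :: real assume "0 < e"
      then have "\<forall>\<^sub>F m in sequentially. L - s m < e" by (rule order_tendstoD[OF t0])
      then obtain N where N: "\<And>m. N \<le> m \<Longrightarrow> L - s m < e" unfolding eventually_sequentially by blast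
      show "\<exists>M. \<forall>m\<ge>M. \<forall>n>m. norm (SP a m x - SP a n x) < e"
      proof (intro exI[of _ N] allI impI)
        fix m n assume "N \<le> m" "m < n"
        then show "norm (SP a m x - SP a n x) < e" using le[of m n x] N[of m] by (simp add: abs_minus_commute)
      qed
    qed
    then show ?thesis unfolding F_def by (simp add: Cauchy_convergent_iff convergent_LIMSEQ_iff)
  qed
  have Fle: "\<bar>F x - SP a m x\<bar> \<le> L - s m" for m x
  proof (rule tendsto_upperbound)
    show "(\<lambda>M. \<bar>SP a M x - SP a m x\<bar>) \<longlonglongrightarrow> \<bar>F x - SP a m x\<bar>" by (intro tendsto_intros Flim)
    show "\<forall>\<^sub>F M in sequentially. \<bar>SP a M x - SP a m x\<bar> \<le> L - s m"
      using eventually_ge_at_top[of m] by eventually_elim (rule le)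
  qed simp
  have FC: "\<bar>F x\<bar> \<le> C" for x
    by (rule tendsto_upperbound[OF tendsto_rabs[OF Flim]]) (simp_all add: SPC)
  have SPm: "SP a m \<in> borel_measurable borel" for m using SP_circ_L2 by (rule circ_L2D)
  have Fm: "F \<in> borel_measurable borel"
    unfolding F_def[abs_def] by (intro borel_measurable_lim_metric SPm)
  have FL2: "F \<in> circ_L2"
  proof (rule circ_L2I[OF _ Fm])
    show "periodic1 F" by (simp add: periodic1_def F_def SP_def ee_period)
    show "integrable m01 (\<lambda>x. (F x)\<^sup>2)"
    proof (rule integrable_m01_bounded)
      show "(\<lambda>x. (F x)\<^sup>2) \<in> borel_measurable borel" by (intro borel_measurable_power Fm)
      show "norm ((F x)\<^sup>2) \<le> C\<^sup>2" for x using power_mono[OF FC[of x], of 2] by simp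
    qed
  qed
  have "f \<doteq> F"
  proof (rule fourier_coeff_inj[OF f FL2])
    fix n
    have "(\<lambda>m. L - s m) \<longlonglongrightarrow> 0" by (rule t0)
    moreover have "\<forall>\<^sub>F m in sequentially. cmod (fourier_coeff F n - a n) \<le> L - s m"
      using eventually_ge_at_top[of "nat \<bar>n\<bar>"]
    proof eventually_elim
      case (elim m)
      have d: "(\<lambda>x. F x - SP a m x) \<in> circ_L2" by (intro circ_L2_diff FL2 SP_circ_L2)
      have "fourier_coeff F n - a n = fourier_coeff (\<lambda>x. F x - SP a m x) n"
        using elim by (simp add: fourier_coeff_diff[OF FL2 SP_circ_L2] fourier_coeff_SP[OF a] trn_def mem_win)
      then have "cmod (fourier_coeff F n - a n) \<le> integral\<^sup>L m01 (\<lambda>x. \<bar>F x - SP a m x\<bar>)"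
        using cmod_fourier_coeff_le[OF d] by simp
      also have "\<dots> \<le> integral\<^sup>L m01 (\<lambda>x. L - s m)"
        by (intro integral_mono integrable_abs circ_L2D(4)[OF d] integrable_m01_continuous continuous_on_const Fle)
      finally show ?case by simp
    qed
    ultimately have "cmod (fourier_coeff F n - a n) \<le> 0" by (rule tendsto_lowerbound) simp
    then show "fourier_coeff f n = fourier_coeff F n" by (simp add: a_def)
  qed
  moreover have "0 \<le> L - s m" for m using L(2)[of m] by simp
  ultimately show ?thesis using that[of F "\<lambda>m. L - s m"] FL2 FC t0 Fle SPC unfolding a_def by blast
qed

lemma fourier_coeff_SP_mult:
  assumes a: "herm a" and b: "herm b"
  shows "fourier_coeff (\<lambda>x. SP a m x * SP b m x) n = conv m (trn m a) (trn m b) n"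
proof -
  have e: "complex_of_real (SP a m x * SP b m x) * ee (- n) x = (\<Sum>j\<in>win m. \<Sum>k\<in>win m. (a j * b k) * (ee j x * ee (k - n) x))" for x
    unfolding of_real_mult of_real_SP[OF a] of_real_SP[OF b]
    unfolding sum_product unfolding sum_distrib_right
    using ee_add[of k "- n" x for k] by (intro sum.cong refl) (simp add: mult_ac)
  have "fourier_coeff (\<lambda>x. SP a m x * SP b m x) n = (\<Sum>j\<in>win m. \<Sum>k\<in>win m. (a j * b k) * (if j + (k - n) = 0 then 1 else 0))"
    unfolding fourier_coeff_fco fco_def e integral_ee_mult[symmetric]
    by (simp add: Bochner_Integration.integral_sum Bochner_Integration.integrable_sum integrable_ee_mult)
  also have "\<dots> = (\<Sum>k\<in>win m. \<Sum>j\<in>win m. if j = n - k then a j * b k else 0)"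
    by (subst sum.swap) (intro sum.cong refl, auto)
  also have "\<dots> = (\<Sum>k\<in>win m. trn m a (n - k) * trn m b k)"
    by (intro sum.cong refl) (auto simp: trn_def)
  finally show ?thesis by (simp add: conv_def)
qed

text \<open>For the bounded representatives the products of partial sums converge uniformly, hence
  in each coefficient. This is the link between the convolutions in \<open>bil\<close> and the
  pointwise products in the equation.\<close>

lemma fourier_coeff_mult:
  assumes f: "f \<in> circ_L2" "\<And>m. (\<Sum>n\<in>win m. cmod (fourier_coeff f n)) \<le> C"
    and g: "g \<in> circ_L2" "\<And>m. (\<Sum>n\<in>win m. cmod (fourier_coeff g n)) \<le> D"
  shows "(\<lambda>x. f x * g x) \<in> circ_L2"
    and "(\<lambda>m. conv m (trn m (fourier_coeff f)) (trn m (fourier_coeff g)) n) \<longlonglongrightarrow> fourier_coeff (\<lambda>x. f x * g x) n"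
proof -
  obtain F \<tau> where F: "F \<in> circ_L2" "f \<doteq> F" "\<And>x. \<bar>F x\<bar> \<le> C" "\<tau> \<longlonglongrightarrow> 0" "\<And>m. 0 \<le> \<tau> m"
    "\<And>m x. \<bar>F x - SP (fourier_coeff f) m x\<bar> \<le> \<tau> m" "\<And>m x. \<bar>SP (fourier_coeff f) m x\<bar> \<le> C"
    using uniform_fourier_series[OF f] by blast
  obtain G \<upsilon> where G: "G \<in> circ_L2" "g \<doteq> G" "\<And>x. \<bar>G x\<bar> \<le> D" "\<upsilon> \<longlonglongrightarrow> 0" "\<And>m. 0 \<le> \<upsilon> m"
    "\<And>m x. \<bar>G x - SP (fourier_coeff g) m x\<bar> \<le> \<upsilon> m" "\<And>m x. \<bar>SP (fourier_coeff g) m x\<bar> \<le> D"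
    using uniform_fourier_series[OF g] by blast
  note fD = circ_L2D[OF f(1)] and gD = circ_L2D[OF g(1)] and FD = circ_L2D[OF F(1)] and GD = circ_L2D[OF G(1)]
  have prod: "(\<lambda>x. p x * q x) \<in> circ_L2"
    if p: "p \<in> circ_L2" "\<And>x. \<bar>p x\<bar> \<le> P" and q: "q \<in> circ_L2" "\<And>x. \<bar>q x\<bar> \<le> Q" for p q P Q
  proof (rule circ_L2I)
    note pD = circ_L2D[OF p(1)] and qD = circ_L2D[OF q(1)]
    show "periodic1 (\<lambda>x. p x * q x)" using pD(1) qD(1) by (simp add: periodic1_def)
    show m: "(\<lambda>x. p x * q x) \<in> borel_measurable borel" by (intro borel_measurable_times pD qD)
    show "integrable m01 (\<lambda>x. (p x * q x)\<^sup>2)"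
    proof (rule integrable_m01_bounded)
      show "(\<lambda>x. (p x * q x)\<^sup>2) \<in> borel_measurable borel" by (intro borel_measurable_power m)
      fix x
      have "\<bar>p x * q x\<bar> \<le> P * Q" unfolding abs_mult using p(2)[of x] q(2)[of x] by (intro mult_mono) auto
      then have "\<bar>p x * q x\<bar>\<^sup>2 \<le> (P * Q)\<^sup>2" by (intro power_mono) auto
      then show "norm ((p x * q x)\<^sup>2) \<le> (P * Q)\<^sup>2" by simp
    qed
  qed
  have FG: "(\<lambda>x. F x * G x) \<in> circ_L2" by (rule prod[OF F(1,3) G(1,3)])
  have eq: "(\<lambda>x. f x * g x) \<doteq> (\<lambda>x. F x * G x)"
    using F(2) G(2) unfolding circ_eq_def by eventually_elim simp
  have m: "(\<lambda>x. f x * g x) \<in> borel_measurable borel" by (intro borel_measurable_times fD gD)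
  show fg: "(\<lambda>x. f x * g x) \<in> circ_L2"
  proof (rule circ_L2I[OF _ m])
    show "periodic1 (\<lambda>x. f x * g x)" using fD(1) gD(1) by (simp add: periodic1_def)
    have "AE x in m01. (f x * g x)\<^sup>2 = (F x * G x)\<^sup>2"
      using eq unfolding circ_eq_def AE_m01 by eventually_elim simp
    then have "integrable m01 (\<lambda>x. (f x * g x)\<^sup>2) \<longleftrightarrow> integrable m01 (\<lambda>x. (F x * G x)\<^sup>2)"
      by (intro integrable_cong_AE measurable_m01 borel_measurable_power m circ_L2D(2)[OF FG])
    then show "integrable m01 (\<lambda>x. (f x * g x)\<^sup>2)" using circ_L2D(3)[OF FG] by simp
  qed
  define a where "a = fourier_coeff f"
  define b where "b = fourier_coeff g"
  have ab: "herm a" "herm b" by (auto simp: herm_def a_def b_def fourier_coeff_minus)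
  have le: "cmod (fourier_coeff (\<lambda>x. f x * g x) n - conv m (trn m a) (trn m b) n) \<le> C * \<upsilon> m + D * \<tau> m" for m
  proof -
    have SS: "(\<lambda>x. SP a m x * SP b m x) \<in> circ_L2"
      unfolding a_def b_def by (rule prod[OF SP_circ_L2 F(7) SP_circ_L2 G(7)])
    have d: "(\<lambda>x. F x * G x - SP a m x * SP b m x) \<in> circ_L2" by (rule circ_L2_diff[OF FG SS])
    have "fourier_coeff (\<lambda>x. f x * g x) n = fourier_coeff (\<lambda>x. F x * G x) n"
      by (rule fourier_coeff_cong[OF m circ_L2D(2)[OF FG] eq])
    then have "fourier_coeff (\<lambda>x. f x * g x) n - conv m (trn m a) (trn m b) n
        = fourier_coeff (\<lambda>x. F x * G x - SP a m x * SP b m x) n"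
      unfolding fourier_coeff_diff[OF FG SS] fourier_coeff_SP_mult[OF ab] by simp
    then have "cmod (fourier_coeff (\<lambda>x. f x * g x) n - conv m (trn m a) (trn m b) n)
       \<le> integral\<^sup>L m01 (\<lambda>x. \<bar>F x * G x - SP a m x * SP b m x\<bar>)"
      using cmod_fourier_coeff_le[OF d] by simp
    also have "\<dots> \<le> integral\<^sup>L m01 (\<lambda>x. C * \<upsilon> m + D * \<tau> m)"
    proof (rule integral_mono)
      show "integrable m01 (\<lambda>x. \<bar>F x * G x - SP a m x * SP b m x\<bar>)" by (rule integrable_abs[OF circ_L2D(4)[OF d]])
      show "integrable m01 (\<lambda>x. C * \<upsilon> m + D * \<tau> m)" by (intro integrable_m01_continuous continuous_on_const)
      fix x
      have "F x * G x - SP a m x * SP b m x = F x * (G x - SP b m x) + SP b m x * (F x - SP a m x)"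
        by (simp add: algebra_simps)
      then have "\<bar>F x * G x - SP a m x * SP b m x\<bar> \<le> \<bar>F x\<bar> * \<bar>G x - SP b m x\<bar> + \<bar>SP b m x\<bar> * \<bar>F x - SP a m x\<bar>"
        by (metis abs_mult abs_triangle_ineq)
      also have "\<dots> \<le> C * \<upsilon> m + D * \<tau> m"
        using F(3)[of x] F(6)[of x m] G(6)[of x m] G(7)[of m x] G(5)[of m] F(5)[of m]
        by (intro add_mono mult_mono) (auto simp: a_def b_def)
      finally show "\<bar>F x * G x - SP a m x * SP b m x\<bar> \<le> C * \<upsilon> m + D * \<tau> m" .
    qed
    finally show ?thesis by simp
  qed
  have "(\<lambda>m. C * \<upsilon> m + D * \<tau> m) \<longlonglongrightarrow> C * 0 + D * 0" by (intro tendsto_intros F(4) G(4))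
  then have "(\<lambda>m. C * \<upsilon> m + D * \<tau> m) \<longlonglongrightarrow> 0" by simp
  then have "(\<lambda>m. fourier_coeff (\<lambda>x. f x * g x) n - conv m (trn m a) (trn m b) n) \<longlonglongrightarrow> 0"
    by (rule Lim_null_comparison[rotated]) (simp add: le)
  then have "(\<lambda>m. fourier_coeff (\<lambda>x. f x * g x) n - (fourier_coeff (\<lambda>x. f x * g x) n - conv m (trn m a) (trn m b) n))
     \<longlonglongrightarrow> fourier_coeff (\<lambda>x. f x * g x) n - 0"
    by (intro tendsto_intros)
  then show "(\<lambda>m. conv m (trn m (fourier_coeff f)) (trn m (fourier_coeff g)) n) \<longlonglongrightarrow> fourier_coeff (\<lambda>x. f x * g x) n"
    by (simp add: a_def b_def)
qed

subsection \<open>Sobolev spaces and weak derivatives\<close>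

definition hN :: "real \<Rightarrow> (int \<Rightarrow> complex) \<Rightarrow> nat \<Rightarrow> real" where
  "hN r a m = L2_set (\<lambda>n. jb n powr r * cmod (a n)) (win m)"

lemma hN_ge0 [simp]: "0 \<le> hN r a m" by (simp add: hN_def)

lemma sobolev_term_eq: "sobolev_term r f n = (jb n powr r * cmod (fourier_coeff f n))\<^sup>2"
proof -
  have "1 + 4 * pi\<^sup>2 * (real_of_int n)\<^sup>2 = (jb n)\<^sup>2" by (simp add: jb_sq power_mult_distrib)
  moreover have "((jb n)\<^sup>2) powr r = (jb n powr r)\<^sup>2"
    by (simp add: power2_eq_square powr_mult)
  ultimately show ?thesis by (simp only: sobolev_term_def power_mult_distrib)
qed

lemma hN_sq: "(hN r (fourier_coeff f) m)\<^sup>2 = (\<Sum>n\<in>win m. sobolev_term r f n)"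
  by (simp add: hN_def L2_set_def sobolev_term_eq sum_nonneg)

lemma sobolev_term_nonneg: "0 \<le> sobolev_term r f n"
  by (simp add: sobolev_term_eq)

lemma finite_subset_win:
  assumes "finite A"
  obtains m where "A \<subseteq> win m"
proof -
  have "\<bar>a\<bar> \<le> (\<Sum>k\<in>A. \<bar>k\<bar>)" if "a \<in> A" for a
    using assms that by (intro member_le_sum) auto
  then have "A \<subseteq> win (nat (\<Sum>k\<in>A. \<bar>k\<bar>))" by (auto simp: mem_win sum_nonneg)
  then show ?thesis by (rule that)
qed

text \<open>Every finite set of frequencies lies in some window, so bounds on windows, the form in
  which all estimates arise, give summability.\<close>

lemma sobolev_summableI:
  assumes "\<And>m. hN r (fourier_coeff f) m \<le> B"
  shows "sobolev_term r f summable_on UNIV" "sob_norm r f \<le> B"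
proof -
  have B0: "0 \<le> B" by (rule order_trans[OF hN_ge0 assms])
  have fin: "sum (sobolev_term r f) A \<le> B\<^sup>2" if A: "finite A" for A
  proof -
    obtain m where m: "A \<subseteq> win m" using finite_subset_win[OF A] by blast
    have "sum (sobolev_term r f) A \<le> sum (sobolev_term r f) (win m)"
      using m by (intro sum_mono2) (auto simp: sobolev_term_nonneg)
    also have "\<dots> \<le> B\<^sup>2" unfolding hN_sq[symmetric] by (intro power_mono assms) simp
    finally show ?thesis .
  qed
  show s: "sobolev_term r f summable_on UNIV"
  proof (rule nonneg_bdd_above_summable_on)
    show "bdd_above (sum (sobolev_term r f) ` {F. F \<subseteq> UNIV \<and> finite F})"
      by (rule bdd_aboveI[of _ "B\<^sup>2"]) (auto simp: fin)
  qed (simp add: sobolev_term_nonneg)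
  have "infsum (sobolev_term r f) UNIV \<le> B\<^sup>2"
    by (rule infsum_le_finite_sums[OF s]) (simp add: fin)
  then show "sob_norm r f \<le> B" unfolding sob_norm_def using B0 by (simp add: real_le_lsqrt)
qed

lemma hN_le_sob_norm:
  assumes "f \<in> sobolev r"
  shows "hN r (fourier_coeff f) m \<le> sob_norm r f"
proof -
  have "(hN r (fourier_coeff f) m)\<^sup>2 \<le> infsum (sobolev_term r f) UNIV"
    unfolding hN_sq using assms
    by (intro finite_sum_le_infsum) (auto simp: sobolev_def sobolev_term_nonneg)
  then show ?thesis unfolding sob_norm_def by (rule real_le_rsqrt)
qed

lemma sobolevI: "f \<in> circ_L2 \<Longrightarrow> (\<And>m. hN r (fourier_coeff f) m \<le> B) \<Longrightarrow> f \<in> sobolev r"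
  using sobolev_summableI(1) by (auto simp: sobolev_def)

lemma sobolev_L2: "f \<in> sobolev r \<Longrightarrow> f \<in> circ_L2"
  by (simp add: sobolev_def)

lemma sob_norm_ge0: "0 \<le> sob_norm r f"
  by (simp add: sob_norm_def infsum_nonneg sobolev_term_nonneg)

lemma hN_mono: "(\<And>n. n \<in> win m \<Longrightarrow> jb n powr r * cmod (a n) \<le> jb n powr q * cmod (b n)) \<Longrightarrow> hN r a m \<le> hN q b m"
  unfolding hN_def by (rule L2_set_mono') (simp add: abs_mult)

lemma hN_exp_mono: "r \<le> q \<Longrightarrow> hN r a m \<le> hN q a m"
  by (intro hN_mono mult_right_mono powr_mono jb_ge1) auto

lemma hN_triangle: "hN r (\<lambda>n. a n + b n) m \<le> hN r a m + hN r b m"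
proof -
  have "hN r (\<lambda>n. a n + b n) m \<le> L2_set (\<lambda>n. jb n powr r * cmod (a n) + jb n powr r * cmod (b n)) (win m)"
    unfolding hN_def
  proof (rule L2_set_mono')
    fix n
    have "jb n powr r * cmod (a n + b n) \<le> jb n powr r * (cmod (a n) + cmod (b n))"
      by (intro mult_left_mono norm_triangle_ineq) auto
    then show "\<bar>jb n powr r * cmod (a n + b n)\<bar> \<le> jb n powr r * cmod (a n) + jb n powr r * cmod (b n)"
      by (simp add: distrib_left)
  qed
  also have "\<dots> \<le> hN r a m + hN r b m" unfolding hN_def by (rule L2_set_triangle_ineq)
  finally show ?thesis .
qed

lemma hN_cmult: "hN r (\<lambda>n. of_real b * a n) m = \<bar>b\<bar> * hN r a m"
  unfolding hN_def by (simp add: norm_mult mult.left_commute L2_set_cmult)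

lemma sobolev_mono: "f \<in> sobolev q \<Longrightarrow> r \<le> q \<Longrightarrow> f \<in> sobolev r"
  by (rule sobolevI[OF sobolev_L2 order_trans[OF hN_exp_mono hN_le_sob_norm]])

lemma sobolev_add:
  assumes "f \<in> sobolev r" "g \<in> sobolev r"
  shows "(\<lambda>x. f x + g x) \<in> sobolev r"
proof (rule sobolevI)
  note L = assms[THEN sobolev_L2]
  show "(\<lambda>x. f x + g x) \<in> circ_L2" by (rule circ_L2_add[OF L])
  show "hN r (fourier_coeff (\<lambda>x. f x + g x)) m \<le> sob_norm r f + sob_norm r g" for m
    unfolding fourier_coeff_add[OF L, abs_def]
    by (rule order_trans[OF hN_triangle add_mono[OF assms[THEN hN_le_sob_norm]]])
qed

lemma sobolev_cmult:
  assumes "f \<in> sobolev r"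
  shows "(\<lambda>x. b * f x) \<in> sobolev r"
proof (rule sobolevI)
  show "(\<lambda>x. b * f x) \<in> circ_L2" by (rule circ_L2_cmult[OF sobolev_L2[OF assms]])
  show "hN r (fourier_coeff (\<lambda>x. b * f x)) m \<le> \<bar>b\<bar> * sob_norm r f" for m
    unfolding fourier_coeff_cmult[abs_def] hN_cmult by (intro mult_left_mono hN_le_sob_norm assms) simp
qed

lemma sobolev_diff: "f \<in> sobolev r \<Longrightarrow> g \<in> sobolev r \<Longrightarrow> (\<lambda>x. f x - g x) \<in> sobolev r"
  using sobolev_add[of f r "\<lambda>x. - 1 * g x"] sobolev_cmult[of g r "- 1"] by simp

lemma fourier_coeff_diff_fun:
  "f \<in> sobolev r \<Longrightarrow> g \<in> sobolev r \<Longrightarrow> fourier_coeff (\<lambda>x. f x - g x) = (\<lambda>n. fourier_coeff f n - fourier_coeff g n)"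
  by (rule ext) (intro fourier_coeff_diff sobolev_L2)

lemma hN_le_sob_dist:
  assumes "f \<in> sobolev r" "g \<in> sobolev r"
  shows "hN r (\<lambda>n. fourier_coeff f n - fourier_coeff g n) m \<le> sob_dist r f g"
  using hN_le_sob_norm[OF sobolev_diff[OF assms]] fourier_coeff_diff_fun[OF assms] by (simp add: sob_dist_def)

lemma sob_dist_leI:
  assumes "f \<in> sobolev r" "g \<in> sobolev r" "\<And>m. hN r (\<lambda>n. fourier_coeff f n - fourier_coeff g n) m \<le> B"
  shows "sob_dist r f g \<le> B"
  using sobolev_summableI(2)[of r "\<lambda>x. f x - g x" B] assms fourier_coeff_diff_fun[OF assms(1,2)] by (simp add: sob_dist_def)

lemma cmod_le_hN: "0 \<le> r \<Longrightarrow> n \<in> win m \<Longrightarrow> cmod (a n) \<le> hN r a m"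
proof -
  assume r: "0 \<le> r" and n: "n \<in> win m"
  have "1 * cmod (a n) \<le> jb n powr r * cmod (a n)"
    using ge_one_powr_ge_zero[OF jb_ge1 r] by (intro mult_right_mono) auto
  also have "\<dots> \<le> hN r a m" unfolding hN_def using n
    by (intro member_le_L2_set[where f = "\<lambda>n. jb n powr r * cmod (a n)"]) auto
  finally show ?thesis by simp
qed

text \<open>Cauchy-Schwarz against \<open>jb n powr (- r)\<close>, which is square summable for r >
  1/2.\<close>

lemma sobolev_l1:
  assumes f: "f \<in> sobolev r" and r: "1/2 < r"
  obtains C where "\<And>m. (\<Sum>n\<in>win m. cmod (fourier_coeff f n)) \<le> C"
proof -
  have "1 < 2 * r" using r by simp
  then obtain C where C: "0 \<le> C" "\<And>m. (\<Sum>n\<in>win m. jb n powr (- (2 * r))) \<le> C"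
    using jb_powr_sum_bound by blast
  have "(\<Sum>n\<in>win m. cmod (fourier_coeff f n)) \<le> sqrt C * sob_norm r f" for m
  proof -
    have e: "cmod (fourier_coeff f n) = \<bar>jb n powr (- r)\<bar> * \<bar>jb n powr r * cmod (fourier_coeff f n)\<bar>" for n
    proof -
      have "jb n powr (- r) * jb n powr r = 1" by (simp add: powr_add[symmetric])
      then show ?thesis by (simp add: abs_mult mult.assoc[symmetric])
    qed
    have "(\<Sum>n\<in>win m. cmod (fourier_coeff f n)) = (\<Sum>n\<in>win m. \<bar>jb n powr (- r)\<bar> * \<bar>jb n powr r * cmod (fourier_coeff f n)\<bar>)"
      by (intro sum.cong refl e)
    also have "\<dots> \<le> L2_set (\<lambda>n. jb n powr (- r)) (win m) * hN r (fourier_coeff f) m"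
      unfolding hN_def by (rule L2_set_mult_ineq)
    also have "\<dots> \<le> sqrt C * sob_norm r f"
    proof (intro mult_mono hN_le_sob_norm f)
      have "(jb n powr (- r))\<^sup>2 = jb n powr (- (2 * r))" for n
        by (simp add: power2_eq_square powr_add[symmetric])
      then show "L2_set (\<lambda>n. jb n powr (- r)) (win m) \<le> sqrt C"
        unfolding L2_set_def using C(2)[of m] by simp
    qed (use C in auto)
    finally show ?thesis .
  qed
  then show ?thesis by (rule that)
qed

section \<open>Test functions, and weak derivatives as Fourier multipliers\<close>

lemma circ_testD:
  assumes "circ_test \<phi>"
  shows "periodic1 \<phi>" "(\<phi> has_real_derivative deriv \<phi> x) (at x)" "circ_test (deriv \<phi>)" "continuous_on UNIV \<phi>" "\<phi> \<in> circ_L2"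
proof -
  show p: "periodic1 \<phi>" using assms by (simp add: circ_test_def)
  have "(deriv ^^ 0) \<phi> differentiable_on UNIV" using assms unfolding circ_test_def by blast
  then have "\<phi> differentiable (at x)" for x by (simp add: differentiable_on_def)
  then show d: "(\<phi> has_real_derivative deriv \<phi> x) (at x)" for x
    by (simp add: DERIV_deriv_iff_real_differentiable)
  show c: "continuous_on UNIV \<phi>" using d by (intro continuous_at_imp_continuous_on) (auto intro: DERIV_isCont)
  then show "\<phi> \<in> circ_L2" using p by (rule circ_L2_continuous)
  show "circ_test (deriv \<phi>)" unfolding circ_test_def
  proof
    show "\<forall>k. (deriv ^^ k) (deriv \<phi>) differentiable_on UNIV"
    proof
      fix k
      have "(deriv ^^ Suc k) \<phi> differentiable_on UNIV" using assms unfolding circ_test_def by blast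
      then show "(deriv ^^ k) (deriv \<phi>) differentiable_on UNIV" by (simp add: funpow_swap1)
    qed
    have "deriv \<phi> (x + 1) = deriv \<phi> x" for x
    proof -
      have "((\<lambda>x. \<phi> (x + 1)) has_real_derivative deriv \<phi> (x + 1)) (at x)"
        using d[of "x + 1"] by (simp add: DERIV_shift)
      moreover have "(\<lambda>x. \<phi> (x + 1)) = \<phi>" using p by (simp add: periodic1_def)
      ultimately show ?thesis using DERIV_imp_deriv by metis
    qed
    then show "periodic1 (deriv \<phi>)" by (simp add: periodic1_def)
  qed
qed

lemma fourier_coeff_deriv:
  assumes t: "circ_test \<phi>"
  shows "fourier_coeff (deriv \<phi>) n = dsym n * fourier_coeff \<phi> n"
proof -
  note T = circ_testD[OF t] and T' = circ_testD[OF circ_testD(3)[OF t]]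
  let ?F = "\<lambda>x. complex_of_real (\<phi> x) * ee (- n) x"
  let ?f = "\<lambda>x. complex_of_real (\<phi> x) * (dsym (- n) * ee (- n) x) + complex_of_real (deriv \<phi> x) * ee (- n) x"
  have "integral\<^sup>L m01 ?f = ?F 1 - ?F 0"
  proof (rule integral_vd_m01)
    fix x
    have "((\<lambda>x. complex_of_real (\<phi> x)) has_vector_derivative complex_of_real (deriv \<phi> x)) (at x)"
      using T(2)[of x] by (intro bounded_linear.has_vector_derivative[OF bounded_linear_of_real])
        (simp add: has_real_derivative_iff_has_vector_derivative)
    then show "(?F has_vector_derivative ?f x) (at x)" by (intro has_vector_derivative_mult ee_vd)
    show "continuous_on UNIV ?f" by (intro continuous_intros T(4) T'(4) continuous_ee)
  qed
  also have "\<dots> = 0" using T(1) ee_period[of "- n" 0] by (simp add: periodic1_def) (metis add_0)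
  finally have z: "integral\<^sup>L m01 ?f = 0" .
  have i: "integrable m01 ?F" "integrable m01 (\<lambda>x. complex_of_real (deriv \<phi> x) * ee (- n) x)"
    by (intro integrable_m01_continuous continuous_intros T(4) T'(4) continuous_ee)+
  have "?f = (\<lambda>x. dsym (- n) * ?F x + complex_of_real (deriv \<phi> x) * ee (- n) x)" by (auto simp: mult_ac)
  then have "integral\<^sup>L m01 ?f = dsym (- n) * integral\<^sup>L m01 ?F + integral\<^sup>L m01 (\<lambda>x. complex_of_real (deriv \<phi> x) * ee (- n) x)"
    using i by simp
  then show ?thesis using z unfolding fourier_coeff_fco fco_def by simp
qed

text \<open>The function \<phi> - \<phi>'' has bounded coefficients, and its symbol is the square of
  \<open>jb\<close>, so the coefficients of \<phi> decay quadratically.\<close>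

lemma circ_test_l1:
  assumes t: "circ_test \<phi>"
  obtains C where "\<And>m. (\<Sum>n\<in>win m. cmod (fourier_coeff \<phi> n)) \<le> C"
proof -
  note t' = circ_testD(3)[OF t] note t'' = circ_testD(3)[OF t']
  define I where "I = integral\<^sup>L m01 (\<lambda>x. \<bar>\<phi> x\<bar>) + integral\<^sup>L m01 (\<lambda>x. \<bar>deriv (deriv \<phi>) x\<bar>)"
  have I0: "0 \<le> I" by (simp add: I_def)
  obtain C where C: "0 \<le> C" "\<And>m. (\<Sum>n\<in>win m. jb n powr (- 2)) \<le> C"
    using jb_powr_sum_bound[of 2] by auto
  have b: "cmod (fourier_coeff \<phi> n) \<le> I * jb n powr (- 2)" for n
  proof -
    have "fourier_coeff (deriv (deriv \<phi>)) n = dsym n * (dsym n * fourier_coeff \<phi> n)"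
      by (simp add: fourier_coeff_deriv[OF t'] fourier_coeff_deriv[OF t])
    moreover have "dsym n * dsym n = 1 - of_real ((jb n)\<^sup>2)"
      unfolding jb_sq by (simp add: dsym_def power2_eq_square algebra_simps)
    ultimately have "of_real ((jb n)\<^sup>2) * fourier_coeff \<phi> n = fourier_coeff \<phi> n - fourier_coeff (deriv (deriv \<phi>)) n"
      by (simp add: mult.assoc[symmetric] left_diff_distrib)
    then have "(jb n)\<^sup>2 * cmod (fourier_coeff \<phi> n) = cmod (fourier_coeff \<phi> n - fourier_coeff (deriv (deriv \<phi>)) n)"
      by (metis norm_mult norm_of_real abs_power2)
    also have "\<dots> \<le> I" unfolding I_def
      by (intro order_trans[OF norm_triangle_ineq4] add_mono cmod_fourier_coeff_le circ_testD(5)[OF t] circ_testD(5)[OF t''])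
    finally have "cmod (fourier_coeff \<phi> n) \<le> I / (jb n)\<^sup>2" by (simp add: field_simps)
    moreover have "jb n powr (- 2) = 1 / (jb n)\<^sup>2" by (simp add: powr_minus divide_inverse)
    ultimately show ?thesis by simp
  qed
  have "(\<Sum>n\<in>win m. cmod (fourier_coeff \<phi> n)) \<le> I * C" for m
  proof -
    have "(\<Sum>n\<in>win m. cmod (fourier_coeff \<phi> n)) \<le> (\<Sum>n\<in>win m. I * jb n powr (- 2))" by (intro sum_mono b)
    also have "\<dots> \<le> I * C" unfolding sum_distrib_left[symmetric] by (intro mult_left_mono C I0)
    finally show ?thesis .
  qed
  then show ?thesis by (rule that)
qed

text \<open>Parseval's formula between a function in L^2 and one with absolutely summable
  coefficients: the partial sums of p converge uniformly, and f is integrable.\<close>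

lemma integral_pairing:
  assumes f: "f \<in> circ_L2" and p: "p \<in> circ_L2" "\<And>m. (\<Sum>n\<in>win m. cmod (fourier_coeff p n)) \<le> C"
  shows "(\<lambda>m. \<Sum>k\<in>win m. fourier_coeff p k * fourier_coeff f (- k)) \<longlonglongrightarrow> of_real (integral\<^sup>L m01 (\<lambda>x. f x * p x))"
proof -
  obtain F \<tau> where F: "F \<in> circ_L2" "p \<doteq> F" "\<And>x. \<bar>F x\<bar> \<le> C" "\<tau> \<longlonglongrightarrow> 0" "\<And>m. 0 \<le> \<tau> m"
    "\<And>m x. \<bar>F x - SP (fourier_coeff p) m x\<bar> \<le> \<tau> m" "\<And>m x. \<bar>SP (fourier_coeff p) m x\<bar> \<le> C"
    using uniform_fourier_series[OF p] by blast
  note fD = circ_L2D[OF f] and pD = circ_L2D[OF p(1)] and FD = circ_L2D[OF F(1)]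
  have fmm: "f \<in> borel_measurable m01" "F \<in> borel_measurable m01" by (intro measurable_m01 fD FD)+
  have herm: "herm (fourier_coeff p)" by (simp add: herm_def fourier_coeff_minus)
  have SPm: "SP (fourier_coeff p) m \<in> borel_measurable m01" for m by (intro measurable_m01 circ_L2D(2)[OF SP_circ_L2])
  have prod: "integrable m01 (\<lambda>x. f x * q x)" if "q \<in> borel_measurable m01" "\<And>x. \<bar>q x\<bar> \<le> B" for q B
  proof (rule Bochner_Integration.integrable_bound[of _ "\<lambda>x. B * \<bar>f x\<bar>"])
    show "integrable m01 (\<lambda>x. B * \<bar>f x\<bar>)" by (intro integrable_mult_right integrable_abs fD)
    show "(\<lambda>x. f x * q x) \<in> borel_measurable m01" by (intro borel_measurable_times fmm that)
    show "AE x in m01. norm (f x * q x) \<le> norm (B * \<bar>f x\<bar>)"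
    proof (rule AE_I2)
      fix x
      have "\<bar>f x\<bar> * \<bar>q x\<bar> \<le> \<bar>f x\<bar> * B" by (intro mult_left_mono that) simp
      also have "\<dots> \<le> \<bar>f x\<bar> * \<bar>B\<bar>" by (intro mult_left_mono) auto
      finally show "norm (f x * q x) \<le> norm (B * \<bar>f x\<bar>)" by (simp add: abs_mult mult.commute)
    qed
  qed
  have eq: "integral\<^sup>L m01 (\<lambda>x. f x * p x) = integral\<^sup>L m01 (\<lambda>x. f x * F x)"
  proof (rule integral_cong_AE)
    show "(\<lambda>x. f x * p x) \<in> borel_measurable m01" "(\<lambda>x. f x * F x) \<in> borel_measurable m01"
      by (intro borel_measurable_times fmm measurable_m01[OF pD(2)])+
    show "AE x in m01. f x * p x = f x * F x"
      using F(2) unfolding circ_eq_def AE_m01 by eventually_elim simp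
  qed
  have S: "complex_of_real (integral\<^sup>L m01 (\<lambda>x. f x * SP (fourier_coeff p) m x)) = (\<Sum>k\<in>win m. fourier_coeff p k * fourier_coeff f (- k))" for m
  proof -
    have "complex_of_real (integral\<^sup>L m01 (\<lambda>x. f x * SP (fourier_coeff p) m x))
       = integral\<^sup>L m01 (\<lambda>x. complex_of_real (f x * SP (fourier_coeff p) m x))"
      by (rule integral_of_real[symmetric]) (rule prod[OF SPm F(7)])
    also have "\<dots> = integral\<^sup>L m01 (\<lambda>x. \<Sum>k\<in>win m. fourier_coeff p k * (complex_of_real (f x) * ee k x))"
      unfolding of_real_mult of_real_SP[OF herm] sum_distrib_left by (simp add: mult_ac)
    also have "\<dots> = (\<Sum>k\<in>win m. fourier_coeff p k * integral\<^sup>L m01 (\<lambda>x. complex_of_real (f x) * ee k x))"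
    proof -
      have "integrable m01 (\<lambda>x. complex_of_real (f x) * ee k x)" for k
        by (intro integrable_m01_mult integrable_of_real fD continuous_ee)
      then show ?thesis by (simp add: Bochner_Integration.integral_sum)
    qed
    finally show ?thesis by (simp add: fourier_coeff_fco fco_def)
  qed
  define If where "If = integral\<^sup>L m01 (\<lambda>x. \<bar>f x\<bar>)"
  have le: "\<bar>integral\<^sup>L m01 (\<lambda>x. f x * F x) - integral\<^sup>L m01 (\<lambda>x. f x * SP (fourier_coeff p) m x)\<bar> \<le> If * \<tau> m" for m
  proof -
    have i: "integrable m01 (\<lambda>x. f x * F x)" "integrable m01 (\<lambda>x. f x * SP (fourier_coeff p) m x)"
      by (rule prod[OF fmm(2) F(3)], rule prod[OF SPm F(7)])
    have "\<bar>integral\<^sup>L m01 (\<lambda>x. f x * F x) - integral\<^sup>L m01 (\<lambda>x. f x * SP (fourier_coeff p) m x)\<bar>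
       = \<bar>integral\<^sup>L m01 (\<lambda>x. f x * F x - f x * SP (fourier_coeff p) m x)\<bar>" using i by simp
    also have "\<dots> \<le> integral\<^sup>L m01 (\<lambda>x. \<bar>f x * F x - f x * SP (fourier_coeff p) m x\<bar>)"
      using integral_norm_bound[of m01 "\<lambda>x. f x * F x - f x * SP (fourier_coeff p) m x"] by simp
    also have "\<dots> \<le> integral\<^sup>L m01 (\<lambda>x. \<bar>f x\<bar> * \<tau> m)"
    proof (rule integral_mono)
      show "integrable m01 (\<lambda>x. \<bar>f x * F x - f x * SP (fourier_coeff p) m x\<bar>)"
        by (intro integrable_abs Bochner_Integration.integrable_diff i)
      show "integrable m01 (\<lambda>x. \<bar>f x\<bar> * \<tau> m)" by (intro integrable_mult_left integrable_abs fD)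
      show "\<bar>f x * F x - f x * SP (fourier_coeff p) m x\<bar> \<le> \<bar>f x\<bar> * \<tau> m" for x
        unfolding right_diff_distrib[symmetric] abs_mult by (intro mult_left_mono F(6)) simp
    qed
    finally show ?thesis by (simp add: If_def)
  qed
  have "(\<lambda>m. If * \<tau> m) \<longlonglongrightarrow> If * 0" by (intro tendsto_intros F(4))
  then have "(\<lambda>m. integral\<^sup>L m01 (\<lambda>x. f x * F x) - integral\<^sup>L m01 (\<lambda>x. f x * SP (fourier_coeff p) m x)) \<longlonglongrightarrow> 0"
    by (intro Lim_null_comparison[OF always_eventually[OF allI[OF le[folded real_norm_def]]]]) simp
  from tendsto_diff[OF tendsto_const[of "integral\<^sup>L m01 (\<lambda>x. f x * F x)"] this]
  have "(\<lambda>m. integral\<^sup>L m01 (\<lambda>x. f x * SP (fourier_coeff p) m x)) \<longlonglongrightarrow> integral\<^sup>L m01 (\<lambda>x. f x * F x)" by simp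
  then have "(\<lambda>m. complex_of_real (integral\<^sup>L m01 (\<lambda>x. f x * SP (fourier_coeff p) m x))) \<longlonglongrightarrow> of_real (integral\<^sup>L m01 (\<lambda>x. f x * F x))"
    by (rule tendsto_of_real)
  then show ?thesis unfolding S eq .
qed

text \<open>Real test functions at a single frequency. The family is closed under differentiation,
  hence smooth, and pairing with it extracts real and imaginary parts of a coefficient.\<close>

definition trig :: "int \<Rightarrow> real \<Rightarrow> real \<Rightarrow> real \<Rightarrow> real" where
  "trig n A B x = A * cos (2 * pi * of_int n * x) + B * sin (2 * pi * of_int n * x)"

lemma deriv_trig: "deriv (trig n A B) = trig n (2 * pi * of_int n * B) (- (2 * pi * of_int n * A))"
proof
  fix x
  have "(trig n A B has_real_derivative trig n (2 * pi * of_int n * B) (- (2 * pi * of_int n * A)) x) (at x)"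
    unfolding trig_def[abs_def] by (auto intro!: derivative_eq_intros simp: algebra_simps)
  then show "deriv (trig n A B) x = trig n (2 * pi * of_int n * B) (- (2 * pi * of_int n * A)) x"
    by (rule DERIV_imp_deriv)
qed

lemma circ_test_trig: "circ_test (trig n A B)"
  unfolding circ_test_def
proof
  have "cos (2 * pi * of_int n * x) = Re (ee n x)" "sin (2 * pi * of_int n * x) = Im (ee n x)" for x
    by (simp_all add: ee_def)
  then show "periodic1 (trig n A B)" by (simp add: periodic1_def trig_def ee_period)
  have "\<exists>A' B'. (deriv ^^ k) (trig n A B) = trig n A' B'" for k
  proof (induction k)
    case (Suc k)
    then obtain A' B' where "(deriv ^^ k) (trig n A B) = trig n A' B'" by blast
    then show ?case using deriv_trig[of n A' B'] by auto
  qed auto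
  moreover have "trig n A' B' differentiable_on UNIV" for A' B'
    unfolding differentiable_on_def
  proof
    fix x
    have "(trig n A' B' has_real_derivative trig n (2 * pi * of_int n * B') (- (2 * pi * of_int n * A')) x) (at x)"
      unfolding trig_def[abs_def] by (auto intro!: derivative_eq_intros simp: algebra_simps)
    then show "trig n A' B' differentiable at x" using real_differentiable_def by blast
  qed
  ultimately show "\<forall>k. (deriv ^^ k) (trig n A B) differentiable_on UNIV" by metis
qed

lemma Re_Im_fourier_coeff:
  assumes f: "f \<in> circ_L2"
  shows "integral\<^sup>L m01 (\<lambda>x. f x * trig n A B x) = A * Re (fourier_coeff f n) - B * Im (fourier_coeff f n)"
proof -
  have i: "integrable m01 (\<lambda>x. complex_of_real (f x) * ee (- n) x)"
    by (intro integrable_m01_mult integrable_of_real circ_L2D[OF f] continuous_ee)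
  have iR: "integrable m01 (\<lambda>x. Re (complex_of_real (f x) * ee (- n) x))" "integrable m01 (\<lambda>x. Im (complex_of_real (f x) * ee (- n) x))"
    using i by (simp_all only: integrable_Re integrable_Im)
  have "f x * trig n A B x = A * Re (complex_of_real (f x) * ee (- n) x) - B * Im (complex_of_real (f x) * ee (- n) x)" for x
    by (simp add: trig_def ee_def algebra_simps)
  then have "integral\<^sup>L m01 (\<lambda>x. f x * trig n A B x)
      = integral\<^sup>L m01 (\<lambda>x. A * Re (complex_of_real (f x) * ee (- n) x) - B * Im (complex_of_real (f x) * ee (- n) x))"
    by simp
  also have "\<dots> = A * integral\<^sup>L m01 (\<lambda>x. Re (complex_of_real (f x) * ee (- n) x)) - B * integral\<^sup>L m01 (\<lambda>x. Im (complex_of_real (f x) * ee (- n) x))"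
    using iR by (simp only: Bochner_Integration.integral_diff integrable_mult_right integral_mult_right_zero)
  also have "\<dots> = A * Re (fourier_coeff f n) - B * Im (fourier_coeff f n)"
    unfolding fourier_coeff_fco fco_def using i by (simp only: integral_Re integral_Im)
  finally show ?thesis .
qed

text \<open>Testing with \<open>trig\<close> gives one direction, and
  \<open>integral_pairing\<close> with arbitrary test functions the other. From here on the choice
  operators can be handled as multipliers.\<close>

lemma has_weak_deriv_iff:
  assumes f: "f \<in> circ_L2" and g: "g \<in> circ_L2"
  shows "has_weak_deriv f g \<longleftrightarrow> (\<forall>n. fourier_coeff g n = dsym n * fourier_coeff f n)"
proof
  assume w: "has_weak_deriv f g"
  show "\<forall>n. fourier_coeff g n = dsym n * fourier_coeff f n"
  proof
    fix n
    have w': "integral\<^sup>L m01 (\<lambda>x. f x * deriv (trig n A B) x) = - integral\<^sup>L m01 (\<lambda>x. g x * trig n A B x)" for A B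
      using w circ_test_trig unfolding has_weak_deriv_def set_integral_m01 by blast
    have 1: "Re (fourier_coeff g n) = - (2 * pi * of_int n * Im (fourier_coeff f n))"
      using w'[of 1 0] unfolding deriv_trig Re_Im_fourier_coeff[OF f] Re_Im_fourier_coeff[OF g] by simp
    have 2: "Im (fourier_coeff g n) = 2 * pi * of_int n * Re (fourier_coeff f n)"
      using w'[of 0 1] unfolding deriv_trig Re_Im_fourier_coeff[OF f] Re_Im_fourier_coeff[OF g] by simp
    show "fourier_coeff g n = dsym n * fourier_coeff f n"
      using 1 2 by (simp add: complex_eq_iff dsym_def)
  qed
next
  assume c: "\<forall>n. fourier_coeff g n = dsym n * fourier_coeff f n"
  show "has_weak_deriv f g"
    unfolding has_weak_deriv_def set_integral_m01
  proof (intro conjI f g allI impI)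
    fix \<phi> assume t: "circ_test \<phi>"
    note t' = circ_testD(3)[OF t]
    obtain C where C: "\<And>m. (\<Sum>n\<in>win m. cmod (fourier_coeff \<phi> n)) \<le> C" using circ_test_l1[OF t] by blast
    obtain C' where C': "\<And>m. (\<Sum>n\<in>win m. cmod (fourier_coeff (deriv \<phi>) n)) \<le> C'" using circ_test_l1[OF t'] by blast
    have 1: "(\<lambda>m. \<Sum>k\<in>win m. fourier_coeff (deriv \<phi>) k * fourier_coeff f (- k)) \<longlonglongrightarrow> of_real (integral\<^sup>L m01 (\<lambda>x. f x * deriv \<phi> x))"
      by (rule integral_pairing[OF f circ_testD(5)[OF t'] C'])
    have 2: "(\<lambda>m. \<Sum>k\<in>win m. fourier_coeff \<phi> k * fourier_coeff g (- k)) \<longlonglongrightarrow> of_real (integral\<^sup>L m01 (\<lambda>x. g x * \<phi> x))"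
      by (rule integral_pairing[OF g circ_testD(5)[OF t] C])
    have "(\<Sum>k\<in>win m. fourier_coeff (deriv \<phi>) k * fourier_coeff f (- k)) = - (\<Sum>k\<in>win m. fourier_coeff \<phi> k * fourier_coeff g (- k))" for m
      unfolding sum_negf[symmetric] by (intro sum.cong refl) (simp add: c fourier_coeff_deriv[OF t])
    then have "(\<lambda>m. - (\<Sum>k\<in>win m. fourier_coeff \<phi> k * fourier_coeff g (- k))) \<longlonglongrightarrow> of_real (integral\<^sup>L m01 (\<lambda>x. f x * deriv \<phi> x))"
      using 1 by simp
    from LIMSEQ_unique[OF this tendsto_minus[OF 2]]
    show "integral\<^sup>L m01 (\<lambda>x. f x * deriv \<phi> x) = - integral\<^sup>L m01 (\<lambda>x. g x * \<phi> x)"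
      by (metis of_real_eq_iff of_real_minus)
  qed
qed

lemma sobolev_synthesis:
  fixes a :: "int \<Rightarrow> complex"
  assumes a: "herm a" and B: "\<And>m. hN r a m \<le> B" and r: "0 \<le> r"
  obtains f where "f \<in> sobolev r" "fourier_coeff f = a"
proof -
  have "(\<Sum>n\<in>win m. (cmod (a n))\<^sup>2) \<le> B\<^sup>2" for m
  proof -
    have "(\<Sum>n\<in>win m. (cmod (a n))\<^sup>2) = (hN 0 a m)\<^sup>2" by (simp add: hN_def L2_set_def sum_nonneg)
    also have "\<dots> \<le> B\<^sup>2" by (intro power_mono order_trans[OF hN_exp_mono[OF r] B]) simp
    finally show ?thesis .
  qed
  then obtain f where f: "f \<in> circ_L2" "\<And>n. fourier_coeff f n = a n" using riesz_fischer[OF a] by blast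
  have fa: "fourier_coeff f = a" using f(2) by (rule ext)
  have "f \<in> sobolev r" by (rule sobolevI[OF f(1), where B = B]) (simp add: fa B)
  then show ?thesis using that fa by blast
qed

text \<open>A weak derivative is first synthesised from its coefficients, so the choice in
  \<open>weak_deriv\<close> has a witness; by \<open>has_weak_deriv_iff\<close> whatever is chosen
  has the same coefficients.\<close>

lemma weak_deriv_sobolev:
  assumes f: "f \<in> sobolev r" and r: "1 \<le> r"
  shows "weak_deriv f \<in> sobolev (r - 1)" "fourier_coeff (weak_deriv f) n = dsym n * fourier_coeff f n"
proof -
  let ?a = "\<lambda>n. dsym n * fourier_coeff f n"
  have h: "hN (r - 1) ?a m \<le> sob_norm r f" for m
  proof (rule order_trans[OF hN_mono hN_le_sob_norm[OF f]])
    fix n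
    have "jb n powr (r - 1) * (cmod (dsym n) * cmod (fourier_coeff f n)) \<le> jb n powr (r - 1) * (jb n * cmod (fourier_coeff f n))"
      by (intro mult_left_mono mult_right_mono cmod_dsym_le) auto
    also have "\<dots> = jb n powr r * cmod (fourier_coeff f n)" by (simp add: powr_diff)
    finally show "jb n powr (r - 1) * cmod (?a n) \<le> jb n powr r * cmod (fourier_coeff f n)" by (simp add: norm_mult)
  qed
  have "herm ?a" by (simp add: herm_def fourier_coeff_minus)
  then obtain g where g: "g \<in> sobolev (r - 1)" "fourier_coeff g = ?a"
    using sobolev_synthesis[of ?a "r - 1" "sob_norm r f"] h r by auto
  have "has_weak_deriv f g" unfolding has_weak_deriv_iff[OF sobolev_L2[OF f] sobolev_L2[OF g(1)]] by (simp add: g(2))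
  then have w: "has_weak_deriv f (weak_deriv f)" unfolding weak_deriv_def by (rule someI[of "has_weak_deriv f"])
  then have L2: "weak_deriv f \<in> circ_L2" by (simp add: has_weak_deriv_def)
  show c: "fourier_coeff (weak_deriv f) n = dsym n * fourier_coeff f n" for n
    using w unfolding has_weak_deriv_iff[OF sobolev_L2[OF f] L2] by blast
  have "fourier_coeff (weak_deriv f) = ?a" using c by (rule ext)
  then show "weak_deriv f \<in> sobolev (r - 1)" using h by (intro sobolevI[OF L2]) simp
qed

lemma dsym_sq: "dsym n * dsym n = 1 - of_real ((jb n)\<^sup>2)"
  unfolding jb_sq by (simp add: dsym_def power2_eq_square algebra_simps)

lemma A_op_coeff:
  assumes f: "f \<in> sobolev 2"
  shows "A_op f \<in> circ_L2" "fourier_coeff (A_op f) n = of_real ((jb n)\<^sup>2) * fourier_coeff f n"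
proof -
  have 1: "weak_deriv f \<in> sobolev 1" using weak_deriv_sobolev(1)[OF f] by simp
  have 2: "weak_deriv (weak_deriv f) \<in> sobolev 0" using weak_deriv_sobolev(1)[OF 1] by simp
  show "A_op f \<in> circ_L2" unfolding A_op_def by (intro circ_L2_diff sobolev_L2[OF f] sobolev_L2[OF 2])
  have "fourier_coeff (A_op f) n = fourier_coeff f n - dsym n * (dsym n * fourier_coeff f n)"
    unfolding A_op_def fourier_coeff_diff[OF sobolev_L2[OF f] sobolev_L2[OF 2]]
    using weak_deriv_sobolev(2)[OF 1] weak_deriv_sobolev(2)[OF f] by simp
  then show "fourier_coeff (A_op f) n = of_real ((jb n)\<^sup>2) * fourier_coeff f n"
    unfolding mult.assoc[symmetric] dsym_sq by (simp add: algebra_simps)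
qed

text \<open>Dividing the coefficients by the symbol of A provides a witness for the choice in
  \<open>A_inv\<close>; as the symbol never vanishes, the equation determines the coefficients of
  the chosen function.\<close>

lemma A_inv_sobolev:
  assumes g: "g \<in> sobolev 0"
  shows "A_inv g \<in> sobolev 2" "fourier_coeff (A_inv g) n = fourier_coeff g n / of_real ((jb n)\<^sup>2)"
proof -
  let ?a = "\<lambda>n. fourier_coeff g n / of_real ((jb n)\<^sup>2)"
  have "herm ?a" by (simp add: herm_def fourier_coeff_minus)
  moreover have "hN 2 ?a m \<le> sob_norm 0 g" for m
  proof (rule order_trans[OF hN_mono hN_le_sob_norm[OF g]])
    fix n show "jb n powr 2 * cmod (?a n) \<le> jb n powr 0 * cmod (fourier_coeff g n)"
      by (simp add: norm_divide norm_power)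
  qed
  ultimately obtain f where f: "f \<in> sobolev 2" "fourier_coeff f = ?a"
    using sobolev_synthesis[of ?a 2] by auto
  have "A_op f \<doteq> g"
    by (rule fourier_coeff_inj[OF A_op_coeff(1)[OF f(1)] sobolev_L2[OF g]]) (simp add: A_op_coeff(2)[OF f(1)] f(2))
  then have i: "A_inv g \<in> sobolev 2 \<and> A_op (A_inv g) \<doteq> g"
    unfolding A_inv_def using f(1) by (intro someI[of "\<lambda>f. f \<in> sobolev 2 \<and> A_op f \<doteq> g"]) blast
  then show "A_inv g \<in> sobolev 2" by blast
  have "fourier_coeff (A_op (A_inv g)) n = fourier_coeff g n"
    using i by (intro fourier_coeff_cong circ_L2D(2) A_op_coeff(1) sobolev_L2[OF g]) blast+
  then show "fourier_coeff (A_inv g) n = fourier_coeff g n / of_real ((jb n)\<^sup>2)"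
    using A_op_coeff(2)[of "A_inv g" n] i by (simp add: field_simps)
qed

lemma hN_tendsto:
  assumes "\<And>n. ((\<lambda>i. f i n) \<longlongrightarrow> a n) F"
  shows "((\<lambda>i. hN r (f i) m) \<longlongrightarrow> hN r a m) F"
  unfolding hN_def L2_set_def by (intro tendsto_intros assms)

text \<open>H^1 is an algebra: \<open>young_weight\<close> with the subadditive weight
  \<open>jb\<close> for the truncated convolutions, then a limit. It is what allows
  \<open>weak_deriv\<close> to be applied to the quadratic expression in the equation for u.\<close>

lemma sobolev_mult:
  assumes f: "f \<in> sobolev 1" and g: "g \<in> sobolev 1"
  shows "(\<lambda>x. f x * g x) \<in> sobolev 1"
proof -
  obtain C where C: "\<And>m. (\<Sum>n\<in>win m. cmod (fourier_coeff f n)) \<le> C" using sobolev_l1[OF f] by auto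
  obtain D where D: "\<And>m. (\<Sum>n\<in>win m. cmod (fourier_coeff g n)) \<le> D" using sobolev_l1[OF g] by auto
  note M = fourier_coeff_mult[OF sobolev_L2[OF f] C sobolev_L2[OF g] D]
  let ?c = "\<lambda>M. conv M (trn M (fourier_coeff f)) (trn M (fourier_coeff g))"
  have "hN 1 (fourier_coeff (\<lambda>x. f x * g x)) m \<le> C * sob_norm 1 g + sob_norm 1 f * D" for m
  proof (rule tendsto_upperbound)
    show "(\<lambda>M. hN 1 (?c M) m) \<longlonglongrightarrow> hN 1 (fourier_coeff (\<lambda>x. f x * g x)) m"
      by (intro hN_tendsto M(2))
    have "hN 1 (?c M) m \<le> C * sob_norm 1 g + sob_norm 1 f * D" for M
    proof -
      let ?p = "\<lambda>n. cmod (trn M (fourier_coeff f) n)" and ?q = "\<lambda>n. cmod (trn M (fourier_coeff g) n)"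
      have s: "supp M ?p" "supp M ?q" by (auto simp: supp_def trn_def)
      have w: "L2_set (\<lambda>n. jb n * cmod (trn M a n)) (win M) = hN 1 a M" for a
        unfolding hN_def by (rule L2_set_cong) (auto simp: trn_def)
      have l: "(\<Sum>n\<in>win M. cmod (trn M a n)) = (\<Sum>n\<in>win M. cmod (a n))" for a :: "int \<Rightarrow> complex"
        by (intro sum.cong) (auto simp: trn_def)
      have C0: "0 \<le> C" "0 \<le> D" by (rule order_trans[OF sum_nonneg C], simp) (rule order_trans[OF sum_nonneg D], simp)
      have "hN 1 (?c M) m \<le> L2_set (\<lambda>n. jb n * conv M ?p ?q n) (win m)"
        unfolding hN_def by (rule L2_set_mono') (simp add: abs_mult mult_left_mono conv_cmod)
      also have "\<dots> \<le> 1 * (sum ?p (win M) * L2_set (\<lambda>n. jb n * ?q n) (win M)) + 1 * (L2_set (\<lambda>n. jb n * ?p n) (win M) * sum ?q (win M))"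
        by (rule young_weight) (use s jb_add in \<open>auto simp: add.commute\<close>)
      also have "\<dots> = (\<Sum>n\<in>win M. cmod (fourier_coeff f n)) * hN 1 (fourier_coeff g) M + hN 1 (fourier_coeff f) M * (\<Sum>n\<in>win M. cmod (fourier_coeff g n))"
        by (simp add: w l)
      also have "\<dots> \<le> C * sob_norm 1 g + sob_norm 1 f * D"
        by (intro add_mono mult_mono C D hN_le_sob_norm f g C0 sob_norm_ge0 hN_ge0 sum_nonneg) auto
      finally show ?thesis .
    qed
    then show "\<forall>\<^sub>F M in sequentially. hN 1 (?c M) m \<le> C * sob_norm 1 g + sob_norm 1 f * D" by simp
  qed simp
  then show ?thesis by (rule sobolevI[OF M(1)])
qed

section \<open>Curves in Sobolev spaces and their Fourier coefficients\<close>

lemma has_vector_derivative_quotient: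
  fixes f :: "real \<Rightarrow> complex"
  assumes "((\<lambda>\<tau>. cmod ((f \<tau> - f t) / of_real (\<tau> - t) - v)) \<longlongrightarrow> 0) (at t)"
  shows "(f has_vector_derivative v) (at t)"
  unfolding has_vector_derivative_def has_derivative_iff_norm
proof
  show "bounded_linear (\<lambda>x. x *\<^sub>R v)" by (rule bounded_linear_scaleR_left)
  show "((\<lambda>y. norm (f y - f t - (y - t) *\<^sub>R v) / norm (y - t)) \<longlongrightarrow> 0) (at t)"
  proof (rule Lim_transform_eventually[OF assms])
    show "\<forall>\<^sub>F \<tau> in at t. cmod ((f \<tau> - f t) / of_real (\<tau> - t) - v) = norm (f \<tau> - f t - (\<tau> - t) *\<^sub>R v) / norm (\<tau> - t)"
      using eventually_neq_at_within[of t t UNIV]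
    proof eventually_elim
      case (elim \<tau>)
      then have "(f \<tau> - f t) / of_real (\<tau> - t) - v = (f \<tau> - f t - (\<tau> - t) *\<^sub>R v) / of_real (\<tau> - t)"
        by (simp add: field_simps scaleR_conv_of_real)
      then show ?case by (simp only: norm_divide norm_of_real real_norm_def)
    qed
  qed
qed

text \<open>A single coefficient is bounded by the norm for r >= 0, so difference quotients converge
  in each coefficient. Openness of J keeps nearby times where u is known to be in the space.\<close>

lemma has_time_deriv_coeff:
  assumes h: "has_time_deriv r u v t" and r: "0 \<le> r" and J: "open J" "t \<in> J" and u: "\<And>\<tau>. \<tau> \<in> J \<Longrightarrow> u \<tau> \<in> sobolev r"
  shows "((\<lambda>\<tau>. fourier_coeff (u \<tau>) n) has_vector_derivative fourier_coeff v n) (at t)"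
proof (rule has_vector_derivative_quotient)
  have v: "v \<in> sobolev r" and lim: "((\<lambda>\<tau>. sob_dist r (\<lambda>x. (u \<tau> x - u t x) / (\<tau> - t)) v) \<longlongrightarrow> 0) (at t)"
    using h by (auto simp: has_time_deriv_def)
  show "((\<lambda>\<tau>. cmod ((fourier_coeff (u \<tau>) n - fourier_coeff (u t) n) / of_real (\<tau> - t) - fourier_coeff v n)) \<longlongrightarrow> 0) (at t)"
  proof (rule Lim_null_comparison[OF _ lim])
    have "\<forall>\<^sub>F \<tau> in at t. \<tau> \<in> J" using eventually_at_in_open'[OF J] .
    then show "\<forall>\<^sub>F \<tau> in at t. norm (cmod ((fourier_coeff (u \<tau>) n - fourier_coeff (u t) n) / of_real (\<tau> - t) - fourier_coeff v n))
        \<le> sob_dist r (\<lambda>x. (u \<tau> x - u t x) / (\<tau> - t)) v"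
    proof eventually_elim
      case (elim \<tau>)
      let ?q = "\<lambda>x. (u \<tau> x - u t x) / (\<tau> - t)"
      have d: "(\<lambda>x. u \<tau> x - u t x) \<in> sobolev r" by (intro sobolev_diff u elim J)
      have e: "?q = (\<lambda>x. inverse (\<tau> - t) * (u \<tau> x - u t x))" by (auto simp: divide_inverse)
      have q: "?q \<in> sobolev r" unfolding e by (rule sobolev_cmult[OF d])
      have "fourier_coeff ?q n = (fourier_coeff (u \<tau>) n - fourier_coeff (u t) n) / of_real (\<tau> - t)"
        unfolding e fourier_coeff_cmult fourier_coeff_diff[OF sobolev_L2[OF u[OF elim]] sobolev_L2[OF u[OF J(2)]]]
        by (simp add: divide_inverse)
      moreover have "cmod (fourier_coeff ?q n - fourier_coeff v n) \<le> hN r (\<lambda>n. fourier_coeff ?q n - fourier_coeff v n) (nat \<bar>n\<bar>)"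
        by (rule cmod_le_hN[OF r]) (simp add: mem_win)
      ultimately show ?case using hN_le_sob_dist[OF q v, of "nat \<bar>n\<bar>"] by simp
    qed
  qed
qed

lemma has_time_derivI:
  assumes v: "v \<in> sobolev r" and J: "open J" "t \<in> J" and u: "\<And>\<tau>. \<tau> \<in> J \<Longrightarrow> u \<tau> \<in> sobolev r"
    and b: "\<And>e. 0 < e \<Longrightarrow> \<exists>d>0. \<forall>\<tau>. \<bar>\<tau> - t\<bar> < d \<longrightarrow>
       (\<forall>m. hN r (\<lambda>n. fourier_coeff (u \<tau>) n - fourier_coeff (u t) n - of_real (\<tau> - t) * fourier_coeff v n) m \<le> \<bar>\<tau> - t\<bar> * e)"
  shows "has_time_deriv r u v t"
  unfolding has_time_deriv_def
proof (intro conjI v tendstoI)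
  fix e :: real assume e: "0 < e"
  obtain d where d: "0 < d" "\<And>\<tau> m. \<bar>\<tau> - t\<bar> < d \<Longrightarrow>
       hN r (\<lambda>n. fourier_coeff (u \<tau>) n - fourier_coeff (u t) n - of_real (\<tau> - t) * fourier_coeff v n) m \<le> \<bar>\<tau> - t\<bar> * (e / 2)"
    using b[of "e / 2"] e by auto
  have "\<forall>\<^sub>F \<tau> in at t. \<tau> \<in> J" using eventually_at_in_open'[OF J] .
  moreover have "\<forall>\<^sub>F \<tau> in at t. \<bar>\<tau> - t\<bar> < d"
    using d(1) unfolding eventually_at by (intro exI[of _ d]) (auto simp: dist_real_def)
  moreover have "\<forall>\<^sub>F \<tau> in at t. \<tau> \<noteq> t" by (rule eventually_neq_at_within)
  ultimately show "\<forall>\<^sub>F \<tau> in at t. dist (sob_dist r (\<lambda>x. (u \<tau> x - u t x) / (\<tau> - t)) v) 0 < e"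
  proof eventually_elim
    case (elim \<tau>)
    let ?q = "\<lambda>x. (u \<tau> x - u t x) / (\<tau> - t)"
    have dd: "(\<lambda>x. u \<tau> x - u t x) \<in> sobolev r" by (intro sobolev_diff u elim J)
    have eq: "?q = (\<lambda>x. inverse (\<tau> - t) * (u \<tau> x - u t x))" by (auto simp: divide_inverse)
    have q: "?q \<in> sobolev r" unfolding eq by (rule sobolev_cmult[OF dd])
    have c: "fourier_coeff ?q n - fourier_coeff v n
       = of_real (inverse (\<tau> - t)) * (fourier_coeff (u \<tau>) n - fourier_coeff (u t) n - of_real (\<tau> - t) * fourier_coeff v n)" for n
      unfolding eq fourier_coeff_cmult fourier_coeff_diff[OF sobolev_L2[OF u[OF elim(1)]] sobolev_L2[OF u[OF J(2)]]]
      using elim(3) by (simp add: field_simps)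
    have "sob_dist r ?q v \<le> e / 2"
    proof (rule sob_dist_leI[OF q v])
      fix m
      have "\<bar>inverse (\<tau> - t)\<bar> * hN r (\<lambda>n. fourier_coeff (u \<tau>) n - fourier_coeff (u t) n - of_real (\<tau> - t) * fourier_coeff v n) m
         \<le> \<bar>inverse (\<tau> - t)\<bar> * (\<bar>\<tau> - t\<bar> * (e / 2))"
        by (intro mult_left_mono d(2) elim) auto
      also have "\<dots> = e / 2" using elim(3) by (simp add: abs_mult[symmetric] mult.assoc[symmetric])
      finally show "hN r (\<lambda>n. fourier_coeff ?q n - fourier_coeff v n) m \<le> e / 2"
        unfolding c hN_cmult .
    qed
    then show ?case using e by (simp add: sob_dist_def sob_norm_ge0)
  qed
qed

lemma sob_C0I:
  assumes u: "\<And>t. t \<in> J \<Longrightarrow> u t \<in> sobolev r"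
    and b: "\<And>t e. t \<in> J \<Longrightarrow> 0 < e \<Longrightarrow> \<exists>d>0. \<forall>\<tau>\<in>J. \<bar>\<tau> - t\<bar> < d \<longrightarrow>
       (\<forall>m. hN r (\<lambda>n. fourier_coeff (u \<tau>) n - fourier_coeff (u t) n) m \<le> e)"
  shows "sob_C0 r J u"
  unfolding sob_C0_def
proof (intro ballI conjI tendstoI)
  fix t e :: real assume t: "t \<in> J" and e: "0 < e"
  obtain d where d: "0 < d" "\<And>\<tau> m. \<tau> \<in> J \<Longrightarrow> \<bar>\<tau> - t\<bar> < d \<Longrightarrow> hN r (\<lambda>n. fourier_coeff (u \<tau>) n - fourier_coeff (u t) n) m \<le> e / 2"
    using b[OF t, of "e / 2"] e by auto
  have "sob_dist r (u \<tau>) (u t) < e" if "\<tau> \<in> J" "\<bar>\<tau> - t\<bar> < d" for \<tau>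
  proof -
    have "sob_dist r (u \<tau>) (u t) \<le> e / 2" using that by (intro sob_dist_leI u t d(2)) auto
    then show ?thesis using e by simp
  qed
  then show "\<forall>\<^sub>F \<tau> in at t within J. dist (sob_dist r (u \<tau>) (u t)) 0 < e"
    unfolding eventually_at using d(1)
    by (intro exI[of _ d]) (auto simp: dist_real_def sob_dist_def sob_norm_ge0)
qed (rule u)

lemma sob_norm_triangle:
  assumes "f \<in> sobolev r" "g \<in> sobolev r"
  shows "sob_norm r f \<le> sob_norm r g + sob_dist r f g"
proof (rule sobolev_summableI(2))
  fix m
  have "hN r (fourier_coeff f) m = hN r (\<lambda>n. fourier_coeff g n + (fourier_coeff f n - fourier_coeff g n)) m" by simp
  also have "\<dots> \<le> hN r (fourier_coeff g) m + hN r (\<lambda>n. fourier_coeff f n - fourier_coeff g n) m" by (rule hN_triangle)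
  also have "\<dots> \<le> sob_norm r g + sob_dist r f g"
    by (intro add_mono hN_le_sob_norm hN_le_sob_dist assms)
  finally show "hN r (fourier_coeff f) m \<le> sob_norm r g + sob_dist r f g" .
qed

lemma sob_dist_commute:
  assumes "f \<in> sobolev r" "g \<in> sobolev r"
  shows "sob_dist r f g = sob_dist r g f"
proof -
  have "fourier_coeff (\<lambda>x. f x - g x) n = - fourier_coeff (\<lambda>x. g x - f x) n" for n
    by (simp add: fourier_coeff_diff_fun[OF assms] fourier_coeff_diff_fun[OF assms(2,1)])
  then have "sobolev_term r (\<lambda>x. f x - g x) = sobolev_term r (\<lambda>x. g x - f x)"
    by (intro ext) (simp add: sobolev_term_def)
  then show ?thesis by (simp add: sob_dist_def sob_norm_def)
qed

lemma sob_C0_bounded: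
  assumes c: "sob_C0 r J u" and K: "compact K" "K \<subseteq> J"
  obtains B where "\<And>t. t \<in> K \<Longrightarrow> sob_norm r (u t) \<le> B"
proof -
  have "continuous_on K (\<lambda>t. sob_norm r (u t))"
    unfolding continuous_on_def
  proof
    fix t assume "t \<in> K"
    then have t: "t \<in> J" using K by auto
    have u: "u \<tau> \<in> sobolev r" if "\<tau> \<in> J" for \<tau> using c that by (simp add: sob_C0_def)
    have "((\<lambda>\<tau>. sob_dist r (u \<tau>) (u t)) \<longlongrightarrow> 0) (at t within J)" using c t by (simp add: sob_C0_def)
    then have "((\<lambda>\<tau>. sob_dist r (u \<tau>) (u t)) \<longlongrightarrow> 0) (at t within K)" by (rule tendsto_within_subset[OF _ K(2)])
    moreover have "\<forall>\<^sub>F \<tau> in at t within K. norm (sob_norm r (u \<tau>) - sob_norm r (u t)) \<le> sob_dist r (u \<tau>) (u t)"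
      unfolding eventually_at
    proof (intro exI[of _ 1] conjI ballI impI)
      fix \<tau> assume "\<tau> \<in> K"
      then have \<tau>: "\<tau> \<in> J" using K by auto
      show "norm (sob_norm r (u \<tau>) - sob_norm r (u t)) \<le> sob_dist r (u \<tau>) (u t)"
        using sob_norm_triangle[OF u[OF \<tau>] u[OF t]] sob_norm_triangle[OF u[OF t] u[OF \<tau>]]
          sob_dist_commute[OF u[OF \<tau>] u[OF t]] by (simp add: abs_le_iff)
    qed simp
    ultimately have "((\<lambda>\<tau>. sob_norm r (u \<tau>) - sob_norm r (u t)) \<longlongrightarrow> 0) (at t within K)"
      by (rule Lim_null_comparison[rotated])
    then show "((\<lambda>t. sob_norm r (u t)) \<longlongrightarrow> sob_norm r (u t)) (at t within K)"
      by (rule LIM_zero_cancel)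
  qed
  then have "compact ((\<lambda>t. sob_norm r (u t)) ` K)" using K by (intro compact_continuous_image)
  then have "bounded ((\<lambda>t. sob_norm r (u t)) ` K)" by (rule compact_imp_bounded)
  then obtain B where "\<forall>x\<in>(\<lambda>t. sob_norm r (u t)) ` K. norm x \<le> B"
    unfolding bounded_iff by blast
  then have "sob_norm r (u t) \<le> B" if "t \<in> K" for t using that by (simp add: sob_norm_ge0)
  then show ?thesis by (rule that)
qed

definition pst :: "(real \<Rightarrow> real) \<Rightarrow> (real \<Rightarrow> real) \<Rightarrow> int \<Rightarrow> complex \<times> complex" where
  "pst u \<rho> n = (fourier_coeff u n, fourier_coeff \<rho> n)"

lemma hrm_pst: "hrm (pst u \<rho>)"
  by (simp add: hrm_def pst_def fourier_coeff_minus)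

lemma Nv_hN: "(Nv (wt r 0) m y)\<^sup>2 = (hN (r + 1) (\<lambda>n. fst (y n)) m)\<^sup>2 + (hN r (\<lambda>n. snd (y n)) m)\<^sup>2"
proof -
  have "(wt r 0 n * sz n (y n))\<^sup>2 = (jb n powr (r + 1) * cmod (fst (y n)))\<^sup>2 + (jb n powr r * cmod (snd (y n)))\<^sup>2" for n
    by (simp add: wt_0 power_mult_distrib sz_sq powr_add algebra_simps)
  then show ?thesis
    by (simp add: Nv_def hN_def L2_set_def sum_nonneg sum.distrib)
qed

lemma hN_fst_le: "hN (r + 1) (\<lambda>n. fst (y n)) m \<le> Nv (wt r 0) m y"
  and hN_snd_le: "hN r (\<lambda>n. snd (y n)) m \<le> Nv (wt r 0) m y"
  by (rule power2_le_imp_le[OF _ Nv_ge0], simp add: Nv_hN)+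

lemma Nv_le_hN: "Nv (wt r 0) m y \<le> hN (r + 1) (\<lambda>n. fst (y n)) m + hN r (\<lambda>n. snd (y n)) m"
proof (rule power2_le_imp_le)
  show "(Nv (wt r 0) m y)\<^sup>2 \<le> (hN (r + 1) (\<lambda>n. fst (y n)) m + hN r (\<lambda>n. snd (y n)) m)\<^sup>2"
    unfolding Nv_hN power2_sum using mult_nonneg_nonneg[OF hN_ge0 hN_ge0, of "r + 1" "\<lambda>n. fst (y n)" m r "\<lambda>n. snd (y n)" m] by simp
qed simp

subsection \<open>Solutions and their Fourier coefficients\<close>

context ch2
begin

lemma ch2_solution_iff:
  "ch2_solution (\<sigma> + 1) J u0 \<rho>0 u \<rho> \<longleftrightarrow>
     sob_C0 (\<sigma> + 1) J u \<and> sob_C0 \<sigma> J \<rho> \<and> sob_C1 \<sigma> J u \<and> sob_C1 (\<sigma> - 1) J \<rho> \<and>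
     (\<forall>t\<in>J.
        (\<lambda>x. time_deriv \<sigma> u t x + u t x * weak_deriv (u t) x) \<doteq>
        (\<lambda>x. - A_inv (weak_deriv
                  (\<lambda>y. (u t y)\<^sup>2 + 1/2 * (weak_deriv (u t) y)\<^sup>2 + 1/2 * (\<rho> t y)\<^sup>2)) x)) \<and>
     (\<forall>t\<in>J.
        (\<lambda>x. time_deriv (\<sigma> - 1) \<rho> t x + u t x * weak_deriv (\<rho> t) x) \<doteq>
        (\<lambda>x. - (\<rho> t x * weak_deriv (u t) x))) \<and>
     u 0 \<doteq> u0 \<and> \<rho> 0 \<doteq> \<rho>0"
  unfolding ch2_solution_def by simp

lemma bdd_pst:
  assumes "u \<in> sobolev (\<sigma> + 1)" "\<rho> \<in> sobolev \<sigma>"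
  shows "bdd (sob_norm (\<sigma> + 1) u + sob_norm \<sigma> \<rho>) (pst u \<rho>)"
  unfolding bdd_def
proof
  fix m
  have "Nv (wt \<sigma> 0) m (pst u \<rho>) \<le> hN (\<sigma> + 1) (fourier_coeff u) m + hN \<sigma> (fourier_coeff \<rho>) m"
    using Nv_le_hN[of \<sigma> m "pst u \<rho>"] by (simp add: pst_def)
  also have "\<dots> \<le> sob_norm (\<sigma> + 1) u + sob_norm \<sigma> \<rho>"
    by (intro add_mono hN_le_sob_norm assms)
  finally show "Nv (wt \<sigma> 0) m (pst u \<rho>) \<le> sob_norm (\<sigma> + 1) u + sob_norm \<sigma> \<rho>" .
qed

text \<open>Identifies \<open>Bq\<close> with the coefficients of the right-hand side of the
  equations. Since \<sigma> - 1 > 1/2, the factors u, u_x, rho and rho_x all have absolutely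
  summable coefficients, so \<open>fourier_coeff_mult\<close> turns the limits of convolutions into
  products.\<close>

lemma rhs_pst:
  assumes u: "u \<in> sobolev (\<sigma> + 1)" and \<rho>: "\<rho> \<in> sobolev \<sigma>"
  defines "N \<equiv> A_inv (weak_deriv (\<lambda>y. (u y)\<^sup>2 + 1/2 * (weak_deriv u y)\<^sup>2 + 1/2 * (\<rho> y)\<^sup>2))"
  shows "N \<in> circ_L2" "(\<lambda>x. u x * weak_deriv u x) \<in> circ_L2"
    "(\<lambda>x. u x * weak_deriv \<rho> x) \<in> circ_L2" "(\<lambda>x. \<rho> x * weak_deriv u x) \<in> circ_L2"
    "fst (Bq (pst u \<rho>) n) = - fourier_coeff (\<lambda>x. u x * weak_deriv u x) n - fourier_coeff N n"
    "snd (Bq (pst u \<rho>) n) = - fourier_coeff (\<lambda>x. u x * weak_deriv \<rho> x) n - fourier_coeff (\<lambda>x. \<rho> x * weak_deriv u x) n"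
proof -
  have ux: "weak_deriv u \<in> sobolev \<sigma>" and uxc: "fourier_coeff (weak_deriv u) = (\<lambda>k. dsym k * fourier_coeff u k)"
    using weak_deriv_sobolev[OF u] \<sigma> by (simp, intro ext) simp
  have rx: "weak_deriv \<rho> \<in> sobolev (\<sigma> - 1)" and rxc: "fourier_coeff (weak_deriv \<rho>) = (\<lambda>k. dsym k * fourier_coeff \<rho> k)"
    using weak_deriv_sobolev[OF \<rho>] \<sigma> by (simp, intro ext) simp
  obtain C where C: "\<And>m. (\<Sum>n\<in>win m. cmod (fourier_coeff u n)) \<le> C" using sobolev_l1[OF u] \<sigma> by auto
  obtain Cx where Cx: "\<And>m. (\<Sum>n\<in>win m. cmod (fourier_coeff (weak_deriv u) n)) \<le> Cx" using sobolev_l1[OF ux] \<sigma> by auto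
  obtain D where D: "\<And>m. (\<Sum>n\<in>win m. cmod (fourier_coeff \<rho> n)) \<le> D" using sobolev_l1[OF \<rho>] \<sigma> by auto
  obtain Dx where Dx: "\<And>m. (\<Sum>n\<in>win m. cmod (fourier_coeff (weak_deriv \<rho>) n)) \<le> Dx" using sobolev_l1[OF rx] \<sigma> by auto
  note L = sobolev_L2[OF u] sobolev_L2[OF ux] sobolev_L2[OF \<rho>] sobolev_L2[OF rx]
  note m_uux = fourier_coeff_mult[OF L(1) C L(2) Cx] and m_uu = fourier_coeff_mult[OF L(1) C L(1) C]
    and m_xx = fourier_coeff_mult[OF L(2) Cx L(2) Cx] and m_rr = fourier_coeff_mult[OF L(3) D L(3) D]
    and m_urx = fourier_coeff_mult[OF L(1) C L(4) Dx] and m_rux = fourier_coeff_mult[OF L(3) D L(2) Cx]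
  show "(\<lambda>x. u x * weak_deriv u x) \<in> circ_L2" "(\<lambda>x. u x * weak_deriv \<rho> x) \<in> circ_L2" "(\<lambda>x. \<rho> x * weak_deriv u x) \<in> circ_L2"
    by (rule m_uux(1), rule m_urx(1), rule m_rux(1))
  \<comment> \<open>Squares are written as products and the sum is bracketed to the right, to match
    \<open>fourier_coeff_mult\<close> and \<open>fourier_coeff_add\<close>.\<close>
  define P where "P y = u y * u y + (1/2 * (weak_deriv u y * weak_deriv u y) + 1/2 * (\<rho> y * \<rho> y))" for y
  have N: "N = A_inv (weak_deriv P)"
    unfolding N_def P_def[abs_def] by (simp add: power2_eq_square add.assoc)
  have s1: "u \<in> sobolev 1" "weak_deriv u \<in> sobolev 1" "\<rho> \<in> sobolev 1"
    using \<sigma> by (auto intro: sobolev_mono[OF u] sobolev_mono[OF ux] sobolev_mono[OF \<rho>])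
  have P1: "P \<in> sobolev 1"
    unfolding P_def[abs_def] by (intro sobolev_add sobolev_cmult sobolev_mult s1)
  have Pc: "fourier_coeff P n = fourier_coeff (\<lambda>x. u x * u x) n
     + 1/2 * fourier_coeff (\<lambda>x. weak_deriv u x * weak_deriv u x) n + 1/2 * fourier_coeff (\<lambda>x. \<rho> x * \<rho> x) n"
  proof -
    note A2 = circ_L2_cmult[OF m_xx(1), of "1/2"] and A3 = circ_L2_cmult[OF m_rr(1), of "1/2"]
    show ?thesis
      unfolding P_def[abs_def] fourier_coeff_add[OF m_uu(1) circ_L2_add[OF A2 A3]] fourier_coeff_add[OF A2 A3] fourier_coeff_cmult
      by simp
  qed
  have Px: "weak_deriv P \<in> sobolev 0" using weak_deriv_sobolev(1)[OF P1] by simp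
  show "N \<in> circ_L2" unfolding N by (rule sobolev_L2[OF A_inv_sobolev(1)[OF Px]])
  have Nc: "fourier_coeff N n = msym n * fourier_coeff P n"
    unfolding N A_inv_sobolev(2)[OF Px] using weak_deriv_sobolev(2)[OF P1] by (simp add: msym_def)
  let ?y = "pst u \<rho>"
  let ?t = "\<lambda>m f. trn m (fourier_coeff f)"
  have t: "(\<lambda>j. fst (trn m ?y j)) = ?t m u" "(\<lambda>j. snd (trn m ?y j)) = ?t m \<rho>"
    "(\<lambda>k. dsym k * fst (trn m ?y k)) = ?t m (weak_deriv u)" "(\<lambda>k. dsym k * snd (trn m ?y k)) = ?t m (weak_deriv \<rho>)" for m
    by (auto simp: trn_def pst_def uxc rxc)
  have b1: "fst (bil m (trn m ?y) (trn m ?y) n) = - conv m (?t m u) (?t m (weak_deriv u)) n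
      - msym n * (conv m (?t m u) (?t m u) n + 1/2 * conv m (?t m (weak_deriv u)) (?t m (weak_deriv u)) n
          + 1/2 * conv m (?t m \<rho>) (?t m \<rho>) n)" for m
    by (simp add: bil_def tra_def rst_def t)
  have b2: "snd (bil m (trn m ?y) (trn m ?y) n) = - conv m (?t m u) (?t m (weak_deriv \<rho>)) n
      - conv m (?t m \<rho>) (?t m (weak_deriv u)) n" for m
    by (simp add: bil_def tra_def rst_def t)
  have lim: "(\<lambda>m. bil m (trn m ?y) (trn m ?y) n) \<longlonglongrightarrow> Bq ?y n" by (rule Bq_lim[OF bdd_pst[OF u \<rho>]])
  have "(\<lambda>m. fst (bil m (trn m ?y) (trn m ?y) n)) \<longlonglongrightarrow> - fourier_coeff (\<lambda>x. u x * weak_deriv u x) n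
      - msym n * (fourier_coeff (\<lambda>x. u x * u x) n + 1/2 * fourier_coeff (\<lambda>x. weak_deriv u x * weak_deriv u x) n
         + 1/2 * fourier_coeff (\<lambda>x. \<rho> x * \<rho> x) n)"
    unfolding b1 by (intro tendsto_intros m_uux(2) m_uu(2) m_xx(2) m_rr(2))
  from LIMSEQ_unique[OF tendsto_fst[OF lim] this]
  show "fst (Bq ?y n) = - fourier_coeff (\<lambda>x. u x * weak_deriv u x) n - fourier_coeff N n"
    unfolding Nc Pc .
  have "(\<lambda>m. snd (bil m (trn m ?y) (trn m ?y) n)) \<longlonglongrightarrow> - fourier_coeff (\<lambda>x. u x * weak_deriv \<rho> x) n
      - fourier_coeff (\<lambda>x. \<rho> x * weak_deriv u x) n"
    unfolding b2 by (intro tendsto_intros m_urx(2) m_rux(2))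
  from LIMSEQ_unique[OF tendsto_snd[OF lim] this]
  show "snd (Bq ?y n) = - fourier_coeff (\<lambda>x. u x * weak_deriv \<rho> x) n - fourier_coeff (\<lambda>x. \<rho> x * weak_deriv u x) n" .
qed

lemma hrm_Bq:
  assumes "bdd B y" "hrm y"
  shows "hrm (Bq y)"
  unfolding hrm_cjp
proof
  fix n
  have "(\<lambda>m. bil m (trn m y) (trn m y) (- n)) \<longlonglongrightarrow> cjp (Bq y n)"
    using bounded_linear.tendsto[OF bounded_linear_cjp Bq_lim[OF assms(1), of n]] hrm_bil[OF hrm_trn[OF assms(2)]]
    by (simp add: hrm_cjp)
  then show "Bq y (- n) = cjp (Bq y n)" using Bq_lim[OF assms(1), of "- n"] by (rule LIMSEQ_unique[rotated])
qed

lemma circ_eq_zero_coeff: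
  assumes "f \<in> circ_L2" "g \<in> circ_L2" "f \<doteq> g"
  shows "fourier_coeff f n = fourier_coeff g n"
  by (rule fourier_coeff_cong[OF circ_L2D(2)[OF assms(1)] circ_L2D(2)[OF assms(2)] assms(3)])

lemma circ_L2_minus: "f \<in> circ_L2 \<Longrightarrow> (\<lambda>x. - f x) \<in> circ_L2"
  using circ_L2_cmult[of f "- 1"] by simp

lemma fourier_coeff_uminus: "fourier_coeff (\<lambda>x. - f x) n = - fourier_coeff f n"
  using fourier_coeff_cmult[of "- 1" f n] by simp

lemma add_eq_minus: "(a::complex) + b = - d \<Longrightarrow> a = - b - d"
  by algebra

lemma time_deriv_spec: "sob_C1 r J u \<Longrightarrow> t \<in> J \<Longrightarrow> has_time_deriv r u (time_deriv r u t) t"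
  unfolding time_deriv_def by (rule someI_ex[of "\<lambda>v. has_time_deriv r u v t"]) (simp add: sob_C1_def)

text \<open>Every function-space solution yields a sequence solution, so uniqueness and stability
  can be proved for sequences. Bounds on compact time intervals come from norm continuity, and the
  derivative equation from comparing coefficients in the equations.\<close>

lemma solution_seqsol:
  assumes sol: "ch2_solution (\<sigma> + 1) {-T<..<T} u0 \<rho>0 u \<rho>" and T: "0 < T"
    and u0: "u0 \<in> sobolev (\<sigma> + 1)" and \<rho>0: "\<rho>0 \<in> sobolev \<sigma>"
  shows "seqsol T (\<lambda>t. pst (u t) (\<rho> t))" "pst (u 0) (\<rho> 0) = pst u0 \<rho>0"
    "\<And>t. \<bar>t\<bar> < T \<Longrightarrow> u t \<in> sobolev (\<sigma> + 1) \<and> \<rho> t \<in> sobolev \<sigma>"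
    "\<And>t. \<bar>t\<bar> < T \<Longrightarrow> time_deriv \<sigma> u t \<in> sobolev \<sigma> \<and> time_deriv (\<sigma> - 1) \<rho> t \<in> sobolev (\<sigma> - 1)"
    "\<And>t n. \<bar>t\<bar> < T \<Longrightarrow> fourier_coeff (time_deriv \<sigma> u t) n = fst (Bq (pst (u t) (\<rho> t)) n)"
    "\<And>t n. \<bar>t\<bar> < T \<Longrightarrow> fourier_coeff (time_deriv (\<sigma> - 1) \<rho> t) n = snd (Bq (pst (u t) (\<rho> t)) n)"
proof -
  let ?J = "{-T<..<T}"
  have J: "open ?J" "\<And>t. t \<in> ?J \<longleftrightarrow> \<bar>t\<bar> < T" by auto
  note S = sol[unfolded ch2_solution_iff]
  have us: "u t \<in> sobolev (\<sigma> + 1)" and rs: "\<rho> t \<in> sobolev \<sigma>" if "t \<in> ?J" for t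
    using S that by (auto simp: sob_C0_def)
  then show "\<And>t. \<bar>t\<bar> < T \<Longrightarrow> u t \<in> sobolev (\<sigma> + 1) \<and> \<rho> t \<in> sobolev \<sigma>" using J by blast
  have us': "u t \<in> sobolev \<sigma>" and rs': "\<rho> t \<in> sobolev (\<sigma> - 1)" if "t \<in> ?J" for t
    using sobolev_mono[OF us[OF that]] sobolev_mono[OF rs[OF that]] by auto
  have C1u: "sob_C1 \<sigma> ?J u" and C1r: "sob_C1 (\<sigma> - 1) ?J \<rho>" using S by auto
  have tds: "time_deriv \<sigma> u t \<in> sobolev \<sigma>" "time_deriv (\<sigma> - 1) \<rho> t \<in> sobolev (\<sigma> - 1)" if "t \<in> ?J" for t
    using time_deriv_spec[OF C1u that] time_deriv_spec[OF C1r that] by (auto simp: has_time_deriv_def)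
  then show "\<And>t. \<bar>t\<bar> < T \<Longrightarrow> time_deriv \<sigma> u t \<in> sobolev \<sigma> \<and> time_deriv (\<sigma> - 1) \<rho> t \<in> sobolev (\<sigma> - 1)" using J by blast
  have z: "0 \<in> ?J" using T by simp
  show "pst (u 0) (\<rho> 0) = pst u0 \<rho>0"
  proof
    fix n
    show "pst (u 0) (\<rho> 0) n = pst u0 \<rho>0 n"
      unfolding pst_def using S
      by (auto intro!: circ_eq_zero_coeff sobolev_L2[OF us[OF z]] sobolev_L2[OF rs[OF z]] sobolev_L2[OF u0] sobolev_L2[OF \<rho>0])
  qed
  have c1: "fourier_coeff (time_deriv \<sigma> u t) n = fst (Bq (pst (u t) (\<rho> t)) n)" if t: "t \<in> ?J" for t n
  proof -
    note R = rhs_pst[OF us[OF t] rs[OF t]]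
    let ?N = "A_inv (weak_deriv (\<lambda>y. (u t y)\<^sup>2 + 1/2 * (weak_deriv (u t) y)\<^sup>2 + 1/2 * (\<rho> t y)\<^sup>2))"
    note v = sobolev_L2[OF tds(1)[OF t]]
    have "fourier_coeff (\<lambda>x. time_deriv \<sigma> u t x + u t x * weak_deriv (u t) x) n = fourier_coeff (\<lambda>x. - ?N x) n"
      using S t by (intro circ_eq_zero_coeff circ_L2_add v R(2) circ_L2_minus R(1)) blast
    then show ?thesis
      unfolding fourier_coeff_add[OF v R(2)] fourier_coeff_uminus R(5) by (rule add_eq_minus)
  qed
  have c2: "fourier_coeff (time_deriv (\<sigma> - 1) \<rho> t) n = snd (Bq (pst (u t) (\<rho> t)) n)" if t: "t \<in> ?J" for t n
  proof -
    note R = rhs_pst[OF us[OF t] rs[OF t]]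
    note v = sobolev_L2[OF tds(2)[OF t]]
    have "fourier_coeff (\<lambda>x. time_deriv (\<sigma> - 1) \<rho> t x + u t x * weak_deriv (\<rho> t) x) n = fourier_coeff (\<lambda>x. - (\<rho> t x * weak_deriv (u t) x)) n"
      using S t by (intro circ_eq_zero_coeff circ_L2_add v R(3) circ_L2_minus R(4)) blast
    then show ?thesis
      unfolding fourier_coeff_add[OF v R(3)] fourier_coeff_uminus R(6) by (rule add_eq_minus)
  qed
  show "\<And>t n. \<bar>t\<bar> < T \<Longrightarrow> fourier_coeff (time_deriv \<sigma> u t) n = fst (Bq (pst (u t) (\<rho> t)) n)"
    "\<And>t n. \<bar>t\<bar> < T \<Longrightarrow> fourier_coeff (time_deriv (\<sigma> - 1) \<rho> t) n = snd (Bq (pst (u t) (\<rho> t)) n)"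
    using c1 c2 J by blast+
  show "seqsol T (\<lambda>t. pst (u t) (\<rho> t))"
    unfolding seqsol_def
  proof (intro conjI allI impI hrm_pst)
    fix t0 assume t0: "t0 < T"
    have K: "compact {-t0..t0}" "{-t0..t0} \<subseteq> ?J" using t0 by auto
    obtain B1 where B1: "\<And>t. t \<in> {-t0..t0} \<Longrightarrow> sob_norm (\<sigma> + 1) (u t) \<le> B1"
      using sob_C0_bounded[OF _ K] S by blast
    obtain B2 where B2: "\<And>t. t \<in> {-t0..t0} \<Longrightarrow> sob_norm \<sigma> (\<rho> t) \<le> B2"
      using sob_C0_bounded[OF _ K] S by blast
    show "\<exists>B. \<forall>t. \<bar>t\<bar> \<le> t0 \<longrightarrow> bdd B (pst (u t) (\<rho> t))"
    proof (intro exI[of _ "B1 + B2"] allI impI)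
      fix t assume "\<bar>t\<bar> \<le> t0"
      then have t: "t \<in> {-t0..t0}" "t \<in> ?J" using t0 by auto
      show "bdd (B1 + B2) (pst (u t) (\<rho> t))"
        by (rule bdd_mono[OF bdd_pst[OF us[OF t(2)] rs[OF t(2)]] add_mono[OF B1[OF t(1)] B2[OF t(1)]]])
    qed
  next
    fix t n assume "\<bar>t\<bar> < T"
    then have t: "t \<in> ?J" using J by blast
    have "((\<lambda>\<tau>. fourier_coeff (u \<tau>) n) has_vector_derivative fst (Bq (pst (u t) (\<rho> t)) n)) (at t)"
      using has_time_deriv_coeff[OF time_deriv_spec[OF C1u t] _ J(1) t us'] \<sigma> c1[OF t] by simp
    moreover have "((\<lambda>\<tau>. fourier_coeff (\<rho> \<tau>) n) has_vector_derivative snd (Bq (pst (u t) (\<rho> t)) n)) (at t)"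
      using has_time_deriv_coeff[OF time_deriv_spec[OF C1r t] _ J(1) t rs'] \<sigma> c2[OF t] by simp
    ultimately have "((\<lambda>\<tau>. (fourier_coeff (u \<tau>) n, fourier_coeff (\<rho> \<tau>) n)) has_vector_derivative
        (fst (Bq (pst (u t) (\<rho> t)) n), snd (Bq (pst (u t) (\<rho> t)) n))) (at t)"
      by (rule has_vector_derivative_Pair)
    then show "((\<lambda>t. pst (u t) (\<rho> t) n) has_vector_derivative Bq (pst (u t) (\<rho> t)) n) (at t)"
      by (simp add: pst_def)
  qed
qed

text \<open>The converse passage: functions are synthesised from the coefficients at each time.
  Strong continuity is a separate hypothesis because \<open>seqsol\<close> does not contain
  it.\<close>

lemma seqsol_solution:
  assumes y: "seqsol T y" "y 0 = pst u0 \<rho>0" and B: "\<And>t. \<bar>t\<bar> < T \<Longrightarrow> bdd B (y t)" and T: "0 < T"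
    and cont: "\<And>t e. \<bar>t\<bar> < T \<Longrightarrow> 0 < e \<Longrightarrow> \<exists>d>0. \<forall>\<tau>. \<bar>\<tau>\<bar> < T \<longrightarrow> \<bar>\<tau> - t\<bar> < d \<longrightarrow> bdd e (\<lambda>n. y \<tau> n - y t n)"
    and u0: "u0 \<in> sobolev (\<sigma> + 1)" and \<rho>0: "\<rho>0 \<in> sobolev \<sigma>"
  obtains u \<rho> where "ch2_solution (\<sigma> + 1) {-T<..<T} u0 \<rho>0 u \<rho>"
proof -
  let ?J = "{-T<..<T}"
  have J: "open ?J" "\<And>t. t \<in> ?J \<longleftrightarrow> \<bar>t\<bar> < T" by auto
  have hy: "hrm (y t)" if "\<bar>t\<bar> < T" for t by (rule seqsolD(1)[OF y(1) that])
  have hB: "hrm (Bq (y t))" if "\<bar>t\<bar> < T" for t by (rule hrm_Bq[OF B[OF that] hy[OF that]])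
  have hh: "herm (\<lambda>n. fst (z n))" "herm (\<lambda>n. snd (z n))" if "hrm z" for z
    using that by (auto simp: hrm_def herm_def)
  \<comment> \<open>Curves are total in time; outside the interval an arbitrary function is
    chosen.\<close>
  have "\<forall>t. \<exists>f. \<bar>t\<bar> < T \<longrightarrow> f \<in> sobolev (\<sigma> + 1) \<and> fourier_coeff f = (\<lambda>n. fst (y t n))"
  proof (intro allI)
    fix t
    show "\<exists>f. \<bar>t\<bar> < T \<longrightarrow> f \<in> sobolev (\<sigma> + 1) \<and> fourier_coeff f = (\<lambda>n. fst (y t n))"
    proof (cases "\<bar>t\<bar> < T")
      case True
      have "hN (\<sigma> + 1) (\<lambda>n. fst (y t n)) m \<le> B" for m
        using order_trans[OF hN_fst_le] B[OF True] by (auto simp: bdd_def)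
      then show ?thesis using sobolev_synthesis[OF hh(1)[OF hy[OF True]], of "\<sigma> + 1" B] \<sigma> by auto
    qed simp
  qed
  then obtain u where u: "\<And>t. \<bar>t\<bar> < T \<Longrightarrow> u t \<in> sobolev (\<sigma> + 1)"
    "\<And>t. \<bar>t\<bar> < T \<Longrightarrow> fourier_coeff (u t) = (\<lambda>n. fst (y t n))" by metis
  have "\<forall>t. \<exists>f. \<bar>t\<bar> < T \<longrightarrow> f \<in> sobolev \<sigma> \<and> fourier_coeff f = (\<lambda>n. snd (y t n))"
  proof (intro allI)
    fix t
    show "\<exists>f. \<bar>t\<bar> < T \<longrightarrow> f \<in> sobolev \<sigma> \<and> fourier_coeff f = (\<lambda>n. snd (y t n))"
    proof (cases "\<bar>t\<bar> < T")
      case True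
      have "hN \<sigma> (\<lambda>n. snd (y t n)) m \<le> B" for m
        using order_trans[OF hN_snd_le] B[OF True] by (auto simp: bdd_def)
      then show ?thesis using sobolev_synthesis[OF hh(2)[OF hy[OF True]], of \<sigma> B] \<sigma> by auto
    qed simp
  qed
  then obtain \<rho> where \<rho>: "\<And>t. \<bar>t\<bar> < T \<Longrightarrow> \<rho> t \<in> sobolev \<sigma>"
    "\<And>t. \<bar>t\<bar> < T \<Longrightarrow> fourier_coeff (\<rho> t) = (\<lambda>n. snd (y t n))" by metis
  have py: "pst (u t) (\<rho> t) = y t" if "\<bar>t\<bar> < T" for t
    using u(2)[OF that] \<rho>(2)[OF that] by (auto simp: pst_def)
  have fs: "hN \<sigma> (\<lambda>n. fst (z n)) m \<le> Nv (wt (\<sigma> - 1) 0) m z" "hN (\<sigma> - 1) (\<lambda>n. snd (z n)) m \<le> Nv (wt (\<sigma> - 1) 0) m z" for z m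
    using hN_fst_le[of "\<sigma> - 1" z m] hN_snd_le[of "\<sigma> - 1" z m] by simp_all
  have Cb0: "0 \<le> Cb B" using bdd_ge0[OF B[of 0]] T K c by (simp add: Cb_def)
  \<comment> \<open>\<open>Bq_diff\<close> turns continuity of y into continuity of
    \<open>Bq (y t)\<close> one order lower; by the mean value inequality the difference quotients
    then converge in that same norm.\<close>
  have tay: "\<exists>d>0. \<forall>\<tau>. \<bar>\<tau> - t\<bar> < d \<longrightarrow> \<bar>\<tau>\<bar> < T \<and>
      (\<forall>m. Nv (wt (\<sigma> - 1) 0) m (\<lambda>n. y \<tau> n - y t n - (\<tau> - t) *\<^sub>R Bq (y t) n) \<le> \<bar>\<tau> - t\<bar> * e
        \<and> Nv (wt (\<sigma> - 1) 0) m (\<lambda>n. Bq (y \<tau>) n - Bq (y t) n) \<le> e)"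
    if t: "\<bar>t\<bar> < T" and e: "0 < e" for t e
  proof -
    have e': "0 < e / (Cb B + 1)" using e Cb0 by simp
    obtain d where d: "0 < d" "\<And>\<tau>. \<bar>\<tau>\<bar> < T \<Longrightarrow> \<bar>\<tau> - t\<bar> < d \<Longrightarrow> bdd (e / (Cb B + 1)) (\<lambda>n. y \<tau> n - y t n)"
      using cont[OF t e'] by blast
    have ee: "Cb B * (e / (Cb B + 1)) \<le> e" using e Cb0 by (simp add: divide_simps)
    have Bd: "Nv (wt (\<sigma> - 1) 0) m (\<lambda>n. Bq (y \<tau>) n - Bq (y t) n) \<le> e" if "\<bar>\<tau>\<bar> < T" "\<bar>\<tau> - t\<bar> < d" for \<tau> m
      by (rule order_trans[OF Bq_diff[OF B[OF that(1)] B[OF t] d(2)[OF that]] ee])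
    show ?thesis
    proof (intro exI[of _ "min d (T - \<bar>t\<bar>)"] conjI allI impI)
      show "0 < min d (T - \<bar>t\<bar>)" using d t by simp
      fix \<tau> m assume "\<bar>\<tau> - t\<bar> < min d (T - \<bar>t\<bar>)"
      then have \<tau>: "\<bar>\<tau> - t\<bar> < d" "\<bar>\<tau> - t\<bar> < T - \<bar>t\<bar>" by auto
      show \<tau>T: "\<bar>\<tau>\<bar> < T" using \<tau>(2) by linarith
      show "Nv (wt (\<sigma> - 1) 0) m (\<lambda>n. Bq (y \<tau>) n - Bq (y t) n) \<le> e" by (rule Bd[OF \<tau>T \<tau>(1)])
      show "Nv (wt (\<sigma> - 1) 0) m (\<lambda>n. y \<tau> n - y t n - (\<tau> - t) *\<^sub>R Bq (y t) n) \<le> \<bar>\<tau> - t\<bar> * e"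
      proof (rule Nv_mean_value)
        fix s assume s: "\<bar>s - t\<bar> \<le> \<bar>\<tau> - t\<bar>"
        then have sT: "\<bar>s\<bar> < T" using \<tau>(2) by linarith
        show "((\<lambda>t. y t n) has_vector_derivative Bq (y s) n) (at s)" for n by (rule seqsolD(3)[OF y(1) sT])
        show "Nv (wt (\<sigma> - 1) 0) m (\<lambda>n. Bq (y s) n - Bq (y t) n) \<le> e" using s \<tau>(1) by (intro Bd sT) linarith
      qed simp
    qed
  qed
  have "\<forall>t. \<exists>f. \<bar>t\<bar> < T \<longrightarrow> f \<in> sobolev \<sigma> \<and> fourier_coeff f = (\<lambda>n. fst (Bq (y t) n))"
  proof (intro allI)
    fix t
    show "\<exists>f. \<bar>t\<bar> < T \<longrightarrow> f \<in> sobolev \<sigma> \<and> fourier_coeff f = (\<lambda>n. fst (Bq (y t) n))"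
    proof (cases "\<bar>t\<bar> < T")
      case True
      have "hN \<sigma> (\<lambda>n. fst (Bq (y t) n)) m \<le> Cb B * B" for m by (rule order_trans[OF fs(1) Bq_bound[OF B[OF True]]])
      then show ?thesis using sobolev_synthesis[OF hh(1)[OF hB[OF True]], of \<sigma> "Cb B * B"] \<sigma> by auto
    qed simp
  qed
  then obtain v where v: "\<And>t. \<bar>t\<bar> < T \<Longrightarrow> v t \<in> sobolev \<sigma>"
    "\<And>t. \<bar>t\<bar> < T \<Longrightarrow> fourier_coeff (v t) = (\<lambda>n. fst (Bq (y t) n))" by metis
  have "\<forall>t. \<exists>f. \<bar>t\<bar> < T \<longrightarrow> f \<in> sobolev (\<sigma> - 1) \<and> fourier_coeff f = (\<lambda>n. snd (Bq (y t) n))"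
  proof (intro allI)
    fix t
    show "\<exists>f. \<bar>t\<bar> < T \<longrightarrow> f \<in> sobolev (\<sigma> - 1) \<and> fourier_coeff f = (\<lambda>n. snd (Bq (y t) n))"
    proof (cases "\<bar>t\<bar> < T")
      case True
      have "hN (\<sigma> - 1) (\<lambda>n. snd (Bq (y t) n)) m \<le> Cb B * B" for m by (rule order_trans[OF fs(2) Bq_bound[OF B[OF True]]])
      then show ?thesis using sobolev_synthesis[OF hh(2)[OF hB[OF True]], of "\<sigma> - 1" "Cb B * B"] \<sigma> by auto
    qed simp
  qed
  then obtain w where w: "\<And>t. \<bar>t\<bar> < T \<Longrightarrow> w t \<in> sobolev (\<sigma> - 1)"
    "\<And>t. \<bar>t\<bar> < T \<Longrightarrow> fourier_coeff (w t) = (\<lambda>n. snd (Bq (y t) n))" by metis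
  have us: "u t \<in> sobolev \<sigma>" if "t \<in> ?J" for t using sobolev_mono[OF u(1)] that J(2) by simp
  have rs: "\<rho> t \<in> sobolev (\<sigma> - 1)" if "t \<in> ?J" for t using sobolev_mono[OF \<rho>(1)] that J(2) by simp
  have htu: "has_time_deriv \<sigma> u (v t) t" if t: "t \<in> ?J" for t
  proof (rule has_time_derivI[OF _ J(1) t us])
    have t': "\<bar>t\<bar> < T" using t J(2) by blast
    show "v t \<in> sobolev \<sigma>" by (rule v(1)[OF t'])
    fix e :: real assume "0 < e"
    then obtain d where d: "0 < d" "\<And>\<tau>. \<bar>\<tau> - t\<bar> < d \<Longrightarrow> \<bar>\<tau>\<bar> < T"
      "\<And>\<tau> m. \<bar>\<tau> - t\<bar> < d \<Longrightarrow> Nv (wt (\<sigma> - 1) 0) m (\<lambda>n. y \<tau> n - y t n - (\<tau> - t) *\<^sub>R Bq (y t) n) \<le> \<bar>\<tau> - t\<bar> * e"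
      using tay[OF t' \<open>0 < e\<close>] by blast
    show "\<exists>d>0. \<forall>\<tau>. \<bar>\<tau> - t\<bar> < d \<longrightarrow>
       (\<forall>m. hN \<sigma> (\<lambda>n. fourier_coeff (u \<tau>) n - fourier_coeff (u t) n - of_real (\<tau> - t) * fourier_coeff (v t) n) m \<le> \<bar>\<tau> - t\<bar> * e)"
    proof (intro exI[of _ d] conjI allI impI d(1))
      fix \<tau> m assume \<tau>: "\<bar>\<tau> - t\<bar> < d"
      show "hN \<sigma> (\<lambda>n. fourier_coeff (u \<tau>) n - fourier_coeff (u t) n - of_real (\<tau> - t) * fourier_coeff (v t) n) m \<le> \<bar>\<tau> - t\<bar> * e"
        using order_trans[OF fs(1) d(3)[OF \<tau>], of m]
        unfolding u(2)[OF t'] u(2)[OF d(2)[OF \<tau>]] v(2)[OF t'] by (simp add: scaleR_conv_of_real)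
    qed
  qed
  have htr: "has_time_deriv (\<sigma> - 1) \<rho> (w t) t" if t: "t \<in> ?J" for t
  proof (rule has_time_derivI[OF _ J(1) t rs])
    have t': "\<bar>t\<bar> < T" using t J(2) by blast
    show "w t \<in> sobolev (\<sigma> - 1)" by (rule w(1)[OF t'])
    fix e :: real assume "0 < e"
    then obtain d where d: "0 < d" "\<And>\<tau>. \<bar>\<tau> - t\<bar> < d \<Longrightarrow> \<bar>\<tau>\<bar> < T"
      "\<And>\<tau> m. \<bar>\<tau> - t\<bar> < d \<Longrightarrow> Nv (wt (\<sigma> - 1) 0) m (\<lambda>n. y \<tau> n - y t n - (\<tau> - t) *\<^sub>R Bq (y t) n) \<le> \<bar>\<tau> - t\<bar> * e"
      using tay[OF t' \<open>0 < e\<close>] by blast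
    show "\<exists>d>0. \<forall>\<tau>. \<bar>\<tau> - t\<bar> < d \<longrightarrow>
       (\<forall>m. hN (\<sigma> - 1) (\<lambda>n. fourier_coeff (\<rho> \<tau>) n - fourier_coeff (\<rho> t) n - of_real (\<tau> - t) * fourier_coeff (w t) n) m \<le> \<bar>\<tau> - t\<bar> * e)"
    proof (intro exI[of _ d] conjI allI impI d(1))
      fix \<tau> m assume \<tau>: "\<bar>\<tau> - t\<bar> < d"
      show "hN (\<sigma> - 1) (\<lambda>n. fourier_coeff (\<rho> \<tau>) n - fourier_coeff (\<rho> t) n - of_real (\<tau> - t) * fourier_coeff (w t) n) m \<le> \<bar>\<tau> - t\<bar> * e"
        using order_trans[OF fs(2) d(3)[OF \<tau>], of m]
        unfolding \<rho>(2)[OF t'] \<rho>(2)[OF d(2)[OF \<tau>]] w(2)[OF t'] by (simp add: scaleR_conv_of_real)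
    qed
  qed
  have spu: "has_time_deriv \<sigma> u (time_deriv \<sigma> u t) t" if "t \<in> ?J" for t
    unfolding time_deriv_def by (rule someI[of "\<lambda>v. has_time_deriv \<sigma> u v t", OF htu[OF that]])
  have spr: "has_time_deriv (\<sigma> - 1) \<rho> (time_deriv (\<sigma> - 1) \<rho> t) t" if "t \<in> ?J" for t
    unfolding time_deriv_def by (rule someI[of "\<lambda>v. has_time_deriv (\<sigma> - 1) \<rho> v t", OF htr[OF that]])
  \<comment> \<open>\<open>time_deriv\<close> may pick another representative than v t; both have
    the derivatives of the coefficients of u as coefficients, and these are unique.\<close>
  have tdu: "time_deriv \<sigma> u t \<in> sobolev \<sigma>" "fourier_coeff (time_deriv \<sigma> u t) = (\<lambda>n. fst (Bq (y t) n))" if t: "t \<in> ?J" for t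
  proof -
    show "time_deriv \<sigma> u t \<in> sobolev \<sigma>" using spu[OF t] by (simp add: has_time_deriv_def)
    show "fourier_coeff (time_deriv \<sigma> u t) = (\<lambda>n. fst (Bq (y t) n))"
    proof
      fix n
      have "((\<lambda>\<tau>. fourier_coeff (u \<tau>) n) has_vector_derivative fourier_coeff (time_deriv \<sigma> u t) n) (at t)"
        using \<sigma> by (intro has_time_deriv_coeff[OF spu[OF t] _ J(1) t us]) auto
      moreover have "((\<lambda>\<tau>. fourier_coeff (u \<tau>) n) has_vector_derivative fourier_coeff (v t) n) (at t)"
        using \<sigma> by (intro has_time_deriv_coeff[OF htu[OF t] _ J(1) t us]) auto
      ultimately have "fourier_coeff (time_deriv \<sigma> u t) n = fourier_coeff (v t) n" by (rule vector_derivative_unique_at)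
      then show "fourier_coeff (time_deriv \<sigma> u t) n = fst (Bq (y t) n)" using v(2) t J(2) by simp
    qed
  qed
  have tdr: "time_deriv (\<sigma> - 1) \<rho> t \<in> sobolev (\<sigma> - 1)" "fourier_coeff (time_deriv (\<sigma> - 1) \<rho> t) = (\<lambda>n. snd (Bq (y t) n))" if t: "t \<in> ?J" for t
  proof -
    show "time_deriv (\<sigma> - 1) \<rho> t \<in> sobolev (\<sigma> - 1)" using spr[OF t] by (simp add: has_time_deriv_def)
    show "fourier_coeff (time_deriv (\<sigma> - 1) \<rho> t) = (\<lambda>n. snd (Bq (y t) n))"
    proof
      fix n
      have "((\<lambda>\<tau>. fourier_coeff (\<rho> \<tau>) n) has_vector_derivative fourier_coeff (time_deriv (\<sigma> - 1) \<rho> t) n) (at t)"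
        using \<sigma> by (intro has_time_deriv_coeff[OF spr[OF t] _ J(1) t rs]) auto
      moreover have "((\<lambda>\<tau>. fourier_coeff (\<rho> \<tau>) n) has_vector_derivative fourier_coeff (w t) n) (at t)"
        using \<sigma> by (intro has_time_deriv_coeff[OF htr[OF t] _ J(1) t rs]) auto
      ultimately have "fourier_coeff (time_deriv (\<sigma> - 1) \<rho> t) n = fourier_coeff (w t) n" by (rule vector_derivative_unique_at)
      then show "fourier_coeff (time_deriv (\<sigma> - 1) \<rho> t) n = snd (Bq (y t) n)" using w(2) t J(2) by simp
    qed
  qed
  have c0: "\<exists>d>0. \<forall>\<tau>\<in>?J. \<bar>\<tau> - t\<bar> < d \<longrightarrow> (\<forall>m. Nv (wt \<sigma> 0) m (\<lambda>n. y \<tau> n - y t n) \<le> e)" if t: "t \<in> ?J" and e: "0 < e" for t e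
  proof -
    obtain d where d: "0 < d" "\<forall>\<tau>. \<bar>\<tau>\<bar> < T \<longrightarrow> \<bar>\<tau> - t\<bar> < d \<longrightarrow> bdd e (\<lambda>n. y \<tau> n - y t n)"
      using cont[OF t[unfolded J(2)] e] by blast
    show ?thesis by (intro exI[of _ d] conjI ballI impI d(1)) (use d(2) J(2) in \<open>simp add: bdd_def\<close>)
  qed
  have c1: "\<exists>d>0. \<forall>\<tau>\<in>?J. \<bar>\<tau> - t\<bar> < d \<longrightarrow> (\<forall>m. Nv (wt (\<sigma> - 1) 0) m (\<lambda>n. Bq (y \<tau>) n - Bq (y t) n) \<le> e)" if t: "t \<in> ?J" and e: "0 < e" for t e
  proof -
    obtain d where d: "0 < d" "\<forall>\<tau>. \<bar>\<tau> - t\<bar> < d \<longrightarrow> \<bar>\<tau>\<bar> < T \<and>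
      (\<forall>m. Nv (wt (\<sigma> - 1) 0) m (\<lambda>n. y \<tau> n - y t n - (\<tau> - t) *\<^sub>R Bq (y t) n) \<le> \<bar>\<tau> - t\<bar> * e
        \<and> Nv (wt (\<sigma> - 1) 0) m (\<lambda>n. Bq (y \<tau>) n - Bq (y t) n) \<le> e)"
      using tay[OF t[unfolded J(2)] e] by blast
    show ?thesis by (intro exI[of _ d] conjI ballI impI allI d(1)) (use d(2) in blast)
  qed
  have Cu: "sob_C0 (\<sigma> + 1) ?J u"
  proof (rule sob_C0I)
    show "u t \<in> sobolev (\<sigma> + 1)" if "t \<in> ?J" for t using u(1) that J(2) by simp
    fix t e :: real assume t: "t \<in> ?J" and e: "0 < e"
    obtain d where d: "0 < d" "\<And>\<tau> m. \<tau> \<in> ?J \<Longrightarrow> \<bar>\<tau> - t\<bar> < d \<Longrightarrow> Nv (wt \<sigma> 0) m (\<lambda>n. y \<tau> n - y t n) \<le> e"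
      using c0[OF t e] by blast
    show "\<exists>d>0. \<forall>\<tau>\<in>?J. \<bar>\<tau> - t\<bar> < d \<longrightarrow> (\<forall>m. hN (\<sigma> + 1) (\<lambda>n. fourier_coeff (u \<tau>) n - fourier_coeff (u t) n) m \<le> e)"
    proof (intro exI[of _ d] conjI ballI allI impI d(1))
      fix \<tau> m assume \<tau>: "\<tau> \<in> ?J" "\<bar>\<tau> - t\<bar> < d"
      show "hN (\<sigma> + 1) (\<lambda>n. fourier_coeff (u \<tau>) n - fourier_coeff (u t) n) m \<le> e"
        using order_trans[OF hN_fst_le d(2)[OF \<tau>], of m] u(2) t \<tau>(1) J(2) by simp
    qed
  qed
  have Cr: "sob_C0 \<sigma> ?J \<rho>"
  proof (rule sob_C0I)
    show "\<rho> t \<in> sobolev \<sigma>" if "t \<in> ?J" for t using \<rho>(1) that J(2) by simp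
    fix t e :: real assume t: "t \<in> ?J" and e: "0 < e"
    obtain d where d: "0 < d" "\<And>\<tau> m. \<tau> \<in> ?J \<Longrightarrow> \<bar>\<tau> - t\<bar> < d \<Longrightarrow> Nv (wt \<sigma> 0) m (\<lambda>n. y \<tau> n - y t n) \<le> e"
      using c0[OF t e] by blast
    show "\<exists>d>0. \<forall>\<tau>\<in>?J. \<bar>\<tau> - t\<bar> < d \<longrightarrow> (\<forall>m. hN \<sigma> (\<lambda>n. fourier_coeff (\<rho> \<tau>) n - fourier_coeff (\<rho> t) n) m \<le> e)"
    proof (intro exI[of _ d] conjI ballI allI impI d(1))
      fix \<tau> m assume \<tau>: "\<tau> \<in> ?J" "\<bar>\<tau> - t\<bar> < d"
      show "hN \<sigma> (\<lambda>n. fourier_coeff (\<rho> \<tau>) n - fourier_coeff (\<rho> t) n) m \<le> e"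
        using order_trans[OF hN_snd_le d(2)[OF \<tau>], of m] \<rho>(2) t \<tau>(1) J(2) by simp
    qed
  qed
  have Ctu: "sob_C0 \<sigma> ?J (time_deriv \<sigma> u)"
  proof (rule sob_C0I[OF tdu(1)])
    fix t e :: real assume t: "t \<in> ?J" and e: "0 < e"
    obtain d where d: "0 < d" "\<And>\<tau> m. \<tau> \<in> ?J \<Longrightarrow> \<bar>\<tau> - t\<bar> < d \<Longrightarrow> Nv (wt (\<sigma> - 1) 0) m (\<lambda>n. Bq (y \<tau>) n - Bq (y t) n) \<le> e"
      using c1[OF t e] by blast
    show "\<exists>d>0. \<forall>\<tau>\<in>?J. \<bar>\<tau> - t\<bar> < d \<longrightarrow> (\<forall>m. hN \<sigma> (\<lambda>n. fourier_coeff (time_deriv \<sigma> u \<tau>) n - fourier_coeff (time_deriv \<sigma> u t) n) m \<le> e)"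
    proof (intro exI[of _ d] conjI ballI allI impI d(1))
      fix \<tau> m assume \<tau>: "\<tau> \<in> ?J" "\<bar>\<tau> - t\<bar> < d"
      show "hN \<sigma> (\<lambda>n. fourier_coeff (time_deriv \<sigma> u \<tau>) n - fourier_coeff (time_deriv \<sigma> u t) n) m \<le> e"
        using order_trans[OF fs(1) d(2)[OF \<tau>], of m] unfolding tdu(2)[OF t] tdu(2)[OF \<tau>(1)] by simp
    qed
  qed
  have Ctr: "sob_C0 (\<sigma> - 1) ?J (time_deriv (\<sigma> - 1) \<rho>)"
  proof (rule sob_C0I[OF tdr(1)])
    fix t e :: real assume t: "t \<in> ?J" and e: "0 < e"
    obtain d where d: "0 < d" "\<And>\<tau> m. \<tau> \<in> ?J \<Longrightarrow> \<bar>\<tau> - t\<bar> < d \<Longrightarrow> Nv (wt (\<sigma> - 1) 0) m (\<lambda>n. Bq (y \<tau>) n - Bq (y t) n) \<le> e"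
      using c1[OF t e] by blast
    show "\<exists>d>0. \<forall>\<tau>\<in>?J. \<bar>\<tau> - t\<bar> < d \<longrightarrow> (\<forall>m. hN (\<sigma> - 1) (\<lambda>n. fourier_coeff (time_deriv (\<sigma> - 1) \<rho> \<tau>) n - fourier_coeff (time_deriv (\<sigma> - 1) \<rho> t) n) m \<le> e)"
    proof (intro exI[of _ d] conjI ballI allI impI d(1))
      fix \<tau> m assume \<tau>: "\<tau> \<in> ?J" "\<bar>\<tau> - t\<bar> < d"
      show "hN (\<sigma> - 1) (\<lambda>n. fourier_coeff (time_deriv (\<sigma> - 1) \<rho> \<tau>) n - fourier_coeff (time_deriv (\<sigma> - 1) \<rho> t) n) m \<le> e"
        using order_trans[OF fs(2) d(2)[OF \<tau>], of m] unfolding tdr(2)[OF t] tdr(2)[OF \<tau>(1)] by simp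
    qed
  qed
  have "ch2_solution (\<sigma> + 1) ?J u0 \<rho>0 u \<rho>"
    unfolding ch2_solution_iff
  proof (intro conjI ballI Cu Cr)
    show "sob_C1 \<sigma> ?J u" unfolding sob_C1_def using us htu Ctu by blast
    show "sob_C1 (\<sigma> - 1) ?J \<rho>" unfolding sob_C1_def using rs htr Ctr by blast
    have z: "\<bar>0::real\<bar> < T" using T by simp
    have p0: "fourier_coeff (u 0) n = fourier_coeff u0 n" "fourier_coeff (\<rho> 0) n = fourier_coeff \<rho>0 n" for n
      using py[OF z] y(2) by (metis pst_def prod.inject)+
    show "u 0 \<doteq> u0" by (rule fourier_coeff_inj[OF sobolev_L2[OF u(1)[OF z]] sobolev_L2[OF u0] p0(1)])
    show "\<rho> 0 \<doteq> \<rho>0" by (rule fourier_coeff_inj[OF sobolev_L2[OF \<rho>(1)[OF z]] sobolev_L2[OF \<rho>0] p0(2)])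
    fix t assume t: "t \<in> ?J"
    have t': "\<bar>t\<bar> < T" using t J(2) by blast
    note R = rhs_pst[OF u(1)[OF t'] \<rho>(1)[OF t'], unfolded py[OF t']]
    note vu = sobolev_L2[OF tdu(1)[OF t]] and vr = sobolev_L2[OF tdr(1)[OF t]]
    show "(\<lambda>x. time_deriv \<sigma> u t x + u t x * weak_deriv (u t) x) \<doteq>
        (\<lambda>x. - A_inv (weak_deriv (\<lambda>y. (u t y)\<^sup>2 + 1/2 * (weak_deriv (u t) y)\<^sup>2 + 1/2 * (\<rho> t y)\<^sup>2)) x)"
    proof (rule fourier_coeff_inj[OF circ_L2_add[OF vu R(2)] circ_L2_minus[OF R(1)]])
      fix n
      show "fourier_coeff (\<lambda>x. time_deriv \<sigma> u t x + u t x * weak_deriv (u t) x) n =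
        fourier_coeff (\<lambda>x. - A_inv (weak_deriv (\<lambda>y. (u t y)\<^sup>2 + 1/2 * (weak_deriv (u t) y)\<^sup>2 + 1/2 * (\<rho> t y)\<^sup>2)) x) n"
        unfolding fourier_coeff_add[OF vu R(2)] fourier_coeff_uminus tdu(2)[OF t] R(5) by simp
    qed
    show "(\<lambda>x. time_deriv (\<sigma> - 1) \<rho> t x + u t x * weak_deriv (\<rho> t) x) \<doteq> (\<lambda>x. - (\<rho> t x * weak_deriv (u t) x))"
    proof (rule fourier_coeff_inj[OF circ_L2_add[OF vr R(3)] circ_L2_minus[OF R(4)]])
      fix n
      show "fourier_coeff (\<lambda>x. time_deriv (\<sigma> - 1) \<rho> t x + u t x * weak_deriv (\<rho> t) x) n =
        fourier_coeff (\<lambda>x. - (\<rho> t x * weak_deriv (u t) x)) n"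
        unfolding fourier_coeff_add[OF vr R(3)] fourier_coeff_uminus tdr(2)[OF t] R(6) by simp
    qed
  qed
  then show ?thesis by (rule that)
qed

end

section \<open>Well-posedness in the function spaces\<close>

context ch2
begin

text \<open>A \<open>seqsol\<close> comes with bounds of unspecified size on compact intervals only.
  By uniqueness it equals the solution from \<open>flow\<close>, which supplies the explicit
  bound.\<close>

lemma seqsol_bdd:
  assumes R: "0 < R" and y: "seqsol (Tm R) y" "bdd R (y 0)" and t: "\<bar>t\<bar> < Tm R"
  shows "bdd (2 * R) (y t)"
proof -
  have h: "hrm (y 0)" using seqsolD(1)[OF y(1), of 0] Tm_pos[OF R] by simp
  obtain y' where y': "seqsol (Tm R) y'" "y' 0 = y 0" "\<And>t. \<bar>t\<bar> < Tm R \<Longrightarrow> bdd (2 * R) (y' t)"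
    apply (rule flow[OF R h y(2)])
    subgoal premises p for z by (rule that[OF p(2-4)])
    done
  have "y t = y' t" by (rule seqsol_unique[OF y(1) y'(1) y'(2)[symmetric] t])
  then show ?thesis using y'(3)[OF t] by simp
qed

text \<open>The interval depends on the bound R and not on the data themselves, so all data with
  this bound are solved uniquely on one interval.\<close>

lemma unique_solution:
  assumes R: "0 < R" and b: "bdd R (pst u0 \<rho>0)" and u0: "u0 \<in> sobolev (\<sigma> + 1)" and \<rho>0: "\<rho>0 \<in> sobolev \<sigma>"
  shows "ch2_unique_solution (\<sigma> + 1) {-Tm R<..<Tm R} u0 \<rho>0"
proof -
  have T: "0 < Tm R" by (rule Tm_pos[OF R])
  obtain y where y: "seqsol (Tm R) y" "y 0 = pst u0 \<rho>0" "\<And>t. \<bar>t\<bar> < Tm R \<Longrightarrow> bdd (2 * R) (y t)"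
    "\<And>t e. \<bar>t\<bar> < Tm R \<Longrightarrow> 0 < e \<Longrightarrow> \<exists>d>0. \<forall>\<tau>. \<bar>\<tau>\<bar> < Tm R \<longrightarrow> \<bar>\<tau> - t\<bar> < d \<longrightarrow> bdd e (\<lambda>n. y \<tau> n - y t n)"
    apply (rule flow[OF R hrm_pst b])
    subgoal premises p for z by (rule that[OF p(2-)])
    done
  obtain u \<rho> where sol: "ch2_solution (\<sigma> + 1) {-Tm R<..<Tm R} u0 \<rho>0 u \<rho>"
    by (rule seqsol_solution[OF y(1,2,3) T y(4) u0 \<rho>0])
  note S = solution_seqsol[OF sol T u0 \<rho>0]
  show ?thesis unfolding ch2_unique_solution_def
  proof (intro exI conjI allI impI ballI)
    show "ch2_solution (\<sigma> + 1) {-Tm R<..<Tm R} u0 \<rho>0 u \<rho>" by (rule sol)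
    fix v \<tau> t assume sol': "ch2_solution (\<sigma> + 1) {-Tm R<..<Tm R} u0 \<rho>0 v \<tau>" and "t \<in> {-Tm R<..<Tm R}"
    then have t: "\<bar>t\<bar> < Tm R" by auto
    note S' = solution_seqsol[OF sol' T u0 \<rho>0]
    have "pst (v t) (\<tau> t) = pst (u t) (\<rho> t)"
      by (rule seqsol_unique[OF S'(1) S(1) _ t]) (simp only: S(2) S'(2))
    then have e: "pst (v t) (\<tau> t) n = pst (u t) (\<rho> t) n" for n by (rule fun_cong)
    show "v t \<doteq> u t"
      by (rule fourier_coeff_inj[OF sobolev_L2[OF conjunct1[OF S'(3)[OF t]]] sobolev_L2[OF conjunct1[OF S(3)[OF t]]]])
        (use e in \<open>simp add: pst_def\<close>)
    show "\<tau> t \<doteq> \<rho> t"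
      by (rule fourier_coeff_inj[OF sobolev_L2[OF conjunct2[OF S'(3)[OF t]]] sobolev_L2[OF conjunct2[OF S(3)[OF t]]]])
        (use e in \<open>simp add: pst_def\<close>)
  qed
qed

lemma data_ball_bdd:
  assumes u0: "u0 \<in> sobolev (\<sigma> + 1)" and \<rho>0: "\<rho>0 \<in> sobolev \<sigma>"
    and b: "(v, \<tau>) \<in> ch2_data_ball (\<sigma> + 1) u0 \<rho>0 \<delta>"
  shows "v \<in> sobolev (\<sigma> + 1)" "\<tau> \<in> sobolev \<sigma>" "bdd (sob_norm (\<sigma> + 1) u0 + sob_norm \<sigma> \<rho>0 + \<delta>) (pst v \<tau>)"
    "bdd \<delta> (\<lambda>n. pst v \<tau> n - pst u0 \<rho>0 n)"
proof -
  show v: "v \<in> sobolev (\<sigma> + 1)" and \<tau>: "\<tau> \<in> sobolev \<sigma>" using b by (auto simp: ch2_data_ball_def)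
  have d: "sob_dist (\<sigma> + 1) v u0 + sob_dist \<sigma> \<tau> \<rho>0 < \<delta>" using b by (auto simp: ch2_data_ball_def)
  show "bdd (sob_norm (\<sigma> + 1) u0 + sob_norm \<sigma> \<rho>0 + \<delta>) (pst v \<tau>)"
    by (rule bdd_mono[OF bdd_pst[OF v \<tau>]]) (use sob_norm_triangle[OF v u0] sob_norm_triangle[OF \<tau> \<rho>0] d in linarith)
  show "bdd \<delta> (\<lambda>n. pst v \<tau> n - pst u0 \<rho>0 n)"
    unfolding bdd_def
  proof
    fix m
    have "Nv (wt \<sigma> 0) m (\<lambda>n. pst v \<tau> n - pst u0 \<rho>0 n)
       \<le> hN (\<sigma> + 1) (\<lambda>n. fourier_coeff v n - fourier_coeff u0 n) m + hN \<sigma> (\<lambda>n. fourier_coeff \<tau> n - fourier_coeff \<rho>0 n) m"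
      using Nv_le_hN[of \<sigma> m "\<lambda>n. pst v \<tau> n - pst u0 \<rho>0 n"] by (simp add: pst_def)
    then show "Nv (wt \<sigma> 0) m (\<lambda>n. pst v \<tau> n - pst u0 \<rho>0 n) \<le> \<delta>"
      using hN_le_sob_dist[OF v u0, of m] hN_le_sob_dist[OF \<tau> \<rho>0, of m] d by linarith
  qed
qed

text \<open>The summand 1 in R matches the radius 1 of the ball of data: every member is bounded by
  R, hence lives on the same interval and stays below 2 R there. The time derivatives follow from
  the states through \<open>Bq_diff\<close>.\<close>

lemma continuous_dependence:
  assumes u0: "u0 \<in> sobolev (\<sigma> + 1)" and \<rho>0: "\<rho>0 \<in> sobolev \<sigma>"
    and R: "R = sob_norm (\<sigma> + 1) u0 + sob_norm \<sigma> \<rho>0 + 1"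
  shows "ch2_continuous_dependence (\<sigma> + 1) {-Tm R<..<Tm R} u0 \<rho>0"
proof -
  have R0: "0 < R" using sob_norm_ge0[of "\<sigma> + 1" u0] sob_norm_ge0[of \<sigma> \<rho>0] by (simp add: R)
  have T: "0 < Tm R" by (rule Tm_pos[OF R0])
  let ?J = "{-Tm R<..<Tm R}"
  note ball = data_ball_bdd[OF u0 \<rho>0, of _ _ 1, folded R]
  show ?thesis
    unfolding ch2_continuous_dependence_def
  proof (intro exI[of _ 1] conjI)
    show "\<forall>(v0, \<sigma>0)\<in>ch2_data_ball (\<sigma> + 1) u0 \<rho>0 1. ch2_unique_solution (\<sigma> + 1) ?J v0 \<sigma>0"
      by (intro ballI, clarify) (intro unique_solution R0 ball)
    have "\<exists>\<eta>>0. \<forall>(w0, \<tau>0)\<in>ch2_data_ball (\<sigma> + 1) u0 \<rho>0 1 \<inter> ch2_data_ball (\<sigma> + 1) v0 \<sigma>0 \<eta>.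
         \<forall>w \<tau>. ch2_solution (\<sigma> + 1) ?J w0 \<tau>0 w \<tau> \<longrightarrow>
            (\<forall>t\<in>C. sob_dist (\<sigma> + 1) (w t) (v t) < \<epsilon> \<and> sob_dist (\<sigma> + 1 - 1) (\<tau> t) (\<rho> t) < \<epsilon> \<and>
                sob_dist (\<sigma> + 1 - 1) (time_deriv (\<sigma> + 1 - 1) w t) (time_deriv (\<sigma> + 1 - 1) v t) < \<epsilon> \<and>
                sob_dist (\<sigma> + 1 - 2) (time_deriv (\<sigma> + 1 - 2) \<tau> t) (time_deriv (\<sigma> + 1 - 2) \<rho> t) < \<epsilon>)"
      if v0: "(v0, \<sigma>0) \<in> ch2_data_ball (\<sigma> + 1) u0 \<rho>0 1" and sol: "ch2_solution (\<sigma> + 1) ?J v0 \<sigma>0 v \<rho>"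
        and C: "C \<subseteq> ?J" and \<epsilon>: "0 < \<epsilon>" for v0 \<sigma>0 v \<rho> C \<epsilon>
    proof -
      note V = ball[OF v0]
      note S = solution_seqsol[OF sol T V(1) V(2)]
      have Cb0: "0 \<le> Cb (2 * R)" using K c R0 by (simp add: Cb_def)
      \<comment> \<open>L dominates both 1 and the Lipschitz constant of \<open>Bq\<close> at size 2
        R, so e = \<epsilon> / (2 L) is small enough for the states and for their time
        derivatives.\<close>
      define L where "L = Cb (2 * R) + 1"
      define e where "e = \<epsilon> / (2 * L)"
      have L: "1 \<le> L" using Cb0 by (simp add: L_def)
      have e0: "0 < e" using \<epsilon> L by (simp add: e_def)
      have "\<epsilon> / (2 * L) \<le> \<epsilon> / 2" using \<epsilon> L by (intro divide_left_mono) auto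
      then have e1: "e < \<epsilon>" using \<epsilon> by (simp add: e_def)
      have "Cb (2 * R) * e \<le> L * e" using e0 by (intro mult_right_mono) (auto simp: L_def)
      also have "L * e = \<epsilon> / 2" using L by (simp add: e_def)
      finally have e2: "Cb (2 * R) * e < \<epsilon>" using \<epsilon> by simp
      obtain \<eta> where \<eta>: "0 < \<eta>" "\<And>z t. seqsol (Tm R) z \<Longrightarrow> bdd R (z 0) \<Longrightarrow> bdd \<eta> (\<lambda>n. z 0 n - pst v0 \<sigma>0 n) \<Longrightarrow> \<bar>t\<bar> < Tm R
            \<Longrightarrow> bdd e (\<lambda>n. z t n - pst (v t) (\<rho> t) n)"
        apply (rule flow_continuous[OF R0 hrm_pst V(3) S(1) S(2) e0])
        subgoal premises p for d by (rule that, rule p(2), rule p(3))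
        done
      show ?thesis
      proof (intro exI[of _ \<eta>] conjI \<eta>(1) ballI, clarify)
        fix w0 \<tau>0 w \<tau> t
        assume w0: "(w0, \<tau>0) \<in> ch2_data_ball (\<sigma> + 1) u0 \<rho>0 1" "(w0, \<tau>0) \<in> ch2_data_ball (\<sigma> + 1) v0 \<sigma>0 \<eta>"
          and sol': "ch2_solution (\<sigma> + 1) ?J w0 \<tau>0 w \<tau>" and tC: "t \<in> C"
        have t: "\<bar>t\<bar> < Tm R" using subsetD[OF C tC] by (simp add: abs_less_iff)
        note W = ball[OF w0(1)]
        note S' = solution_seqsol[OF sol' T W(1) W(2)]
        have close: "bdd e (\<lambda>n. pst (w t) (\<tau> t) n - pst (v t) (\<rho> t) n)"
          by (rule \<eta>(2)[OF S'(1) _ _ t]) (simp_all only: S'(2) W(3) data_ball_bdd(4)[OF V(1) V(2) w0(2)])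
        have bv: "bdd (2 * R) (pst (v t) (\<rho> t))" by (rule seqsol_bdd[OF R0 S(1) _ t]) (simp only: S(2) V(3))
        have bw: "bdd (2 * R) (pst (w t) (\<tau> t))" by (rule seqsol_bdd[OF R0 S'(1) _ t]) (simp only: S'(2) W(3))
        have dB: "Nv (wt (\<sigma> - 1) 0) m (\<lambda>n. Bq (pst (w t) (\<tau> t)) n - Bq (pst (v t) (\<rho> t)) n) \<le> Cb (2 * R) * e" for m
          by (rule Bq_diff[OF bw bv close])
        have 1: "sob_dist (\<sigma> + 1) (w t) (v t) \<le> e"
        proof (rule sob_dist_leI)
          show "hN (\<sigma> + 1) (\<lambda>n. fourier_coeff (w t) n - fourier_coeff (v t) n) m \<le> e" for m
            using order_trans[OF hN_fst_le close[unfolded bdd_def, rule_format], of m] by (simp add: pst_def)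
        qed (use S(3)[OF t] S'(3)[OF t] in blast)+
        have 2: "sob_dist \<sigma> (\<tau> t) (\<rho> t) \<le> e"
        proof (rule sob_dist_leI)
          show "hN \<sigma> (\<lambda>n. fourier_coeff (\<tau> t) n - fourier_coeff (\<rho> t) n) m \<le> e" for m
            using order_trans[OF hN_snd_le close[unfolded bdd_def, rule_format], of m] by (simp add: pst_def)
        qed (use S(3)[OF t] S'(3)[OF t] in blast)+
        have 3: "sob_dist \<sigma> (time_deriv \<sigma> w t) (time_deriv \<sigma> v t) \<le> Cb (2 * R) * e"
        proof (rule sob_dist_leI)
          show "hN \<sigma> (\<lambda>n. fourier_coeff (time_deriv \<sigma> w t) n - fourier_coeff (time_deriv \<sigma> v t) n) m \<le> Cb (2 * R) * e" for m
            using order_trans[OF hN_fst_le[of "\<sigma> - 1"] dB, of m] by (simp add: S(5)[OF t] S'(5)[OF t])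
        qed (use S(4)[OF t] S'(4)[OF t] in blast)+
        have 4: "sob_dist (\<sigma> - 1) (time_deriv (\<sigma> - 1) \<tau> t) (time_deriv (\<sigma> - 1) \<rho> t) \<le> Cb (2 * R) * e"
        proof (rule sob_dist_leI)
          show "hN (\<sigma> - 1) (\<lambda>n. fourier_coeff (time_deriv (\<sigma> - 1) \<tau> t) n - fourier_coeff (time_deriv (\<sigma> - 1) \<rho> t) n) m \<le> Cb (2 * R) * e" for m
            using order_trans[OF hN_snd_le[of "\<sigma> - 1"] dB, of m] by (simp add: S(6)[OF t] S'(6)[OF t])
        qed (use S(4)[OF t] S'(4)[OF t] in blast)+
        have s: "\<sigma> + 1 - 1 = \<sigma>" "\<sigma> + 1 - 2 = \<sigma> - 1" by simp_all
        show "sob_dist (\<sigma> + 1) (w t) (v t) < \<epsilon> \<and> sob_dist (\<sigma> + 1 - 1) (\<tau> t) (\<rho> t) < \<epsilon> \<and>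
                sob_dist (\<sigma> + 1 - 1) (time_deriv (\<sigma> + 1 - 1) w t) (time_deriv (\<sigma> + 1 - 1) v t) < \<epsilon> \<and>
                sob_dist (\<sigma> + 1 - 2) (time_deriv (\<sigma> + 1 - 2) \<tau> t) (time_deriv (\<sigma> + 1 - 2) \<rho> t) < \<epsilon>"
          unfolding s
          using le_less_trans[OF 1 e1] le_less_trans[OF 2 e1] le_less_trans[OF 3 e2] le_less_trans[OF 4 e2] by blast
      qed
    qed
    then show "\<forall>(v0, \<sigma>0)\<in>ch2_data_ball (\<sigma> + 1) u0 \<rho>0 1. \<forall>v \<rho>. ch2_solution (\<sigma> + 1) ?J v0 \<sigma>0 v \<rho> \<longrightarrow>
       (\<forall>C \<epsilon>. compact C \<and> C \<subseteq> ?J \<and> \<epsilon> > 0 \<longrightarrow>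
        (\<exists>\<eta>>0. \<forall>(w0, \<tau>0)\<in>ch2_data_ball (\<sigma> + 1) u0 \<rho>0 1 \<inter> ch2_data_ball (\<sigma> + 1) v0 \<sigma>0 \<eta>.
         \<forall>w \<tau>. ch2_solution (\<sigma> + 1) ?J w0 \<tau>0 w \<tau> \<longrightarrow>
            (\<forall>t\<in>C. sob_dist (\<sigma> + 1) (w t) (v t) < \<epsilon> \<and> sob_dist (\<sigma> + 1 - 1) (\<tau> t) (\<rho> t) < \<epsilon> \<and>
                sob_dist (\<sigma> + 1 - 1) (time_deriv (\<sigma> + 1 - 1) w t) (time_deriv (\<sigma> + 1 - 1) v t) < \<epsilon> \<and>
                sob_dist (\<sigma> + 1 - 2) (time_deriv (\<sigma> + 1 - 2) \<tau> t) (time_deriv (\<sigma> + 1 - 2) \<rho> t) < \<epsilon>)))"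
      by (intro ballI, clarify) blast
  qed simp
qed

end

theorem corollary3p4:
  fixes s :: real and u0 \<rho>0 :: "real \<Rightarrow> real"
  assumes "s > 5/2"
    and "u0 \<in> sobolev s" and "\<rho>0 \<in> sobolev (s - 1)"
  shows "\<exists>T>0. ch2_unique_solution s {-T<..<T} u0 \<rho>0 \<and>
               ch2_continuous_dependence s {-T<..<T} u0 \<rho>0"
proof -
  have "3/2 < s - 1" using assms(1) by simp
  then obtain K c where "ch2 (s - 1) K c" by (rule ch2_exists)
  then interpret ch2 "s - 1" K c .
  have s: "s - 1 + 1 = s" by simp
  define R where "R = sob_norm s u0 + sob_norm (s - 1) \<rho>0 + 1"
  have R0: "0 < R" using sob_norm_ge0[of s u0] sob_norm_ge0[of "s - 1" \<rho>0] by (simp add: R_def)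
  have b: "bdd R (pst u0 \<rho>0)"
    by (rule bdd_mono[OF bdd_pst[unfolded s, OF assms(2,3)]]) (simp add: R_def)
  have "ch2_unique_solution s {-Tm R<..<Tm R} u0 \<rho>0"
    by (rule unique_solution[unfolded s, OF R0 b assms(2,3)])
  moreover have "ch2_continuous_dependence s {-Tm R<..<Tm R} u0 \<rho>0"
    by (rule continuous_dependence[unfolded s, OF assms(2,3) R_def])
  ultimately show ?thesis using Tm_pos[OF R0] by blast
qed

end
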